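(* Let $G$ be a finite group and $p$ a prime. Suppose that $G$ has a $p$-block $B_1$ with $\mathrm{IBr}(B_1)\subseteq \mathrm{LBr}(G)$. Then for every $p$-block $B\in \mathrm{Bl}(G)$, $$\frac{\dim_F(B)}{|D_B|}=\sum_{\varphi\in \mathrm{IBr}(B)}\varphi(1)^2,$$ where $D_B$ denotes a defect group of $B$. Hence the Holm–Willems conjecture holds for $G$: for every $B\in\mathrm{Bl}(G)$, $$\frac{\dim_F(B)}{l(B)\,|D_B|}\leq \sum_{\varphi\in \mathrm{IBr}(B)}\varphi(1)^2,$$ with equality if and only if $l(B)=1$.
   Context: $(K,R,F)$ is a splitting $p$-modular system for $G$: $R$ is a complete discrete valuation ring with maximal ideal $\pi$, $K$ is its quotient field (of characteristic $0$), $F=R/\pi$ has characteristic $p$, and $K$, $F$ are splitting fields. $\mathrm{Bl}(G)$ is the set of $p$-blocks of $G$, viewed as block algebras of $F[G]$, so $\dim_F(B)$ is the $F$-dimension of the block algebra $B$. $\mathrm{IBr}(B)$ is the set of irreducible Brauer characters belonging to $B$, and $l(B)=|\mathrm{IBr}(B)|$. $\mathrm{LBr}(G)$ is the set of linear (degree one) Brauer characters of $G$. *)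

theory Defs
  imports
    "HOL-Algebra.Left_Coset"
    "HOL-Algebra.Multiplicative_Group"
    "HOL-Algebra.Algebraic_Closure_Type"
    "HOL-Library.Function_Algebras"
    "Jordan_Normal_Form.Char_Poly"
    "Jordan_Normal_Form.VS_Connect"
begin

section \<open>Modular systems\<close>

text \<open>A discrete valuation ring is given through its normalized valuation \<open>v\<close> on its quotient
  field, which is the whole type \<open>'k\<close>. Instead of the value \<open>\<infinity>\<close> at \<open>0\<close>, the integer \<open>v 0\<close> is
  arbitrary and never used.\<close>

definition discrete_valuation :: "('k::field \<Rightarrow> int) \<Rightarrow> bool" where
  "discrete_valuation v \<longleftrightarrow>
     (\<forall>x y. x \<noteq> 0 \<longrightarrow> y \<noteq> 0 \<longrightarrow> v (x * y) = v x + v y) \<and>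
     (\<forall>x y. x \<noteq> 0 \<longrightarrow> y \<noteq> 0 \<longrightarrow> x + y \<noteq> 0 \<longrightarrow> min (v x) (v y) \<le> v (x + y)) \<and>
     (\<exists>x. x \<noteq> 0 \<and> v x = 1)"

definition val_ring :: "('k::field \<Rightarrow> int) \<Rightarrow> 'k set" where
  "val_ring v = {x. x = 0 \<or> 0 \<le> v x}"

definition val_ideal :: "('k::field \<Rightarrow> int) \<Rightarrow> 'k set" where
  "val_ideal v = {x. x = 0 \<or> 0 < v x}"

definition val_close :: "('k::field \<Rightarrow> int) \<Rightarrow> nat \<Rightarrow> 'k \<Rightarrow> 'k \<Rightarrow> bool" where
  "val_close v N x y \<longleftrightarrow> x = y \<or> int N \<le> v (x - y)"

definition val_complete :: "('k::field \<Rightarrow> int) \<Rightarrow> bool" where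
  "val_complete v \<longleftrightarrow>
     (\<forall>s :: nat \<Rightarrow> 'k. range s \<subseteq> val_ring v \<longrightarrow>
        (\<forall>N. \<exists>M. \<forall>m\<ge>M. \<forall>n\<ge>M. val_close v N (s m) (s n)) \<longrightarrow>
        (\<exists>L\<in>val_ring v. \<forall>N. \<exists>M. \<forall>n\<ge>M. val_close v N (s n) L))"

text \<open>The map \<open>red\<close> exhibits \<open>'f\<close> as the residue field of the valuation ring; its values
  outside the valuation ring are irrelevant.\<close>

definition residue_map :: "('k::field \<Rightarrow> int) \<Rightarrow> ('k \<Rightarrow> 'f::field) \<Rightarrow> bool" where
  "residue_map v red \<longleftrightarrow>
     red 1 = 1 \<and>
     (\<forall>x\<in>val_ring v. \<forall>y\<in>val_ring v.
        red (x + y) = red x + red y \<and> red (x * y) = red x * red y) \<and>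
     red ` val_ring v = UNIV \<and>
     (\<forall>x\<in>val_ring v. red x = 0 \<longleftrightarrow> x \<in> val_ideal v)"


section \<open>Matrix representations and splitting fields\<close>

definition mat_rep :: "('g, 'm) monoid_scheme \<Rightarrow> nat \<Rightarrow> ('g \<Rightarrow> 'a::field mat) \<Rightarrow> bool" where
  "mat_rep G n \<rho> \<longleftrightarrow>
     (\<forall>g\<in>carrier G. \<rho> g \<in> carrier_mat n n) \<and>
     \<rho> \<one>\<^bsub>G\<^esub> = 1\<^sub>m n \<and>
     (\<forall>g\<in>carrier G. \<forall>h\<in>carrier G. \<rho> (g \<otimes>\<^bsub>G\<^esub> h) = \<rho> g * \<rho> h)"

definition irred_rep :: "('g, 'm) monoid_scheme \<Rightarrow> nat \<Rightarrow> ('g \<Rightarrow> 'a::field mat) \<Rightarrow> bool" where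
  "irred_rep G n \<rho> \<longleftrightarrow>
     mat_rep G n \<rho> \<and> 0 < n \<and>
     (\<forall>W. VectorSpace.subspace class_ring W (module_vec TYPE('a) n) \<longrightarrow>
          (\<forall>g\<in>carrier G. \<forall>w\<in>W. \<rho> g *\<^sub>v w \<in> W) \<longrightarrow>
          W = {0\<^sub>v n} \<or> W = carrier_vec n)"

text \<open>A field is a splitting field for \<open>G\<close> if every simple module of the group algebra has only
  the scalars as endomorphisms.\<close>

definition splitting_field :: "'a::field itself \<Rightarrow> ('g, 'm) monoid_scheme \<Rightarrow> bool" where
  "splitting_field _ G \<longleftrightarrow>
     (\<forall>n (\<rho> :: 'g \<Rightarrow> 'a mat). irred_rep G n \<rho> \<longrightarrow>
        (\<forall>A\<in>carrier_mat n n. (\<forall>g\<in>carrier G. A * \<rho> g = \<rho> g * A) \<longrightarrow>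
           (\<exists>c. A = c \<cdot>\<^sub>m 1\<^sub>m n)))"

definition splitting_modular_system ::
  "('g, 'm) monoid_scheme \<Rightarrow> nat \<Rightarrow> ('k::field_char_0 \<Rightarrow> int) \<Rightarrow> ('k \<Rightarrow> 'f::field) \<Rightarrow> bool" where
  "splitting_modular_system G p v red \<longleftrightarrow>
     discrete_valuation v \<and> val_complete v \<and> residue_map v red \<and> CHAR('f) = p \<and>
     splitting_field TYPE('k) G \<and> splitting_field TYPE('f) G"


section \<open>Brauer characters\<close>

text \<open>A splitting field for \<open>G\<close> need not contain the eigenvalues of the individual group
  elements: the field with two elements splits the symmetric group on three letters.
  Eigenvalues are therefore taken in the algebraic closure of \<open>'f\<close> and lifted to roots of unity
  in the algebraic closure of \<open>'k\<close>. The lifting uses a ring homomorphism \<open>\<theta>\<close> from the integral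
  closure of the valuation ring in the algebraic closure of \<open>'k\<close> to the algebraic closure of
  \<open>'f\<close> which extends the residue map. Such a \<open>\<theta>\<close> exists by lying over. As the
  maximal ideal lying over is unique for complete \<open>v\<close>, two choices differ by an automorphism of
  the algebraic closure of \<open>'f\<close> over \<open>'f\<close>, which permutes the eigenvalues of each group element;
  so the Brauer characters do not depend on \<open>\<theta>\<close>.\<close>

definition integral_over :: "'k::field set \<Rightarrow> 'k alg_closure set" where
  "integral_over R =
     {x. \<exists>q :: 'k poly. lead_coeff q = 1 \<and> (\<forall>i. Polynomial.coeff q i \<in> R) \<and>
           poly (map_poly to_ac q) x = 0}"

definition residue_extension ::
  "('k::field \<Rightarrow> int) \<Rightarrow> ('k \<Rightarrow> 'f::field) \<Rightarrow> ('k alg_closure \<Rightarrow> 'f alg_closure) \<Rightarrow> bool" where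
  "residue_extension v red \<theta> \<longleftrightarrow>
     (\<forall>x\<in>integral_over (val_ring v). \<forall>y\<in>integral_over (val_ring v).
        \<theta> (x + y) = \<theta> x + \<theta> y \<and> \<theta> (x * y) = \<theta> x * \<theta> y) \<and>
     (\<forall>r\<in>val_ring v. \<theta> (to_ac r) = to_ac (red r))"

definition root_lift ::
  "nat \<Rightarrow> ('k::field alg_closure \<Rightarrow> 'f::field alg_closure) \<Rightarrow> 'f alg_closure \<Rightarrow> 'k alg_closure" where
  "root_lift p \<theta> \<zeta> = (THE z. (\<exists>m>0. coprime m p \<and> z ^ m = 1) \<and> \<theta> z = \<zeta>)"

definition p_regular :: "('g, 'm) monoid_scheme \<Rightarrow> nat \<Rightarrow> 'g set" where
  "p_regular G p = {g \<in> carrier G. \<not> p dvd group.ord G g}"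

definition brauer_character ::
  "('g, 'm) monoid_scheme \<Rightarrow> nat \<Rightarrow> ('k::field alg_closure \<Rightarrow> 'f::field alg_closure) \<Rightarrow>
   ('g \<Rightarrow> 'f mat) \<Rightarrow> 'g \<Rightarrow> 'k alg_closure" where
  "brauer_character G p \<theta> \<rho> =
     (\<lambda>g\<in>p_regular G p.
        (\<Sum>\<zeta>\<in>#proots (map_poly to_ac (char_poly (\<rho> g))). root_lift p \<theta> \<zeta>))"

definition LBr ::
  "('g, 'm) monoid_scheme \<Rightarrow> nat \<Rightarrow> ('k::field alg_closure \<Rightarrow> 'f::field alg_closure) \<Rightarrow>
   ('g \<Rightarrow> 'k alg_closure) set" where
  "LBr G p \<theta> =
     {\<phi>. (\<exists>n \<rho>. mat_rep G n \<rho> \<and> \<phi> = brauer_character G p \<theta> \<rho>) \<and> \<phi> \<one>\<^bsub>G\<^esub> = 1}"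

text \<open>The value \<open>\<phi>(1)\<close> of a Brauer character is a natural number; this is that number.\<close>

definition character_degree :: "('g, 'm) monoid_scheme \<Rightarrow> ('g \<Rightarrow> 'c::semiring_1) \<Rightarrow> nat" where
  "character_degree G \<phi> = (THE n. \<phi> \<one>\<^bsub>G\<^esub> = of_nat n)"


section \<open>Group algebra and blocks\<close>

definition group_algebra :: "('g, 'm) monoid_scheme \<Rightarrow> ('g \<Rightarrow> 'f::field) ring" where
  "group_algebra G =
     \<lparr>carrier = {a. \<forall>g. g \<notin> carrier G \<longrightarrow> a g = 0},
      monoid.mult = (\<lambda>a b g. if g \<in> carrier G
        then \<Sum>h\<in>carrier G. a h * b (inv\<^bsub>G\<^esub> h \<otimes>\<^bsub>G\<^esub> g) else 0),
      one = (\<lambda>g. if g = \<one>\<^bsub>G\<^esub> then 1 else 0),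
      zero = (\<lambda>g. 0),
      add = (\<lambda>a b g. a g + b g)\<rparr>"

definition central_idempotents :: "('a, 'm) ring_scheme \<Rightarrow> 'a set" where
  "central_idempotents A =
     {e \<in> carrier A. e \<otimes>\<^bsub>A\<^esub> e = e \<and> (\<forall>a\<in>carrier A. a \<otimes>\<^bsub>A\<^esub> e = e \<otimes>\<^bsub>A\<^esub> a)}"

definition block_idempotents :: "('a, 'm) ring_scheme \<Rightarrow> 'a set" where
  "block_idempotents A =
     {e \<in> central_idempotents A. e \<noteq> \<zero>\<^bsub>A\<^esub> \<and>
        \<not> (\<exists>e1\<in>central_idempotents A. \<exists>e2\<in>central_idempotents A.
             e1 \<noteq> \<zero>\<^bsub>A\<^esub> \<and> e2 \<noteq> \<zero>\<^bsub>A\<^esub> \<and> e1 \<otimes>\<^bsub>A\<^esub> e2 = \<zero>\<^bsub>A\<^esub> \<and> e = e1 \<oplus>\<^bsub>A\<^esub> e2)}"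

definition block_algebra :: "('a, 'm) ring_scheme \<Rightarrow> 'a \<Rightarrow> 'a set" where
  "block_algebra A e = (\<lambda>a. a \<otimes>\<^bsub>A\<^esub> e) ` carrier A"

definition Bl :: "('g, 'm) monoid_scheme \<Rightarrow> ('g \<Rightarrow> 'f::field) set set" where
  "Bl G = block_algebra (group_algebra G) ` block_idempotents (group_algebra G)"

definition block_idem :: "('g, 'm) monoid_scheme \<Rightarrow> ('g \<Rightarrow> 'f::field) set \<Rightarrow> 'g \<Rightarrow> 'f" where
  "block_idem G B =
     (THE e. e \<in> block_idempotents (group_algebra G) \<and> B = block_algebra (group_algebra G) e)"

definition block_dim :: "('g \<Rightarrow> 'f::field) set \<Rightarrow> nat" where
  "block_dim B = vector_space.dim (\<lambda>(c::'f) a g. c * a g) B"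

definition rep_extend ::
  "('g, 'm) monoid_scheme \<Rightarrow> nat \<Rightarrow> ('g \<Rightarrow> 'f::field mat) \<Rightarrow> ('g \<Rightarrow> 'f) \<Rightarrow> 'f mat" where
  "rep_extend G n \<rho> a = mat n n (\<lambda>(i, j). \<Sum>g\<in>carrier G. a g * \<rho> g $$ (i, j))"

definition rep_in_block ::
  "('g, 'm) monoid_scheme \<Rightarrow> ('g \<Rightarrow> 'f::field) set \<Rightarrow> nat \<Rightarrow> ('g \<Rightarrow> 'f mat) \<Rightarrow> bool" where
  "rep_in_block G B n \<rho> \<longleftrightarrow> rep_extend G n \<rho> (block_idem G B) = 1\<^sub>m n"

definition IBr ::
  "('g, 'm) monoid_scheme \<Rightarrow> nat \<Rightarrow> ('k::field alg_closure \<Rightarrow> 'f::field alg_closure) \<Rightarrow>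
   ('g \<Rightarrow> 'f) set \<Rightarrow> ('g \<Rightarrow> 'k alg_closure) set" where
  "IBr G p \<theta> B =
     {\<phi>. \<exists>n \<rho>. irred_rep G n \<rho> \<and> rep_in_block G B n \<rho> \<and> \<phi> = brauer_character G p \<theta> \<rho>}"


section \<open>Defect groups\<close>

text \<open>A defect group of a block is a minimal subgroup \<open>D\<close> such that the block idempotent is a
  relative trace from \<open>D\<close>, that is, the sum of \<open>t a t\<^sup>-\<^sup>1\<close> over representatives \<open>t\<close> of the left
  cosets of \<open>D\<close>, for some \<open>a\<close> fixed under conjugation by \<open>D\<close>.\<close>

definition conj_act :: "('g, 'm) monoid_scheme \<Rightarrow> 'g \<Rightarrow> ('g \<Rightarrow> 'f::field) \<Rightarrow> 'g \<Rightarrow> 'f" where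
  "conj_act G t a = (\<lambda>g. if g \<in> carrier G then a (inv\<^bsub>G\<^esub> t \<otimes>\<^bsub>G\<^esub> g \<otimes>\<^bsub>G\<^esub> t) else 0)"

definition fixed_points :: "('g, 'm) monoid_scheme \<Rightarrow> 'g set \<Rightarrow> ('g \<Rightarrow> 'f::field) set" where
  "fixed_points G D = {a \<in> carrier (group_algebra G). \<forall>d\<in>D. conj_act G d a = a}"

definition relative_trace ::
  "('g, 'm) monoid_scheme \<Rightarrow> 'g set \<Rightarrow> ('g \<Rightarrow> 'f::field) \<Rightarrow> 'g \<Rightarrow> 'f" where
  "relative_trace G D a = (\<lambda>g. \<Sum>T\<in>lcosets\<^bsub>G\<^esub> D. conj_act G (SOME t. t \<in> T) a g)"

definition defect_group ::
  "('g, 'm) monoid_scheme \<Rightarrow> ('g \<Rightarrow> 'f::field) set \<Rightarrow> 'g set \<Rightarrow> bool" where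
  "defect_group G B D \<longleftrightarrow>
     subgroup D G \<and> block_idem G B \<in> relative_trace G D ` fixed_points G D \<and>
     (\<forall>Q. subgroup Q G \<longrightarrow> block_idem G B \<in> relative_trace G Q ` fixed_points G Q \<longrightarrow>
          Q \<subseteq> D \<longrightarrow> Q = D)"

end

theory Submission
  imports Defs "HOL-Algebra.Sylow"
begin

text \<open>Let \<open>e\<^sub>1\<close> be the idempotent of the block whose simple modules all are linear, with characters
  \<open>\<lambda>\<close>, one of them \<open>\<lambda>\<^sub>1\<close>. The group \<open>N\<close> of all \<open>g\<close> with \<open>g e\<^sub>1 = \<lambda>\<^sub>1(g) e\<^sub>1\<close> is a normal
  \<open>p'\<close>-subgroup, the group \<open>H\<close> on which all \<open>\<lambda>\<close> agree contains \<open>N\<close> and all \<open>p\<close>-elements, and \<open>H/N\<close>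
  is a \<open>p\<close>-group, because \<open>(h - \<lambda>\<^sub>1(h)) e\<^sub>1\<close> is nilpotent for \<open>h \<in> H\<close>. So \<open>G\<close> has
  \<open>p\<close>-length one.

  After extending scalars to the algebraic closure, take a block idempotent \<open>e\<close> and a primitive
  idempotent \<open>i\<close> of the group algebra of \<open>N\<close> with \<open>e i \<noteq> 0\<close>, and let \<open>S\<close> be a Sylow
  \<open>p\<close>-subgroup of the stabilizer of the isomorphism type of \<open>i\<close>. As \<open>p\<close>-power roots are unique in
  characteristic \<open>p\<close>, \<open>S\<close> acts on \<open>i\<close> through honest units \<open>w\<^sub>x\<close>, so that \<open>w\<^sub>x - i\<close> lies in the
  radical. The modules \<open>i e A\<close> and \<open>i A\<close> are free over the group algebra of these units, which makes
  \<open>S\<close> a defect group and the block \<open>|S|\<close> times as large as the part of it annihilated by the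
  radical. The latter has the dimension of the sum of the matrix algebras of the simple modules in
  the block. Relative traces descend to the small field along a linear retraction, and the matrix
  algebras are indexed by Brauer characters because a Brauer character determines the traces of all
  \<open>p\<close>-regular elements.\<close>

section \<open>Spaces of functions\<close>

text \<open>A splitting field for the group need not split \<open>N\<close>, nor contain the roots
  that trivialize the cocycle of \<open>S\<close>; hence the passage to the closure. The defect
  group is not recomputed there: the local result says that any subgroup from which the idempotent
  is a relative trace contains one of order \<open>card S\<close> with the same property, and this
  survives the retraction.

  One tool recurs: paired with a class function, the \<open>q\<close>-th power of an element,
  \<open>q\<close> a power of \<open>p\<close>, sees only the words invariant under rotation. For
  the indicator of the \<open>p\<close>-elements this makes the coefficient sum over
  \<open>p\<close>-elements vanish on nilpotent elements, which replaces Maschke's theorem for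
  \<open>N\<close> and forces the radical to annihilate the fixed points; for trace functions it
  shows that a Brauer character determines its simple module.

  The structure of the group enters because the cosets \<open>N #> x\<close> with \<open>x\<close>
  in \<open>S\<close> cover \<open>St \<inter> H\<close>: so the units \<open>w x\<close> are
  permuted by all homogeneous units of the corner, and the \<open>p\<close>-elements in the support
  of a corner element lie in these cosets. Freeness is never stated; two opposite inequalities of
  dimensions take its place.\<close>

definition sc :: "'a::field \<Rightarrow> ('x \<Rightarrow> 'a) \<Rightarrow> 'x \<Rightarrow> 'a" where
  "sc c a = (\<lambda>x. c * a x)"

text \<open>Vectors are total functions with prescribed support, so that one interpretation
  \<open>fv\<close> serves every space in the development; finite dimension is always witnessed by a
  finite support set.\<close>

definition FS :: "'x set \<Rightarrow> ('x \<Rightarrow> 'a::field) set" where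
  "FS S = {a. \<forall>x. x \<notin> S \<longrightarrow> a x = 0}"

definition res :: "'x set \<Rightarrow> ('x \<Rightarrow> 'a::field) \<Rightarrow> 'x \<Rightarrow> 'a" where
  "res S a = (\<lambda>x. if x \<in> S then a x else 0)"

definition sing :: "'x \<Rightarrow> 'x \<Rightarrow> 'a::field" where
  "sing g = (\<lambda>x. if x = g then 1 else 0)"

lemma sc_apply [simp]: "sc c a x = c * a x"
  by (simp add: sc_def)

lemma res_apply: "res S a x = (if x \<in> S then a x else 0)"
  by (simp add: res_def)

lemma sing_apply: "sing g x = (if x = g then 1 else 0)"
  by (simp add: sing_def)

lemma sum_fun_apply: "sum f S x = (\<Sum>i\<in>S. f i x)"
  for f :: "'i \<Rightarrow> 'x \<Rightarrow> 'a::comm_monoid_add"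
  by (induction S rule: infinite_finite_induct) auto

lemma additive_sum:
  fixes h :: "'b::comm_monoid_add \<Rightarrow> 'c::comm_monoid_add"
  assumes "h 0 = 0" "\<And>x y. h (x + y) = h x + h y"
  shows "h (sum g A) = (\<Sum>i\<in>A. h (g i))"
  by (induction A rule: infinite_finite_induct) (simp_all add: assms)

lemma FS_D: "a \<in> FS S \<Longrightarrow> x \<notin> S \<Longrightarrow> a x = 0"
  by (simp add: FS_def)

lemma FS_I: "(\<And>x. x \<notin> S \<Longrightarrow> a x = 0) \<Longrightarrow> a \<in> FS S"
  by (simp add: FS_def)

lemma FS_mono: "S \<subseteq> T \<Longrightarrow> a \<in> FS S \<Longrightarrow> a \<in> FS T"
  by (auto simp: FS_def)

global_interpretation fv: vector_space "sc :: 'a::field \<Rightarrow> ('x \<Rightarrow> 'a) \<Rightarrow> _"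
  by unfold_locales (auto simp: fun_eq_iff algebra_simps)

lemma span_sum_sc: "(\<And>i. i \<in> I \<Longrightarrow> v i \<in> B) \<Longrightarrow> (\<Sum>i\<in>I. sc (c i) (v i)) \<in> fv.span B"
  by (rule fv.span_sum, rule fv.span_scale, rule fv.span_base)

lemma subspace_sum_sc:
  "fv.subspace B \<Longrightarrow> (\<And>i. i \<in> I \<Longrightarrow> v i \<in> B) \<Longrightarrow> (\<Sum>i\<in>I. sc (c i) (v i)) \<in> B"
  by (rule fv.subspace_sum, assumption, rule fv.subspace_scale)

lemma FS_0 [simp]: "0 \<in> FS S"
  and FS_add: "a \<in> FS S \<Longrightarrow> b \<in> FS S \<Longrightarrow> a + b \<in> FS S"
  and FS_diff: "a \<in> FS S \<Longrightarrow> b \<in> FS S \<Longrightarrow> a - b \<in> FS S"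
  and FS_sc: "a \<in> FS S \<Longrightarrow> sc c a \<in> FS S"
  and FS_res: "a \<in> FS S \<Longrightarrow> res T a \<in> FS S"
  and FS_res': "res T a \<in> FS T"
  and FS_sing: "g \<in> S \<Longrightarrow> sing g \<in> FS S"
  by (auto simp: FS_def res_def sing_def)

lemma FS_sum: "(\<And>i. i \<in> I \<Longrightarrow> f i \<in> FS S) \<Longrightarrow> sum f I \<in> FS S"
  by (induction I rule: infinite_finite_induct) (auto intro: FS_add)

lemma res_0 [simp]: "res S 0 = 0"
  and res_add: "res S (a + b) = res S a + res S b"
  and res_sc: "res S (sc c a) = sc c (res S a)"
  by (auto simp: res_def fun_eq_iff)

lemma res_sum: "res S (sum f I) = (\<Sum>i\<in>I. res S (f i))"
  by (rule additive_sum[of "res S"]) (simp_all add: res_add)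

lemma sc_sum_left: "sc (sum f I) a = (\<Sum>i\<in>I. sc (f i) a)"
  by (auto simp: fun_eq_iff sum_fun_apply sum_distrib_right)

lemma FS_expand:
  assumes "a \<in> FS S" "finite S"
  shows "a = (\<Sum>g\<in>S. sc (a g) (sing g))"
proof
  fix x
  have "(\<Sum>g\<in>S. a g * sing g x) = (\<Sum>g\<in>S. if g = x then a g else 0)"
    by (intro sum.cong) (auto simp: sing_def)
  thus "a x = (\<Sum>g\<in>S. sc (a g) (sing g)) x"
    using assms by (auto simp: sum_fun_apply sum.delta FS_D)
qed

lemma subspace_FS: "fv.subspace (FS S)"
  by (auto simp: fv.subspace_def FS_add FS_sc)

lemma FS_span: "finite S \<Longrightarrow> FS S \<subseteq> fv.span (sing ` S)"
  by (rule subsetI, subst FS_expand, assumption, assumption)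
     (auto intro!: span_sum_sc)

lemma finite_basis:
  assumes "U \<subseteq> FS S" "finite S"
  obtains B where "B \<subseteq> U" "fv.independent B" "U \<subseteq> fv.span B" "finite B" "card B = fv.dim U"
proof -
  obtain B where B: "B \<subseteq> U" "fv.independent B" "U \<subseteq> fv.span B" "card B = fv.dim U"
    using fv.basis_exists by blast
  have "finite B"
    using fv.independent_span_bound[of "sing ` S" B] B FS_span[OF assms(2)] assms by blast
  thus ?thesis using that B by blast
qed

lemma family_independent:
  assumes "finite J"
    and "\<And>c. (\<Sum>j\<in>J. sc (c j) (v j)) = 0 \<Longrightarrow> \<forall>j\<in>J. c j = 0"
  shows "inj_on v J" "fv.independent (v ` J)"
proof -
  show inj: "inj_on v J"
  proof (rule inj_onI, rule ccontr)
    fix j k assume jk: "j \<in> J" "k \<in> J" "v j = v k" "j \<noteq> k"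
    let ?c = "\<lambda>i. if i = j then 1 else if i = k then -1 else 0 :: 'b"
    have "(\<Sum>i\<in>J. sc (?c i) (v i)) = (\<Sum>i\<in>{j,k}. sc (?c i) (v i))"
      using assms(1) jk by (intro sum.mono_neutral_right) (auto simp: fun_eq_iff)
    also have "\<dots> = 0" using jk by (auto simp: fun_eq_iff)
    finally show False using assms(2)[of ?c] jk(1) by (metis zero_neq_one)
  qed
  show "fv.independent (v ` J)"
  proof (rule fv.independent_if_scalars_zero)
    show "finite (v ` J)" using assms(1) by simp
    fix f x assume *: "(\<Sum>x\<in>v ` J. sc (f x) x) = 0" "x \<in> v ` J"
    have "(\<Sum>j\<in>J. sc (f (v j)) (v j)) = 0"
      using *(1) by (simp add: sum.reindex[OF inj])
    thus "f x = 0" using assms(2)[of "f \<circ> v"] *(2) by auto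
  qed
qed

text \<open>Indexed families instead of sets, because the bases needed later consist of products
  indexed by pairs; injectivity of the indexing comes for free from independence.\<close>

lemma family_card_le_dim:
  assumes "finite J"
    and "\<And>c. (\<Sum>j\<in>J. sc (c j) (v j)) = 0 \<Longrightarrow> \<forall>j\<in>J. c j = 0"
    and "\<And>j. j \<in> J \<Longrightarrow> v j \<in> U" "U \<subseteq> FS S" "finite S"
  shows "card J \<le> fv.dim U"
proof -
  obtain B where B: "B \<subseteq> U" "fv.independent B" "U \<subseteq> fv.span B" "finite B" "card B = fv.dim U"
    by (rule finite_basis[OF assms(4,5)])
  note * = family_independent[of J v, OF assms(1,2)]
  have "card (v ` J) \<le> card B"
    using fv.independent_span_bound[OF B(4) *(2)] B(3) assms(3) by blast
  thus ?thesis using card_image[OF *(1)] B(5) by simp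
qed

lemma dim_family:
  assumes "finite J"
    and "\<And>c. (\<Sum>j\<in>J. sc (c j) (v j)) = 0 \<Longrightarrow> \<forall>j\<in>J. c j = 0"
    and "\<And>j. j \<in> J \<Longrightarrow> v j \<in> U"
    and "\<And>u. u \<in> U \<Longrightarrow> \<exists>c. u = (\<Sum>j\<in>J. sc (c j) (v j))"
  shows "fv.dim U = card J"
proof -
  note * = family_independent[of J v, OF assms(1,2)]
  have "U \<subseteq> fv.span (v ` J)"
  proof
    fix u assume "u \<in> U"
    then obtain c where "u = (\<Sum>j\<in>J. sc (c j) (v j))" using assms(4) by blast
    thus "u \<in> fv.span (v ` J)" by (auto intro!: span_sum_sc)
  qed
  hence "fv.dim U = card (v ` J)"
    using fv.dim_unique[of "v ` J" U "card (v ` J)"] *(2) assms(3) by auto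
  thus ?thesis using card_image[OF *(1)] by simp
qed

lemma basis_expand:
  assumes "finite B" "u \<in> fv.span B"
  shows "\<exists>c. u = (\<Sum>b\<in>B. sc (c b) b)"
  using assms fv.span_finite[OF assms(1)] by auto

lemma basis_unique:
  assumes "finite B" "fv.independent B" "(\<Sum>b\<in>B. sc (c b) b) = 0"
  shows "\<forall>b\<in>B. c b = 0"
  by (intro ballI, rule fv.independentD[OF assms(2,1) subset_refl assms(3)])

lemma dim_mono_FS:
  assumes "U \<subseteq> V" "V \<subseteq> FS S" "finite S"
  shows "fv.dim U \<le> fv.dim V"
proof -
  obtain B where B: "B \<subseteq> U" "fv.independent B" "U \<subseteq> fv.span B" "finite B" "card B = fv.dim U"
    by (rule finite_basis[OF order_trans[OF assms(1,2)] assms(3)])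
  have "card B \<le> fv.dim V"
    by (rule family_card_le_dim[of B "\<lambda>b. b", OF B(4) basis_unique[OF B(4,2)] _ assms(2,3)])
       (use B(1) assms(1) in auto)
  thus ?thesis using B(5) by simp
qed

lemma dim_le_inj:
  fixes f :: "('x \<Rightarrow> 'a::field) \<Rightarrow> 'y \<Rightarrow> 'a"
  assumes U: "U \<subseteq> FS S" "finite S" "fv.subspace U"
    and add: "\<And>x y. f (x + y) = f x + f y" and scl: "\<And>c x. f (sc c x) = sc c (f x)"
    and inj: "\<And>x. x \<in> U \<Longrightarrow> f x = 0 \<Longrightarrow> x = 0"
    and V: "\<And>x. x \<in> U \<Longrightarrow> f x \<in> V" "V \<subseteq> FS Y" "finite Y"
  shows "fv.dim U \<le> fv.dim V"
proof -
  obtain B where B: "B \<subseteq> U" "fv.independent B" "U \<subseteq> fv.span B" "finite B" "card B = fv.dim U"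
    by (rule finite_basis[OF U(1,2)])
  have f0: "f 0 = 0" using scl[of 0 0] by (simp add: fun_eq_iff)
  have fsum: "f (\<Sum>i\<in>I. sc (c i) (g i)) = (\<Sum>i\<in>I. sc (c i) (f (g i)))"
    for I :: "('x \<Rightarrow> 'a) set" and c g
    by (simp add: additive_sum[of f, OF f0 add] scl)
  have "card B \<le> fv.dim V"
  proof (rule family_card_le_dim[OF B(4) _ _ V(2,3), of f])
    fix c assume "(\<Sum>j\<in>B. sc (c j) (f j)) = 0"
    hence "f (\<Sum>j\<in>B. sc (c j) j) = 0" by (simp add: fsum)
    hence "(\<Sum>j\<in>B. sc (c j) j) = 0"
      using B(1) U(3) by (intro inj) (auto intro!: subspace_sum_sc)
    thus "\<forall>j\<in>B. c j = 0" by (rule basis_unique[OF B(4,2)])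
  qed (use B V in auto)
  thus ?thesis using B by simp
qed

lemma dim_FS: "finite S \<Longrightarrow> fv.dim (FS S :: ('x \<Rightarrow> 'a::field) set) = card S"
proof (rule dim_family[where v = sing])
  fix c :: "'x \<Rightarrow> 'a" assume S: "finite S" and *: "(\<Sum>j\<in>S. sc (c j) (sing j)) = 0"
  show "\<forall>j\<in>S. c j = 0"
  proof
    fix x assume x: "x \<in> S"
    have "res S c = (\<Sum>g\<in>S. sc (res S c g) (sing g))" by (rule FS_expand[OF FS_res' S])
    also have "\<dots> = (\<Sum>g\<in>S. sc (c g) (sing g))" by (intro sum.cong) (auto simp: res_def)
    finally show "c x = 0" using x * by (metis res_apply zero_fun_apply)
  qed
next
  fix u :: "'x \<Rightarrow> 'a" assume "finite S" "u \<in> FS S"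
  thus "\<exists>c. u = (\<Sum>j\<in>S. sc (c j) (sing j))" using FS_expand by blast
qed (auto intro: FS_sing)

lemma dim_sum_le:
  assumes "U \<subseteq> FS S" "V \<subseteq> FS S" "finite S"
    and "\<And>w. w \<in> W \<Longrightarrow> \<exists>u\<in>U. \<exists>v\<in>V. w = u + v"
  shows "fv.dim W \<le> fv.dim U + fv.dim V"
proof -
  obtain B where B: "B \<subseteq> U" "fv.independent B" "U \<subseteq> fv.span B" "finite B" "card B = fv.dim U"
    by (rule finite_basis[OF assms(1,3)])
  obtain C where C: "C \<subseteq> V" "fv.independent C" "V \<subseteq> fv.span C" "finite C" "card C = fv.dim V"
    by (rule finite_basis[OF assms(2,3)])
  have "W \<subseteq> fv.span (B \<union> C)"
  proof
    fix w assume "w \<in> W"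
    then obtain u v where "u \<in> U" "v \<in> V" "w = u + v" using assms(4) by blast
    thus "w \<in> fv.span (B \<union> C)"
      using B(3) C(3) fv.span_mono[of B "B \<union> C"] fv.span_mono[of C "B \<union> C"]
      by (auto intro!: fv.span_add)
  qed
  hence "fv.dim W \<le> card (B \<union> C)" using B C by (intro fv.dim_le_card) auto
  also have "\<dots> \<le> card B + card C" by (rule card_Un_le)
  finally show ?thesis using B C by simp
qed

lemma dim_sum_ge:
  assumes "fv.subspace U" "fv.subspace V" "U \<inter> V \<subseteq> {0}" "U \<subseteq> W" "V \<subseteq> W" "W \<subseteq> FS S" "finite S"
  shows "fv.dim U + fv.dim V \<le> fv.dim (W :: ('x \<Rightarrow> 'a::field) set)"
proof -
  obtain B where B: "B \<subseteq> U" "fv.independent B" "U \<subseteq> fv.span B" "finite B" "card B = fv.dim U"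
    by (rule finite_basis[OF order_trans[OF assms(4,6)] assms(7)])
  obtain C where C: "C \<subseteq> V" "fv.independent C" "V \<subseteq> fv.span C" "finite C" "card C = fv.dim V"
    by (rule finite_basis[OF order_trans[OF assms(5,6)] assms(7)])
  \<comment> \<open>The disjoint sum as index set avoids a separate proof that the two bases have no
    common element.\<close>
  have "card (Sum_Type.Plus B C) \<le> fv.dim W"
  proof (rule family_card_le_dim[where v = "case_sum (\<lambda>b. b) (\<lambda>b. b)" and S = S])
    fix c assume "(\<Sum>j\<in>Sum_Type.Plus B C. sc (c j) (case_sum (\<lambda>b. b) (\<lambda>b. b) j)) = 0"
    hence *: "(\<Sum>b\<in>B. sc (c (Inl b)) b) + (\<Sum>b\<in>C. sc (c (Inr b)) b) = 0"
      using B(4) C(4) by (simp add: sum.Plus)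
    have u: "(\<Sum>b\<in>B. sc (c (Inl b)) b) \<in> U"
      using B assms by (auto intro!: subspace_sum_sc)
    have v: "(\<Sum>b\<in>C. sc (c (Inr b)) b) \<in> V"
      using C assms by (auto intro!: subspace_sum_sc)
    have eq: "(\<Sum>b\<in>B. sc (c (Inl b)) b) = - (\<Sum>b\<in>C. sc (c (Inr b)) b)"
      using * by (simp add: eq_neg_iff_add_eq_0)
    have "(\<Sum>b\<in>B. sc (c (Inl b)) b) \<in> V" unfolding eq by (rule fv.subspace_neg[OF assms(2) v])
    hence 0: "(\<Sum>b\<in>B. sc (c (Inl b)) b) = 0" using subsetD[OF assms(3) IntI[OF u]] by simp
    hence 1: "(\<Sum>b\<in>C. sc (c (Inr b)) b) = 0" using eq by simp
    show "\<forall>j\<in>Sum_Type.Plus B C. c j = 0"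
      using basis_unique[OF B(4,2) 0] basis_unique[OF C(4,2) 1] by auto
  qed (use B C assms in auto)
  thus ?thesis using B C by (simp add: card_Plus)
qed

section \<open>Actions of p-groups on finite sets\<close>

text \<open>An orbit contributes its size times a constant, which vanishes in characteristic
  \<open>p\<close> unless the orbit is a point. The weight \<open>\<kappa>\<close> is general
  because the sums that occur run over coefficients and matrix entries as well as over bare
  points.\<close>

lemma p_group_sum_fixed:
  fixes P (structure) and \<kappa> :: "'w \<Rightarrow> 'a::comm_ring_1"
  assumes "group P" "card (carrier P) = p ^ k" "prime p" "CHAR('a) = p" "finite \<Omega>"
    and cl: "\<And>x w. x \<in> carrier P \<Longrightarrow> w \<in> \<Omega> \<Longrightarrow> act x w \<in> \<Omega>"
    and one: "\<And>w. w \<in> \<Omega> \<Longrightarrow> act \<one> w = w"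
    and comp: "\<And>x y w. x \<in> carrier P \<Longrightarrow> y \<in> carrier P \<Longrightarrow> w \<in> \<Omega> \<Longrightarrow> act (x \<otimes> y) w = act x (act y w)"
    and inv: "\<And>x w. x \<in> carrier P \<Longrightarrow> w \<in> \<Omega> \<Longrightarrow> \<kappa> (act x w) = \<kappa> w"
  shows "sum \<kappa> \<Omega> = sum \<kappa> {w \<in> \<Omega>. \<forall>x\<in>carrier P. act x w = w}"
proof -
  interpret group P by fact
  have fin: "finite (carrier P)" using assms(2,3) by (metis card.infinite power_not_zero prime_gt_0_nat less_numeral_extra(3))
  define Orb where "Orb w = (\<lambda>x. act x w) ` carrier P" for w
  have Orb_self: "w \<in> Orb w" if "w \<in> \<Omega>" for w
    using one[OF that] unfolding Orb_def by (metis image_eqI one_closed)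
  have Orb_sub: "Orb w \<subseteq> \<Omega>" if "w \<in> \<Omega>" for w using cl that by (auto simp: Orb_def)
  have Orb_eq: "Orb w' = Orb w" if w: "w \<in> \<Omega>" and w': "w' \<in> Orb w" for w w'
  proof -
    from w' obtain y where y: "y \<in> carrier P" "w' = act y w" by (auto simp: Orb_def)
    have "act x w' \<in> Orb w" if "x \<in> carrier P" for x
      using comp[OF that y(1) w] y that by (auto simp: Orb_def intro!: image_eqI[of _ _ "x \<otimes> y"])
    moreover have "act x w \<in> Orb w'" if x: "x \<in> carrier P" for x
    proof -
      have "act x w = act (x \<otimes> inv y \<otimes> y) w" using x y by (simp add: m_assoc)
      also have "\<dots> = act (x \<otimes> inv y) w'" using x y w by (simp add: comp)
      finally show ?thesis using x y by (auto simp: Orb_def)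
    qed
    ultimately show ?thesis unfolding Orb_def[of w'] by (auto simp: Orb_def[of w])
  qed
  have size: "of_nat (card (Orb w)) * \<kappa> w = (if \<forall>x\<in>carrier P. act x w = w then \<kappa> w else 0)"
    if w: "w \<in> \<Omega>" for w
  proof -
    define St where "St = {x \<in> carrier P. act x w = w}"
    \<comment> \<open>Orbit-stabilizer by fibres: each fibre of \<open>x \<mapsto> act x w\<close>
      is a translate of the stabilizer, so the orbit size divides \<open>p ^ k\<close>.\<close>
    have fib: "card {x \<in> carrier P. act x w = o'} = card St" if o': "o' \<in> Orb w" for o'
    proof -
      from o' obtain y where y: "y \<in> carrier P" "o' = act y w" by (auto simp: Orb_def)
      have "bij_betw (\<lambda>x. y \<otimes> x) St {x \<in> carrier P. act x w = o'}"
      proof (rule bij_betwI[where g = "\<lambda>x. inv y \<otimes> x"])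
        show "(\<lambda>x. y \<otimes> x) \<in> St \<rightarrow> {x \<in> carrier P. act x w = o'}"
          using y w by (auto simp: St_def comp)
        show "(\<lambda>x. inv y \<otimes> x) \<in> {x \<in> carrier P. act x w = o'} \<rightarrow> St"
        proof
          fix x assume "x \<in> {x \<in> carrier P. act x w = o'}"
          hence x: "x \<in> carrier P" "act x w = act y w" using y by auto
          have "act (inv y \<otimes> x) w = act (inv y) (act y w)" using x y w by (simp add: comp)
          also have "\<dots> = act (inv y \<otimes> y) w" using y w by (subst comp) auto
          also have "\<dots> = w" using y w one by simp
          finally show "inv y \<otimes> x \<in> St" using x y by (simp add: St_def)
        qed
      qed (use y in \<open>auto simp: St_def m_assoc[symmetric]\<close>)
      thus ?thesis by (simp add: bij_betw_same_card)
    qed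
    have "card (carrier P) = (\<Sum>o'\<in>Orb w. card {x \<in> carrier P. act x w = o'})"
      using fin by (subst card_UN_disjoint[symmetric]) (auto simp: Orb_def intro!: arg_cong[of _ _ card])
    also have "\<dots> = card (Orb w) * card St" by (simp add: fib)
    finally have "card (Orb w) dvd p ^ k" using assms(2) by (metis dvd_triv_left)
    then obtain j where j: "card (Orb w) = p ^ j" using assms(3) divides_primepow_nat by blast
    show ?thesis
    proof (cases j)
      case 0
      hence "card (Orb w) = 1" using j by simp
      then obtain z where "Orb w = {z}" using card_1_singletonE by blast
      hence "Orb w = {w}" using Orb_self[OF w] by simp
      hence "\<forall>x\<in>carrier P. act x w = w" unfolding Orb_def by blast
      thus ?thesis using 0 j by simp
    next
      case (Suc j')
      have "\<not> (\<forall>x\<in>carrier P. act x w = w)"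
      proof
        assume "\<forall>x\<in>carrier P. act x w = w"
        hence "Orb w = {w}" by (auto simp: Orb_def)
        hence "p ^ j = 1" using j by simp
        thus False using Suc assms(3) by (simp add: prime_nat_iff)
      qed
      moreover have "of_nat (card (Orb w)) = (0 :: 'a)"
        using j Suc assms(4) by (metis dvd_triv_left of_nat_eq_0_iff_char_dvd power_Suc)
      ultimately show ?thesis by (simp only: mult_zero_left if_False)
    qed
  qed
  have Un: "\<Union> (Orb ` \<Omega>) = \<Omega>"
  proof
    show "\<Union> (Orb ` \<Omega>) \<subseteq> \<Omega>" using Orb_sub by (rule UN_least)
    show "\<Omega> \<subseteq> \<Union> (Orb ` \<Omega>)" using Orb_self by (intro subsetI UN_I)
  qed
  have disj: "A \<inter> B = {}" if AB: "A \<in> Orb ` \<Omega>" "B \<in> Orb ` \<Omega>" "A \<noteq> B" for A B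
  proof (rule ccontr)
    assume "A \<inter> B \<noteq> {}"
    then obtain z where z: "z \<in> A" "z \<in> B" by blast
    from AB obtain a b where ab: "a \<in> \<Omega>" "A = Orb a" "b \<in> \<Omega>" "B = Orb b" by blast
    have "Orb z = Orb a" by (rule Orb_eq) (use z ab in auto)
    moreover have "Orb z = Orb b" by (rule Orb_eq) (use z ab in auto)
    ultimately show False using ab AB(3) by simp
  qed
  have "sum \<kappa> \<Omega> = sum \<kappa> (\<Union> (Orb ` \<Omega>))" by (simp only: Un)
  also have "\<dots> = (\<Sum>C\<in>Orb ` \<Omega>. sum \<kappa> C)"
  proof (subst sum.Union_disjoint)
    show "\<forall>A\<in>Orb ` \<Omega>. finite A" using fin by (auto simp: Orb_def)
    show "\<forall>A\<in>Orb ` \<Omega>. \<forall>B\<in>Orb ` \<Omega>. A \<noteq> B \<longrightarrow> A \<inter> B = {}"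
      using disj by (intro ballI impI)
  qed auto
  also have "\<dots> = (\<Sum>C\<in>Orb ` \<Omega>. \<Sum>w\<in>C. if \<forall>x\<in>carrier P. act x w = w then \<kappa> w else 0)"
  proof (rule sum.cong[OF refl])
    fix C assume "C \<in> Orb ` \<Omega>"
    then obtain w where w: "w \<in> \<Omega>" "C = Orb w" by blast
    show "sum \<kappa> C = (\<Sum>w\<in>C. if \<forall>x\<in>carrier P. act x w = w then \<kappa> w else 0)"
    proof (cases "\<forall>x\<in>carrier P. act x w = w")
      case True
      hence "C = {w}" using w by (auto simp: Orb_def)
      thus ?thesis using True by simp
    next
      case False
      have 1: "\<kappa> w' = \<kappa> w" if "w' \<in> C" for w' using that w inv by (auto simp: Orb_def)
      have nofix: "\<not> (\<forall>x\<in>carrier P. act x w' = w')" if "w' \<in> C" for w'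
      proof
        assume "\<forall>x\<in>carrier P. act x w' = w'"
        hence "Orb w' = {w'}" by (auto simp: Orb_def)
        hence "Orb w = {w'}" using Orb_eq w that by blast
        moreover have "act x w \<in> Orb w" if "x \<in> carrier P" for x using that by (simp add: Orb_def)
        ultimately have "\<forall>x\<in>carrier P. act x w = w" using Orb_self[OF w(1)] by auto
        thus False using False by contradiction
      qed
      have "(\<Sum>w\<in>C. if \<forall>x\<in>carrier P. act x w = w then \<kappa> w else 0) = (\<Sum>w\<in>C. 0)"
        by (rule sum.cong[OF refl], rule if_not_P[OF nofix])
      moreover have "sum \<kappa> C = of_nat (card C) * \<kappa> w" using 1 by simp
      ultimately show ?thesis using size[OF w(1)] False unfolding w(2) by simp
    qed
  qed
  also have "\<dots> = (\<Sum>w\<in>\<Union> (Orb ` \<Omega>). if \<forall>x\<in>carrier P. act x w = w then \<kappa> w else 0)"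
  proof (subst sum.Union_disjoint)
    show "\<forall>A\<in>Orb ` \<Omega>. finite A" using fin by (auto simp: Orb_def)
    show "\<forall>A\<in>Orb ` \<Omega>. \<forall>B\<in>Orb ` \<Omega>. A \<noteq> B \<longrightarrow> A \<inter> B = {}"
      using disj by (intro ballI impI)
  qed auto
  also note Un
  also have "(\<Sum>w\<in>\<Omega>. if \<forall>x\<in>carrier P. act x w = w then \<kappa> w else 0) =
      sum \<kappa> {w \<in> \<Omega>. \<forall>x\<in>carrier P. act x w = w}"
    using assms(5) by (simp add: sum.inter_filter)
  finally show ?thesis .
qed

section \<open>The group algebra\<close>

locale fin_group = group G for G :: "('g, 'm) monoid_scheme" (structure) +
  assumes fin: "finite (carrier G)"
begin

definition conv :: "('g \<Rightarrow> 'a::field) \<Rightarrow> ('g \<Rightarrow> 'a) \<Rightarrow> 'g \<Rightarrow> 'a" (infixl \<open>\<star>\<close> 70) where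
  "a \<star> b = (\<lambda>g. if g \<in> carrier G then \<Sum>h\<in>carrier G. a h * b (inv h \<otimes> g) else 0)"

abbreviation A1 :: "'g \<Rightarrow> 'a::field" where "A1 \<equiv> sing \<one>"

lemma conv_apply: "g \<in> carrier G \<Longrightarrow> (a \<star> b) g = (\<Sum>h\<in>carrier G. a h * b (inv h \<otimes> g))"
  by (simp add: conv_def)

lemma conv_apply': "g \<in> carrier G \<Longrightarrow> (a \<star> b) g = (\<Sum>h\<in>carrier G. a (g \<otimes> inv h) * b h)"
  unfolding conv_apply
  by (rule sum.reindex_bij_witness[of _ "\<lambda>h. g \<otimes> inv h" "\<lambda>h. inv h \<otimes> g"])
     (auto simp: inv_mult_group m_assoc, auto simp: m_assoc[symmetric])

lemma conv_in [simp, intro]: "a \<star> b \<in> FS (carrier G)"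
  by (auto simp: conv_def FS_def)

lemma FS_eqI:
  "a \<in> FS (carrier G) \<Longrightarrow> b \<in> FS (carrier G) \<Longrightarrow> (\<And>g. g \<in> carrier G \<Longrightarrow> a g = b g) \<Longrightarrow> a = b"
  by (metis FS_D ext)

lemma conv_assoc: "a \<star> b \<star> c = a \<star> (b \<star> c)"
proof (rule FS_eqI)
  fix g assume g: "g \<in> carrier G"
  have "(a \<star> b \<star> c) g = (\<Sum>h\<in>carrier G. \<Sum>k\<in>carrier G. a k * b (inv k \<otimes> (g \<otimes> inv h)) * c h)"
    using g by (simp add: conv_apply'[OF g, of "a \<star> b" c] conv_apply sum_distrib_right)
  also have "\<dots> = (\<Sum>k\<in>carrier G. \<Sum>h\<in>carrier G. a k * (b (inv k \<otimes> g \<otimes> inv h) * c h))"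
    using g by (subst sum.swap) (auto intro!: sum.cong simp: m_assoc mult.assoc)
  also have "\<dots> = (a \<star> (b \<star> c)) g"
    using g by (simp add: conv_apply[OF g, of a "b \<star> c"] conv_apply' sum_distrib_left)
  finally show "(a \<star> b \<star> c) g = (a \<star> (b \<star> c)) g" .
qed auto

lemma conv_add_left: "(a + b) \<star> c = a \<star> c + b \<star> c"
  and conv_add_right: "c \<star> (a + b) = c \<star> a + c \<star> b"
  and conv_diff_left: "(a - b) \<star> c = a \<star> c - b \<star> c"
  and conv_diff_right: "c \<star> (a - b) = c \<star> a - c \<star> b"
  and conv_0_left [simp]: "0 \<star> c = 0"
  and conv_0_right [simp]: "c \<star> 0 = 0"
  and conv_sc_left: "sc r a \<star> c = sc r (a \<star> c)"
  and conv_sc_right: "c \<star> sc r a = sc r (c \<star> a)"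
  by (auto simp: conv_def fun_eq_iff algebra_simps sum.distrib sum_subtractf sum_distrib_left)

lemma conv_sum_left: "sum f I \<star> c = (\<Sum>i\<in>I. f i \<star> c)"
  by (rule additive_sum[of "\<lambda>a. a \<star> c"]) (simp_all add: conv_add_left)

lemma conv_sum_right: "c \<star> sum f I = (\<Sum>i\<in>I. c \<star> f i)"
  by (rule additive_sum[of "\<lambda>a. c \<star> a"]) (simp_all add: conv_add_right)

lemma sing_conv:
  assumes "g \<in> carrier G"
  shows "sing g \<star> a = (\<lambda>x. if x \<in> carrier G then a (inv g \<otimes> x) else 0)"
proof
  fix x
  have "(\<Sum>h\<in>carrier G. sing g h * a (inv h \<otimes> x)) = (\<Sum>h\<in>carrier G. if h = g then a (inv h \<otimes> x) else 0)"
    by (intro sum.cong) (auto simp: sing_def)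
  thus "(sing g \<star> a) x = (if x \<in> carrier G then a (inv g \<otimes> x) else 0)"
    using assms fin by (simp add: conv_def)
qed

lemma conv_sing:
  assumes "g \<in> carrier G"
  shows "a \<star> sing g = (\<lambda>x. if x \<in> carrier G then a (x \<otimes> inv g) else 0)"
proof
  fix x
  have "(\<Sum>h\<in>carrier G. a (x \<otimes> inv h) * sing g h) = (\<Sum>h\<in>carrier G. if h = g then a (x \<otimes> inv h) else 0)"
    by (intro sum.cong) (auto simp: sing_def)
  thus "(a \<star> sing g) x = (if x \<in> carrier G then a (x \<otimes> inv g) else 0)"
    using assms fin conv_apply'[of x a "sing g"] FS_D[OF conv_in[of a "sing g"], of x] by auto
qed

lemma sing_mult: "g \<in> carrier G \<Longrightarrow> h \<in> carrier G \<Longrightarrow> sing g \<star> sing h = (sing (g \<otimes> h) :: 'g \<Rightarrow> 'a::field)"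
proof
  fix x assume gh: "g \<in> carrier G" "h \<in> carrier G"
  have "inv g \<otimes> x = h \<longleftrightarrow> x = g \<otimes> h" if "x \<in> carrier G"
    using gh that by (metis inv_solve_left)
  thus "(sing g \<star> sing h) x = (sing (g \<otimes> h) x :: 'a)"
    using gh by (auto simp: sing_conv[OF gh(1)] sing_apply)
qed

lemma A1_left [simp]: "a \<in> FS (carrier G) \<Longrightarrow> A1 \<star> a = a"
  and A1_right [simp]: "a \<in> FS (carrier G) \<Longrightarrow> a \<star> A1 = a"
  by (auto simp: sing_conv conv_sing FS_def fun_eq_iff)

lemma A1_conv_assoc [simp]: "A1 \<star> (a \<star> b) = a \<star> b" "(a \<star> b) \<star> A1 = a \<star> b"
  by simp_all

lemma A1_in [simp]: "A1 \<in> FS (carrier G)"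
  by (simp add: FS_sing)

lemma conv_pair:
  "(\<Sum>g\<in>carrier G. f g * (a \<star> b) g) = (\<Sum>h\<in>carrier G. \<Sum>k\<in>carrier G. f (h \<otimes> k) * a h * b k)"
proof -
  have "(\<Sum>g\<in>carrier G. f g * (a \<star> b) g) = (\<Sum>h\<in>carrier G. \<Sum>g\<in>carrier G. f g * a h * b (inv h \<otimes> g))"
    by (subst sum.swap) (auto intro!: sum.cong simp: conv_apply sum_distrib_left mult.assoc)
  also have "\<dots> = (\<Sum>h\<in>carrier G. \<Sum>k\<in>carrier G. f (h \<otimes> k) * a h * b k)"
  proof (rule sum.cong[OF refl])
    fix h assume "h \<in> carrier G"
    thus "(\<Sum>g\<in>carrier G. f g * a h * b (inv h \<otimes> g)) = (\<Sum>k\<in>carrier G. f (h \<otimes> k) * a h * b k)"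
      by (intro sum.reindex_bij_witness[of _ "\<lambda>k. h \<otimes> k" "\<lambda>g. inv h \<otimes> g"]) (auto simp: m_assoc[symmetric])
  qed
  finally show ?thesis .
qed

lemma class_fun_comm:
  assumes "\<And>h k. h \<in> carrier G \<Longrightarrow> k \<in> carrier G \<Longrightarrow> f (h \<otimes> k) = f (k \<otimes> h)"
  shows "(\<Sum>g\<in>carrier G. f g * (a \<star> b) g) = (\<Sum>g\<in>carrier G. f g * (b \<star> a) g)"
  unfolding conv_pair by (subst sum.swap) (auto intro!: sum.cong simp: assms mult.assoc mult.commute)

lemma conv_one_comm: "(a \<star> b) \<one> = (b \<star> a) \<one>"
proof -
  have *: "(\<Sum>g\<in>carrier G. (if g = \<one> then 1 else 0) * c g) = c \<one>" for c :: "'g \<Rightarrow> 'a"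
    using fin by (simp add: if_distrib[of "\<lambda>x. x * _"] cong: if_cong)
  have "h \<otimes> k = \<one> \<longleftrightarrow> k \<otimes> h = \<one>" if "h \<in> carrier G" "k \<in> carrier G" for h k
    using that by (metis inv_comm)
  thus ?thesis
    using class_fun_comm[of "\<lambda>g. if g = \<one> then 1 else 0" a b] by (simp add: *)
qed

lemma conv_supp:
  assumes "a \<in> FS S" "b \<in> FS T" "\<And>x y. x \<in> S \<Longrightarrow> y \<in> T \<Longrightarrow> x \<in> carrier G \<Longrightarrow> y \<in> carrier G \<Longrightarrow> x \<otimes> y \<in> U"
  shows "a \<star> b \<in> FS U"
proof (rule FS_I)
  fix g assume g: "g \<notin> U"
  have "a h * b (inv h \<otimes> g) = 0" if "g \<in> carrier G" "h \<in> carrier G" for h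
  proof (cases "h \<in> S \<and> inv h \<otimes> g \<in> T")
    case True
    hence "h \<otimes> (inv h \<otimes> g) \<in> U" using assms(3) that by auto
    thus ?thesis using g that by (simp add: m_assoc[symmetric])
  next
    case False
    thus ?thesis using assms(1,2) by (auto simp: FS_def)
  qed
  thus "(a \<star> b) g = 0" by (simp add: conv_def)
qed

text \<open>With cosets of a normal subgroup, or unions of them, for \<open>S\<close>,
  \<open>C\<close> and \<open>C'\<close>, this is the grading of the group algebra by the quotient
  group. It serves to cut products into homogeneous components.\<close>

lemma res_conv:
  assumes "a \<in> FS S" "\<And>h g. h \<in> S \<Longrightarrow> h \<in> carrier G \<Longrightarrow> g \<in> carrier G \<Longrightarrow> h \<otimes> g \<in> C' \<longleftrightarrow> g \<in> C"
  shows "res C' (a \<star> y) = a \<star> res C y"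
proof
  fix g
  show "res C' (a \<star> y) g = (a \<star> res C y) g"
  proof (cases "g \<in> carrier G")
    case True
    have *: "a h * res C y (inv h \<otimes> g) = (if g \<in> C' then a h * y (inv h \<otimes> g) else 0)"
      if h: "h \<in> carrier G" for h
    proof (cases "h \<in> S")
      case False thus ?thesis using assms(1) by (simp add: FS_def)
    next
      case S: True
      have "h \<otimes> (inv h \<otimes> g) = g" using h True by (simp add: m_assoc[symmetric])
      hence "inv h \<otimes> g \<in> C \<longleftrightarrow> g \<in> C'" using assms(2)[OF S h, of "inv h \<otimes> g"] h True by simp
      thus ?thesis by (simp add: res_def)
    qed
    show ?thesis using True by (simp add: res_def[of C'] conv_apply * )
  qed (simp add: res_def conv_def)
qed

lemma conv_res:
  assumes "a \<in> FS S" "\<And>h g. h \<in> S \<Longrightarrow> h \<in> carrier G \<Longrightarrow> g \<in> carrier G \<Longrightarrow> g \<otimes> h \<in> C' \<longleftrightarrow> g \<in> C"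
  shows "res C' (y \<star> a) = res C y \<star> a"
proof
  fix g
  show "res C' (y \<star> a) g = (res C y \<star> a) g"
  proof (cases "g \<in> carrier G")
    case True
    have *: "res C y (g \<otimes> inv h) * a h = (if g \<in> C' then y (g \<otimes> inv h) * a h else 0)"
      if h: "h \<in> carrier G" for h
    proof (cases "h \<in> S")
      case False thus ?thesis using assms(1) by (simp add: FS_def)
    next
      case S: True
      have "g \<otimes> inv h \<otimes> h = g" using h True by (simp add: m_assoc)
      hence "g \<otimes> inv h \<in> C \<longleftrightarrow> g \<in> C'" using assms(2)[OF S h, of "g \<otimes> inv h"] h True by simp
      thus ?thesis by (simp add: res_def)
    qed
    show ?thesis using True by (simp add: res_def[of C'] conv_apply' * )
  qed (simp add: res_def conv_def)
qed

lemma central_if_sing: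
  assumes "z \<in> FS (carrier G)" "S \<subseteq> carrier G" "\<And>g. g \<in> S \<Longrightarrow> z \<star> sing g = sing g \<star> z" "a \<in> FS S"
  shows "z \<star> a = a \<star> z"
proof -
  have "finite S" using assms(2) fin finite_subset by blast
  hence "a = (\<Sum>g\<in>S. sc (a g) (sing g))" by (rule FS_expand[OF assms(4)])
  hence "z \<star> a = z \<star> (\<Sum>g\<in>S. sc (a g) (sing g))" "a \<star> z = (\<Sum>g\<in>S. sc (a g) (sing g)) \<star> z" by simp_all
  thus ?thesis using assms(3) by (simp add: conv_sum_left conv_sum_right conv_sc_left conv_sc_right)
qed

subsection \<open>Powers and polynomials\<close>

text \<open>Powers in the corner algebra with unit \<open>u\<close>, whence the zeroth power
  \<open>u\<close>; \<open>pw A1\<close> gives the ordinary powers.\<close>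

fun pw :: "('g \<Rightarrow> 'a::field) \<Rightarrow> ('g \<Rightarrow> 'a) \<Rightarrow> nat \<Rightarrow> 'g \<Rightarrow> 'a" where
  "pw u y 0 = u"
| "pw u y (Suc n) = y \<star> pw u y n"

definition nilp :: "('g \<Rightarrow> 'a::field) \<Rightarrow> bool" where
  "nilp a \<longleftrightarrow> (\<exists>n. pw A1 a n = 0)"

text \<open>Horner evaluation at \<open>y\<close> in the corner with unit \<open>u\<close>. Under
  the assumptions of the context below it is multiplicative, so identities between polynomials in
  one variable can be used inside the noncommutative algebra.\<close>

definition pev :: "('g \<Rightarrow> 'a::field) \<Rightarrow> ('g \<Rightarrow> 'a) \<Rightarrow> 'a poly \<Rightarrow> 'g \<Rightarrow> 'a" where
  "pev u y f = fold_coeffs (\<lambda>c a. sc c u + y \<star> a) f 0"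

lemma pev_0 [simp]: "pev u y 0 = 0"
  by (simp add: pev_def)

lemma pev_pCons [simp]: "pev u y (pCons c f) = sc c u + y \<star> pev u y f"
  by (cases "f = 0 \<and> c = 0") (auto simp: pev_def)

lemma pev_add:
  fixes f g :: "'a::field poly"
  shows "pev u y (f + g) = pev u y f + pev u y g"
proof -
  have "\<forall>g. pev u y (f + g) = pev u y f + pev u y g"
  proof (rule pCons_induct[where P = "\<lambda>f. \<forall>g. pev u y (f + g) = pev u y f + pev u y g"])
    fix c :: 'a and f assume IH: "\<forall>g. pev u y (f + g) = pev u y f + pev u y g"
    show "\<forall>g. pev u y (pCons c f + g) = pev u y (pCons c f) + pev u y g"
    proof
      fix g :: "'a poly"
      obtain d g' where g: "g = pCons d g'" using pCons_cases by blast
      show "pev u y (pCons c f + g) = pev u y (pCons c f) + pev u y g"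
        unfolding g add_pCons pev_pCons spec[OF IH] by (simp only: conv_add_right fv.scale_left_distrib ac_simps)
    qed
  qed simp
  thus ?thesis by blast
qed

lemma pev_smult: "pev u y (smult c f) = sc c (pev u y f)"
  by (rule pCons_induct[where P = "\<lambda>f. pev u y (smult c f) = sc c (pev u y f)"])
     (simp_all add: conv_sc_right fv.scale_right_distrib)

context
  fixes u y :: "'g \<Rightarrow> 'a::field"
  assumes u: "u \<star> u = u" and uy: "u \<star> y = y" and yu: "y \<star> u = y"
begin

lemma pev_unit: "u \<star> pev u y f = pev u y f"
  by (rule pCons_induct[where P = "\<lambda>f. u \<star> pev u y f = pev u y f"])
     (simp_all add: conv_add_right conv_sc_right u conv_assoc[symmetric] uy)

lemma pev_mult: "pev u y (f * g) = pev u y f \<star> pev u y g"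
  by (rule pCons_induct[where P = "\<lambda>f. pev u y (f * g) = pev u y f \<star> pev u y g"])
     (simp_all add: pev_add pev_smult conv_add_left conv_sc_left conv_assoc pev_unit)

lemma pev_const: "pev u y [:c:] = sc c u"
  by simp

lemma pev_X: "pev u y [:0, 1:] = y"
  by (simp add: conv_sc_right yu fv.scale_right_distrib)

lemma pev_power: "pev u y (f ^ n) = pw u (pev u y f) n"
  by (induction n) (simp_all add: pev_mult one_pCons)

lemma pw_X: "pev u y ([:0, 1:] ^ n) = pw u y n"
  by (simp only: pev_power pev_X)

lemma pw_unit: "pw u y n = u \<star> pw A1 y n" if "y \<in> FS (carrier G)" "u \<in> FS (carrier G)"
proof (induction n)
  case 0 show ?case using that by simp
next
  case (Suc n)
  have "pw u y (Suc n) = y \<star> u \<star> pw A1 y n" by (simp add: Suc conv_assoc)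
  thus ?case by (simp add: yu uy conv_assoc[symmetric])
qed

lemma pw_comm_u: "u \<star> pw A1 y (Suc n) = pw A1 y (Suc n)"
  by (simp add: conv_assoc[symmetric] uy)

text \<open>The powers with exponents from 0 to \<open>card (carrier G)\<close> are one more than
  the dimension of the group algebra, so they are dependent.\<close>

lemma pev_eq_0_exists:
  obtains f where "f \<noteq> 0" "pev u y f = 0"
proof -
  have "\<exists>c. (\<Sum>j\<in>{..card (carrier G)}. sc (c j) (pw u y j)) = 0 \<and> (\<exists>j\<in>{..card (carrier G)}. c j \<noteq> 0)"
  proof (rule ccontr)
    assume no: "\<nexists>c. (\<Sum>j\<in>{..card (carrier G)}. sc (c j) (pw u y j)) = 0 \<and> (\<exists>j\<in>{..card (carrier G)}. c j \<noteq> 0)"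
    have "pw u y j \<in> FS (carrier G)" for j
      by (cases j) (use conv_in[of u u] u in auto)
    hence "card {..card (carrier G)} \<le> fv.dim (FS (carrier G) :: ('g \<Rightarrow> 'a) set)"
      by (intro family_card_le_dim[where v = "pw u y" and S = "carrier G"]) (use no fin in auto)
    thus False by (simp add: dim_FS fin)
  qed
  then obtain c j where c: "(\<Sum>j\<in>{..card (carrier G)}. sc (c j) (pw u y j)) = 0"
    "j \<le> card (carrier G)" "c j \<noteq> 0" by auto
  define f where "f = (\<Sum>j\<in>{..card (carrier G)}. smult (c j) ([:0, 1:] ^ j))"
  have coef: "Polynomial.coeff ([:0, 1:] ^ i) k = (if i = k then 1 else 0 :: 'a)" for i k
    by (metis Polynomial.coeff_monom x_as_monom monom_power mult_1 power_one)
  have "Polynomial.coeff f j = c j"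
    using c(2) by (simp add: f_def Polynomial.coeff_sum coef if_distrib[of "\<lambda>x. _ * x"] cong: if_cong)
  hence "f \<noteq> 0" using c(3) by auto
  moreover have "pev u y f = 0"
    unfolding f_def
    by (subst additive_sum[of "pev u y"]) (simp_all add: pev_add pev_smult pw_X c(1))
  ultimately show ?thesis using that by blast
qed

text \<open>Fitting's lemma for a non-nilpotent \<open>y\<close>. That the polynomial has no
  constant term is essential: the idempotent is a multiple of \<open>y\<close>.\<close>

lemma fitting:
  assumes nn: "\<forall>n. pw u y n \<noteq> 0"
  obtains q where "pev u y (pCons 0 q) \<noteq> 0" "pev u y (pCons 0 q) \<star> pev u y (pCons 0 q) = pev u y (pCons 0 q)"
proof -
  obtain f where f: "f \<noteq> 0" "pev u y f = 0" by (rule pev_eq_0_exists)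
  define r where "r = order 0 f"
  obtain h where h: "f = [:0, 1:] ^ r * h" "\<not> [:0, 1:] dvd h"
    using order_decomp[OF f(1), of 0] by (auto simp: r_def)
  have "poly h 0 \<noteq> 0" using h(2) poly_eq_0_iff_dvd[of h 0] by auto
  define h1 where "h1 = smult (inverse (poly h 0)) h"
  have h1: "poly h1 0 = 1" using \<open>poly h 0 \<noteq> 0\<close> by (simp add: h1_def)
  have f1: "pev u y ([:0, 1:] ^ r * h1) = 0"
    using f(2) by (simp add: h1_def h(1) pev_smult)
  have "[:0, 1:] dvd 1 - h1" using h1 poly_eq_0_iff_dvd[of "1 - h1" 0] by simp
  then obtain w where w: "1 - h1 = [:0, 1:] * w" unfolding dvd_def by blast
  define n where "n = Suc r"
  \<comment> \<open>\<open>K\<close> is divisible by the power \<open>Suc r\<close> of X, because X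
    divides \<open>1 - h1\<close>, and it is 1 modulo \<open>h1\<close>. So it is idempotent modulo
    the annihilating polynomial, and it fixes the \<open>r\<close>-th power of \<open>y\<close>,
    which keeps it nonzero.\<close>
  define K where "K = (1 - h1) ^ n"
  have K: "K = [:0, 1:] ^ r * ([:0, 1:] * w ^ n)"
    by (simp only: K_def w n_def power_mult_distrib power_Suc ac_simps)
  have "h1 dvd K - 1"
  proof -
    have "(1 - h1) - 1 dvd (1 - h1) ^ n - 1 ^ n" by (metis dvd_triv_left power_diff_sumr2)
    thus ?thesis by (simp add: K_def)
  qed
  then obtain m where m: "K - 1 = h1 * m" unfolding dvd_def by blast
  have "K * K = K + K * (K - 1)" by (simp add: algebra_simps)
  also have "K * (K - 1) = ([:0, 1:] ^ r * h1) * (m * ([:0, 1:] * w ^ n))"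
    unfolding m by (subst K) (simp only: ac_simps)
  finally have KK: "pev u y K \<star> pev u y K = pev u y K"
    using pev_mult[of K K] pev_mult[of "[:0, 1:] ^ r * h1"] f1 by (simp add: pev_add)
  have "[:0, 1:] ^ r * K = [:0, 1:] ^ r + ([:0, 1:] ^ r * h1) * m"
    using m by (simp add: algebra_simps)
  hence "pev u y ([:0, 1:] ^ r) \<star> pev u y K = pev u y ([:0, 1:] ^ r)"
    using pev_mult[of "[:0, 1:] ^ r" K] pev_mult[of "[:0, 1:] ^ r * h1" m] f1 by (simp add: pev_add)
  hence "pev u y K \<noteq> 0" using nn by (auto simp: pw_X)
  moreover have "K = pCons 0 ([:0, 1:] ^ r * w ^ n)" unfolding K by simp
  ultimately show ?thesis using that KK by metis
qed

end

text \<open>Split a linear factor off an annihilating polynomial. If \<open>y - sc c u\<close> has a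
  left inverse, the cofactor annihilates as well, and its degree is smaller; degree zero is
  impossible since \<open>u\<close> is nonzero.\<close>

lemma eigenvalue_exists:
  fixes u y :: "'g \<Rightarrow> 'a::alg_closed_field"
  assumes u: "u \<star> u = u" and uy: "u \<star> y = y" and yu: "y \<star> u = y" and "u \<noteq> 0"
  shows "\<exists>c. \<forall>z. z \<star> (y - sc c u) \<noteq> u"
proof -
  note pm = pev_mult[OF u uy yu] and pun = pev_unit[OF u uy yu]
  define Z where "Z f \<longleftrightarrow> pev u y f = 0" for f
  define Q where "Q \<longleftrightarrow> (\<exists>c. \<forall>z. z \<star> (y - sc c u) \<noteq> u)"
  have "Q" if "f \<noteq> 0" "Z f" "degree f = n" for f n
    using that
  proof (induction n arbitrary: f)
    case 0
    then obtain c where c: "f = [:c:]" using degree_eq_zeroE by blast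
    have "c \<noteq> 0" using 0(1) c by auto
    moreover have "sc c u = 0" using 0(2) unfolding c Z_def by simp
    ultimately have "u = 0" by (metis fv.scale_eq_0_iff)
    thus ?case using \<open>u \<noteq> 0\<close> by contradiction
  next
    case (Suc n)
    then obtain c where c: "poly f c = 0" using alg_closed_imp_poly_has_root[of f] by auto
    then obtain g where g: "f = [:-c, 1:] * g" unfolding poly_eq_0_iff_dvd dvd_def by blast
    have "g \<noteq> 0" using Suc.prems(1) g by auto
    moreover from this have "degree f = 1 + degree g" unfolding g by (subst degree_mult_eq) auto
    ultimately have g0: "g \<noteq> 0" "degree g = n" using Suc.prems(3) by auto
    show ?case
    proof (cases "\<exists>z. z \<star> (y - sc c u) = u")
      case True
      then obtain z where z: "z \<star> (y - sc c u) = u" by blast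
      have X: "pev u y [:-c, 1:] = y - sc c u"
        by (simp add: conv_sc_right yu fun_eq_iff)
      have "pev u y g = z \<star> (y - sc c u) \<star> pev u y g" by (simp add: z pun)
      also have "\<dots> = z \<star> pev u y f" unfolding g by (simp only: pm X conv_assoc)
      finally have "Z g" using Suc.prems(2) by (simp add: Z_def)
      thus ?thesis using Suc.IH g0 by blast
    next
      case False
      thus ?thesis unfolding Q_def by blast
    qed
  qed
  moreover obtain f where "f \<noteq> 0" "pev u y f = 0" by (rule pev_eq_0_exists[OF u uy yu])
  ultimately show ?thesis unfolding Q_def Z_def by blast
qed

text \<open>\<open>y\<close> commutes with scalars, so the identity can be proved for polynomials,
  where the freshman's dream applies, and then evaluated.\<close>

lemma pev_frobenius:
  fixes u y :: "'g \<Rightarrow> 'a::field"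
  assumes u: "u \<star> u = u" and uy: "u \<star> y = y" and yu: "y \<star> u = y"
    and "prime (CHAR('a))" "q = CHAR('a) ^ k"
  shows "pw u (y - sc c u) q = pw u y q - sc (c ^ q) u"
proof -
  have ch: "CHAR('a poly) = CHAR('a)" by simp
  have "([:0, 1:] + [:-c:]) ^ q = [:0, 1:] ^ q + [:-c:] ^ q"
    by (rule freshmans_dream') (use assms ch in simp_all)
  also have "[:-c:] ^ q = [:(-c) ^ q:]" by (rule poly_const_pow)
  also have "(- c) ^ q = - (c ^ q)"
  \<comment> \<open>Getting the sign from the same identity treats odd \<open>p\<close> and
    \<open>p = 2\<close> alike.\<close>
  proof -
    have "(c + - c) ^ q = c ^ q + (- c) ^ q"
      by (rule freshmans_dream') (use assms in simp_all)
    moreover have "q > 0" using assms by (simp add: prime_gt_0_nat)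
    ultimately show ?thesis by (simp add: power_0_left eq_neg_iff_add_eq_0 add.commute)
  qed
  finally have "pev u y (([:0, 1:] + [:-c:]) ^ q) = pev u y ([:0, 1:] ^ q + [:- (c ^ q):])" by simp
  thus ?thesis
    by (simp add: pev_power[OF u uy yu] pev_add pw_X[OF u uy yu] conv_sc_right yu fun_eq_iff)
qed

lemma nilp_idem: "nilp a \<Longrightarrow> a \<star> a = a \<Longrightarrow> a = 0"
proof -
  assume n: "nilp a" and a: "a \<star> a = a"
  have *: "pw A1 a (Suc m) = a" for m
    by (induction m) (use a conv_in[of a a] in auto)
  from n obtain k where "pw A1 a k = 0" by (auto simp: nilp_def)
  hence "pw A1 a (Suc k) = 0" by simp
  thus "a = 0" using * by simp
qed

lemma pw_add: "pw A1 a (m + n) = pw A1 a m \<star> pw A1 a n" if "a \<in> FS (carrier G)"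
proof (induction m)
  case 0
  have "pw A1 a n \<in> FS (carrier G)" by (cases n) (auto simp: FS_sing)
  thus ?case by simp
qed (simp add: conv_assoc)

lemma pw_le: "pw A1 a m = 0 \<Longrightarrow> m \<le> n \<Longrightarrow> a \<in> FS (carrier G) \<Longrightarrow> pw A1 a n = 0"
  using pw_add[of a m "n - m"] by simp

subsection \<open>The coefficient sum over p-elements\<close>

definition words :: "nat \<Rightarrow> 'g list set" where
  "words n = {xs. set xs \<subseteq> carrier G \<and> length xs = n}"

definition wprod :: "'g list \<Rightarrow> 'g" where
  "wprod xs = foldr (\<otimes>) xs \<one>"

lemma finite_words: "finite (words n)"
  using finite_lists_length_eq[OF fin, of n] by (simp add: words_def)

lemma wprod_closed: "set xs \<subseteq> carrier G \<Longrightarrow> wprod xs \<in> carrier G"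
  by (induction xs) (auto simp: wprod_def)

lemma wprod_append: "set xs \<subseteq> carrier G \<Longrightarrow> set ys \<subseteq> carrier G \<Longrightarrow> wprod (xs @ ys) = wprod xs \<otimes> wprod ys"
proof (induction xs)
  case (Cons x xs)
  have "wprod xs \<in> carrier G" "wprod ys \<in> carrier G" using Cons by (auto intro: wprod_closed)
  moreover have "wprod (x # zs) = x \<otimes> wprod zs" for zs by (simp add: wprod_def)
  ultimately show ?case using Cons by (simp add: m_assoc)
qed (use wprod_closed[of ys] in \<open>simp add: wprod_def\<close>)

lemma word_sum:
  "(\<Sum>g\<in>carrier G. f g * pw A1 a n g) = (\<Sum>xs\<in>words n. f (wprod xs) * prod_list (map a xs))"
proof (induction n arbitrary: f)
  case 0
  have "words 0 = {[]}" by (auto simp: words_def)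
  thus ?case using fin by (simp add: sing_def if_distrib[of "\<lambda>x. _ * x"] wprod_def cong: if_cong)
next
  case (Suc n)
  have W: "words (Suc n) = (\<lambda>(h, xs). h # xs) ` (carrier G \<times> words n)"
    by (auto simp: words_def length_Suc_conv image_iff)
  have "(\<Sum>g\<in>carrier G. f g * pw A1 a (Suc n) g) =
      (\<Sum>h\<in>carrier G. a h * (\<Sum>k\<in>carrier G. f (h \<otimes> k) * pw A1 a n k))"
    by (simp add: conv_pair sum_distrib_left mult_ac)
  also have "\<dots> = (\<Sum>h\<in>carrier G. \<Sum>xs\<in>words n. f (wprod (h # xs)) * prod_list (map a (h # xs)))"
    by (simp add: Suc.IH[of "\<lambda>k. f (_ \<otimes> k)"] sum_distrib_left mult_ac wprod_def)
  also have "\<dots> = (\<Sum>xs\<in>words (Suc n). f (wprod xs) * prod_list (map a xs))"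
    unfolding W by (subst sum.reindex) (auto simp: inj_on_def sum.cartesian_product case_prod_beta)
  finally show ?case .
qed

text \<open>The power expands into words of length \<open>q\<close>. Rotating a word changes neither
  the product of its coefficients nor the class function at its value, so in characteristic
  \<open>p\<close> only the constant words survive.\<close>

lemma word_rotate_sum:
  fixes a :: "'g \<Rightarrow> 'a::field"
  assumes p: "prime p" "CHAR('a) = p" "q = p ^ k"
    and f: "\<And>h k. h \<in> carrier G \<Longrightarrow> k \<in> carrier G \<Longrightarrow> f (h \<otimes> k) = f (k \<otimes> h)"
  shows "(\<Sum>g\<in>carrier G. f g * pw A1 a q g) = (\<Sum>g\<in>carrier G. f (g [^] q) * a g ^ q)"
proof -
  have q: "q > 0" using p by (simp add: prime_gt_0_nat)
  let ?\<kappa> = "\<lambda>xs. f (wprod xs) * prod_list (map a xs)"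
  let ?P = "integer_mod_group q"
  let ?act = "\<lambda>x. rotate (nat x)"
  have rot: "rotate m xs \<in> words q" if "xs \<in> words q" for m xs using that by (auto simp: words_def)
  have inv: "?\<kappa> (rotate m xs) = ?\<kappa> xs" if xs: "xs \<in> words q" for m xs
  proof -
    let ?m = "m mod length xs"
    have s: "set (take ?m xs) \<subseteq> carrier G" "set (drop ?m xs) \<subseteq> carrier G"
      using xs set_take_subset[of ?m xs] set_drop_subset[of ?m xs] by (auto simp: words_def)
    have "f (wprod (rotate m xs)) = f (wprod (take ?m xs @ drop ?m xs))"
      unfolding rotate_drop_take wprod_append[OF s] wprod_append[OF s(2,1)]
      by (rule f) (use s wprod_closed in auto)
    moreover have "prod_list (map a (rotate m xs)) = prod_list (map a (take ?m xs @ drop ?m xs))"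
      unfolding rotate_drop_take by (simp add: mult.commute del: append_take_drop_id)
    ultimately show ?thesis by simp
  qed
  have "sum ?\<kappa> (words q) = sum ?\<kappa> {xs \<in> words q. \<forall>x\<in>carrier ?P. ?act x xs = xs}"
  proof (rule p_group_sum_fixed[where P = ?P and p = p and k = k])
    show "card (carrier ?P) = p ^ k" using q by (simp add: carrier_integer_mod_group flip: p(3))
    show "?act (x \<otimes>\<^bsub>?P\<^esub> y) w = ?act x (?act y w)"
      if "x \<in> carrier ?P" "y \<in> carrier ?P" "w \<in> words q" for x y w
    proof -
      have "nat ((x + y) mod int q) = (nat x + nat y) mod q"
        using that q by (simp add: carrier_integer_mod_group nat_mod_distrib nat_add_distrib)
      moreover have "length w = q" using that by (simp add: words_def)
      ultimately show ?thesis by (simp add: rotate_rotate) (metis rotate_conv_mod)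
    qed
  qed (use p q inv rot finite_words in auto)
  also have "{xs \<in> words q. \<forall>x\<in>carrier ?P. ?act x xs = xs} = (\<lambda>g. replicate q g) ` carrier G"
  proof (intro equalityI subsetI)
    fix xs assume "xs \<in> {xs \<in> words q. \<forall>x\<in>carrier ?P. ?act x xs = xs}"
    hence xs: "xs \<in> words q" "\<And>x. x \<in> {0..<int q} \<Longrightarrow> rotate (nat x) xs = xs"
      using q by (auto simp: carrier_integer_mod_group)
    have len: "length xs = q" using xs(1) by (simp add: words_def)
    define x where "x = xs ! 0"
    have xi: "xs ! i = x" if "i < q" for i
    proof -
      have "rotate i xs = xs" using xs(2)[of "int i"] that by simp
      thus ?thesis using nth_rotate[of 0 xs i] len that q unfolding x_def by simp
    qed
    have "xs = replicate q x" by (rule nth_equalityI) (simp_all add: len xi)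
    moreover have "x \<in> carrier G" using xs(1) len q nth_mem[of 0 xs] unfolding x_def by (auto simp: words_def)
    ultimately show "xs \<in> (\<lambda>g. replicate q g) ` carrier G" by blast
  next
    fix xs assume "xs \<in> (\<lambda>g. replicate q g) ` carrier G"
    moreover have "rotate m (replicate q x) = replicate q x" for m and x :: 'g
      by (rule nth_equalityI) (simp_all add: nth_rotate)
    ultimately show "xs \<in> {xs \<in> words q. \<forall>x\<in>carrier ?P. ?act x xs = xs}"
      by (auto simp: words_def)
  qed
  also have "sum ?\<kappa> \<dots> = (\<Sum>g\<in>carrier G. f (g [^] q) * a g ^ q)"
  proof (subst sum.reindex)
    show "inj_on (replicate q) (carrier G)" using q by (auto simp: inj_on_def)
    have "wprod (replicate m g) = g [^] m" if "g \<in> carrier G" for g m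
      using that by (induction m) (simp_all add: wprod_def, metis nat_pow_Suc nat_pow_Suc2)
    thus "sum (?\<kappa> \<circ> replicate q) (carrier G) = (\<Sum>g\<in>carrier G. f (g [^] q) * a g ^ q)"
      by (intro sum.cong) (auto simp: prod_list_replicate)
  qed
  finally show ?thesis by (simp add: word_sum)
qed

definition pelt :: "nat \<Rightarrow> 'g set" where
  "pelt p = {g \<in> carrier G. \<exists>k. g [^] (p ^ k) = \<one>}"

text \<open>Apply \<open>word_rotate_sum\<close> with the indicator of the \<open>p\<close>-elements
  and \<open>q\<close> so large that the \<open>q\<close>-th power is zero. Taking
  \<open>q\<close>-th powers in the group preserves and reflects being a \<open>p\<close>-element,
  hence the right side is the \<open>q\<close>-th power of the sum.\<close>

lemma nilp_pelt_sum:
  fixes a :: "'g \<Rightarrow> 'a::field"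
  assumes p: "prime p" "CHAR('a) = p" and a: "a \<in> FS (carrier G)" "nilp a"
  shows "(\<Sum>g\<in>pelt p. a g) = 0"
proof -
  obtain k where k: "pw A1 a k = 0" using a(2) by (auto simp: nilp_def)
  define q where "q = p ^ k"
  have "k \<le> q" using p(1) by (simp add: q_def less_imp_le prime_gt_1_nat self_le_ge2_pow prime_ge_2_nat)
  hence 0: "pw A1 a q = 0" using pw_le[OF k _ a(1)] by simp
  define f where "f = (\<lambda>g. if g \<in> pelt p then 1 else 0 :: 'a)"
  have pw_swap: "(h \<otimes> x) [^] n \<otimes> h = h \<otimes> (x \<otimes> h) [^] n" if "h \<in> carrier G" "x \<in> carrier G" for h x and n :: nat
    using that by (induction n) (simp_all add: m_assoc, simp add: m_assoc[symmetric])
  \<comment> \<open>The indicator is a class function because \<open>x \<otimes> h\<close> and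
    \<open>h \<otimes> x\<close> are conjugate.\<close>
  have one: "(x \<otimes> h) [^] n = \<one>" if "h \<in> carrier G" "x \<in> carrier G" "(h \<otimes> x) [^] n = \<one>" for h x and n :: nat
  proof -
    have "h \<otimes> (x \<otimes> h) [^] n = h \<otimes> \<one>" using pw_swap[OF that(1,2), of n] that by simp
    thus ?thesis using that by (metis l_cancel m_closed nat_pow_closed one_closed)
  qed
  have "(\<Sum>g\<in>carrier G. f g * pw A1 a q g) = (\<Sum>g\<in>carrier G. f (g [^] q) * a g ^ q)"
    by (rule word_rotate_sum[OF p q_def]) (use one in \<open>auto simp: f_def pelt_def\<close>)
  also have "\<dots> = (\<Sum>g\<in>carrier G. (f g * a g) ^ q)"
  proof (rule sum.cong[OF refl])
    fix g assume g: "g \<in> carrier G"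
    have "g [^] q \<in> pelt p \<longleftrightarrow> g \<in> pelt p"
    proof
      assume "g [^] q \<in> pelt p"
      then obtain j where "(g [^] q) [^] (p ^ j) = \<one>" by (auto simp: pelt_def)
      thus "g \<in> pelt p" using g by (auto simp: pelt_def nat_pow_pow q_def power_add[symmetric])
    next
      assume "g \<in> pelt p"
      then obtain j where "g [^] (p ^ j) = \<one>" by (auto simp: pelt_def)
      hence "(g [^] (p ^ j)) [^] q = \<one>" by simp
      hence "(g [^] q) [^] (p ^ j) = \<one>" using g by (simp add: nat_pow_pow mult.commute)
      thus "g [^] q \<in> pelt p" using g by (auto simp: pelt_def)
    qed
    moreover have "q > 0" using p by (simp add: q_def prime_gt_0_nat)
    ultimately show "f (g [^] q) * a g ^ q = (f g * a g) ^ q" by (simp add: f_def)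
  qed
  also have "\<dots> = (\<Sum>g\<in>carrier G. f g * a g) ^ q"
    by (rule freshmans_dream_sum'[symmetric]) (use p in \<open>simp_all add: q_def\<close>)
  finally have "(\<Sum>g\<in>carrier G. f g * a g) = 0" using 0 by simp
  moreover have "(\<Sum>g\<in>carrier G. f g * a g) = (\<Sum>g\<in>pelt p. a g)"
    unfolding f_def using fin
    by (subst sum.mono_neutral_right[of "carrier G" "pelt p"]) (auto simp: pelt_def)
  ultimately show ?thesis by simp
qed

end

lemma char_p_root_1:
  fixes x :: "'a::field"
  assumes "prime p" "CHAR('a) = p" "x ^ (p ^ k) = 1"
  shows "x = 1"
proof -
  have "(1 + (x - 1)) ^ (p ^ k) = 1 ^ (p ^ k) + (x - 1) ^ (p ^ k)"
    by (rule freshmans_dream') (use assms in auto)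
  hence "(x - 1) ^ (p ^ k) = 0" using assms(3) by simp
  thus ?thesis by simp
qed

lemma dim_pos:
  fixes U :: "('x \<Rightarrow> 'a::field) set"
  assumes "U \<subseteq> FS S" "finite S" "u \<in> U" "u \<noteq> 0"
  shows "fv.dim U > 0"
proof -
  have "card {u} \<le> fv.dim U"
    by (rule family_card_le_dim[where v = "\<lambda>u. u" and S = S])
       (use assms fv.scale_eq_0_iff in auto)
  thus ?thesis by simp
qed

section \<open>Sylow subgroups, subgroups of p-power index, conjugation\<close>

context fin_group
begin

lemma finite_sub: "S \<subseteq> carrier G \<Longrightarrow> finite S"
  using fin finite_subset by blast

lemma sylow_subgroup:
  assumes "prime q" "subgroup T G"
  obtains S k m where "subgroup S G" "S \<subseteq> T" "card S = q ^ k" "card T = q ^ k * m" "\<not> q dvd m"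
proof -
  have T: "T \<subseteq> carrier G" using assms(2) subgroup.subset by blast
  have finT: "finite T" using finite_sub T .
  have "card T \<noteq> 0" using finT subgroup.one_closed[OF assms(2)] by auto
  then obtain m where m: "card T = q ^ multiplicity q (card T) * m" "\<not> q dvd m"
    using multiplicity_decompose'[of "card T" q] assms(1)
    by (metis not_prime_unit)
  interpret T: group "G\<lparr>carrier := T\<rparr>" using assms(2) by (rule subgroup_imp_group)
  have "sylow (G\<lparr>carrier := T\<rparr>) q (multiplicity q (card T)) m"
    unfolding sylow_eq sylow_axioms_def using assms(1) m(1) finT T.is_group by (simp add: Coset.order_def)
  from sylow.sylow_thm[OF this] obtain S where S: "subgroup S (G\<lparr>carrier := T\<rparr>)"
    "card S = q ^ multiplicity q (card T)" by blast
  have "subgroup S G" "S \<subseteq> T"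
    using incl_subgroup[OF assms(2) S(1)] subgroup.subset[OF S(1)] by auto
  thus ?thesis using that S(2) m by blast
qed

lemma subgroup_nat_pow: "subgroup S G \<Longrightarrow> x \<in> S \<Longrightarrow> x [^] (n::nat) \<in> S"
  by (induction n) (auto simp: subgroup.one_closed subgroup.m_closed)

lemma subgroup_pow_card:
  assumes "subgroup S G" "x \<in> S"
  shows "x [^] card S = \<one>"
proof -
  interpret S: group "G\<lparr>carrier := S\<rparr>" using assms(1) by (rule subgroup_imp_group)
  have "x [^]\<^bsub>G\<lparr>carrier := S\<rparr>\<^esub> Coset.order (G\<lparr>carrier := S\<rparr>) = \<one>"
    using S.pow_order_eq_1[of x] assms(2) by simp
  thus ?thesis by (simp add: Coset.order_def nat_pow_consistent[symmetric])
qed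

text \<open>By Bezout, \<open>x\<close> is itself a power of \<open>x [^] a\<close>.\<close>

lemma coprime_pow_in:
  assumes "subgroup S G" "x \<in> carrier G" "x [^] (a::nat) \<in> S" "x [^] (b::nat) = \<one>" "coprime a b"
  shows "x \<in> S"
proof (cases "a = 0")
  case True
  thus ?thesis using assms subgroup.one_closed by fastforce
next
  case False
  obtain u v where uv: "a * u = b * v + gcd a b" using bezout_nat[OF False] by blast
  have "x [^] (a * u) \<in> S"
    using subgroup_nat_pow[OF assms(1,3), of u] assms(2) by (simp add: nat_pow_pow)
  moreover have "x [^] (a * u) = x"
    using assms(2,4,5) by (simp add: uv nat_pow_mult[symmetric] nat_pow_pow[symmetric])
  ultimately show ?thesis by simp
qed

lemma subgroup_card_dvd: "subgroup S G \<Longrightarrow> subgroup T G \<Longrightarrow> S \<subseteq> T \<Longrightarrow> card S dvd card T"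
proof -
  assume S: "subgroup S G" and T: "subgroup T G" and ST: "S \<subseteq> T"
  interpret T: group "G\<lparr>carrier := T\<rparr>" using T by (rule subgroup_imp_group)
  have "subgroup S (G\<lparr>carrier := T\<rparr>)" using subgroup_incl[OF S T ST] .
  from T.lagrange[OF this]
  have "card T = card (rcosets\<^bsub>G\<lparr>carrier := T\<rparr>\<^esub> S) * card S" by (simp add: Coset.order_def)
  thus ?thesis by simp
qed

text \<open>If a prime \<open>q\<close> other than \<open>p\<close> divided the index, a Sylow
  \<open>q\<close>-subgroup of \<open>Q\<close> would be too large for \<open>N\<close>; but each of
  its elements has a \<open>p\<close>-power in \<open>N\<close> and order prime to \<open>p\<close>,
  so it lies in \<open>N\<close>.\<close>

lemma p_index:
  assumes "prime p" "subgroup Q G" "subgroup N G" "N \<subseteq> Q"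
    and pw: "\<And>x. x \<in> Q \<Longrightarrow> \<exists>k. x [^] (p ^ k) \<in> N"
  shows "\<exists>j. card Q = card N * p ^ j"
proof -
  obtain r where r: "card Q = card N * r" using subgroup_card_dvd[OF assms(3,2,4)] by (auto elim: dvdE)
  have finQ: "finite Q" using finite_sub subgroup.subset assms(2) by blast
  have "card Q \<noteq> 0" using finQ subgroup.one_closed[OF assms(2)] by auto
  have "q = p" if q: "prime q" "q dvd r" for q
  proof (rule ccontr)
    assume "q \<noteq> p"
    obtain S k m where S: "subgroup S G" "S \<subseteq> Q" "card S = q ^ k" "card Q = q ^ k * m" "\<not> q dvd m"
      using sylow_subgroup[OF q(1) assms(2)] .
    have "S \<subseteq> N"
    proof
      fix x assume x: "x \<in> S"
      hence xQ: "x \<in> Q" using S(2) by blast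
      then obtain l where l: "x [^] (p ^ l) \<in> N" using pw by blast
      have "x [^] (q ^ k) = \<one>" using subgroup_pow_card[OF S(1) x] S(3) by simp
      moreover have "coprime (p ^ l) (q ^ k)"
        using \<open>q \<noteq> p\<close> q(1) assms(1) by (simp add: primes_coprime)
      ultimately show "x \<in> N"
        using coprime_pow_in[OF assms(3) _ l] subgroup.mem_carrier[OF assms(2) xQ] by blast
    qed
    hence "q ^ k dvd card N" using subgroup_card_dvd[OF S(1) assms(3)] S(3) by simp
    hence "q ^ k * q dvd card N * r" using q(2) by (rule mult_dvd_mono)
    hence "q ^ k * q dvd q ^ k * m" using r S(4) by simp
    thus False using S(5) q(1) by (simp add: prime_gt_0_nat)
  qed
  moreover have "r \<noteq> 0" using r \<open>card Q \<noteq> 0\<close> by auto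
  ultimately have "\<exists>j. r = p ^ j"
  proof -
    obtain m where m: "r = p ^ multiplicity p r * m" "\<not> p dvd m"
      using multiplicity_decompose'[OF \<open>r \<noteq> 0\<close>, of p] assms(1) by (metis not_prime_unit)
    have "m = 1"
    proof (rule ccontr)
      assume "m \<noteq> 1"
      then obtain q where "prime q" "q dvd m" using prime_factor_nat by blast
      thus False using m \<open>\<And>q. prime q \<Longrightarrow> q dvd r \<Longrightarrow> q = p\<close> by (metis dvd_mult)
    qed
    thus ?thesis using m(1) by auto
  qed
  thus ?thesis using r by blast
qed

subsection \<open>Conjugation\<close>

definition cj :: "'g \<Rightarrow> ('g \<Rightarrow> 'a::field) \<Rightarrow> 'g \<Rightarrow> 'a" where
  "cj g a = sing g \<star> a \<star> sing (inv g)"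

lemma cj_apply: "g \<in> carrier G \<Longrightarrow> x \<in> carrier G \<Longrightarrow> cj g a x = a (inv g \<otimes> x \<otimes> g)"
  by (simp add: cj_def conv_assoc sing_conv conv_sing m_assoc)

lemma cj_in [simp]: "cj g a \<in> FS (carrier G)"
  by (simp add: cj_def)

lemma cj_one: "a \<in> FS (carrier G) \<Longrightarrow> cj \<one> a = a"
  by (simp add: cj_def)

lemma sing_inv_l: "g \<in> carrier G \<Longrightarrow> sing (inv g) \<star> (sing g \<star> a) = A1 \<star> a"
  and sing_inv_r: "g \<in> carrier G \<Longrightarrow> sing g \<star> (sing (inv g) \<star> a) = A1 \<star> a"
  by (simp_all add: sing_mult conv_assoc[symmetric])

lemma cj_mult: "g \<in> carrier G \<Longrightarrow> cj g (a \<star> b) = cj g a \<star> cj g b"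
  by (simp add: cj_def conv_assoc sing_inv_l)

lemma cj_cj: "g \<in> carrier G \<Longrightarrow> h \<in> carrier G \<Longrightarrow> cj g (cj h a) = cj (g \<otimes> h) a"
  by (rule FS_eqI) (simp_all add: cj_apply inv_mult_group m_assoc)

lemma sing_cj: "g \<in> carrier G \<Longrightarrow> sing g \<star> a = cj g a \<star> sing g"
  by (simp only: cj_def conv_assoc[of "sing g \<star> a"]) (simp add: sing_mult)

lemma cj_add: "cj g (a + b) = cj g a + cj g b"
  and cj_sc: "cj g (sc c a) = sc c (cj g a)"
  and cj_0: "cj g 0 = 0"
  by (simp_all add: cj_def conv_add_left conv_add_right conv_sc_left conv_sc_right)

lemma cj_sum: "cj g (sum f I) = (\<Sum>i\<in>I. cj g (f i))"
  by (rule additive_sum[of "cj g"]) (simp_all add: cj_0 cj_add)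

lemma central_cj: "a \<in> FS (carrier G) \<Longrightarrow> g \<in> carrier G \<Longrightarrow>
    (\<And>b. b \<in> FS (carrier G) \<Longrightarrow> a \<star> b = b \<star> a) \<Longrightarrow> cj g a = a"
  unfolding cj_def using FS_sing[of g "carrier G"] 
  by (metis A1_right conv_assoc inv_closed r_inv sing_mult)

lemma cj_fix_comm: "a \<in> FS (carrier G) \<Longrightarrow> g \<in> carrier G \<Longrightarrow> cj g a = a \<Longrightarrow> a \<star> sing g = sing g \<star> a"
  by (simp add: sing_cj)

lemma nilp_if_corner:
  assumes "u \<star> u = u" "u \<star> y = y" "y \<star> u = y" "y \<in> FS (carrier G)" "u \<in> FS (carrier G)" "pw u y n = 0"
  shows "nilp y"
proof -
  have "pw u y (Suc n) = 0" using assms(6) by simp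
  hence "pw A1 y (Suc n) = 0" using pw_unit[OF assms(1-5), of "Suc n"] pw_comm_u[OF assms(1-3), of n] by simp
  thus ?thesis unfolding nilp_def by blast
qed

end

section \<open>The stabilizer of a primitive idempotent\<close>

text \<open>All that the local argument needs from modular theory. \<open>I\<close> indexes the
  simple modules, with degrees \<open>n k\<close> and matrix coefficients \<open>m k i j\<close>;
  \<open>m_surj\<close> says that the algebra maps onto the product of the matrix algebras,
  \<open>m_nil\<close> that the kernel is nil, and \<open>e_prim\<close> that \<open>e\<close> is a
  block idempotent over the algebraically closed field.\<close>

locale core = fin_group G for G :: "('g, 'm) monoid_scheme" (structure) +
  fixes p :: nat and N H :: "'g set" and I :: "'i set" and n :: "'i \<Rightarrow> nat"
    and m :: "'i \<Rightarrow> nat \<Rightarrow> nat \<Rightarrow> 'g \<Rightarrow> 'a::alg_closed_field" and e :: "'g \<Rightarrow> 'a"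
  assumes p: "prime p" and ch: "CHAR('a) = p"
    and N: "N \<lhd> G" and pN: "\<not> p dvd card N"
    and H: "H \<lhd> G" and NH: "N \<subseteq> H" and pH: "pelt p \<subseteq> H" and HN: "\<And>h. h \<in> H \<Longrightarrow> \<exists>k. h [^] (p ^ k) \<in> N"
    and finI: "finite I"
    and m_one: "\<And>k i j. k \<in> I \<Longrightarrow> i < n k \<Longrightarrow> j < n k \<Longrightarrow> m k i j \<one> = (if i = j then 1 else 0)"
    and m_mult: "\<And>k i j g h. k \<in> I \<Longrightarrow> i < n k \<Longrightarrow> j < n k \<Longrightarrow> g \<in> carrier G \<Longrightarrow> h \<in> carrier G \<Longrightarrow>
        m k i j (g \<otimes> h) = (\<Sum>r<n k. m k i r g * m k r j h)"
    and m_surj: "\<And>k i j. k \<in> I \<Longrightarrow> i < n k \<Longrightarrow> j < n k \<Longrightarrow> \<exists>a\<in>FS (carrier G). \<forall>k'\<in>I. \<forall>i'<n k'. \<forall>j'<n k'.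
        (\<Sum>g\<in>carrier G. a g * m k' i' j' g) = (if (k', i', j') = (k, i, j) then 1 else 0)"
    and m_nil: "\<And>a. a \<in> FS (carrier G) \<Longrightarrow> (\<And>k i j. k \<in> I \<Longrightarrow> i < n k \<Longrightarrow> j < n k \<Longrightarrow>
        (\<Sum>g\<in>carrier G. a g * m k i j g) = 0) \<Longrightarrow> nilp a"
    and e_in: "e \<in> FS (carrier G)" and ee: "e \<star> e = e" and e_nz: "e \<noteq> 0"
    and e_cent: "\<And>a. a \<in> FS (carrier G) \<Longrightarrow> e \<star> a = a \<star> e"
    and e_prim: "\<And>k. k \<in> FS (carrier G) \<Longrightarrow> k \<star> k = k \<Longrightarrow>
        (\<And>a. a \<in> FS (carrier G) \<Longrightarrow> k \<star> a = a \<star> k) \<Longrightarrow> k \<star> e = e \<or> k \<star> e = 0"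
begin

lemma N_sub: "subgroup N G" using N by (simp add: normal_def)
lemma N_carr: "N \<subseteq> carrier G" using N_sub subgroup.subset by blast
lemma finN: "finite N" using finite_sub N_carr .
lemma FSN_in: "a \<in> FS N \<Longrightarrow> a \<in> FS (carrier G)" using FS_mono N_carr by blast

lemma FSN_conv: "a \<in> FS N \<Longrightarrow> b \<in> FS N \<Longrightarrow> a \<star> b \<in> FS N"
  by (erule conv_supp, assumption) (rule subgroup.m_closed[OF N_sub])

lemma A1_N: "A1 \<in> FS N" by (rule FS_sing, rule subgroup.one_closed[OF N_sub])

lemma pelt_N: "pelt p \<inter> N = {\<one>}"
proof (intro equalityI subsetI)
  fix x assume x: "x \<in> pelt p \<inter> N"
  then obtain k where k: "x [^] (p ^ k) = \<one>" "x \<in> carrier G" by (auto simp: pelt_def)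
  have "coprime (p ^ k) (card N)" using p pN by (simp add: prime_imp_coprime)
  moreover have "x [^] card N = \<one>" using x by (intro subgroup_pow_card N_sub) auto
  ultimately have "x \<in> {\<one>}" using coprime_pow_in[of "{\<one>}" x] k triv_subgroup by simp
  thus "x \<in> {\<one>}" .
next
  fix x assume "x \<in> {\<one>}"
  thus "x \<in> pelt p \<inter> N" using N_sub by (auto simp: pelt_def subgroup.one_closed)
qed

text \<open>The coefficient sum over \<open>p\<close>-elements reduces to the coefficient at
  \<open>\<one>\<close>, since \<open>N\<close> contains no other \<open>p\<close>-element. This is
  the form in which the semisimplicity of the group algebra of \<open>N\<close> is used.\<close>

lemma nilpN:
  fixes a :: "'g \<Rightarrow> 'a"
  assumes a: "a \<in> FS N" "nilp a"
  shows "a \<one> = 0"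
proof -
  have fp: "finite (pelt p)" using finite_sub by (auto simp: pelt_def)
  have "(\<Sum>g\<in>pelt p. a g) = (\<Sum>g\<in>{\<one>}. a g)"
  proof (rule sum.mono_neutral_right[OF fp])
    show "{\<one>} \<subseteq> pelt p" using pelt_N by blast
    show "\<forall>g\<in>pelt p - {\<one>}. a g = 0" using pelt_N FS_D[OF a(1)] by blast
  qed
  thus ?thesis using nilp_pelt_sum[OF p ch FSN_in[OF a(1)] a(2)] by simp
qed

text \<open>The trace form is nondegenerate: the inverse of any element of the support can be taken
  as the second argument.\<close>

lemma nondeg:
  assumes "u \<in> FS N" "u \<noteq> 0"
  obtains z where "z \<in> FS N" "(u \<star> z) \<one> \<noteq> 0"
proof -
  obtain g where g: "u g \<noteq> 0" using assms(2) by (auto simp: fun_eq_iff)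
  hence gN: "g \<in> N" using assms(1) FS_D by metis
  hence gG: "g \<in> carrier G" using N_carr by blast
  have "inv g \<in> N" using gN N_sub by (rule subgroup.m_inv_closed[rotated])
  moreover have "(u \<star> sing (inv g)) \<one> = u g" using gG by (simp add: conv_sing)
  ultimately show ?thesis using that[of "sing (inv g)"] g FS_sing by metis
qed

definition corner :: "('g \<Rightarrow> 'a) \<Rightarrow> ('g \<Rightarrow> 'a) set" where
  "corner i = {a \<in> FS N. i \<star> a = a \<and> a \<star> i = a}"

lemma corner_subspace: "fv.subspace (corner i)"
  by (auto simp: fv.subspace_def corner_def FS_add FS_sc conv_add_left conv_add_right conv_sc_left conv_sc_right)

lemma corner_less:
  assumes i: "i \<in> FS N" "i \<star> i = i" and k: "k \<in> corner i" "k \<star> k = k" "k \<noteq> i"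
  shows "fv.dim (corner k) < fv.dim (corner i)"
proof -
  define k' where "k' = i - k"
  have kk: "k \<in> FS N" "i \<star> k = k" "k \<star> i = k" using k by (auto simp: corner_def)
  have k': "k' \<in> FS N" "k' \<star> k = 0" "k \<star> k' = 0" "k' \<star> k' = k'" "i \<star> k' = k'" "k' \<star> i = k'" "k' \<noteq> 0"
    using kk k i by (auto simp: k'_def FS_diff conv_diff_left conv_diff_right)
  have sub: "corner l \<subseteq> corner i" if l: "l \<in> FS N" "i \<star> l = l" "l \<star> i = l" for l
  proof
    fix a assume "a \<in> corner l"
    hence a: "a \<in> FS N" "l \<star> a = a" "a \<star> l = a" by (auto simp: corner_def)
    have "i \<star> (l \<star> a) = l \<star> a" "(a \<star> l) \<star> i = a \<star> l"
      by (simp only: conv_assoc[symmetric] l, simp only: conv_assoc l)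
    thus "a \<in> corner i" using a by (simp add: corner_def)
  qed
  have "fv.dim (corner k) + fv.dim (corner k') \<le> fv.dim (corner i)"
  proof (rule dim_sum_ge[OF corner_subspace corner_subspace _ sub sub])
    show "corner k \<inter> corner k' \<subseteq> {0}"
    proof
      fix x assume "x \<in> corner k \<inter> corner k'"
      hence x: "k \<star> x = x" "k' \<star> x = x" by (auto simp: corner_def)
      have "x = k \<star> (k' \<star> x)" by (simp add: x)
      thus "x \<in> {0}" by (simp add: conv_assoc[symmetric] k')
    qed
    show "corner i \<subseteq> FS N" by (auto simp: corner_def)
  qed (use kk k' finN in auto)
  moreover have "fv.dim (corner k') > 0"
    by (rule dim_pos[where S = N and u = k']) (use k' finN in \<open>auto simp: corner_def\<close>)
  ultimately show ?thesis by simp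
qed

lemma exists_min_idem:
  obtains i where "i \<in> FS N" "i \<star> i = i" "e \<star> i \<noteq> 0"
    "\<forall>k\<in>corner i. k \<star> k = k \<longrightarrow> k = 0 \<or> k = i"
proof -
  let ?P = "\<lambda>i. i \<in> FS N \<and> i \<star> i = i \<and> e \<star> i \<noteq> 0"
  have "?P A1" using A1_N e_nz e_in by simp
  \<comment> \<open>The corner has least dimension only among the idempotents not annihilated by
    \<open>e\<close>, so primitivity still needs an argument for the annihilated ones.\<close>
  then obtain i where i: "?P i" and min: "\<And>k. ?P k \<Longrightarrow> fv.dim (corner i) \<le> fv.dim (corner k)"
    using ex_has_least_nat[of ?P A1 "\<lambda>i. fv.dim (corner i)"] by blast
  have i1: "i \<in> FS N" "i \<star> i = i" using i by auto
  have main: "k = i" if k: "k \<in> corner i" "k \<star> k = k" "e \<star> k \<noteq> 0" for k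
  proof (rule ccontr)
    assume "k \<noteq> i"
    hence "fv.dim (corner k) < fv.dim (corner i)" by (rule corner_less[OF i1 k(1,2)])
    moreover have "?P k" using k by (auto simp: corner_def)
    ultimately show False using min[of k] by simp
  qed
  have "k = 0 \<or> k = i" if k: "k \<in> corner i" "k \<star> k = k" for k
  proof (cases "e \<star> k = 0")
    case False thus ?thesis using main k by blast
  next
    case True
    \<comment> \<open>When \<open>e\<close> annihilates \<open>k\<close> it does not annihilate the
      complement, so minimality applies to \<open>i - k\<close> instead.\<close>
    have "i - k \<in> corner i" "(i - k) \<star> (i - k) = i - k"
      using k i1 by (auto simp: corner_def FS_diff conv_diff_left conv_diff_right)
    moreover have "e \<star> (i - k) \<noteq> 0" using True i by (simp add: conv_diff_right)
    ultimately have "i - k = i" using main by blast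
    hence "k = 0" by (simp add: fun_eq_iff)
    thus ?thesis by simp
  qed
  thus ?thesis using that i by blast
qed

lemma pev_corner:
  assumes "i \<in> FS N" "i \<star> i = i" "y \<in> corner i"
  shows "pev i y f \<in> corner i"
proof -
  have "i \<in> corner i" using assms by (simp add: corner_def)
  have mult: "a \<star> b \<in> corner i" if "a \<in> corner i" "b \<in> corner i" for a b
    using that by (auto simp: corner_def FSN_conv conv_assoc) (simp add: conv_assoc[symmetric])
  show ?thesis
  proof (rule pCons_induct[where P = "\<lambda>f. pev i y f \<in> corner i"])
    show "pev i y 0 \<in> corner i" using fv.subspace_0[OF corner_subspace] by simp
    fix c f assume "pev i y f \<in> corner i"
    hence "y \<star> pev i y f \<in> corner i" by (rule mult[OF assms(3)])
    thus "pev i y (pCons c f) \<in> corner i"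
      unfolding pev_pCons
      by (rule fv.subspace_add[OF corner_subspace fv.subspace_scale[OF corner_subspace \<open>i \<in> corner i\<close>]])
  qed
qed

text \<open>An element of the corner is a scalar plus a nilpotent element (\<open>loc\<close>, by an
  eigenvalue and Fitting's lemma), and nilpotent elements of the corner vanish (\<open>nil0\<close>,
  by the nondegenerate trace form). So the corner consists of scalars.\<close>

lemma exists_prim_idem:
  obtains i where "i \<in> FS N" "i \<star> i = i" "e \<star> i \<noteq> 0"
    "\<forall>a\<in>FS N. \<exists>c. i \<star> a \<star> i = sc c i"
proof -
  obtain i where i: "i \<in> FS N" "i \<star> i = i" "e \<star> i \<noteq> 0"
    and idem: "\<forall>k\<in>corner i. k \<star> k = k \<longrightarrow> k = 0 \<or> k = i" by (rule exists_min_idem)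
  have i0: "i \<noteq> 0" using i(3) by auto
  have iG: "i \<in> FS (carrier G)" using i(1) FSN_in by blast
  have loc: "\<exists>c n. pw i (y - sc c i) n = 0" if y: "y \<in> corner i" for y
  proof -
    have iy: "i \<star> y = y" "y \<star> i = y" "y \<in> FS N" using y by (auto simp: corner_def)
    obtain c where c: "\<And>z. z \<star> (y - sc c i) \<noteq> i"
      using eigenvalue_exists[OF i(2) iy(1,2) i0] by blast
    define y0 where "y0 = y - sc c i"
    have y0: "y0 \<in> corner i" "i \<star> y0 = y0" "y0 \<star> i = y0"
      using iy i by (auto simp: y0_def corner_def FS_diff FS_sc conv_diff_left conv_diff_right conv_sc_left conv_sc_right)
    have "\<exists>n. pw i y0 n = 0"
    proof (rule ccontr)
      assume "\<nexists>n. pw i y0 n = 0"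
      hence nn: "\<forall>n. pw i y0 n \<noteq> 0" by blast
      obtain q where q: "pev i y0 (pCons 0 q) \<noteq> 0"
        "pev i y0 (pCons 0 q) \<star> pev i y0 (pCons 0 q) = pev i y0 (pCons 0 q)"
        by (rule fitting[OF i(2) y0(2,3) nn])
      \<comment> \<open>The Fitting idempotent must be the unit of the corner. Being a multiple of
        \<open>y0\<close>, it provides the left inverse which the choice of \<open>c\<close>
        excludes.\<close>
      have "pev i y0 (pCons 0 q) = i"
        using bspec[OF idem pev_corner[OF i(1,2) y0(1)]] q by blast
      moreover have "pCons 0 q = q * [:0, 1:]" by simp
      ultimately have "pev i y0 q \<star> y0 = i"
        using pev_mult[OF i(2) y0(2,3), of q "[:0, 1:]"] pev_X[OF i(2) y0(2,3)] by metis
      thus False using c unfolding y0_def by blast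
    qed
    thus ?thesis unfolding y0_def by blast
  qed
  have nil0: "y = 0" if y: "y \<in> corner i" and n: "pw i y k = 0" for y k
  proof -
    have iy: "i \<star> y = y" "y \<star> i = y" "y \<in> FS N" using y by (auto simp: corner_def)
    define M where "M = (LEAST k. pw i y k = 0)"
    have M: "pw i y M = 0" unfolding M_def using n by (rule LeastI)
    have "M \<noteq> 0" using M i0 by (metis pw.simps(1))
    then obtain M' where M': "M = Suc M'" using not0_implies_Suc by blast
    have M'0: "pw i y M' \<noteq> 0" using not_less_Least[of M' "\<lambda>k. pw i y k = 0"] M' unfolding M_def by simp
    \<comment> \<open>A right inverse would lower the least exponent \<open>M\<close> that
      annihilates \<open>y\<close>.\<close>
    have no_inv: "y \<star> b \<noteq> i" for b
    proof
      assume b: "y \<star> b = i"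
      have "pw i y M = pw i y M' \<star> y"
        using pev_mult[OF i(2) iy(1,2), of "[:0, 1:] ^ M'" "[:0, 1:]"]
        by (simp only: M' pw_X[OF i(2) iy(1,2), symmetric] power_Suc2 pev_X[OF i(2) iy(1,2)])
      hence "pw i y M' \<star> y \<star> b = 0" using M by simp
      moreover have "pw i y M' \<star> i = pw i y M'"
        using pev_mult[OF i(2) iy(1,2), of "[:0, 1:] ^ M'" "[:1:]"]
        by (simp only: pw_X[OF i(2) iy(1,2)] pev_const[OF i(2) iy(1,2)] fv.scale_one) (simp add: pw_X[OF i(2) iy(1,2)])
      ultimately show False using M'0 b by (simp add: conv_assoc)
    qed
    have tr0: "(y \<star> z) \<one> = 0" if z: "z \<in> FS N" for z
    proof -
      define w where "w = y \<star> (i \<star> z \<star> i)"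
      have w: "w \<in> corner i"
        using i iy z by (auto simp: w_def corner_def FSN_conv conv_assoc) (simp add: conv_assoc[symmetric])
      hence w': "i \<star> w = w" "w \<star> i = w" "w \<in> FS N" by (auto simp: corner_def)
      obtain c k where c: "pw i (w - sc c i) k = 0" using loc[OF w] by blast
      \<comment> \<open>Otherwise the \<open>k\<close>-th power of X - c has a nonzero constant
        coefficient \<open>d\<close>, and the equation it gives for \<open>w\<close> makes
        \<open>w\<close>, hence \<open>y\<close>, right invertible.\<close>
      have "c = 0"
      proof (rule ccontr)
        assume c0: "c \<noteq> 0"
        obtain q d where q: "[:-c, 1:] ^ k = pCons d q" using pCons_cases by blast
        have "poly ([:-c, 1:] ^ k) 0 = (-c) ^ k" by simp
        hence d: "d = (-c) ^ k" unfolding q by simp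
        hence d0: "d \<noteq> 0" using c0 by simp
        have "pev i w [:-c, 1:] = w - sc c i"
          by (simp add: conv_sc_right w' fun_eq_iff)
        hence "pev i w (pCons d q) = 0"
          using c pev_power[OF i(2) w'(1,2), of "[:-c, 1:]" k] by (simp add: q)
        hence "w \<star> pev i w q = sc (- d) i" by (simp add: fun_eq_iff add_eq_0_iff)
        hence "w \<star> sc (- inverse d) (pev i w q) = sc (- inverse d) (sc (- d) i)"
          by (simp only: conv_sc_right)
        also have "\<dots> = i" using d0 by (simp add: fun_eq_iff)
        finally have "y \<star> (i \<star> z \<star> i \<star> sc (- inverse d) (pev i w q)) = i"
          by (simp add: w_def conv_assoc)
        thus False using no_inv by blast
      qed
      hence "pw i w k = 0" using c by simp
      hence "nilp w" by (rule nilp_if_corner[OF i(2) w'(1,2) FSN_in[OF w'(3)] iG])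
      hence "w \<one> = 0" using nilpN w' by blast
      moreover have "w \<one> = (i \<star> (y \<star> i \<star> z)) \<one>"
        unfolding w_def conv_assoc[symmetric] by (subst conv_one_comm) (simp add: conv_assoc)
      ultimately show ?thesis by (simp add: iy conv_assoc[symmetric])
    qed
    show "y = 0"
    proof (rule ccontr)
      assume "y \<noteq> 0"
      from nondeg[OF iy(3) this] obtain z where "z \<in> FS N" "(y \<star> z) \<one> \<noteq> 0" .
      thus False using tr0 by blast
    qed
  qed
  have "\<exists>c. i \<star> a \<star> i = sc c i" if a: "a \<in> FS N" for a
  proof -
    have y: "i \<star> a \<star> i \<in> corner i"
      using a i by (auto simp: corner_def FSN_conv conv_assoc) (simp add: conv_assoc[symmetric])
    obtain c k where c: "pw i (i \<star> a \<star> i - sc c i) k = 0" using loc[OF y] by blast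
    have "i \<star> a \<star> i - sc c i \<in> corner i"
      using y i fv.subspace_diff[OF corner_subspace y] fv.subspace_scale[OF corner_subspace, of i i c]
      by (auto simp: corner_def)
    from nil0[OF this c] show ?thesis by (intro exI[of _ c]) simp
  qed
  thus ?thesis using that i by blast
qed

end

section \<open>Relative traces over left cosets\<close>

context fin_group
begin

text \<open>The representatives are chosen exactly as in \<open>relative_trace\<close>; on elements
  fixed by \<open>D\<close> the choice does not matter, by \<open>cj_coset\<close>.\<close>

definition Tr :: "'g set \<Rightarrow> ('g \<Rightarrow> 'a::field) \<Rightarrow> 'g \<Rightarrow> 'a" where
  "Tr D a = (\<Sum>c\<in>lcosets D. cj (SOME t. t \<in> c) a)"

lemma conj_act_cj: "t \<in> carrier G \<Longrightarrow> conj_act G t a = cj t a"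
  by (auto simp: conj_act_def fun_eq_iff cj_apply FS_D[OF cj_in])

lemma lcoset_rep:
  assumes "subgroup D G" "c \<in> lcosets D"
  shows "(SOME t. t \<in> c) \<in> c" "(SOME t. t \<in> c) \<in> carrier G" "c = (SOME t. t \<in> c) <# D"
    "c \<subseteq> carrier G" "card c = card D"
proof -
  obtain g where g: "g \<in> carrier G" "c = g <# D" using assms(2) by (auto simp: LCOSETS_def)
  have "g \<in> c" using lcos_self[OF g(1) assms(1)] g by simp
  thus 1: "(SOME t. t \<in> c) \<in> c" by (rule someI[of "\<lambda>t. t \<in> c"])
  show 4: "c \<subseteq> carrier G" using g subgroup.subset[OF assms(1)] by (auto simp: l_coset_def subset_iff)
  show 2: "(SOME t. t \<in> c) \<in> carrier G" using 1 4 by blast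
  obtain d where d: "d \<in> D" "(SOME t. t \<in> c) = g \<otimes> d" using 1 g by (auto simp: l_coset_def)
  have dG: "d \<in> carrier G" using d(1) assms(1) subgroup.mem_carrier by metis
  show "c = (SOME t. t \<in> c) <# D"
  proof (intro equalityI subsetI)
    fix x assume "x \<in> c"
    then obtain d' where d': "d' \<in> D" "x = g \<otimes> d'" using g by (auto simp: l_coset_def)
    have "x = (SOME t. t \<in> c) \<otimes> (inv d \<otimes> d')"
      using d d' dG g subgroup.mem_carrier[OF assms(1) d'(1)] by (simp add: m_assoc) (simp add: m_assoc[symmetric])
    moreover have "inv d \<otimes> d' \<in> D" using assms(1) d(1) d'(1) by (simp add: subgroup.m_closed subgroup.m_inv_closed)
    ultimately show "x \<in> (SOME t. t \<in> c) <# D" by (auto simp: l_coset_def)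
  next
    fix x assume "x \<in> (SOME t. t \<in> c) <# D"
    then obtain d' where d': "d' \<in> D" "x = g \<otimes> d \<otimes> d'" using d by (auto simp: l_coset_def)
    hence "x = g \<otimes> (d \<otimes> d')" using dG g subgroup.mem_carrier[OF assms(1) d'(1)] by (simp add: m_assoc)
    moreover have "d \<otimes> d' \<in> D" using assms(1) d(1) d'(1) by (simp add: subgroup.m_closed)
    ultimately show "x \<in> c" using g by (auto simp: l_coset_def)
  qed
  show "card c = card D"
    using l_card_cosets_equal[OF assms(2)] subgroup.subset[OF assms(1)] fin by simp
qed

lemma lcosets_finite: "subgroup D G \<Longrightarrow> finite (lcosets D)"
  by (auto simp: LCOSETS_def intro: fin)

lemma cj_coset:
  assumes D: "subgroup D G" "\<And>d. d \<in> D \<Longrightarrow> cj d a = a" and c: "c \<in> lcosets D" "x \<in> c"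
  shows "cj (SOME t. t \<in> c) a = cj x a"
proof -
  note r = lcoset_rep[OF D(1) c(1)]
  obtain d where d: "d \<in> D" "x = (SOME t. t \<in> c) \<otimes> d"
    using c(2) r(3) by (metis (no_types, lifting) UN_E l_coset_def singletonD)
  have "cj x a = cj (SOME t. t \<in> c) (cj d a)"
    using d r(2) subgroup.mem_carrier[OF D(1) d(1)] by (simp add: cj_cj)
  thus ?thesis using D(2)[OF d(1)] by simp
qed

lemma lcoset_mult: "subgroup D G \<Longrightarrow> g \<in> carrier G \<Longrightarrow> c \<in> lcosets D \<Longrightarrow> g <# c \<in> lcosets D"
proof -
  assume D: "subgroup D G" and g: "g \<in> carrier G" and c: "c \<in> lcosets D"
  then obtain h where h: "h \<in> carrier G" "c = h <# D" by (auto simp: LCOSETS_def)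
  have "g <# c = (g \<otimes> h) <# D" using h g subgroup.subset[OF D] by (simp add: lcos_m_assoc)
  thus ?thesis using g h by (auto simp: LCOSETS_def)
qed

lemma lcoset_mult_mult: "g \<in> carrier G \<Longrightarrow> h \<in> carrier G \<Longrightarrow> c \<subseteq> carrier G \<Longrightarrow> g <# (h <# c) = (g \<otimes> h) <# c"
  by (simp add: lcos_m_assoc)

lemma lcoset_one: "c \<subseteq> carrier G \<Longrightarrow> \<one> <# c = c"
  by (rule lcos_mult_one)

text \<open>Conjugation by \<open>g\<close> permutes the summands along the permutation of the left
  cosets by \<open>g\<close>.\<close>

lemma cj_Tr:
  assumes D: "subgroup D G" "\<And>d. d \<in> D \<Longrightarrow> cj d a = a" and g: "g \<in> carrier G"
  shows "cj g (Tr D a) = Tr D a"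
proof -
  have "cj g (Tr D a) = (\<Sum>c\<in>lcosets D. cj (g \<otimes> (SOME t. t \<in> c)) a)"
    unfolding Tr_def cj_sum using g lcoset_rep(2)[OF D(1)] by (intro sum.cong) (auto simp: cj_cj)
  also have "\<dots> = (\<Sum>c\<in>lcosets D. cj (SOME t. t \<in> c) a)"
  proof (rule sum.reindex_bij_witness[of _ "\<lambda>c. inv g <# c" "\<lambda>c. g <# c"])
    fix c assume c: "c \<in> lcosets D"
    note r = lcoset_rep[OF D(1) c]
    show "inv g <# (g <# c) = c" "g <# (inv g <# c) = c"
      using r(4) g by (simp_all add: lcoset_mult_mult lcoset_one)
    show "g <# c \<in> lcosets D" "inv g <# c \<in> lcosets D" using lcoset_mult D(1) g c by simp_all
    have "g \<otimes> (SOME t. t \<in> c) \<in> g <# c" using r(1) by (auto simp: l_coset_def)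
    from cj_coset[OF D \<open>g <# c \<in> lcosets D\<close> this]
    show "cj (SOME t. t \<in> g <# c) a = cj (g \<otimes> (SOME t. t \<in> c)) a" by simp
  qed
  finally show ?thesis by (simp add: Tr_def)
qed

lemma Tr_in: "Tr D a \<in> FS (carrier G)"
  unfolding Tr_def by (intro FS_sum cj_in)

lemma Tr_central:
  assumes D: "subgroup D G" "\<And>d. d \<in> D \<Longrightarrow> cj d a = a" and b: "b \<in> FS (carrier G)"
  shows "Tr D a \<star> b = b \<star> Tr D a"
  by (rule central_if_sing[OF Tr_in subset_refl _ b], rule cj_fix_comm[OF Tr_in _ cj_Tr[OF D]])

lemma relative_trace_Tr:
  assumes "subgroup D G"
  shows "relative_trace G D a = Tr D a"
proof
  fix g
  show "relative_trace G D a g = Tr D a g"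
    unfolding relative_trace_def Tr_def sum_fun_apply
    by (intro sum.cong) (simp_all add: conj_act_cj lcoset_rep(2)[OF assms])
qed

lemma fixed_points_cj:
  assumes "subgroup D G"
  shows "fixed_points G D = {a \<in> FS (carrier G). \<forall>d\<in>D. cj d a = a}"
  using subgroup.mem_carrier[OF assms]
  by (auto simp: fixed_points_def group_algebra_def FS_def conj_act_cj)

end

section \<open>The corner of a primitive idempotent, graded by cosets of N\<close>

locale core_i = core G p N H I n m e
  for G :: "('g, 'm) monoid_scheme" (structure) and p N H and I :: "'i set" and n
    and m :: "'i \<Rightarrow> nat \<Rightarrow> nat \<Rightarrow> 'g \<Rightarrow> 'a::alg_closed_field" and e +
  fixes i :: "'g \<Rightarrow> 'a"
  assumes i_N: "i \<in> FS N" and ii: "i \<star> i = i" and ei: "e \<star> i \<noteq> 0"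
    and i_scal: "\<forall>a\<in>FS N. \<exists>c. i \<star> a \<star> i = sc c i"
begin

lemma i_G: "i \<in> FS (carrier G)" using i_N FSN_in by blast
lemma i0: "i \<noteq> 0" using ei by auto
lemma ii_l: "i \<star> (i \<star> a) = i \<star> a" by (simp add: conv_assoc[symmetric] ii)
lemma ii_r: "a \<star> i \<star> i = a \<star> i" by (simp add: conv_assoc ii)

lemma coset_conv:
  assumes "a \<in> FS (N #> s)" "b \<in> FS (N #> t)" "s \<in> carrier G" "t \<in> carrier G"
  shows "a \<star> b \<in> FS (N #> (s \<otimes> t))"
proof (rule conv_supp[OF assms(1,2)])
  fix x y assume "x \<in> N #> s" "y \<in> N #> t"
  hence "x \<otimes> y \<in> (N #> s) <#> (N #> t)" by (auto simp: set_mult_def)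
  thus "x \<otimes> y \<in> N #> (s \<otimes> t)" using normal.rcos_sum[OF N assms(3,4)] by simp
qed

lemma coset_one: "N #> \<one> = N" by (rule coset_mult_one[OF N_carr])
lemma coset_self: "t \<in> carrier G \<Longrightarrow> t \<in> N #> t" using rcos_self[OF _ N_sub] .
lemma coset_N: "x \<in> N \<Longrightarrow> N #> x = N"
  using coset_join2[OF _ N_sub] N_carr by blast
lemma coset_sub: "t \<in> carrier G \<Longrightarrow> N #> t \<subseteq> carrier G" by (rule r_coset_subset_G[OF N_carr])
lemma coset_sing: "t \<in> carrier G \<Longrightarrow> sing t \<in> FS (N #> t)" by (rule FS_sing[OF coset_self])
lemma coset_conv_l: "a \<in> FS N \<Longrightarrow> b \<in> FS (N #> t) \<Longrightarrow> t \<in> carrier G \<Longrightarrow> a \<star> b \<in> FS (N #> t)"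
  using coset_conv[of a \<one> b t] by (simp add: coset_one)
lemma coset_conv_r: "a \<in> FS (N #> t) \<Longrightarrow> b \<in> FS N \<Longrightarrow> t \<in> carrier G \<Longrightarrow> a \<star> b \<in> FS (N #> t)"
  using coset_conv[of a t b \<one>] by (simp add: coset_one)
lemma coset_FS_G: "t \<in> carrier G \<Longrightarrow> a \<in> FS (N #> t) \<Longrightarrow> a \<in> FS (carrier G)"
  using FS_mono[OF coset_sub] .
lemma coset_eqI: "x \<in> N #> t \<Longrightarrow> t \<in> carrier G \<Longrightarrow> N #> x = N #> t"
  by (metis N_sub repr_independence)

lemma coset_shift_l: "a \<in> FS (N #> g) \<Longrightarrow> g \<in> carrier G \<Longrightarrow> sing (inv g) \<star> a \<in> FS N"
  using coset_conv[OF coset_sing, of "inv g" a g] by (simp add: coset_one)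
lemma coset_shift_r: "a \<in> FS (N #> g) \<Longrightarrow> g \<in> carrier G \<Longrightarrow> a \<star> sing (inv g) \<in> FS N"
  using coset_conv[OF _ coset_sing, of a g "inv g"] by (simp add: coset_one)

lemma i_tr: "a \<in> FS N \<Longrightarrow> (i \<star> a) \<one> = (i \<star> a \<star> i) \<one>"
  using conv_one_comm[of "i \<star> a" i] by (simp add: ii_l)

text \<open>If this coefficient were zero, the trace form would vanish on all products with
  \<open>i\<close>, since the corner consists of multiples of \<open>i\<close>.\<close>

lemma i_one: "i \<one> \<noteq> 0"
proof -
  obtain z where z: "z \<in> FS N" "(i \<star> z) \<one> \<noteq> 0" by (rule nondeg[OF i_N i0])
  obtain c where "i \<star> z \<star> i = sc c i" using i_scal z(1) by blast
  thus ?thesis using z i_tr by auto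
qed

text \<open>Translated into the group algebra of \<open>N\<close>, the element \<open>a\<close> has
  a partner \<open>z\<close> under the trace form. The product of both, compressed by
  \<open>i\<close>, is a multiple \<open>c\<close> of \<open>i\<close>, and its coefficient at
  \<open>\<one>\<close> shows that \<open>c\<close> is nonzero.\<close>

lemma left_inv:
  assumes a: "a \<in> FS (N #> g)" "g \<in> carrier G" "a \<star> i = a" "a \<noteq> 0"
  obtains b where "b \<in> FS (N #> inv g)" "i \<star> b = b" "b \<star> a = i"
proof -
  let ?a = "sing (inv g) \<star> a"
  have aN: "?a \<in> FS N" by (rule coset_shift_l[OF a(1,2)])
  have "sing g \<star> ?a = a" using a coset_FS_G[OF a(2,1)] by (simp add: sing_inv_r)
  hence "?a \<noteq> 0" using a(4) by auto
  from nondeg[OF aN this] obtain z where z: "z \<in> FS N" "(?a \<star> z) \<one> \<noteq> 0" .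
  have zaN: "z \<star> ?a \<in> FS N" using z aN FSN_conv by blast
  obtain c where c: "i \<star> (z \<star> ?a) \<star> i = sc c i" using i_scal zaN by blast
  have za: "z \<star> ?a \<star> i = z \<star> ?a" by (simp add: conv_assoc a(3))
  have "(i \<star> (z \<star> ?a) \<star> i) \<one> = (z \<star> ?a) \<one>"
    using i_tr[OF zaN] conv_one_comm[of i "z \<star> ?a"] za by simp
  hence c0: "c \<noteq> 0" using c z(2) conv_one_comm[of z ?a] by auto
  let ?b = "sc (inverse c) (i \<star> z \<star> sing (inv g))"
  have "?b \<in> FS (N #> inv g)"
    using a(2) i_N z(1) by (intro FS_sc coset_conv_l[OF FSN_conv] coset_sing) auto
  moreover have "i \<star> ?b = ?b" by (simp add: conv_sc_right conv_assoc ii_l)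
  moreover have "?b \<star> a = sc (inverse c) (i \<star> (z \<star> ?a) \<star> i)"
    by (simp add: conv_sc_left conv_assoc a(3))
  hence "?b \<star> a = i" using c c0 by simp
  ultimately show ?thesis using that by blast
qed

lemma right_inv:
  assumes b: "b \<in> FS (N #> g)" "g \<in> carrier G" "i \<star> b = b" "b \<noteq> 0"
  obtains a where "a \<in> FS (N #> inv g)" "a \<star> i = a" "b \<star> a = i"
proof -
  let ?b = "b \<star> sing (inv g)"
  have bN: "?b \<in> FS N" by (rule coset_shift_r[OF b(1,2)])
  have "?b \<star> sing g = b" using b coset_FS_G[OF b(2,1)] by (simp add: conv_assoc sing_mult)
  hence "?b \<noteq> 0" using b(4) by auto
  from nondeg[OF bN this] obtain z where z: "z \<in> FS N" "(?b \<star> z) \<one> \<noteq> 0" .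
  have bzN: "?b \<star> z \<in> FS N" using z bN FSN_conv by blast
  obtain c where c: "i \<star> (?b \<star> z) \<star> i = sc c i" using i_scal bzN by blast
  have bz: "i \<star> (?b \<star> z) = ?b \<star> z" by (simp add: conv_assoc[symmetric] b(3))
  have c0: "c \<noteq> 0" using i_tr[OF bzN] bz c z(2) by auto
  let ?a = "sc (inverse c) (sing (inv g) \<star> z \<star> i)"
  have "?a \<in> FS (N #> inv g)"
    using b(2) i_N z(1) by (intro FS_sc coset_conv_r coset_sing) auto
  moreover have "?a \<star> i = ?a" by (simp add: conv_sc_left ii_r)
  moreover have "b \<star> ?a = sc (inverse c) (i \<star> (?b \<star> z) \<star> i)"
    unfolding bz by (simp add: conv_sc_right conv_assoc)
  hence "b \<star> ?a = i" using c c0 by simp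
  ultimately show ?thesis using that by blast
qed

text \<open>The component of degree \<open>N #> t\<close> in the corner of the whole group algebra
  at \<open>i\<close>. Each component has dimension at most one (\<open>Rt_dim1\<close>), and
  nonzero elements are units (\<open>Rt_inverse\<close>).\<close>

definition Rt :: "'g \<Rightarrow> ('g \<Rightarrow> 'a) set" where
  "Rt t = {u \<in> FS (N #> t). i \<star> u = u \<and> u \<star> i = u}"

lemma Rt_mult: "u \<in> Rt s \<Longrightarrow> v \<in> Rt t \<Longrightarrow> s \<in> carrier G \<Longrightarrow> t \<in> carrier G \<Longrightarrow> u \<star> v \<in> Rt (s \<otimes> t)"
  by (auto simp: Rt_def coset_conv conv_assoc) (simp add: conv_assoc[symmetric])

lemma Rt_cong: "N #> s = N #> t \<Longrightarrow> Rt s = Rt t" by (simp add: Rt_def)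

lemma Rt_sc: "u \<in> Rt t \<Longrightarrow> sc c u \<in> Rt t"
  by (auto simp: Rt_def FS_sc conv_sc_left conv_sc_right)

lemma Rt_one: "u \<in> Rt \<one> \<Longrightarrow> \<exists>c. u = sc c i"
proof -
  assume "u \<in> Rt \<one>"
  hence u: "u \<in> FS N" "i \<star> u \<star> i = u" by (simp_all add: Rt_def coset_one)
  show ?thesis using bspec[OF i_scal u(1)] u(2) by simp
qed

lemma i_Rt: "i \<in> Rt \<one>" by (simp add: Rt_def coset_one i_N ii)

text \<open>The left inverse from \<open>left_inv\<close> is two-sided: the opposite product is a
  scalar \<open>c\<close> by \<open>Rt_one\<close>, and \<open>u = sc c u\<close> forces
  \<open>c = 1\<close>.\<close>

lemma Rt_inverse:
  assumes u: "u \<in> Rt t" "t \<in> carrier G" "u \<noteq> 0"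
  obtains v where "v \<in> Rt (inv t)" "u \<star> v = i" "v \<star> u = i"
proof -
  have u': "u \<in> FS (N #> t)" "i \<star> u = u" "u \<star> i = u" using u(1) by (auto simp: Rt_def)
  obtain b where b: "b \<in> FS (N #> inv t)" "i \<star> b = b" "b \<star> u = i"
    using left_inv[OF u'(1) u(2) u'(3) u(3)] .
  let ?v = "b \<star> i"
  have v: "?v \<in> Rt (inv t)"
    unfolding Rt_def
  proof (intro CollectI conjI)
    show "?v \<in> FS (N #> inv t)" by (rule coset_conv_r[OF b(1) i_N]) (use u(2) in simp)
    show "i \<star> ?v = ?v" by (simp only: conv_assoc[symmetric] b(2))
  qed (rule ii_r)
  have vu: "?v \<star> u = i" using b u' by (simp add: conv_assoc)
  have "u \<star> ?v \<in> Rt \<one>" using Rt_mult[OF u(1) v] u(2) by simp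
  then obtain c where c: "u \<star> ?v = sc c i" using Rt_one by blast
  have "u = u \<star> (?v \<star> u)" by (simp only: vu u')
  also have "\<dots> = (u \<star> ?v) \<star> u" by (rule conv_assoc[symmetric])
  also have "\<dots> = sc c u" by (simp only: c conv_sc_left u')
  finally have "sc (1 - c) u = 0" by (simp add: fun_eq_iff algebra_simps)
  hence "c = 1" using u(3) by (metis eq_iff_diff_eq_0 fv.scale_eq_0_iff)
  hence "u \<star> ?v = i" using c by simp
  thus ?thesis using that v vu by blast
qed

lemma Rt_dim1:
  assumes "u \<in> Rt t" "t \<in> carrier G" "u \<noteq> 0" "u' \<in> Rt t"
  shows "\<exists>c. u' = sc c u"
proof -
  obtain v where v: "v \<in> Rt (inv t)" "u \<star> v = i" by (rule Rt_inverse[OF assms(1-3)])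
  have "v \<star> u' \<in> Rt \<one>" using Rt_mult[OF v(1) assms(4)] assms(2) by simp
  then obtain c where c: "v \<star> u' = sc c i" using Rt_one by blast
  have "u' = u \<star> v \<star> u'" using v assms(4) by (simp add: Rt_def)
  also have "\<dots> = sc c u" using assms(1) by (simp add: conv_assoc c conv_sc_right Rt_def)
  finally show ?thesis by blast
qed

lemma Rt_nz_mult:
  assumes "u \<in> Rt s" "v \<in> Rt t" "s \<in> carrier G" "t \<in> carrier G" "u \<noteq> 0" "v \<noteq> 0"
  shows "u \<star> v \<noteq> 0"
proof
  assume 0: "u \<star> v = 0"
  obtain w where "w \<star> u = i" by (rule Rt_inverse[OF assms(1,3,5)])
  hence "i \<star> v = 0" using 0 by (metis conv_0_right conv_assoc)
  thus False using assms(2,6) by (simp add: Rt_def)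
qed

text \<open>A unit of degree \<open>t\<close> is an equivalence between \<open>i\<close> and its
  conjugate by \<open>t\<close>; so this is the stabilizer of the isomorphism type of
  \<open>i\<close>.\<close>

definition St :: "'g set" where
  "St = {t \<in> carrier G. \<exists>u\<in>Rt t. u \<noteq> 0}"

lemma St_carr: "St \<subseteq> carrier G" by (auto simp: St_def)

lemma N_St: "N \<subseteq> St"
  using i_Rt i0 N_carr by (auto simp: St_def Rt_def coset_N coset_one intro!: bexI[of _ i])

lemma St_sub: "subgroup St G"
proof (rule subgroupI)
  show "St \<noteq> {}" using N_St subgroup.one_closed[OF N_sub] by blast
  fix t assume "t \<in> St"
  then obtain u where u: "t \<in> carrier G" "u \<in> Rt t" "u \<noteq> 0" by (auto simp: St_def)
  obtain v where v: "v \<in> Rt (inv t)" "u \<star> v = i" by (rule Rt_inverse[OF u(2,1,3)])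
  have "v \<noteq> 0" using v i0 by auto
  thus "inv t \<in> St" using v u by (auto simp: St_def)
next
  fix s t assume "s \<in> St" "t \<in> St"
  then obtain u v where "s \<in> carrier G" "t \<in> carrier G" "u \<in> Rt s" "v \<in> Rt t" "u \<noteq> 0" "v \<noteq> 0"
    by (auto simp: St_def)
  thus "s \<otimes> t \<in> St" using Rt_mult[of u s v t] Rt_nz_mult[of u s v t] by (auto simp: St_def)
qed (rule St_carr)

lemma Rt_notin: "t \<in> carrier G \<Longrightarrow> t \<notin> St \<Longrightarrow> u \<in> Rt t \<Longrightarrow> u = 0"
  by (auto simp: St_def)

lemma i_mid_Rt: "a \<in> FS (N #> t) \<Longrightarrow> t \<in> carrier G \<Longrightarrow> i \<star> a \<star> i \<in> Rt t"
  by (simp add: Rt_def ii_r coset_conv_l coset_conv_r i_N) (simp add: conv_assoc ii_l)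

subsection \<open>The central element generated by the idempotent\<close>

lemma cj_N: "a \<in> FS N \<Longrightarrow> g \<in> carrier G \<Longrightarrow> cj g a \<in> FS N"
proof (rule FS_I)
  fix x assume a: "a \<in> FS N" and g: "g \<in> carrier G" and x: "x \<notin> N"
  show "cj g a x = 0"
  proof (cases "x \<in> carrier G")
    case True
    have "inv g \<otimes> x \<otimes> g \<notin> N"
    proof
      assume "inv g \<otimes> x \<otimes> g \<in> N"
      hence "g \<otimes> (inv g \<otimes> x \<otimes> g) \<otimes> inv g \<in> N" using normal.inv_op_closed2[OF N g] by simp
      thus False using x True g by (simp add: m_assoc) (simp add: m_assoc[symmetric])
    qed
    thus ?thesis using True g a by (simp add: cj_apply FS_D)
  qed (simp add: FS_D[OF cj_in])
qed

text \<open>The trace of \<open>i\<close> from the trivial subgroup to \<open>N\<close>: up to the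
  nonzero factor \<open>zc\<close>, the central idempotent of the group algebra of \<open>N\<close>
  belonging to \<open>i\<close>.\<close>

definition z :: "'g \<Rightarrow> 'a" where "z = (\<Sum>x\<in>N. cj x i)"

lemma z_N: "z \<in> FS N"
  unfolding z_def using cj_N[OF i_N] N_carr by (intro FS_sum) blast

lemma z_G: "z \<in> FS (carrier G)" using z_N FSN_in by blast

lemma cj_z: assumes "x \<in> N" shows "cj x z = z"
proof -
  have x: "x \<in> carrier G" using assms N_carr by blast
  have "cj x z = (\<Sum>y\<in>N. cj (x \<otimes> y) i)"
    unfolding z_def cj_sum using x N_carr by (intro sum.cong) (auto simp: cj_cj)
  also have "\<dots> = (\<Sum>y\<in>N. cj y i)"
    by (rule sum.reindex_bij_witness[of _ "\<lambda>y. inv x \<otimes> y" "\<lambda>y. x \<otimes> y"])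
       (use assms x N_carr N_sub in \<open>auto simp: m_assoc[symmetric] subset_iff subgroup.m_closed subgroup.m_inv_closed\<close>)
  finally show ?thesis by (simp add: z_def)
qed

lemma cj_gz: assumes "x \<in> N" "g \<in> carrier G" shows "cj x (cj g z) = cj g z"
proof -
  have x: "x \<in> carrier G" using assms N_carr by blast
  have y: "inv g \<otimes> x \<otimes> g \<in> N" using normal.inv_op_closed1[OF N assms(2,1)] .
  have "cj x (cj g z) = cj (g \<otimes> (inv g \<otimes> x \<otimes> g)) z"
    using x assms by (simp add: cj_cj) (simp add: m_assoc[symmetric])
  also have "\<dots> = cj g (cj (inv g \<otimes> x \<otimes> g) z)" using x assms by (simp add: cj_cj)
  finally show ?thesis using cj_z[OF y] by simp
qed

lemma gz_comm: "g \<in> carrier G \<Longrightarrow> a \<in> FS N \<Longrightarrow> cj g z \<star> a = a \<star> cj g z"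
  by (rule central_if_sing[OF cj_in N_carr]) (use N_carr in \<open>auto intro!: cj_fix_comm cj_gz\<close>)

lemma z_comm: "a \<in> FS N \<Longrightarrow> z \<star> a = a \<star> z"
  using gz_comm[of \<one> a] by (simp add: cj_one z_G)

text \<open>With \<open>c\<close> the scalar by which \<open>z\<close> acts on \<open>i\<close>,
  also \<open>z \<star> z = sc c z\<close>. For \<open>c = 0\<close> the coefficient of the
  nilpotent \<open>z\<close> at \<open>\<one>\<close> would vanish, but it is \<open>card N\<close>
  times that of \<open>i\<close>.\<close>

lemma z_i_ex: "\<exists>c. c \<noteq> 0 \<and> z \<star> i = sc c i"
proof -
  obtain c where c: "i \<star> z \<star> i = sc c i" using i_scal z_N by blast
  have zi: "z \<star> i = sc c i" using c z_comm[OF i_N] by (metis ii_r)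
  have "z \<star> z = (\<Sum>x\<in>N. cj x (z \<star> i))"
  proof -
    have "z \<star> z = (\<Sum>x\<in>N. z \<star> cj x i)" by (subst (2) z_def) (simp add: conv_sum_right)
    also have "\<dots> = (\<Sum>x\<in>N. cj x (z \<star> i))"
      using N_carr by (intro sum.cong) (auto simp: cj_mult cj_z)
    finally show ?thesis .
  qed
  hence zz: "z \<star> z = sc c z" unfolding zi cj_sc fv.scale_sum_right[symmetric] z_def[symmetric] .
  have "c \<noteq> 0"
  proof
    assume "c = 0"
    hence "pw A1 z 2 = 0" using zz z_G by (simp add: numeral_2_eq_2 fun_eq_iff)
    hence "z \<one> = 0" using nilpN[OF z_N] by (auto simp: nilp_def)
    moreover have "cj x i \<one> = i \<one>" if "x \<in> N" for x
      using that N_carr by (auto simp: cj_apply subset_iff)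
    hence "z \<one> = of_nat (card N) * i \<one>" by (simp add: z_def sum_fun_apply)
    ultimately show False using i_one pN ch by (simp add: of_nat_eq_0_iff_char_dvd)
  qed
  thus ?thesis using zi by blast
qed

definition zc :: 'a where "zc = (SOME c. c \<noteq> 0 \<and> z \<star> i = sc c i)"

lemma zc: "zc \<noteq> 0" "z \<star> i = sc zc i"
  using someI_ex[OF z_i_ex] by (auto simp: zc_def)

text \<open>A unit \<open>u\<close> of degree \<open>t\<close> is an element of the group algebra of
  \<open>N\<close> times \<open>sing t\<close>, so it carries \<open>z\<close> across to its
  conjugate: \<open>cj t z \<star> u = u \<star> z\<close>. Cancelling \<open>u\<close> leaves the
  claim.\<close>

lemma tz_i: assumes t: "t \<in> St" shows "cj t z \<star> i = sc zc i"
proof -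
  obtain u where u: "t \<in> carrier G" "u \<in> Rt t" "u \<noteq> 0" using t by (auto simp: St_def)
  obtain v where v: "v \<in> Rt (inv t)" "u \<star> v = i" by (rule Rt_inverse[OF u(2,1,3)])
  have u': "u \<in> FS (N #> t)" "i \<star> u = u" "u \<star> i = u" using u(2) by (auto simp: Rt_def)
  let ?a = "u \<star> sing (inv t)"
  have a: "?a \<in> FS N" by (rule coset_shift_r[OF u'(1) u(1)])
  have ua: "u = ?a \<star> sing t" using u coset_FS_G[OF u(1) u'(1)] by (simp add: conv_assoc sing_mult)
  have "cj t z \<star> u = cj t z \<star> ?a \<star> sing t" by (subst ua) (simp add: conv_assoc)
  also have "\<dots> = ?a \<star> (cj t z \<star> sing t)" using gz_comm[OF u(1) a] by (simp add: conv_assoc)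
  also have "cj t z \<star> sing t = sing t \<star> z" using sing_cj[OF u(1), of z] by simp
  also have "?a \<star> (sing t \<star> z) = u \<star> z" using ua by (simp add: conv_assoc[symmetric])
  also have "u \<star> z = u \<star> (z \<star> i)" using z_comm[OF i_N] u' by (simp add: conv_assoc[symmetric])
  also have "\<dots> = sc zc u" using zc u' by (simp add: conv_sc_right)
  finally have "cj t z \<star> (u \<star> v) = sc zc (u \<star> v)" by (simp add: conv_assoc[symmetric] conv_sc_left)
  thus ?thesis using v by simp
qed

lemma tz_z: assumes t: "t \<in> St" shows "cj t z \<star> z = sc zc z"
proof -
  have tG: "t \<in> carrier G" using t St_carr by blast
  have "cj t z \<star> z = (\<Sum>x\<in>N. cj t z \<star> cj x i)" by (subst (2) z_def) (simp add: conv_sum_right)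
  also have "\<dots> = (\<Sum>x\<in>N. cj x (cj t z \<star> i))"
    using N_carr tG by (intro sum.cong) (auto simp: cj_mult cj_gz)
  also have "\<dots> = sc zc z" unfolding tz_i[OF t] cj_sc by (simp add: z_def fv.scale_sum_right)
  finally show ?thesis .
qed

text \<open>The product of \<open>z\<close> with its conjugate is \<open>zc\<close> times either
  factor: once by \<open>tz_z\<close> for \<open>t\<close>, once by conjugating \<open>tz_z\<close>
  for \<open>inv t\<close>.\<close>

lemma tz: assumes t: "t \<in> St" shows "cj t z = z"
proof -
  have tG: "t \<in> carrier G" using t St_carr by blast
  have it: "inv t \<in> St" using t St_sub subgroup.m_inv_closed by metis
  have "cj t (cj (inv t) z \<star> z) = cj t (sc zc z)" using tz_z[OF it] by simp
  hence "z \<star> cj t z = sc zc (cj t z)" using tG by (simp add: cj_mult cj_cj cj_one z_G cj_sc)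
  moreover have "z \<star> cj t z = cj t z \<star> z" using gz_comm[OF tG z_N] by simp
  ultimately have "sc zc (cj t z) = sc zc z" using tz_z[OF t] by metis
  hence "cj t z g = z g" for g using zc(1) by (metis mult_cancel_left sc_apply)
  thus ?thesis by blast
qed

text \<open>All components of degree outside \<open>St\<close> are zero, so \<open>i\<close> is
  orthogonal to each conjugate of \<open>i\<close> occurring in \<open>cj g z\<close>.\<close>

lemma gz_i: assumes g: "g \<in> carrier G" "g \<notin> St" shows "cj g z \<star> i = 0"
proof -
  have "i \<star> cj (g \<otimes> x) i = 0" if x: "x \<in> N" for x
  proof -
    have xG: "x \<in> carrier G" "x \<in> St" using x N_carr N_St by auto
    have gx: "g \<otimes> x \<in> carrier G" "g \<otimes> x \<notin> St"
    proof -
      show "g \<otimes> x \<in> carrier G" using g xG by simp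
      show "g \<otimes> x \<notin> St"
      proof
        assume "g \<otimes> x \<in> St"
        hence "g \<otimes> x \<otimes> inv x \<in> St" using xG St_sub by (simp add: subgroup.m_closed subgroup.m_inv_closed)
        thus False using g xG by (simp add: m_assoc)
      qed
    qed
    have "i \<star> sing (g \<otimes> x) \<star> i = 0"
      using Rt_notin[OF gx i_mid_Rt[OF coset_sing[OF gx(1)] gx(1)]] .
    thus ?thesis by (simp add: cj_def conv_assoc[symmetric])
  qed
  hence "i \<star> cj g z = 0"
    unfolding z_def cj_sum conv_sum_right using g N_carr by (intro sum.neutral) (auto simp: cj_cj)
  thus ?thesis using gz_comm[OF g(1) i_N] by simp
qed

text \<open>A suitable multiple \<open>Y\<close> of the trace of \<open>z\<close> is a central
  idempotent that fixes \<open>i\<close>. Since \<open>e\<close> and \<open>i\<close> have nonzero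
  product, primitivity of \<open>e\<close> gives \<open>Y \<star> e = e\<close>.\<close>

lemma trace_S:
  assumes S: "subgroup S G" "S \<subseteq> St" "\<not> p dvd card St div card S"
  obtains c where "e = sc c (Tr S (z \<star> e))"
proof -
  have zS: "cj d z = z" if "d \<in> S" for d using tz that S by blast
  define Q where "Q = {c \<in> lcosets S. (SOME t. t \<in> c) \<in> St}"
  have finS: "finite S" using finite_sub S St_carr by blast
  have cS: "card S > 0" using finS subgroup.one_closed[OF S(1)] by (auto simp: card_gt_0_iff)
  have UQ: "\<Union> Q = St"
  proof (intro equalityI subsetI)
    fix x assume "x \<in> \<Union> Q"
    then obtain c where c: "c \<in> lcosets S" "(SOME t. t \<in> c) \<in> St" "x \<in> c" by (auto simp: Q_def)
    have "x \<in> (SOME t. t \<in> c) <# S" using lcoset_rep(3)[OF S(1) c(1)] c(3) by simp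
    then obtain d where "d \<in> S" "x = (SOME t. t \<in> c) \<otimes> d" by (auto simp: l_coset_def)
    thus "x \<in> St" using c(2) S(2) St_sub by (auto simp: subgroup.m_closed)
  next
    fix x assume x: "x \<in> St"
    hence xG: "x \<in> carrier G" using St_carr by blast
    have c: "x <# S \<in> lcosets S" "x \<in> x <# S" using xG lcos_self[OF xG S(1)] by (auto simp: LCOSETS_def)
    have "(SOME t. t \<in> x <# S) \<in> x <# S" by (rule lcoset_rep(1)[OF S(1) c(1)])
    then obtain d where "d \<in> S" "(SOME t. t \<in> x <# S) = x \<otimes> d" by (auto simp: l_coset_def)
    hence "(SOME t. t \<in> x <# S) \<in> St" using x S(2) St_sub by (auto simp: subgroup.m_closed)
    thus "x \<in> \<Union> Q" using c by (auto simp: Q_def)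
  qed
  have "card S * card Q = card (\<Union> Q)"
  proof (rule card_partition)
    show "finite Q" using lcosets_finite[OF S(1)] by (simp add: Q_def)
    show "finite (\<Union> Q)" using UQ finite_sub[OF St_carr] by simp
    show "card c = card S" if "c \<in> Q" for c using that lcoset_rep(5)[OF S(1)] by (auto simp: Q_def)
    show "c1 \<inter> c2 = {}" if "c1 \<in> Q" "c2 \<in> Q" "c1 \<noteq> c2" for c1 c2
      using that lcos_disjoint[OF S(1)] by (auto simp: Q_def)
  qed
  hence "card S * card Q = card St" by (simp only: UQ)
  hence Q: "card Q = card St div card S" using cS by (metis nonzero_mult_div_cancel_left less_numeral_extra(3))
  have pQ: "(of_nat (card Q) :: 'a) \<noteq> 0" using S(3) Q ch by (simp add: of_nat_eq_0_iff_char_dvd)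
  \<comment> \<open>Each of the \<open>card Q\<close> cosets of \<open>S\<close> inside
    \<open>St\<close> contributes \<open>zc\<close> to the action on \<open>i\<close>, the others
    nothing. The index is prime to \<open>p\<close>, so this can be inverted.\<close>
  define c where "c = inverse (zc * of_nat (card Q))"
  define Y where "Y = sc c (Tr S z)"
  have c: "c * (zc * of_nat (card Q)) = 1" using pQ zc(1) unfolding c_def by (intro left_inverse) simp
  have "Tr S z \<star> i = (\<Sum>c\<in>lcosets S. cj (SOME t. t \<in> c) z \<star> i)" by (simp add: Tr_def conv_sum_left)
  also have "\<dots> = (\<Sum>c\<in>lcosets S. if (SOME t. t \<in> c) \<in> St then sc zc i else 0)"
    using tz_i gz_i lcoset_rep(2)[OF S(1)] by (intro sum.cong) auto
  also have "\<dots> = (\<Sum>c\<in>Q. sc zc i)"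
    unfolding Q_def by (rule sum.inter_filter[OF lcosets_finite[OF S(1)], symmetric])
  also have "\<dots> = sc (zc * of_nat (card Q)) i" by (simp add: fun_eq_iff sum_fun_apply)
  finally have Yi: "Y \<star> i = i" using c by (simp add: Y_def conv_sc_left)
  have Tc: "Tr S z \<star> b = b \<star> Tr S z" if "b \<in> FS (carrier G)" for b
    using Tr_central[of S z, OF S(1) zS that] .
  have Yc: "Y \<star> b = b \<star> Y" if "b \<in> FS (carrier G)" for b
    using Tc[OF that] by (simp add: Y_def conv_sc_left conv_sc_right)
  have Y_in: "Y \<in> FS (carrier G)" by (simp add: Y_def FS_sc Tr_in)
  have cjY: "cj g Y = Y" if "g \<in> carrier G" for g by (rule central_cj[OF Y_in that Yc])
  have Yz: "Y \<star> z = z"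
  proof -
    have "Y \<star> z = (\<Sum>x\<in>N. cj x (Y \<star> i))"
      unfolding z_def conv_sum_right using N_carr by (intro sum.cong) (auto simp: cj_mult cjY)
    thus ?thesis by (simp add: Yi z_def)
  qed
  have "Y \<star> Tr S z = (\<Sum>c\<in>lcosets S. cj (SOME t. t \<in> c) (Y \<star> z))"
    unfolding Tr_def conv_sum_right using lcoset_rep(2)[OF S(1)] by (intro sum.cong) (auto simp: cj_mult cjY)
  hence "Y \<star> Tr S z = Tr S z" by (simp add: Yz Tr_def)
  hence YY: "Y \<star> Y = Y" by (subst (2) Y_def) (simp add: conv_sc_right Y_def)
  have "Y \<star> e \<noteq> 0"
  proof
    assume "Y \<star> e = 0"
    hence "e \<star> Y \<star> i = 0" using Yc[OF e_in] by simp
    thus False using ei by (simp add: conv_assoc Yi)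
  qed
  hence "Y \<star> e = e" using e_prim[OF Y_in YY Yc] by blast
  moreover have "Tr S z \<star> e = Tr S (z \<star> e)"
    unfolding Tr_def conv_sum_left using lcoset_rep(2)[OF S(1)]
    by (intro sum.cong) (auto simp: cj_mult central_cj[OF e_in _ e_cent])
  ultimately have "e = sc c (Tr S (z \<star> e))" by (simp add: Y_def conv_sc_left)
  thus ?thesis using that by blast
qed

end

lemma of_nat_mod_CHAR: "of_nat (x mod CHAR('a)) = (of_nat x :: 'a::semiring_1)"
proof -
  have "(of_nat x :: 'a) = of_nat (CHAR('a) * (x div CHAR('a)) + x mod CHAR('a))" by simp
  thus ?thesis by (simp only: of_nat_add of_nat_mult of_nat_CHAR) simp
qed

section \<open>The Sylow subgroup of the stabilizer and its cocycle\<close>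

context core_i
begin

text \<open>The covering property is a count. \<open>St \<inter> H\<close> has order
  \<open>card N * p ^ j\<close> by \<open>p_index\<close>, the factor \<open>p ^ j\<close> divides
  the order \<open>p ^ k\<close> of a Sylow subgroup \<open>S\<close>, and the products of
  \<open>N\<close> and \<open>S\<close> are \<open>card N * p ^ k\<close> distinct elements of
  \<open>St \<inter> H\<close>.\<close>

lemma exists_S:
  obtains S k where "subgroup S G" "S \<subseteq> St" "card S = p ^ k" "\<not> p dvd card St div card S"
    "S \<inter> N = {\<one>}" "\<forall>y\<in>St \<inter> H. \<exists>x\<in>S. y \<in> N #> x"
proof -
  obtain S k l where S: "subgroup S G" "S \<subseteq> St" "card S = p ^ k" "card St = p ^ k * l" "\<not> p dvd l"
    using sylow_subgroup[OF p St_sub] .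
  have p0: "p > 0" using p by (simp add: prime_gt_0_nat)
  have Sp: "S \<subseteq> pelt p"
    using subgroup_pow_card[OF S(1)] S(3) subgroup.mem_carrier[OF S(1)] by (auto simp: pelt_def)
  have SN: "S \<inter> N = {\<one>}"
    using pelt_N Sp subgroup.one_closed[OF S(1)] subgroup.one_closed[OF N_sub] by blast
  have Hs: "subgroup H G" using H by (simp add: normal_def)
  define Q where "Q = St \<inter> H"
  have Q: "subgroup Q G" unfolding Q_def by (rule subgroups_Inter_pair[OF St_sub Hs])
  have NQ: "N \<subseteq> Q" using N_St NH by (auto simp: Q_def)
  have SQ: "S \<subseteq> Q" using S(2) Sp pH by (auto simp: Q_def)
  have finQ: "finite Q" using finite_sub Q subgroup.subset by blast
  obtain j where j: "card Q = card N * p ^ j"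
    using p_index[OF p Q N_sub NQ] HN by (auto simp: Q_def)
  have "p ^ j dvd p ^ k * l"
    using subgroup_card_dvd[OF Q St_sub] j S(4) by (auto simp: Q_def intro: dvd_trans[of _ "card N * p ^ j"])
  moreover have "coprime (p ^ j) l" using p S(5) by (simp add: prime_imp_coprime)
  ultimately have "p ^ j dvd p ^ k" by (simp add: coprime_dvd_mult_left_iff)
  hence le: "p ^ j \<le> p ^ k" using p0 by (intro dvd_imp_le) auto
  define f where "f = (\<lambda>(a, x). a \<otimes> x)"
  have inj: "inj_on f (N \<times> S)"
  proof (rule inj_onI, clarsimp simp: f_def)
    fix a x b y assume *: "a \<in> N" "x \<in> S" "b \<in> N" "y \<in> S" "a \<otimes> x = b \<otimes> y"
    have c: "a \<in> carrier G" "x \<in> carrier G" "b \<in> carrier G" "y \<in> carrier G"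
      using * N_sub S(1) subgroup.mem_carrier by metis+
    have "inv b \<otimes> a = inv b \<otimes> (a \<otimes> x) \<otimes> inv x" using c by (simp add: m_assoc)
    also have "\<dots> = y \<otimes> inv x" unfolding *(5) using c by (simp add: m_assoc[symmetric])
    finally have eq: "inv b \<otimes> a = y \<otimes> inv x" .
    have "inv b \<otimes> a \<in> N" using * N_sub by (simp add: subgroup.m_closed subgroup.m_inv_closed)
    moreover have "y \<otimes> inv x \<in> S" using * S(1) by (simp add: subgroup.m_closed subgroup.m_inv_closed)
    ultimately have "inv b \<otimes> a = \<one>" "y \<otimes> inv x = \<one>" using eq SN by auto
    thus "a = b \<and> x = y" using c by (metis inv_closed inv_equality inv_inv)
  qed
  have sub: "f ` (N \<times> S) \<subseteq> Q"
    using NQ SQ Q by (auto simp: f_def intro: subgroup.m_closed)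
  have "card (f ` (N \<times> S)) = card N * p ^ k" using card_image[OF inj] S(3) by (simp add: card_cartesian_product)
  hence "card Q \<le> card (f ` (N \<times> S))" using j le by simp
  hence eq: "f ` (N \<times> S) = Q" by (intro card_subset_eq finQ sub) (simp add: card_mono[OF finQ sub] le_antisym)
  have "\<exists>x\<in>S. y \<in> N #> x" if "y \<in> St \<inter> H" for y
  proof -
    have "y \<in> f ` (N \<times> S)" using that eq by (simp add: Q_def)
    thus ?thesis by (auto simp: f_def r_coset_def)
  qed
  moreover have "\<not> p dvd card St div card S" using S p0 by simp
  ultimately show ?thesis using that S SN by blast
qed

text \<open>Arbitrary units multiply up to a 2-cocycle \<open>al\<close>. Its power with exponent
  \<open>card S\<close> is a coboundary, as for every finite group; since that exponent is a power
  of \<open>p\<close>, roots are unique and \<open>al\<close> itself is a coboundary.\<close>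

lemma exists_w:
  assumes S: "subgroup S G" "S \<subseteq> St" "card S = p ^ k"
  obtains w where "\<forall>x\<in>S. w x \<in> Rt x \<and> w x \<noteq> 0" "\<forall>x\<in>S. \<forall>y\<in>S. w x \<star> w y = w (x \<otimes> y)"
proof -
  have SG: "x \<in> carrier G" if "x \<in> S" for x using that S(1) subgroup.mem_carrier by metis
  have finS: "finite S" using finite_sub S(1) subgroup.subset by blast
  have Sm: "x \<otimes> y \<in> S" if "x \<in> S" "y \<in> S" for x y using that S(1) by (simp add: subgroup.m_closed)
  have "\<forall>x\<in>S. \<exists>u. u \<in> Rt x \<and> u \<noteq> 0" using S(2) by (auto simp: St_def)
  then obtain u where u: "\<forall>x\<in>S. u x \<in> Rt x \<and> u x \<noteq> 0" using bchoice by metis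
  have "\<forall>x\<in>S. \<forall>y\<in>S. \<exists>c. u x \<star> u y = sc c (u (x \<otimes> y))"
    using u Rt_mult Rt_dim1 SG Sm by (meson m_closed)
  then obtain al where al: "\<And>x y. x \<in> S \<Longrightarrow> y \<in> S \<Longrightarrow> u x \<star> u y = sc (al x y) (u (x \<otimes> y))"
    by metis
  have al0: "al x y \<noteq> 0" if "x \<in> S" "y \<in> S" for x y
  proof
    assume "al x y = 0"
    hence "u x \<star> u y = 0" using al[OF that] by simp
    thus False using Rt_nz_mult[of "u x" x "u y" y] u that SG by blast
  qed
  have coc: "al x y * al (x \<otimes> y) z = al y z * al x (y \<otimes> z)" if "x \<in> S" "y \<in> S" "z \<in> S" for x y z
  proof -
    have "sc (al x y * al (x \<otimes> y) z) (u (x \<otimes> y \<otimes> z)) = u x \<star> u y \<star> u z"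
      using that Sm by (simp add: al conv_sc_left)
    also have "\<dots> = u x \<star> (u y \<star> u z)" by (rule conv_assoc)
    also have "\<dots> = sc (al y z * al x (y \<otimes> z)) (u (x \<otimes> y \<otimes> z))"
      using that Sm SG by (simp add: al conv_sc_right m_assoc)
    finally show ?thesis using u Sm that by (metis fv.scale_cancel_right)
  qed
  \<comment> \<open>The product of the cocycle identity over its last argument exhibits the power of
    \<open>al\<close> as the coboundary of \<open>be\<close>.\<close>
  define be where "be x = (\<Prod>z\<in>S. al x z)" for x
  have be0: "be x \<noteq> 0" if "x \<in> S" for x using al0[OF that] finS by (simp add: be_def)
  have cob: "al x y ^ card S * be (x \<otimes> y) = be y * be x" if xy: "x \<in> S" "y \<in> S" for x y
  proof -
    have "al x y ^ card S * be (x \<otimes> y) = (\<Prod>z\<in>S. al x y * al (x \<otimes> y) z)"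
      by (simp add: be_def prod.distrib)
    also have "\<dots> = (\<Prod>z\<in>S. al y z * al x (y \<otimes> z))" using coc xy by (intro prod.cong) auto
    also have "\<dots> = be y * (\<Prod>z\<in>S. al x (y \<otimes> z))" by (simp add: be_def prod.distrib)
    also have "(\<Prod>z\<in>S. al x (y \<otimes> z)) = be x"
      unfolding be_def
      by (rule prod.reindex_bij_witness[of _ "\<lambda>z. inv y \<otimes> z" "\<lambda>z. y \<otimes> z"])
         (use xy S(1) SG Sm in \<open>auto simp: m_assoc[symmetric] subgroup.m_inv_closed\<close>)
    finally show ?thesis .
  qed
  have s0: "card S > 0" using S(3) p by (simp add: prime_gt_0_nat)
  have "\<forall>x\<in>S. \<exists>g. g ^ card S = be x" using nth_root_exists[OF s0] by metis
  then obtain ga where ga: "\<forall>x\<in>S. ga x ^ card S = be x" using bchoice by metis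
  have ga0: "ga x \<noteq> 0" if "x \<in> S" for x using ga be0[OF that] that s0 by (metis power_0_left zero_less_iff_neq_zero)
  define w where "w x = sc (inverse (ga x)) (u x)" for x
  have "w x \<star> w y = w (x \<otimes> y)" if xy: "x \<in> S" "y \<in> S" for x y
  proof -
    define mu where "mu = al x y * ga (x \<otimes> y) / (ga x * ga y)"
    have "mu ^ card S = al x y ^ card S * be (x \<otimes> y) / (be x * be y)"
      using ga xy Sm by (simp add: mu_def power_mult_distrib power_divide)
    also have "\<dots> = 1" using cob[OF xy] be0 xy by (simp add: mult.commute)
    finally have "mu = 1" using char_p_root_1[OF p ch, of mu k] S(3) by simp
    hence *: "al x y * ga (x \<otimes> y) = ga x * ga y" using ga0 xy by (simp add: mu_def)
    have "inverse (ga y) * (inverse (ga x) * al x y) = inverse (ga (x \<otimes> y))"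
      using * ga0 xy Sm by (simp add: field_simps)
    thus ?thesis by (simp only: w_def conv_sc_left conv_sc_right al[OF xy] fv.scale_scale mult.assoc)
  qed
  moreover have "w x \<in> Rt x \<and> w x \<noteq> 0" if "x \<in> S" for x
    using u ga0[OF that] that Rt_sc fv.scale_eq_0_iff[of "inverse (ga x)" "u x"] by (auto simp: w_def)
  ultimately show ?thesis using that by blast
qed

end

section \<open>The normalized p-group of units\<close>

locale core_w = core_i G p N H I n m e i
  for G :: "('g, 'm) monoid_scheme" (structure) and p N H and I :: "'i set" and n
    and m :: "'i \<Rightarrow> nat \<Rightarrow> nat \<Rightarrow> 'g \<Rightarrow> 'a::alg_closed_field" and e i +
  fixes S :: "'g set" and k\<^sub>S :: nat and w :: "'g \<Rightarrow> 'g \<Rightarrow> 'a"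
  assumes S: "subgroup S G" and S_St: "S \<subseteq> St" and card_S: "card S = p ^ k\<^sub>S"
    and S_ind: "\<not> p dvd card St div card S" and SN: "S \<inter> N = {\<one>}"
    and S_cov: "\<forall>y\<in>St \<inter> H. \<exists>x\<in>S. y \<in> N #> x"
    and w_Rt: "\<forall>x\<in>S. w x \<in> Rt x \<and> w x \<noteq> 0"
    and w_hom: "\<forall>x\<in>S. \<forall>y\<in>S. w x \<star> w y = w (x \<otimes> y)"
begin

lemma SG: "x \<in> S \<Longrightarrow> x \<in> carrier G" using S subgroup.mem_carrier by metis
lemma finS: "finite S" using finite_sub S subgroup.subset by blast
lemma S_one: "\<one> \<in> S" by (rule subgroup.one_closed[OF S])
lemma S_mult: "x \<in> S \<Longrightarrow> y \<in> S \<Longrightarrow> x \<otimes> y \<in> S" by (rule subgroup.m_closed[OF S])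
lemma S_inv: "x \<in> S \<Longrightarrow> inv x \<in> S" by (rule subgroup.m_inv_closed[OF S])
lemma S_grp: "group (G\<lparr>carrier := S\<rparr>)" by (rule subgroup_imp_group[OF S])
lemma w_FS: "x \<in> S \<Longrightarrow> w x \<in> FS (N #> x)" using w_Rt by (auto simp: Rt_def)
lemma w_G: "x \<in> S \<Longrightarrow> w x \<in> FS (carrier G)" using w_FS coset_FS_G SG by blast
lemma iw: "x \<in> S \<Longrightarrow> i \<star> w x = w x" using w_Rt by (auto simp: Rt_def)
lemma wi: "x \<in> S \<Longrightarrow> w x \<star> i = w x" using w_Rt by (auto simp: Rt_def)
lemma wi': "x \<in> S \<Longrightarrow> w x \<star> (i \<star> a) = w x \<star> a" by (simp add: conv_assoc[symmetric] wi)
lemma w_mult: "x \<in> S \<Longrightarrow> y \<in> S \<Longrightarrow> w x \<star> w y = w (x \<otimes> y)" using w_hom by blast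

lemma w_one: "w \<one> = i"
proof -
  have "w \<one> \<in> Rt \<one>" "w \<one> \<noteq> 0" using w_Rt S_one by auto
  then obtain c where c: "w \<one> = sc c i" using Rt_one by blast
  have "sc (c * c) i = sc c i" using w_mult[OF S_one S_one] by (simp add: c conv_sc_left conv_sc_right ii)
  hence "c * c = c" using i0 by (metis fv.scale_cancel_right)
  moreover have "c \<noteq> 0" using c \<open>w \<one> \<noteq> 0\<close> by auto
  ultimately show ?thesis using c by simp
qed

lemma w_inv: "x \<in> S \<Longrightarrow> w (inv x) \<star> w x = i" "x \<in> S \<Longrightarrow> w x \<star> w (inv x) = i"
  using w_mult S_inv SG by (simp_all add: w_one)

lemma w_pow_S: "x \<in> S \<Longrightarrow> x [^] (p ^ k\<^sub>S) = \<one>"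
  using subgroup_pow_card[OF S] card_S by simp

lemma S_pelt: "S \<subseteq> pelt p" using w_pow_S SG by (auto simp: pelt_def)

text \<open>The conjugate has degree in \<open>St \<inter> H\<close>, because elements of
  \<open>S\<close> are \<open>p\<close>-elements and \<open>H\<close> is normal; so it is a multiple
  \<open>c\<close> of some \<open>w x'\<close>. Both have order dividing a power of
  \<open>p\<close>, hence \<open>c\<close> is a root of unity of such order and equals 1.\<close>

lemma w_normal:
  assumes t: "t \<in> carrier G" and u: "u \<in> Rt t" "u \<noteq> 0" and v: "v \<in> Rt (inv t)" "u \<star> v = i" "v \<star> u = i"
    and x: "x \<in> S"
  shows "\<exists>x'\<in>S. u \<star> w x \<star> v = w x'"
proof -
  have tS: "t \<in> St" using t u by (auto simp: St_def)
  have xG: "x \<in> carrier G" using SG x by blast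
  have "t \<otimes> x \<otimes> inv t \<in> St"
    using tS x S_St St_sub by (simp add: subgroup.m_closed subgroup.m_inv_closed subset_iff)
  moreover have "t \<otimes> x \<otimes> inv t \<in> H"
    using normal.inv_op_closed2[OF H t, of x] S_pelt pH x by auto
  ultimately obtain x' where x': "x' \<in> S" "t \<otimes> x \<otimes> inv t \<in> N #> x'" using S_cov by blast
  have "u \<star> w x \<star> v \<in> Rt (t \<otimes> x \<otimes> inv t)"
    using Rt_mult[OF Rt_mult[OF u(1) _ t xG] v(1)] w_Rt x t xG by auto
  also have "Rt (t \<otimes> x \<otimes> inv t) = Rt x'" by (rule Rt_cong[OF coset_eqI[OF x'(2) SG[OF x'(1)]]])
  finally obtain c where c: "u \<star> w x \<star> v = sc c (w x')"
    using Rt_dim1[of "w x'" x'] w_Rt x'(1) SG by blast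
  define Q where "Q j \<longleftrightarrow> u \<star> w (x [^] j) \<star> v = sc (c ^ j) (w (x' [^] j))" for j :: nat
  have "Q j" for j
  proof (induction j)
    case 0
    show ?case using u(1) v(2) by (simp add: Q_def w_one Rt_def)
  next
    case (Suc j)
    have S': "x [^] j \<in> S" "x' [^] j \<in> S" using subgroup_nat_pow[OF S] x x' by auto
    have "u \<star> w (x [^] Suc j) \<star> v = u \<star> (w (x [^] j) \<star> w x) \<star> v" using w_mult[OF S'(1) x] by simp
    also have "\<dots> = u \<star> (w (x [^] j) \<star> i \<star> w x) \<star> v" using wi[OF S'(1)] by simp
    also have "\<dots> = (u \<star> w (x [^] j) \<star> v) \<star> (u \<star> w x \<star> v)" by (simp only: v(3)[symmetric] conv_assoc)
    also have "\<dots> = sc (c ^ Suc j) (w (x' [^] Suc j))"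
      using Suc w_mult[OF S'(2) x'(1)] by (simp add: Q_def c conv_sc_left conv_sc_right)
    finally show ?case unfolding Q_def .
  qed
  hence "Q (p ^ k\<^sub>S)" .
  hence "i = sc (c ^ (p ^ k\<^sub>S)) i"
    using w_pow_S x x'(1) u(1) v(2) by (simp add: Q_def w_one Rt_def)
  hence "c ^ (p ^ k\<^sub>S) = 1" using i0 by (metis fv.scale_cancel_right fv.scale_one)
  hence "c = 1" using char_p_root_1[OF p ch] by blast
  thus ?thesis using c x'(1) by auto
qed

text \<open>Each \<open>i \<star> sing g \<star> i\<close> is zero or a homogeneous unit, and a
  homogeneous unit permutes the \<open>w x\<close> by \<open>w_normal\<close>. Linear combination of
  these cases covers every \<open>a\<close>.\<close>

lemma fixed_stable:
  assumes y: "i \<star> y = y" "\<forall>x\<in>S. w x \<star> y = y" and a: "a \<in> FS (carrier G)" and x: "x \<in> S"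
  shows "w x \<star> (i \<star> a \<star> y) = i \<star> a \<star> y"
proof -
  have *: "w x \<star> (i \<star> sing g \<star> i \<star> y) = i \<star> sing g \<star> i \<star> y" if g: "g \<in> carrier G" for g
  proof (cases "i \<star> sing g \<star> i = 0")
    case True thus ?thesis by simp
  next
    case False
    define u where "u = i \<star> sing g \<star> i"
    have u: "u \<in> Rt g" unfolding u_def by (rule i_mid_Rt[OF coset_sing[OF g] g])
    have u0: "u \<noteq> 0" using False by (simp add: u_def)
    obtain v where v: "v \<in> Rt (inv g)" "u \<star> v = i" "v \<star> u = i" by (rule Rt_inverse[OF u g u0])
    have v0: "v \<noteq> 0" using v i0 by auto
    obtain x' where x': "x' \<in> S" "v \<star> w x \<star> u = w x'"
      using w_normal[OF inv_closed[OF g] v(1) v0 _ v(3,2) x] u g by auto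
    have "w x \<star> (u \<star> y) = u \<star> (v \<star> w x \<star> u) \<star> y"
      using v(2) iw[OF x] by (metis conv_assoc)
    also have "\<dots> = u \<star> y" using x' y by (simp add: conv_assoc)
    finally show ?thesis by (simp add: u_def)
  qed
  have "i \<star> a \<star> y = (\<Sum>g\<in>carrier G. sc (a g) (i \<star> sing g \<star> i \<star> y))"
    by (subst FS_expand[OF a fin])
       (simp add: conv_sum_left conv_sum_right conv_sc_left conv_sc_right conv_assoc y(1))
  thus ?thesis using * by (simp add: conv_sum_right conv_sc_right)
qed

text \<open>Counting modulo \<open>p\<close> requires a finite set, but the field is infinite. So
  the count runs over \<open>Y\<close>, the additive group generated by the orbit of
  \<open>v\<close>, with natural numbers modulo \<open>p\<close> as coefficients.\<close>

lemma fixed_vector: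
  assumes K: "\<And>y y'. y \<in> K \<Longrightarrow> y' \<in> K \<Longrightarrow> y + y' \<in> K" "\<And>c y. y \<in> K \<Longrightarrow> sc c y \<in> K"
    and wK: "\<And>x y. x \<in> S \<Longrightarrow> y \<in> K \<Longrightarrow> w x \<star> y \<in> K" and iK: "\<And>y. y \<in> K \<Longrightarrow> i \<star> y = y"
    and v: "v \<in> K" "v \<noteq> 0"
  shows "\<exists>y\<in>K. y \<noteq> 0 \<and> (\<forall>x\<in>S. w x \<star> y = y)"
proof -
  define F where "F c = (\<Sum>x\<in>S. sc (of_nat (c x)) (w x \<star> v))" for c :: "'g \<Rightarrow> nat"
  define Y where "Y = range F"
  have p0: "p > 0" using p by (simp add: prime_gt_0_nat)
  have Fmod: "F c = F (\<lambda>x. if x \<in> S then c x mod p else 0)" for c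
    unfolding F_def using ch by (intro sum.cong) (auto simp: of_nat_mod_CHAR)
  let ?C = "{c. \<forall>x. (x \<in> S \<longrightarrow> c x \<in> {..<p}) \<and> (x \<notin> S \<longrightarrow> c x = 0)}"
  have "Y \<subseteq> F ` ?C"
  proof
    fix y assume "y \<in> Y"
    then obtain c where "y = F c" by (auto simp: Y_def)
    hence "y = F (\<lambda>x. if x \<in> S then c x mod p else 0)" using Fmod by simp
    moreover have "(\<lambda>x. if x \<in> S then c x mod p else 0) \<in> ?C" using p0 by auto
    ultimately show "y \<in> F ` ?C" by blast
  qed
  moreover have "finite ?C" by (rule finite_set_of_finite_funs) (use finS in auto)
  ultimately have finY: "finite Y" using finite_subset by blast
  have K0: "0 \<in> K" using K(2)[of v 0] v by simp
  have FK: "F c \<in> K" for c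
    unfolding F_def using K(2) wK v(1)
    by (intro fv.subspace_sum) (auto simp: fv.subspace_def K K0)
  have Fadd: "F c + F c' = F (\<lambda>x. c x + c' x)" for c c'
    by (simp only: F_def sum.distrib of_nat_add fv.scale_left_distrib)
  have vF: "sc (of_nat j) v = F (\<lambda>x. if x = \<one> then j else 0)" for j
  proof -
    have "F (\<lambda>x. if x = \<one> then j else 0) = (\<Sum>x\<in>{\<one>}. sc (of_nat j) (w x \<star> v))"
      unfolding F_def using finS S_one by (intro sum.mono_neutral_cong_right) auto
    thus ?thesis using iK[OF v(1)] by (simp add: w_one)
  qed
  have wF: "w y \<star> F c = F (\<lambda>x. c (inv y \<otimes> x))" if y: "y \<in> S" for y c
  proof -
    have "w y \<star> F c = (\<Sum>x\<in>S. sc (of_nat (c x)) (w (y \<otimes> x) \<star> v))"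
      unfolding F_def conv_sum_right using y by (intro sum.cong) (auto simp: conv_sc_right conv_assoc[symmetric] w_mult)
    also have "\<dots> = F (\<lambda>x. c (inv y \<otimes> x))"
      unfolding F_def
      by (rule sum.reindex_bij_witness[of _ "\<lambda>z. inv y \<otimes> z" "\<lambda>z. y \<otimes> z"])
         (use y SG S_mult S_inv in \<open>auto simp: m_assoc[symmetric]\<close>)
    finally show ?thesis .
  qed
  \<comment> \<open>Translations by multiples of \<open>v\<close> move every point, so
    \<open>p\<close> divides \<open>card Y\<close>. The action of \<open>S\<close> then has a number
    of fixed points divisible by \<open>p\<close>, and zero is one of them.\<close>
  have "sum (\<lambda>_. 1::'a) Y = sum (\<lambda>_. 1) {y \<in> Y. \<forall>j\<in>carrier (integer_mod_group p). y + sc (of_nat (nat j)) v = y}"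
  proof (rule p_group_sum_fixed[where P = "integer_mod_group p" and p = p and k = 1])
    show "card (carrier (integer_mod_group p)) = p ^ 1" using p0 by (simp add: carrier_integer_mod_group)
    show "y + sc (of_nat (nat j)) v \<in> Y" if "y \<in> Y" for j y using that by (auto simp: Y_def vF Fadd)
    fix j j' y assume "j \<in> carrier (integer_mod_group p)" "j' \<in> carrier (integer_mod_group p)"
    hence j: "0 \<le> j" "0 \<le> j'" using p0 by (auto simp: carrier_integer_mod_group)
    have "nat ((j + j') mod int p) = (nat j + nat j') mod p"
      using j by (simp add: nat_mod_distrib nat_add_distrib)
    hence "(of_nat (nat ((j + j') mod int p)) :: 'a) = of_nat (nat j) + of_nat (nat j')"
      using ch by (metis of_nat_add of_nat_mod_CHAR)
    thus "y + sc (of_nat (nat (j \<otimes>\<^bsub>integer_mod_group p\<^esub> j'))) v = y + sc (of_nat (nat j')) v + sc (of_nat (nat j)) v"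
      by (simp add: fun_eq_iff algebra_simps)
  qed (use p ch finY in auto)
  also have "{y \<in> Y. \<forall>j\<in>carrier (integer_mod_group p). y + sc (of_nat (nat j)) v = y} = {}"
  proof -
    have "1 \<in> carrier (integer_mod_group p)" using prime_gt_1_nat[OF p] by (auto simp: carrier_integer_mod_group)
    moreover have "y + sc (of_nat (nat 1)) v \<noteq> y" for y using v(2) by simp
    ultimately show ?thesis by blast
  qed
  finally have Y0: "(of_nat (card Y) :: 'a) = 0" by simp
  define Fx where "Fx = {y \<in> Y. \<forall>x\<in>S. w x \<star> y = y}"
  have "sum (\<lambda>_. 1::'a) Y = sum (\<lambda>_. 1) {y \<in> Y. \<forall>x\<in>carrier (G\<lparr>carrier := S\<rparr>). w x \<star> y = y}"
  proof (rule p_group_sum_fixed[OF S_grp _ p ch finY, where k = k\<^sub>S])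
    show "w x \<star> y \<in> Y" if "x \<in> carrier (G\<lparr>carrier := S\<rparr>)" "y \<in> Y" for x y
      using that by (auto simp: Y_def wF)
    show "w \<one>\<^bsub>G\<lparr>carrier := S\<rparr>\<^esub> \<star> y = y" if "y \<in> Y" for y
      using that iK FK by (auto simp: Y_def w_one)
    show "w (x \<otimes>\<^bsub>G\<lparr>carrier := S\<rparr>\<^esub> x') \<star> y = w x \<star> (w x' \<star> y)"
      if "x \<in> carrier (G\<lparr>carrier := S\<rparr>)" "x' \<in> carrier (G\<lparr>carrier := S\<rparr>)" for x x' y
      using that by (simp add: w_mult[symmetric] conv_assoc)
  qed (use card_S in auto)
  hence F0: "(of_nat (card Fx) :: 'a) = 0" using Y0 by (simp add: Fx_def)
  have "Fx \<noteq> {0}" using F0 by auto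
  moreover have "0 \<in> Fx"
    using vF[of 0] by (auto simp: Fx_def Y_def)
  ultimately obtain y where "y \<in> Fx" "y \<noteq> 0" by blast
  thus ?thesis using FK by (auto simp: Fx_def Y_def)
qed

subsection \<open>Matrix coefficients\<close>

definition ev :: "'i \<Rightarrow> nat \<Rightarrow> nat \<Rightarrow> ('g \<Rightarrow> 'a) \<Rightarrow> 'a" where
  "ev k a b r = (\<Sum>g\<in>carrier G. r g * m k a b g)"

text \<open>For fixed \<open>k\<close> and \<open>a\<close>, these functions span a copy of the
  simple module \<open>k\<close> inside the group algebra, with \<open>b\<close> numbering the basis
  (\<open>conv_Zc\<close>).\<close>

definition Zc :: "'i \<Rightarrow> nat \<Rightarrow> nat \<Rightarrow> 'g \<Rightarrow> 'a" where
  "Zc k a b = (\<lambda>g. if g \<in> carrier G then m k a b (inv g) else 0)"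

text \<open>The Jacobson radical, as the common kernel of the simple modules.\<close>

definition J :: "('g \<Rightarrow> 'a) set" where
  "J = {r \<in> FS (carrier G). \<forall>k\<in>I. \<forall>a<n k. \<forall>b<n k. ev k a b r = 0}"

lemma ev_mult:
  assumes "k \<in> I" "a < n k" "b < n k"
  shows "ev k a b (r \<star> r') = (\<Sum>c<n k. ev k a c r * ev k c b r')"
proof -
  have "ev k a b (r \<star> r') = (\<Sum>g\<in>carrier G. m k a b g * (r \<star> r') g)" by (simp add: ev_def mult.commute)
  also have "\<dots> = (\<Sum>g\<in>carrier G. \<Sum>h\<in>carrier G. (\<Sum>c<n k. m k a c g * m k c b h) * r g * r' h)"
    using assms by (simp add: conv_pair m_mult)
  also have "\<dots> = (\<Sum>g\<in>carrier G. \<Sum>h\<in>carrier G. \<Sum>c<n k. (r g * m k a c g) * (r' h * m k c b h))"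
    by (intro sum.cong refl) (simp add: sum_distrib_right sum_distrib_left mult_ac)
  also have "\<dots> = (\<Sum>g\<in>carrier G. \<Sum>c<n k. \<Sum>h\<in>carrier G. (r g * m k a c g) * (r' h * m k c b h))"
    by (rule sum.cong[OF refl], rule sum.swap)
  also have "\<dots> = (\<Sum>c<n k. \<Sum>g\<in>carrier G. \<Sum>h\<in>carrier G. (r g * m k a c g) * (r' h * m k c b h))"
    by (rule sum.swap)
  also have "\<dots> = (\<Sum>c<n k. ev k a c r * ev k c b r')" by (simp add: ev_def sum_product)
  finally show ?thesis .
qed

lemma ev_add: "ev k a b (r + r') = ev k a b r + ev k a b r'"
  and ev_diff: "ev k a b (r - r') = ev k a b r - ev k a b r'"
  and ev_sc: "ev k a b (sc c r) = c * ev k a b r"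
  and ev_0: "ev k a b 0 = 0"
  by (simp_all add: ev_def algebra_simps sum.distrib sum_subtractf sum_distrib_left)

lemma ev_sum: "ev k a b (sum f U) = (\<Sum>x\<in>U. ev k a b (f x))"
  by (rule additive_sum[of "ev k a b"]) (simp_all add: ev_0 ev_add)

lemma ev_sing: "g \<in> carrier G \<Longrightarrow> ev k a b (sing g) = m k a b g"
  using fin by (simp add: ev_def sing_def if_distrib[of "\<lambda>x. x * _"] cong: if_cong)

lemma J_mult_l: "r \<in> J \<Longrightarrow> a \<star> r \<in> J" and J_mult_r: "r \<in> J \<Longrightarrow> r \<star> a \<in> J"
  by (auto simp: J_def ev_mult)

lemma J_G: "r \<in> J \<Longrightarrow> r \<in> FS (carrier G)" by (simp add: J_def)

lemma J_nil: "r \<in> J \<Longrightarrow> nilp r"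
  by (rule m_nil) (auto simp: J_def ev_def)

lemma Zc_G: "Zc k a b \<in> FS (carrier G)" by (auto simp: Zc_def FS_def)

lemma conv_Zc:
  assumes "k \<in> I" "a < n k" "b < n k"
  shows "r \<star> Zc k a b = (\<Sum>c<n k. sc (ev k c b r) (Zc k a c))"
proof (rule FS_eqI)
  fix g assume g: "g \<in> carrier G"
  have "(r \<star> Zc k a b) g = (\<Sum>h\<in>carrier G. r h * m k a b (inv g \<otimes> h))"
    using g by (simp add: conv_apply Zc_def inv_mult_group)
  also have "\<dots> = (\<Sum>h\<in>carrier G. \<Sum>c<n k. m k a c (inv g) * (r h * m k c b h))"
    using g assms by (simp add: m_mult sum_distrib_left mult_ac)
  also have "\<dots> = (\<Sum>c<n k. m k a c (inv g) * ev k c b r)"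
    by (subst sum.swap) (simp add: ev_def sum_distrib_left)
  finally show "(r \<star> Zc k a b) g = (\<Sum>c<n k. sc (ev k c b r) (Zc k a c)) g"
    using g by (simp add: sum_fun_apply Zc_def mult.commute)
qed (auto intro!: FS_sum FS_sc Zc_G)

lemma conv_Zc_one:
  assumes "k \<in> I" "a < n k" "b < n k"
  shows "(r \<star> Zc k a b) \<one> = ev k a b r"
proof -
  have "(r \<star> Zc k a b) \<one> = (\<Sum>c<n k. if c = a then ev k c b r else 0)"
    unfolding conv_Zc[OF assms] sum_fun_apply
    by (rule sum.cong) (use assms in \<open>auto simp: Zc_def m_one\<close>)
  thus ?thesis using assms by simp
qed

text \<open>On the part of a simple module cut out by \<open>i\<close>, the units have a nonzero
  fixed vector \<open>y\<close>. By simplicity every vector there has the form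
  \<open>i \<star> a \<star> y\<close>, which is fixed by \<open>fixed_stable\<close>; so
  \<open>w x\<close> acts like \<open>i\<close> on every simple module.\<close>

lemma w_J: assumes x: "x \<in> S" shows "w x - i \<in> J"
proof -
  have "ev k a b (w x - i) = 0" if k: "k \<in> I" "a < n k" "b < n k" for k a b
  proof -
    define V where "V = {y. \<exists>c. y = (\<Sum>r<n k. sc (c r) (Zc k a r))}"
    have Vadd: "y + y' \<in> V" if "y \<in> V" "y' \<in> V" for y y'
    proof -
      from that obtain c c' where "y = (\<Sum>r<n k. sc (c r) (Zc k a r))" "y' = (\<Sum>r<n k. sc (c' r) (Zc k a r))"
        by (auto simp: V_def)
      hence "y + y' = (\<Sum>r<n k. sc (c r + c' r) (Zc k a r))"
        by (simp only: sum.distrib fv.scale_left_distrib)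
      thus ?thesis unfolding V_def by (intro CollectI exI)
    qed
    have Vsc: "sc d y \<in> V" if "y \<in> V" for y d
    proof -
      from that obtain c where "y = (\<Sum>r<n k. sc (c r) (Zc k a r))" by (auto simp: V_def)
      hence "sc d y = (\<Sum>r<n k. sc (d * c r) (Zc k a r))" by (simp only: fv.scale_sum_right fv.scale_scale)
      thus ?thesis unfolding V_def by (intro CollectI exI)
    qed
    have V0: "0 \<in> V" unfolding V_def by (intro CollectI exI[of _ "\<lambda>_. 0"]) simp
    have V_sub: "fv.subspace V" by (simp add: fv.subspace_def Vadd Vsc V0)
    have ZV: "r \<star> Zc k a b' \<in> V" if "b' < n k" for r b'
      unfolding conv_Zc[OF k(1,2) that] V_def by (intro CollectI exI[of _ "\<lambda>c. ev k c b' r"] refl)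
    have VG: "r \<star> y \<in> V" if y: "y \<in> V" for r y
    proof -
      from y obtain c where "y = (\<Sum>r<n k. sc (c r) (Zc k a r))" by (auto simp: V_def)
      hence "r \<star> y = (\<Sum>b'<n k. sc (c b') (r \<star> Zc k a b'))" by (simp add: conv_sum_right conv_sc_right)
      also have "\<dots> \<in> V" by (rule subspace_sum_sc[OF V_sub]) (simp add: ZV)
      finally show ?thesis .
    qed
    have wfix: "w x \<star> (i \<star> Zc k a b) = i \<star> Zc k a b"
    proof (cases "i \<star> Zc k a b = 0")
      case True thus ?thesis by simp
    next
      case False
      have "\<exists>y\<in>{y \<in> V. i \<star> y = y}. y \<noteq> 0 \<and> (\<forall>x\<in>S. w x \<star> y = y)"
      proof (rule fixed_vector)
        show "i \<star> Zc k a b \<in> {y \<in> V. i \<star> y = y}" using ZV[OF k(3)] by (simp add: ii_l)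
        show "w x \<star> y \<in> {y \<in> V. i \<star> y = y}" if "x \<in> S" "y \<in> {y \<in> V. i \<star> y = y}" for x y
          using that VG by (simp add: conv_assoc[symmetric] iw)
      qed (use False Vadd Vsc in \<open>auto simp: conv_add_right conv_sc_right\<close>)
      then obtain y where y: "y \<in> V" "i \<star> y = y" "y \<noteq> 0" "\<forall>x\<in>S. w x \<star> y = y" by blast
      obtain c where c: "y = (\<Sum>r<n k. sc (c r) (Zc k a r))" using y(1) by (auto simp: V_def)
      have "\<exists>r<n k. c r \<noteq> 0"
      proof (rule ccontr)
        assume "\<not> (\<exists>r<n k. c r \<noteq> 0)"
        hence "y = (\<Sum>r<n k. 0)" unfolding c by (intro sum.cong) auto
        thus False using y(3) by simp
      qed
      then obtain r where r: "r < n k" "c r \<noteq> 0" by blast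
      \<comment> \<open>An element acting as a matrix unit, which takes \<open>y\<close> to a
        multiple of the given basis vector.\<close>
      obtain d where d: "d \<in> FS (carrier G)" "\<forall>k'\<in>I. \<forall>i'<n k'. \<forall>j'<n k'.
          (\<Sum>g\<in>carrier G. d g * m k' i' j' g) = (if (k', i', j') = (k, b, r) then 1 else 0)"
        using m_surj[OF k(1,3) r(1)] by blast
      have dev: "ev k b' r' d = (if b' = b \<and> r' = r then 1 else 0)" if "b' < n k" "r' < n k" for b' r'
        using d(2) k(1) that by (simp add: ev_def)
      have dZ: "d \<star> Zc k a r' = (if r' = r then Zc k a b else 0)" if r': "r' < n k" for r'
      proof -
        have "d \<star> Zc k a r' = (\<Sum>c<n k. sc (if c = b \<and> r' = r then 1 else 0) (Zc k a c))"
          unfolding conv_Zc[OF k(1,2) r'] using dev r' by (intro sum.cong) auto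
        also have "\<dots> = (\<Sum>c<n k. if c = b then (if r' = r then Zc k a b else 0) else 0)"
          by (intro sum.cong) auto
        also have "\<dots> = (if r' = r then Zc k a b else 0)" using k(3) by (subst sum.delta) simp_all
        finally show ?thesis .
      qed
      have "d \<star> y = (\<Sum>r'<n k. if r' = r then sc (c r) (Zc k a b) else 0)"
        unfolding c conv_sum_right conv_sc_right by (intro sum.cong) (auto simp: dZ)
      also have "\<dots> = sc (c r) (Zc k a b)" using r(1) by (subst sum.delta) simp_all
      finally have "sc (inverse (c r)) d \<star> y = Zc k a b" using r(2) by (simp add: conv_sc_left)
      hence "i \<star> Zc k a b = i \<star> sc (inverse (c r)) d \<star> y" by (simp add: conv_assoc)
      thus ?thesis using fixed_stable[OF y(2,4) FS_sc[OF d(1)] x] by metis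
    qed
    have "(w x - i) \<star> Zc k a b = 0" using wfix wi'[OF x] by (simp add: conv_diff_left)
    thus ?thesis using conv_Zc_one[OF k, of "w x - i"] by simp
  qed
  thus ?thesis using w_G[OF x] i_G by (auto simp: J_def FS_diff)
qed

end

context core_w
begin

subsection \<open>Defect groups contain conjugates of S\<close>

text \<open>The sum over \<open>N\<close> makes the conjugate of \<open>a\<close> commute with the
  group algebra of \<open>N\<close>. Applied to a trace it only multiplies by \<open>card N\<close>,
  which is invertible.\<close>

definition Ya :: "('g \<Rightarrow> 'a) \<Rightarrow> 'g \<Rightarrow> 'g \<Rightarrow> 'a" where
  "Ya a g = (\<Sum>y\<in>N. cj y (cj g a))"

lemma Ya_in: "Ya a g \<in> FS (carrier G)" unfolding Ya_def by (intro FS_sum cj_in)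

lemma cj_Ya_N: assumes x: "x \<in> N" and g: "g \<in> carrier G" shows "cj x (Ya a g) = Ya a g"
proof -
  have xG: "x \<in> carrier G" using x N_carr by blast
  have "cj x (Ya a g) = (\<Sum>y\<in>N. cj (x \<otimes> y) (cj g a))"
    unfolding Ya_def cj_sum using xG N_carr by (intro sum.cong) (auto simp: cj_cj subset_iff)
  also have "\<dots> = (\<Sum>y\<in>N. cj y (cj g a))"
    by (rule sum.reindex_bij_witness[of _ "\<lambda>y. inv x \<otimes> y" "\<lambda>y. x \<otimes> y"])
       (use x xG N_carr N_sub in \<open>auto simp: m_assoc[symmetric] subset_iff subgroup.m_closed subgroup.m_inv_closed\<close>)
  finally show ?thesis by (simp add: Ya_def)
qed

lemma cj_Ya: assumes x: "x \<in> carrier G" and g: "g \<in> carrier G" shows "cj x (Ya a g) = Ya a (x \<otimes> g)"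
proof -
  have "cj x (Ya a g) = (\<Sum>y\<in>N. cj (x \<otimes> y \<otimes> inv x) (cj (x \<otimes> g) a))"
    unfolding Ya_def cj_sum
  proof (rule sum.cong[OF refl])
    fix y assume "y \<in> N"
    hence y: "y \<in> carrier G" using N_carr by blast
    have "x \<otimes> y \<otimes> inv x \<otimes> (x \<otimes> g) = x \<otimes> (y \<otimes> (inv x \<otimes> x) \<otimes> g)"
      using x y g by (simp only: m_assoc m_closed inv_closed)
    hence "x \<otimes> y \<otimes> inv x \<otimes> (x \<otimes> g) = x \<otimes> (y \<otimes> g)" using x y g by simp
    thus "cj x (cj y (cj g a)) = cj (x \<otimes> y \<otimes> inv x) (cj (x \<otimes> g) a)"
      using x y g by (simp add: cj_cj)
  qed
  also have "\<dots> = (\<Sum>y\<in>N. cj y (cj (x \<otimes> g) a))"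
  proof (rule sum.reindex_bij_witness[of _ "\<lambda>y. inv x \<otimes> y \<otimes> x" "\<lambda>y. x \<otimes> y \<otimes> inv x"])
    fix y assume yN: "y \<in> N"
    hence y: "y \<in> carrier G" using N_carr by blast
    show "inv x \<otimes> (x \<otimes> y \<otimes> inv x) \<otimes> x = y" "x \<otimes> (inv x \<otimes> y \<otimes> x) \<otimes> inv x = y"
      using x y by (simp_all add: m_assoc) (simp_all add: m_assoc[symmetric])
    show "x \<otimes> y \<otimes> inv x \<in> N" "inv x \<otimes> y \<otimes> x \<in> N"
      using normal.inv_op_closed2[OF N x yN] normal.inv_op_closed1[OF N x yN] by simp_all
  qed simp
  finally show ?thesis by (simp add: Ya_def)
qed

lemma Ya_comm: "g \<in> carrier G \<Longrightarrow> b \<in> FS N \<Longrightarrow> Ya a g \<star> b = b \<star> Ya a g"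
  by (rule central_if_sing[OF Ya_in N_carr], rule cj_fix_comm[OF Ya_in])
     (use N_carr in \<open>auto simp: cj_Ya_N\<close>)

text \<open>Moving \<open>w x\<close> across replaces \<open>Ya a g\<close> by
  \<open>Ya a (x \<otimes> g)\<close>, while modulo the radical \<open>w x\<close> is just
  \<open>i\<close>. Matrix coefficients do not see the radical.\<close>

lemma ev_Ya:
  assumes x: "x \<in> S" and g: "g \<in> carrier G" and kab: "k \<in> I" "b < n k" "c < n k"
  shows "ev k b c (i \<star> Ya a (x \<otimes> g)) = ev k b c (i \<star> Ya a g)"
proof -
  have xG: "x \<in> carrier G" and xgG: "x \<otimes> g \<in> carrier G" using SG[OF x] g by auto
  define d where "d = w x \<star> sing (inv x)"
  have dN: "d \<in> FS N" unfolding d_def by (rule coset_shift_r[OF w_FS[OF x] xG])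
  have wd: "w x = d \<star> sing x" using w_G[OF x] xG by (simp add: d_def conv_assoc sing_mult)
  have "w x \<star> Ya a g = d \<star> (sing x \<star> Ya a g)" by (simp only: wd conv_assoc)
  also have "\<dots> = d \<star> (Ya a (x \<otimes> g) \<star> sing x)" using sing_cj[OF xG] cj_Ya[OF xG g] by metis
  also have "\<dots> = Ya a (x \<otimes> g) \<star> w x" using Ya_comm[OF xgG dN] by (metis wd conv_assoc)
  finally have *: "w x \<star> Ya a g = Ya a (x \<otimes> g) \<star> w x" .
  have J0: "ev k b c r = 0" if "r \<in> J" for r using that kab by (auto simp: J_def)
  have "ev k b c (i \<star> Ya a g) = ev k b c (w x \<star> Ya a g) - ev k b c ((w x - i) \<star> Ya a g)"
    by (simp add: conv_diff_left ev_diff)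
  also have "\<dots> = ev k b c (Ya a (x \<otimes> g) \<star> w x)" using J0[OF J_mult_r[OF w_J[OF x]]] * by simp
  also have "\<dots> = ev k b c (Ya a (x \<otimes> g) \<star> i) + ev k b c (Ya a (x \<otimes> g) \<star> (w x - i))"
    by (simp add: conv_diff_right ev_diff)
  also have "\<dots> = ev k b c (i \<star> Ya a (x \<otimes> g))"
    using J0[OF J_mult_l[OF w_J[OF x]]] Ya_comm[OF xgG i_N] by simp
  finally show ?thesis by simp
qed

text \<open>Some matrix coefficient of the non-nilpotent \<open>i \<star> e\<close> is nonzero. Up
  to \<open>card N\<close> it is a sum over the left cosets of \<open>D\<close> whose summand is
  invariant under \<open>S\<close>, so \<open>S\<close> fixes some coset \<open>g <# D\<close>; this
  means that a conjugate of \<open>S\<close> lies in \<open>D\<close>.\<close>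

lemma defect_lower:
  assumes D: "subgroup D G" and a: "a \<in> FS (carrier G)" "\<And>d. d \<in> D \<Longrightarrow> cj d a = a" and e: "e = Tr D a"
  shows "\<exists>g\<in>carrier G. \<forall>x\<in>S. inv g \<otimes> x \<otimes> g \<in> D"
proof -
  have "i \<star> e \<in> FS (carrier G)" by simp
  moreover have "\<not> nilp (i \<star> e)"
  proof
    assume nil: "nilp (i \<star> e)"
    have ie: "i \<star> e = e \<star> i" using e_cent[OF i_G] by simp
    have "(i \<star> e) \<star> (i \<star> e) = i \<star> (e \<star> i) \<star> e" by (simp only: conv_assoc)
    also have "\<dots> = i \<star> (i \<star> e) \<star> e" by (simp only: ie)
    also have "\<dots> = i \<star> e" by (simp add: ii_l) (simp add: conv_assoc ee)
    finally have "i \<star> e = 0" using nilp_idem[OF nil] by blast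
    thus False using ie ei by simp
  qed
  ultimately obtain k b c where kbc: "k \<in> I" "b < n k" "c < n k" "ev k b c (i \<star> e) \<noteq> 0"
    using m_nil[of "i \<star> e"] unfolding ev_def by blast
  define \<kappa> where "\<kappa> T = ev k b c (i \<star> Ya a (SOME t. t \<in> T))" for T
  note rep = lcoset_rep[OF D]
  have Ya_rep: "Ya a (SOME t. t \<in> T) = Ya a g" if "T \<in> lcosets D" "g \<in> T" for T g
    using cj_coset[OF D a(2) that] by (simp add: Ya_def)
  have "(\<Sum>T\<in>lcosets D. \<kappa> T) = ev k b c (i \<star> (\<Sum>T\<in>lcosets D. Ya a (SOME t. t \<in> T)))"
    by (simp add: \<kappa>_def conv_sum_right ev_sum)
  also have "(\<Sum>T\<in>lcosets D. Ya a (SOME t. t \<in> T)) = (\<Sum>y\<in>N. cj y (Tr D a))"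
    unfolding Ya_def Tr_def cj_sum by (rule sum.swap)
  also have "\<dots> = (\<Sum>y\<in>N. e)"
    using cj_Tr[OF D a(2)] N_carr e by (intro sum.cong) auto
  also have "ev k b c (i \<star> (\<Sum>y\<in>N. e)) = (\<Sum>y\<in>N. ev k b c (i \<star> e))"
    unfolding conv_sum_right ev_sum ..
  also have "\<dots> = of_nat (card N) * ev k b c (i \<star> e)" by simp
  finally have nz: "(\<Sum>T\<in>lcosets D. \<kappa> T) \<noteq> 0" using kbc(4) pN ch by (simp add: of_nat_eq_0_iff_char_dvd)
  have "sum \<kappa> (lcosets D) = sum \<kappa> {T \<in> lcosets D. \<forall>x\<in>carrier (G\<lparr>carrier := S\<rparr>). x <# T = T}"
  proof (rule p_group_sum_fixed[OF S_grp _ p ch lcosets_finite[OF D], where k = k\<^sub>S])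
    show "card (carrier (G\<lparr>carrier := S\<rparr>)) = p ^ k\<^sub>S" using card_S by simp
    fix x T assume xS: "x \<in> carrier (G\<lparr>carrier := S\<rparr>)" and T: "T \<in> lcosets D"
    hence xT: "x \<in> carrier G" "x <# T \<in> lcosets D" using SG lcoset_mult[OF D] by auto
    thus "x <# T \<in> lcosets D" by blast
    have "x \<otimes> (SOME t. t \<in> T) \<in> x <# T" using rep(1)[OF T] by (auto simp: l_coset_def)
    from Ya_rep[OF xT(2) this] show "\<kappa> (x <# T) = \<kappa> T"
      using ev_Ya[OF _ rep(2)[OF T] kbc(1-3)] xS by (simp add: \<kappa>_def)
  next
    fix x y T assume "x \<in> carrier (G\<lparr>carrier := S\<rparr>)" "y \<in> carrier (G\<lparr>carrier := S\<rparr>)" "T \<in> lcosets D"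
    thus "(x \<otimes>\<^bsub>G\<lparr>carrier := S\<rparr>\<^esub> y) <# T = x <# (y <# T)"
      using SG rep(4) by (simp add: lcoset_mult_mult)
  qed (use rep(4) lcoset_one in auto)
  moreover have "{T \<in> lcosets D. \<forall>x\<in>carrier (G\<lparr>carrier := S\<rparr>). x <# T = T} = {T \<in> lcosets D. \<forall>x\<in>S. x <# T = T}"
    by simp
  ultimately have "sum \<kappa> {T \<in> lcosets D. \<forall>x\<in>S. x <# T = T} \<noteq> 0" using nz by simp
  hence "{T \<in> lcosets D. \<forall>x\<in>S. x <# T = T} \<noteq> {}" by (rule contrapos_nn) (simp only: sum.empty)
  then obtain T where T: "T \<in> lcosets D" "\<forall>x\<in>S. x <# T = T" by blast
  define g where "g = (SOME t. t \<in> T)"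
  have g: "g \<in> T" "g \<in> carrier G" "T = g <# D" using rep[OF T(1)] by (auto simp: g_def)
  have "inv g \<otimes> x \<otimes> g \<in> D" if x: "x \<in> S" for x
  proof -
    have "x \<otimes> g \<in> x <# T" using g(1) by (auto simp: l_coset_def)
    hence "x \<otimes> g \<in> g <# D" using T(2) x g(3) by simp
    then obtain d where d: "d \<in> D" "x \<otimes> g = g \<otimes> d" by (auto simp: l_coset_def)
    hence "inv g \<otimes> (x \<otimes> g) = d" using g(2) D subgroup.mem_carrier[OF D d(1)] by (simp add: m_assoc[symmetric])
    thus ?thesis using d(1) g(2) SG[OF x] by (simp add: m_assoc)
  qed
  thus ?thesis using g(2) by blast
qed

subsection \<open>The radical annihilates the fixed points\<close>

text \<open>Take all elements of \<open>N\<close> times chosen representatives of the right cosets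
  of \<open>St \<inter> H\<close>. As that group is the product of \<open>N\<close> and
  \<open>S\<close>, the translates by \<open>S\<close> partition the whole group, and they provide
  the free basis behind the dimension formulas.\<close>

lemma exists_transversal:
  obtains Gam where "\<forall>g\<in>carrier G. \<exists>x\<in>S. inv x \<otimes> g \<in> Gam"
    "\<forall>g\<in>carrier G. \<forall>x\<in>S. \<forall>y\<in>S. inv x \<otimes> g \<in> Gam \<longrightarrow> inv y \<otimes> g \<in> Gam \<longrightarrow> x = y"
    "\<forall>h\<in>N. \<forall>g\<in>carrier G. h \<otimes> g \<in> Gam \<longleftrightarrow> g \<in> Gam"
proof -
  define Q where "Q = St \<inter> H"
  have Hs: "subgroup H G" using H by (simp add: normal_def)
  have Q: "subgroup Q G" unfolding Q_def by (rule subgroups_Inter_pair[OF St_sub Hs])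
  have NQ: "N \<subseteq> Q" using N_St NH by (auto simp: Q_def)
  have SQ: "S \<subseteq> Q" using S_St S_pelt pH by (auto simp: Q_def)
  define rep where "rep g = (SOME t. t \<in> Q #> g)" for g
  have rep: "rep g \<in> Q #> g" if "g \<in> carrier G" for g
    unfolding rep_def using rcos_self[OF that Q] by (rule someI[of "\<lambda>t. t \<in> Q #> g"])
  have rep_eq: "rep (q \<otimes> g) = rep g" if "q \<in> Q" "g \<in> carrier G" for q g
  proof -
    have "q \<otimes> g \<in> Q #> g" using that by (auto simp: r_coset_def)
    hence "Q #> (q \<otimes> g) = Q #> g" by (metis Q repr_independence that(2))
    thus ?thesis by (simp add: rep_def)
  qed
  have repG: "rep g \<in> carrier G" if "g \<in> carrier G" for g
    using rep[OF that] r_coset_subset_G[OF subgroup.subset[OF Q] that] by blast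
  define Gam where "Gam = {g \<in> carrier G. \<exists>h\<in>N. g = h \<otimes> rep g}"
  have nG: "h \<in> carrier G" if "h \<in> N" for h using that N_carr by blast
  have 1: "\<exists>x\<in>S. inv x \<otimes> g \<in> Gam" if g: "g \<in> carrier G" for g
  proof -
    obtain q where q: "q \<in> Q" "rep g = q \<otimes> g" using rep[OF g] by (auto simp: r_coset_def)
    have qG: "q \<in> carrier G" using q(1) Q subgroup.mem_carrier by metis
    have "inv q \<in> St \<inter> H" using q(1) Q by (simp add: subgroup.m_inv_closed flip: Q_def)
    then obtain x where x: "x \<in> S" "inv q \<in> N #> x" using S_cov by blast
    then obtain h where h: "h \<in> N" "inv q = h \<otimes> x" by (auto simp: r_coset_def)
    have c: "x \<in> carrier G" "h \<in> carrier G" using x h SG nG by auto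
    have gq: "g = h \<otimes> x \<otimes> rep g" using q qG g h(2)[symmetric] by (simp add: m_assoc[symmetric])
    have "inv x \<otimes> g = (inv x \<otimes> h \<otimes> x) \<otimes> rep g"
      using c repG[OF g] by (subst gq) (simp add: m_assoc)
    moreover have "rep (inv x \<otimes> g) = rep g" using rep_eq[of "inv x" g] S_inv[OF x(1)] SQ g by blast
    moreover have "inv x \<otimes> h \<otimes> x \<in> N" using normal.inv_op_closed1[OF N c(1) h(1)] .
    moreover have "inv x \<otimes> g \<in> carrier G" using c g by simp
    ultimately have "inv x \<otimes> g \<in> Gam"
      unfolding Gam_def by (intro CollectI conjI bexI[of _ "inv x \<otimes> h \<otimes> x"]) simp_all
    thus ?thesis using x(1) by blast
  qed
  have 2: "x = y" if g: "g \<in> carrier G" and xy: "x \<in> S" "y \<in> S" "inv x \<otimes> g \<in> Gam" "inv y \<otimes> g \<in> Gam" for g x y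
  proof -
    have c: "x \<in> carrier G" "y \<in> carrier G" using xy SG by auto
    have r: "rep (inv x \<otimes> g) = rep g" "rep (inv y \<otimes> g) = rep g"
      using rep_eq[of "inv x" g] rep_eq[of "inv y" g] S_inv xy SQ g by blast+
    obtain h l where h: "h \<in> N" "inv x \<otimes> g = h \<otimes> rep g" "l \<in> N" "inv y \<otimes> g = l \<otimes> rep g"
      using xy r by (auto simp: Gam_def)
    have hc: "h \<in> carrier G" "l \<in> carrier G" using h nG by auto
    have "g = x \<otimes> (inv x \<otimes> g)" "g = y \<otimes> (inv y \<otimes> g)" using c g by (simp_all add: m_assoc[symmetric])
    hence "x \<otimes> h \<otimes> rep g = y \<otimes> l \<otimes> rep g" using h c hc repG[OF g] by (simp add: m_assoc)
    hence "x \<otimes> h = y \<otimes> l" using c hc repG[OF g] by simp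
    hence "inv y \<otimes> x \<otimes> h = l" using c hc by (simp add: m_assoc inv_solve_left')
    hence "inv y \<otimes> x = l \<otimes> inv h" using c hc by (simp add: inv_solve_right)
    moreover have "inv y \<otimes> x \<in> S" using xy S_mult S_inv by blast
    moreover have "l \<otimes> inv h \<in> N" using h N_sub by (simp add: subgroup.m_closed subgroup.m_inv_closed)
    ultimately have "inv y \<otimes> x = \<one>" using SN by auto
    thus "x = y" using c by (metis inv_closed inv_equality inv_inv)
  qed
  have 3: "h \<otimes> g \<in> Gam \<longleftrightarrow> g \<in> Gam" if h: "h \<in> N" and g: "g \<in> carrier G" for h g
  proof -
    have r: "rep (h \<otimes> g) = rep g" using rep_eq[of h g] h NQ g by blast
    have hG: "h \<in> carrier G" using h nG by blast
    have "(\<exists>l\<in>N. h \<otimes> g = l \<otimes> rep g) \<longleftrightarrow> (\<exists>l\<in>N. g = l \<otimes> rep g)"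
    proof
      assume "\<exists>l\<in>N. h \<otimes> g = l \<otimes> rep g"
      then obtain l where l: "l \<in> N" "h \<otimes> g = l \<otimes> rep g" by blast
      have "g = inv h \<otimes> (h \<otimes> g)" using hG g by (simp add: m_assoc[symmetric])
      hence "g = inv h \<otimes> l \<otimes> rep g" using l hG nG[OF l(1)] repG[OF g] by (simp add: m_assoc)
      thus "\<exists>l\<in>N. g = l \<otimes> rep g" using l h N_sub by (blast intro: subgroup.m_closed subgroup.m_inv_closed)
    next
      assume "\<exists>l\<in>N. g = l \<otimes> rep g"
      then obtain l where l: "l \<in> N" "g = l \<otimes> rep g" by blast
      hence "h \<otimes> g = h \<otimes> l \<otimes> rep g" using hG nG[OF l(1)] repG[OF g] by (metis m_assoc)
      thus "\<exists>l\<in>N. h \<otimes> g = l \<otimes> rep g" using l h N_sub by (blast intro: subgroup.m_closed)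
    qed
    thus ?thesis using r hG g by (simp add: Gam_def)
  qed
  show ?thesis using that 1 2 3 by blast
qed

definition Gam :: "'g set" where
  "Gam = (SOME Gam. (\<forall>g\<in>carrier G. \<exists>x\<in>S. inv x \<otimes> g \<in> Gam) \<and>
    (\<forall>g\<in>carrier G. \<forall>x\<in>S. \<forall>y\<in>S. inv x \<otimes> g \<in> Gam \<longrightarrow> inv y \<otimes> g \<in> Gam \<longrightarrow> x = y) \<and>
    (\<forall>h\<in>N. \<forall>g\<in>carrier G. h \<otimes> g \<in> Gam \<longleftrightarrow> g \<in> Gam))"

lemma Gam: "\<forall>g\<in>carrier G. \<exists>x\<in>S. inv x \<otimes> g \<in> Gam"
    "\<forall>g\<in>carrier G. \<forall>x\<in>S. \<forall>y\<in>S. inv x \<otimes> g \<in> Gam \<longrightarrow> inv y \<otimes> g \<in> Gam \<longrightarrow> x = y"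
    "\<forall>h\<in>N. \<forall>g\<in>carrier G. h \<otimes> g \<in> Gam \<longleftrightarrow> g \<in> Gam"
proof -
  let ?P = "\<lambda>Gam. (\<forall>g\<in>carrier G. \<exists>x\<in>S. inv x \<otimes> g \<in> Gam) \<and>
    (\<forall>g\<in>carrier G. \<forall>x\<in>S. \<forall>y\<in>S. inv x \<otimes> g \<in> Gam \<longrightarrow> inv y \<otimes> g \<in> Gam \<longrightarrow> x = y) \<and>
    (\<forall>h\<in>N. \<forall>g\<in>carrier G. h \<otimes> g \<in> Gam \<longleftrightarrow> g \<in> Gam)"
  obtain Ga where "?P Ga" by (rule exists_transversal) blast
  hence "?P Gam" unfolding Gam_def by (rule someI[of ?P])
  thus "\<forall>g\<in>carrier G. \<exists>x\<in>S. inv x \<otimes> g \<in> Gam"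
    "\<forall>g\<in>carrier G. \<forall>x\<in>S. \<forall>y\<in>S. inv x \<otimes> g \<in> Gam \<longrightarrow> inv y \<otimes> g \<in> Gam \<longrightarrow> x = y"
    "\<forall>h\<in>N. \<forall>g\<in>carrier G. h \<otimes> g \<in> Gam \<longleftrightarrow> g \<in> Gam" by blast+
qed

definition Gx :: "'g \<Rightarrow> 'g set" where
  "Gx x = {g \<in> carrier G. inv x \<otimes> g \<in> Gam}"

text \<open>\<open>w x\<close> lives on \<open>N #> x\<close>, and \<open>Gam\<close> is stable
  under \<open>N\<close>, so multiplication by \<open>w x\<close> moves the part on
  \<open>Gam\<close> to its translate.\<close>

lemma Gx_shift:
  assumes x: "x \<in> S"
  shows "res (Gx x) (w x \<star> y) = w x \<star> res Gam y"
proof (rule res_conv[OF w_FS[OF x]])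
  fix h g assume h: "h \<in> N #> x" "h \<in> carrier G" and g: "g \<in> carrier G"
  obtain l where l: "l \<in> N" "h = l \<otimes> x" using h by (auto simp: r_coset_def)
  have c: "x \<in> carrier G" "l \<in> carrier G" using SG[OF x] l N_carr by auto
  have "inv x \<otimes> (h \<otimes> g) = (inv x \<otimes> l \<otimes> x) \<otimes> g" using c g l by (simp add: m_assoc)
  moreover have "inv x \<otimes> l \<otimes> x \<in> N" using normal.inv_op_closed1[OF N c(1) l(1)] .
  ultimately show "h \<otimes> g \<in> Gx x \<longleftrightarrow> g \<in> Gam" using Gam(3) g h by (simp add: Gx_def)
qed

lemma res_Gx_sum:
  assumes "y \<in> FS (carrier G)"
  shows "(\<Sum>x\<in>S. res (Gx x) y) = y"
proof
  fix g
  show "(\<Sum>x\<in>S. res (Gx x) y) g = y g"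
  proof (cases "g \<in> carrier G")
    case False thus ?thesis using assms by (simp add: sum_fun_apply res_def Gx_def FS_D)
  next
    case True
    then obtain x where x: "x \<in> S" "inv x \<otimes> g \<in> Gam" using Gam(1) by blast
    have "(\<Sum>x'\<in>S. res (Gx x') y g) = (\<Sum>x'\<in>S. if x' = x then y g else 0)"
      using Gam(2) x True by (intro sum.cong) (auto simp: res_def Gx_def)
    thus ?thesis using x finS by (simp add: sum_fun_apply)
  qed
qed

text \<open>A fixed vector is recovered from its part on \<open>Gam\<close>: its part on each
  translate is \<open>w x\<close> times that part.\<close>

lemma fixed_decomp:
  assumes "y \<in> FS (carrier G)" "\<forall>x\<in>S. w x \<star> y = y"
  shows "y = (\<Sum>x\<in>S. w x) \<star> res Gam y"
proof -
  have "y = (\<Sum>x\<in>S. res (Gx x) y)" using res_Gx_sum[OF assms(1)] by simp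
  also have "\<dots> = (\<Sum>x\<in>S. w x \<star> res Gam y)"
    using assms(2) Gx_shift by (intro sum.cong) metis+
  finally show ?thesis by (simp add: conv_sum_left)
qed

lemma pelt_sum_w: assumes "x \<in> S" shows "(\<Sum>g\<in>pelt p. w x g) = i \<one>"
proof -
  have fp: "finite (pelt p)" using finite_sub by (auto simp: pelt_def)
  have "(\<Sum>g\<in>pelt p. (w x - i) g) = 0"
    by (rule nilp_pelt_sum[OF p ch J_G J_nil]) (rule w_J[OF assms])+
  hence "(\<Sum>g\<in>pelt p. w x g) = (\<Sum>g\<in>pelt p. i g)" by (simp add: sum_subtractf)
  also have "\<dots> = (\<Sum>g\<in>{\<one>}. i g)"
  proof (rule sum.mono_neutral_right[OF fp])
    show "{\<one>} \<subseteq> pelt p" using pelt_N by blast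
    show "\<forall>g\<in>pelt p - {\<one>}. i g = 0" using pelt_N FS_D[OF i_N] by blast
  qed
  finally show ?thesis by simp
qed

lemma S_coset_inj: "x \<in> S \<Longrightarrow> y \<in> S \<Longrightarrow> g \<in> N #> x \<Longrightarrow> g \<in> N #> y \<Longrightarrow> x = y"
proof -
  assume x: "x \<in> S" and y: "y \<in> S" and "g \<in> N #> x" "g \<in> N #> y"
  then obtain h l where h: "h \<in> N" "l \<in> N" "h \<otimes> x = l \<otimes> y" by (auto simp: r_coset_def)
  have c: "x \<in> carrier G" "y \<in> carrier G" "h \<in> carrier G" "l \<in> carrier G" using x y h SG N_carr by auto
  have "inv l \<otimes> h = inv l \<otimes> (h \<otimes> x) \<otimes> inv x" using c by (simp add: m_assoc)
  also have "\<dots> = y \<otimes> inv x" unfolding h(3) using c by (simp add: m_assoc[symmetric])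
  finally have eq: "inv l \<otimes> h = y \<otimes> inv x" .
  have "inv l \<otimes> h \<in> N" using h N_sub by (simp add: subgroup.m_closed subgroup.m_inv_closed)
  moreover have "y \<otimes> inv x \<in> S" using x y S_mult S_inv by blast
  ultimately have "y \<otimes> inv x = \<one>" using eq SN by auto
  thus "x = y" using c by (metis inv_closed inv_equality inv_inv)
qed

lemma coset_mem: "x \<in> carrier G \<Longrightarrow> g \<in> carrier G \<Longrightarrow> h \<in> N #> x \<Longrightarrow> g \<otimes> h \<in> N \<longleftrightarrow> g \<in> N #> inv x"
proof -
  assume x: "x \<in> carrier G" and g: "g \<in> carrier G" and "h \<in> N #> x"
  then obtain l where l: "l \<in> N" "h = l \<otimes> x" by (auto simp: r_coset_def)
  have lG: "l \<in> carrier G" using l N_carr by auto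
  have eq: "g \<otimes> h = (g \<otimes> l \<otimes> inv g) \<otimes> (g \<otimes> x)" using x g lG l(2) by (simp add: m_assoc) (simp add: m_assoc[symmetric])
  have nN: "g \<otimes> l \<otimes> inv g \<in> N" by (rule normal.inv_op_closed2[OF N g l(1)])
  have "g \<otimes> h \<in> N \<longleftrightarrow> g \<otimes> x \<in> N"
  proof
    assume "g \<otimes> h \<in> N"
    hence *: "inv (g \<otimes> l \<otimes> inv g) \<otimes> (g \<otimes> h) \<in> N"
      by (rule subgroup.m_closed[OF N_sub subgroup.m_inv_closed[OF N_sub nN]])
    have "g \<otimes> l \<otimes> inv g \<in> carrier G" "g \<otimes> x \<in> carrier G" using x g lG by auto
    hence "inv (g \<otimes> l \<otimes> inv g) \<otimes> ((g \<otimes> l \<otimes> inv g) \<otimes> (g \<otimes> x)) = g \<otimes> x"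
      by (metis inv_closed l_inv l_one m_assoc)
    thus "g \<otimes> x \<in> N" using * unfolding eq by simp
  next
    assume "g \<otimes> x \<in> N"
    thus "g \<otimes> h \<in> N" unfolding eq using nN N_sub by (simp add: subgroup.m_closed)
  qed
  also have "\<dots> \<longleftrightarrow> g \<in> N #> inv x"
  proof
    assume "g \<otimes> x \<in> N"
    moreover have "g = g \<otimes> x \<otimes> inv x" using g x by (simp add: m_assoc)
    ultimately show "g \<in> N #> inv x" by (auto simp: r_coset_def)
  next
    assume "g \<in> N #> inv x"
    then obtain l' where "l' \<in> N" "g = l' \<otimes> inv x" by (auto simp: r_coset_def)
    thus "g \<otimes> x \<in> N" using x N_carr by (auto simp: m_assoc subset_iff)
  qed
  finally show ?thesis .
qed

lemma coset_mem': "x \<in> carrier G \<Longrightarrow> g \<in> carrier G \<Longrightarrow> h \<in> N #> inv x \<Longrightarrow> h \<otimes> g \<in> N \<longleftrightarrow> g \<in> N #> x"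
proof -
  assume x: "x \<in> carrier G" and g: "g \<in> carrier G" and "h \<in> N #> inv x"
  then obtain l where l: "l \<in> N" "h = l \<otimes> inv x" by (auto simp: r_coset_def)
  have lG: "l \<in> carrier G" using l N_carr by auto
  have "h \<otimes> g \<in> N \<longleftrightarrow> inv x \<otimes> g \<in> N"
  proof
    assume "h \<otimes> g \<in> N"
    hence "inv l \<otimes> (h \<otimes> g) \<in> N" using l N_sub by (simp add: subgroup.m_closed subgroup.m_inv_closed)
    thus "inv x \<otimes> g \<in> N" using l lG x g by (simp add: m_assoc) (simp add: m_assoc[symmetric])
  next
    assume "inv x \<otimes> g \<in> N"
    thus "h \<otimes> g \<in> N" using l lG x g N_sub by (simp add: m_assoc subgroup.m_closed)
  qed
  also have "\<dots> \<longleftrightarrow> g \<in> N #> x"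
  proof
    assume a: "inv x \<otimes> g \<in> N"
    have "x \<otimes> (inv x \<otimes> g) \<otimes> inv x \<in> N" by (rule normal.inv_op_closed2[OF N x a])
    moreover have "g = x \<otimes> (inv x \<otimes> g) \<otimes> inv x \<otimes> x" using x g by (simp add: m_assoc) (simp add: m_assoc[symmetric])
    ultimately show "g \<in> N #> x" by (auto simp: r_coset_def)
  next
    assume "g \<in> N #> x"
    then obtain l' where l': "l' \<in> N" "g = l' \<otimes> x" by (auto simp: r_coset_def)
    have "inv x \<otimes> l' \<otimes> x \<in> N" by (rule normal.inv_op_closed1[OF N x l'(1)])
    thus "inv x \<otimes> g \<in> N" using l' x N_carr by (auto simp: m_assoc subset_iff)
  qed
  finally show ?thesis .
qed

text \<open>From a nonzero product one obtains a radical element \<open>r'\<close> of the corner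
  whose components on the cosets of \<open>S\<close> are multiples \<open>al x\<close> of
  \<open>w x\<close>, with sum of the \<open>al x\<close> equal to 1. Then its coefficient sum over
  the \<open>p\<close>-elements is \<open>i \<one>\<close>, although \<open>r'\<close> is
  nilpotent.\<close>

lemma J_stilde: assumes r: "r \<in> J" shows "r \<star> (\<Sum>x\<in>S. w x) = 0"
proof (rule ccontr)
  define s where "s = (\<Sum>x\<in>S. w x)"
  assume "r \<star> (\<Sum>x\<in>S. w x) \<noteq> 0"
  hence rs: "r \<star> s \<noteq> 0" by (simp add: s_def)
  have si: "s \<star> i = s" "i \<star> s = s" unfolding s_def conv_sum_left conv_sum_right by (simp_all add: wi iw)
  obtain g where g: "(r \<star> s) g \<noteq> 0" using rs by (auto simp: fun_eq_iff)
  hence gG: "g \<in> carrier G" by (metis FS_D conv_in)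
  define q where "q = res (N #> g) (r \<star> s)"
  have "q g \<noteq> 0" using g coset_self[OF gG] by (simp add: q_def res_def)
  hence q0: "q \<noteq> 0" by auto
  have qc: "q \<in> FS (N #> g)" unfolding q_def by (rule FS_res')
  have stab: "h \<in> N \<Longrightarrow> g' \<in> carrier G \<Longrightarrow> g' \<otimes> h \<in> N #> t \<longleftrightarrow> g' \<in> N #> t" if t: "t \<in> carrier G" for h g' t
  proof -
    assume h: "h \<in> N" and g': "g' \<in> carrier G"
    have hG: "h \<in> carrier G" using h N_carr by blast
    have "g' \<otimes> h \<in> N #> g'"
    proof -
      have "g' \<otimes> h = (g' \<otimes> h \<otimes> inv g') \<otimes> g'" using hG g' by (simp add: m_assoc)
      thus ?thesis using normal.inv_op_closed2[OF N g' h] by (auto simp: r_coset_def)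
    qed
    hence eq: "N #> (g' \<otimes> h) = N #> g'" by (rule coset_eqI[OF _ g'])
    show "g' \<otimes> h \<in> N #> t \<longleftrightarrow> g' \<in> N #> t"
      using coset_eqI[OF _ t] eq coset_self[OF g'] coset_self[of "g' \<otimes> h"] g' hG by (metis m_closed)
  qed
  have qi: "q \<star> i = q"
  proof -
    have "q \<star> i = res (N #> g) (r \<star> s \<star> i)" unfolding q_def
      by (rule conv_res[OF i_N, symmetric]) (rule stab[OF gG])
    thus ?thesis by (simp add: q_def conv_assoc si)
  qed
  \<comment> \<open>Multiplication by \<open>b\<close> shifts a nonzero component to degree
    \<open>N\<close> and normalizes it to \<open>i\<close>, without leaving the radical.\<close>
  obtain b where b: "b \<in> FS (N #> inv g)" "i \<star> b = b" "b \<star> q = i" by (rule left_inv[OF qc gG qi q0])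
  define r' where "r' = b \<star> r \<star> i"
  have r'J: "r' \<in> J" unfolding r'_def by (intro J_mult_r J_mult_l r)
  have r's: "r' \<star> s = b \<star> (r \<star> s)" by (simp add: r'_def conv_assoc si)
  have r'i: "r' \<star> i = r'" "i \<star> r' = r'"
    by (simp_all add: r'_def ii_r conv_assoc[symmetric] b(2))
  have "res N (b \<star> (r \<star> s)) = b \<star> q" unfolding q_def
    by (rule res_conv[OF b(1)]) (rule coset_mem'[OF gG])
  hence resN: "res N (r' \<star> s) = i" by (simp add: r's b(3))
  have part: "res (N #> t) r' \<in> Rt t" if t: "t \<in> carrier G" for t
  proof -
    have "res (N #> t) r' \<star> i = res (N #> t) (r' \<star> i)"
      by (rule conv_res[OF i_N, symmetric]) (rule stab[OF t])
    moreover have "i \<star> res (N #> t) r' = res (N #> t) (i \<star> r')"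
    proof (rule res_conv[OF i_N, symmetric])
      fix h g' assume h: "h \<in> N" and g': "g' \<in> carrier G"
      have "h \<otimes> g' \<in> N #> g'" using h by (auto simp: r_coset_def)
      hence "N #> (h \<otimes> g') = N #> g'" by (rule coset_eqI[OF _ g'])
      thus "h \<otimes> g' \<in> N #> t \<longleftrightarrow> g' \<in> N #> t"
        using coset_eqI[OF _ t] coset_self[OF g'] coset_self[of "h \<otimes> g'"] g' h N_carr by (metis m_closed subsetD)
    qed
    ultimately show ?thesis by (simp add: Rt_def r'i FS_res')
  qed
  have "\<forall>x\<in>S. \<exists>c. res (N #> x) r' = sc c (w x)"
    using part Rt_dim1 w_Rt SG by blast
  then obtain al where al: "\<forall>x\<in>S. res (N #> x) r' = sc (al x) (w x)" using bchoice by metis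
  have "i = (\<Sum>x\<in>S. res N (r' \<star> w x))" using resN by (simp add: s_def conv_sum_right res_sum)
  also have "\<dots> = (\<Sum>x\<in>S. res (N #> inv x) r' \<star> w x)"
  proof (rule sum.cong[OF refl])
    fix x assume x: "x \<in> S"
    show "res N (r' \<star> w x) = res (N #> inv x) r' \<star> w x"
      by (rule conv_res[OF w_FS[OF x]]) (rule coset_mem[OF SG[OF x]])
  qed
  also have "\<dots> = (\<Sum>x\<in>S. sc (al (inv x)) i)"
    using al S_inv by (intro sum.cong) (auto simp: conv_sc_left w_inv)
  also have "\<dots> = sc (\<Sum>x\<in>S. al (inv x)) i" by (simp only: fv.scale_sum_left)
  also have "(\<Sum>x\<in>S. al (inv x)) = (\<Sum>x\<in>S. al x)"
    by (rule sum.reindex_bij_witness[of _ "\<lambda>x. inv x" "\<lambda>x. inv x"]) (use S_inv SG in auto)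
  finally have "sc 1 i = sc (\<Sum>x\<in>S. al x) i" unfolding fv.scale_one .
  hence al1: "(\<Sum>x\<in>S. al x) = 1" using i0 by (metis fv.scale_cancel_right)
  \<comment> \<open>A \<open>p\<close>-element in the support of \<open>r'\<close> lies in
    \<open>H\<close>, and in \<open>St\<close> because \<open>r'\<close> has a nonzero component
    there; so \<open>S_cov\<close> places it in a coset of \<open>N\<close> meeting
    \<open>S\<close>.\<close>
  have "r' g = (\<Sum>x\<in>S. res (N #> x) r' g)" if g: "g \<in> pelt p" for g
  proof (cases "r' g = 0")
    case True thus ?thesis by (simp add: res_def)
  next
    case False
    have gG: "g \<in> carrier G" using g by (simp add: pelt_def)
    have "res (N #> g) r' g \<noteq> 0" using False coset_self[OF gG] by (simp add: res_def)
    hence "res (N #> g) r' \<noteq> 0" by auto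
    hence "g \<in> St" using part[OF gG] gG by (auto simp: St_def)
    then obtain x where x: "x \<in> S" "g \<in> N #> x" using S_cov g pH by blast
    have "(\<Sum>x'\<in>S. res (N #> x') r' g) = (\<Sum>x'\<in>S. if x' = x then r' g else 0)"
      using S_coset_inj x by (intro sum.cong) (auto simp: res_def)
    thus ?thesis using x finS by simp
  qed
  hence "(\<Sum>g\<in>pelt p. r' g) = (\<Sum>g\<in>pelt p. \<Sum>x\<in>S. res (N #> x) r' g)" by (rule sum.cong[OF refl])
  also have "\<dots> = (\<Sum>x\<in>S. \<Sum>g\<in>pelt p. res (N #> x) r' g)" by (rule sum.swap)
  also have "\<dots> = (\<Sum>x\<in>S. al x * i \<one>)"
    using al by (intro sum.cong) (auto simp: sum_distrib_left[symmetric] pelt_sum_w)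
  also have "\<dots> = i \<one>" by (simp add: sum_distrib_right[symmetric] al1)
  finally show False using nilp_pelt_sum[OF p ch J_G[OF r'J] J_nil[OF r'J]] i_one by simp
qed

lemma J_fixed:
  assumes "r \<in> J" "y \<in> FS (carrier G)" "\<forall>x\<in>S. w x \<star> y = y"
  shows "r \<star> y = 0"
  by (subst fixed_decomp[OF assms(2,3)]) (simp add: conv_assoc[symmetric] J_stilde[OF assms(1)])

end

context core_w
begin

subsection \<open>Dimensions\<close>

text \<open>For a central idempotent \<open>f\<close>, the right ideal generated by
  \<open>i \<star> f\<close>; \<open>Mw f\<close> consists of its fixed points under the units
  \<open>w x\<close>.\<close>

definition Mf :: "('g \<Rightarrow> 'a) \<Rightarrow> ('g \<Rightarrow> 'a) set" where
  "Mf f = {y \<in> FS (carrier G). i \<star> y = y \<and> f \<star> y = y}"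

definition Mw :: "('g \<Rightarrow> 'a) \<Rightarrow> ('g \<Rightarrow> 'a) set" where
  "Mw f = {y \<in> Mf f. \<forall>x\<in>S. w x \<star> y = y}"

lemma Mf_sub: "fv.subspace (Mf f)"
  by (auto simp: fv.subspace_def Mf_def FS_add FS_sc conv_add_right conv_sc_right)

lemma Mw_sub: "fv.subspace (Mw f)"
  using Mf_sub[of f] by (auto simp: fv.subspace_def Mw_def conv_add_right conv_sc_right)

lemma Mf_G: "Mf f \<subseteq> FS (carrier G)" by (auto simp: Mf_def)
lemma Mw_G: "Mw f \<subseteq> FS (carrier G)" by (auto simp: Mf_def Mw_def)

text \<open>Record the coordinates of all \<open>w x \<star> y\<close> along a basis of the fixed
  points. The kernel of this map is stable under the units; if it were nonzero it would contain a
  nonzero fixed vector, all of whose coordinates vanish.\<close>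

lemma dim_Mf_le:
  assumes f: "f \<in> FS (carrier G)" "\<And>a. a \<in> FS (carrier G) \<Longrightarrow> f \<star> a = a \<star> f"
  shows "fv.dim (Mf f) \<le> card S * fv.dim (Mw f)"
proof -
  obtain B where B: "B \<subseteq> Mw f" "fv.independent B" "Mw f \<subseteq> fv.span B" "finite B" "card B = fv.dim (Mw f)"
    by (rule finite_basis[OF Mw_G fin])
  \<comment> \<open>The coordinates must be defined beyond the fixed points, so \<open>B\<close> is
    extended to a basis of the space of all functions.\<close>
  define B' where "B' = fv.extend_basis B"
  have B': "fv.independent B'" "fv.span B' = UNIV" "B \<subseteq> B'"
    unfolding B'_def using fv.independent_extend_basis[OF B(2)] fv.span_extend_basis[OF B(2)]
      fv.extend_basis_superset[OF B(2)] by auto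
  define L where "L y = (\<lambda>(x, b). if x \<in> S \<and> b \<in> B then fv.representation B' (w x \<star> y) b else 0)" for y
  have add: "fv.representation B' (y + y') b = fv.representation B' y b + fv.representation B' y' b" for y y' b
    using fv.representation_add[OF B'(1)] B'(2) by simp
  have scl: "fv.representation B' (sc c y) b = c * fv.representation B' y b" for c y b
    using fv.representation_scale[OF B'(1)] B'(2) by simp
  have rep0: "fv.representation B' 0 b = 0" for b using scl[of 0 0 b] by simp
  have "fv.dim (Mf f) \<le> fv.dim (FS (S \<times> B) :: ('g \<times> ('g \<Rightarrow> 'a) \<Rightarrow> 'a) set)"
  proof (rule dim_le_inj[of "Mf f" "carrier G" L, OF Mf_G fin Mf_sub])
    show "L (y + y') = L y + L y'" for y y'
      by (auto simp: L_def fun_eq_iff conv_add_right add)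
    show "L (sc c y) = sc c (L y)" for c y
      by (auto simp: L_def fun_eq_iff conv_sc_right scl)
    show "L y \<in> FS (S \<times> B)" for y by (auto simp: L_def FS_def)
    show "finite (S \<times> B)" using finS B(4) by simp
    fix y assume y: "y \<in> Mf f" and Ly: "L y = 0"
    show "y = 0"
    proof (rule ccontr)
      assume y0: "y \<noteq> 0"
      define K where "K = {y \<in> Mf f. \<forall>x\<in>S. \<forall>b\<in>B. fv.representation B' (w x \<star> y) b = 0}"
      have "\<exists>y\<in>K. y \<noteq> 0 \<and> (\<forall>x\<in>S. w x \<star> y = y)"
      proof (rule fixed_vector[of K y])
        have "fv.representation B' (w x \<star> y) b = 0" if "x \<in> S" "b \<in> B" for x b
          using fun_cong[OF Ly, of "(x, b)"] that by (simp add: L_def)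
        thus "y \<in> K" using y by (simp add: K_def)
        show "y \<noteq> 0" by (rule y0)
        show "u + u' \<in> K" if "u \<in> K" "u' \<in> K" for u u'
          using that fv.subspace_add[OF Mf_sub, of u f u'] by (simp add: K_def conv_add_right add)
        show "sc c u \<in> K" if "u \<in> K" for c u
          using that fv.subspace_scale[OF Mf_sub, of u f c] by (simp add: K_def conv_sc_right scl)
        show "i \<star> u = u" if "u \<in> K" for u using that by (simp add: K_def Mf_def)
        fix x u assume x: "x \<in> S" and u: "u \<in> K"
        have uM: "i \<star> u = u" "f \<star> u = u" using u by (auto simp: K_def Mf_def)
        have "f \<star> (w x \<star> u) = w x \<star> u" using f(2)[OF w_G[OF x]] uM by (metis conv_assoc)
        hence "w x \<star> u \<in> Mf f" by (simp add: Mf_def conv_assoc[symmetric] iw[OF x])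
        moreover have "fv.representation B' (w x' \<star> (w x \<star> u)) b = 0" if "x' \<in> S" "b \<in> B" for x' b
          using u that S_mult[OF that(1) x] by (simp add: conv_assoc[symmetric] w_mult[OF that(1) x] K_def)
        ultimately show "w x \<star> u \<in> K" by (simp add: K_def)
      qed
      then obtain u where u: "u \<in> K" "u \<noteq> 0" "\<forall>x\<in>S. w x \<star> u = u" by blast
      have "u \<in> fv.span B" using u B(3) by (auto simp: K_def Mw_def)
      hence r: "fv.representation B' u = fv.representation B u"
        by (rule fv.representation_extend[OF B'(1) _ B'(3)])
      have "fv.representation B u b = 0" if "b \<in> B" for b
        using u that S_one r by (auto simp: K_def)
      hence "u = 0"
        using fv.sum_representation_eq[OF B(2) \<open>u \<in> fv.span B\<close> B(4) subset_refl] by simp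
      thus False using u(2) by simp
    qed
  qed auto
  also have "\<dots> = card S * fv.dim (Mw f)" using finS B by (simp add: dim_FS card_cartesian_product)
  finally show ?thesis .
qed

text \<open>The parts of a basis of fixed vectors on the different translates of \<open>Gam\<close>
  have disjoint supports, and each part determines its fixed vector, so all of them together are
  independent.\<close>

lemma dim_Mw_le: "card S * fv.dim (Mw A1) \<le> fv.dim (Mf A1)"
proof -
  obtain B where B: "B \<subseteq> Mw A1" "fv.independent B" "Mw A1 \<subseteq> fv.span B" "finite B" "card B = fv.dim (Mw A1)"
    by (rule finite_basis[OF Mw_G fin])
  have resM: "i \<star> res (Gx x) y = res (Gx x) (i \<star> y)" if x: "x \<in> S" for x y
  proof (rule res_conv[OF i_N, symmetric])
    fix h g assume h: "h \<in> N" "h \<in> carrier G" and g: "g \<in> carrier G"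
    have c: "x \<in> carrier G" using SG[OF x] .
    have "inv x \<otimes> (h \<otimes> g) = (inv x \<otimes> h \<otimes> x) \<otimes> (inv x \<otimes> g)" using c g h by (simp add: m_assoc) (simp add: m_assoc[symmetric])
    moreover have "inv x \<otimes> h \<otimes> x \<in> N" using normal.inv_op_closed1[OF N c h(1)] .
    ultimately show "h \<otimes> g \<in> Gx x \<longleftrightarrow> g \<in> Gx x" using Gam(3) c g h by (simp add: Gx_def)
  qed
  have Gdisj: "res (Gx x) (res (Gx x') y) = (if x = x' then res (Gx x) y else 0)" if "x \<in> S" "x' \<in> S" for x x' y
    using Gam(2) that by (auto simp: res_def fun_eq_iff Gx_def)
  have "card (S \<times> B) \<le> fv.dim (Mf A1)"
  proof (rule family_card_le_dim[where v = "\<lambda>(x, b). res (Gx x) b" and S = "carrier G"])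
    fix c assume "(\<Sum>j\<in>S \<times> B. sc (c j) (case j of (x, b) \<Rightarrow> res (Gx x) b)) = 0"
    hence *: "(\<Sum>x\<in>S. \<Sum>b\<in>B. sc (c (x, b)) (res (Gx x) b)) = 0"
      by (simp add: sum.cartesian_product split_def)
    have "c (x, b) = 0" if xb: "x \<in> S" "b \<in> B" for x b
    proof -
      define y where "y = (\<Sum>b\<in>B. sc (c (x, b)) b)"
      have y: "y \<in> Mw A1" unfolding y_def using B(1) by (intro subspace_sum_sc[OF Mw_sub]) blast
      hence y': "i \<star> y = y" "\<forall>x\<in>S. w x \<star> y = y" "y \<in> FS (carrier G)" by (auto simp: Mw_def Mf_def)
      have "0 = res (Gx x) (\<Sum>x'\<in>S. \<Sum>b\<in>B. sc (c (x', b)) (res (Gx x') b))" unfolding * by simp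
      also have "\<dots> = (\<Sum>x'\<in>S. \<Sum>b\<in>B. sc (c (x', b)) (if x = x' then res (Gx x) b else 0))"
        unfolding res_sum res_sc
        by (rule sum.cong[OF refl], rule sum.cong[OF refl]) (simp only: Gdisj[OF xb(1)])
      also have "\<dots> = (\<Sum>x'\<in>S. if x' = x then (\<Sum>b\<in>B. sc (c (x, b)) (res (Gx x) b)) else 0)"
        by (intro sum.cong refl) auto
      also have "\<dots> = (\<Sum>b\<in>B. sc (c (x, b)) (res (Gx x) b))" using xb finS by simp
      also have "\<dots> = res (Gx x) y" by (simp add: y_def res_sum res_sc)
      finally have "res (Gx x) y = 0" by simp
      hence "w x \<star> res Gam y = 0" using Gx_shift[OF xb(1), of y] y'(2) xb(1) by simp
      hence "w (inv x) \<star> w x \<star> res Gam y = 0" by (simp add: conv_assoc)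
      hence "i \<star> res Gam y = 0" using w_inv[OF xb(1)] by simp
      moreover have "w x' \<star> (i \<star> res Gam y) = w x' \<star> res Gam y" if "x' \<in> S" for x' by (rule wi'[OF that])
      ultimately have "w x' \<star> res Gam y = 0" if "x' \<in> S" for x' using that by (metis conv_0_right)
      hence "y = 0" using fixed_decomp[OF y'(3,2)] by (simp add: conv_sum_left)
      thus ?thesis using basis_unique[OF B(4,2), of "\<lambda>b. c (x, b)"] xb(2) unfolding y_def by blast
    qed
    thus "\<forall>j\<in>S \<times> B. c j = 0" by auto
  next
    show "(case j of (x, b) \<Rightarrow> res (Gx x) b) \<in> Mf A1" if "j \<in> S \<times> B" for j
      using that B(1) resM by (auto simp: Mf_def Mw_def FS_res)
  qed (use finS B(4) Mf_G fin in auto)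
  thus ?thesis using B(5) by (simp add: card_cartesian_product)
qed

text \<open>The upper bound holds for \<open>e\<close> and for its complement; the sum of the two
  bounds is attained for \<open>A1\<close>. So both are equalities, the numerical form of the
  freeness of a direct summand.\<close>

lemma dim_Me: "fv.dim (Mf e) = card S * fv.dim (Mw e)"
proof -
  define f where "f = A1 - e"
  have f_in: "f \<in> FS (carrier G)" using e_in by (simp add: f_def FS_diff)
  have f_c: "f \<star> a = a \<star> f" if "a \<in> FS (carrier G)" for a
    using that e_cent[OF that] by (simp add: f_def conv_diff_left conv_diff_right)
  have fe: "f \<star> y = y - e \<star> y" if "y \<in> FS (carrier G)" for y
    using that by (simp add: f_def conv_diff_left)
  have eef: "e \<star> (e \<star> y) = e \<star> y" for y by (simp add: conv_assoc[symmetric] ee)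
  have "fv.dim (Mf A1) \<le> fv.dim (Mf e) + fv.dim (Mf f)"
  proof (rule dim_sum_le[OF Mf_G Mf_G fin])
    fix y assume "y \<in> Mf A1"
    hence y: "y \<in> FS (carrier G)" "i \<star> y = y" by (auto simp: Mf_def)
    have ie: "i \<star> (e \<star> y) = e \<star> y" using e_cent[OF i_G] y(2) by (metis conv_assoc)
    have "e \<star> y \<in> Mf e" using ie by (simp add: Mf_def eef)
    moreover have "y - e \<star> y \<in> Mf f"
      using y ie by (simp add: Mf_def FS_diff conv_diff_right fe eef)
    ultimately show "\<exists>u\<in>Mf e. \<exists>v\<in>Mf f. y = u + v" by (intro bexI[of _ "e \<star> y"] bexI[of _ "y - e \<star> y"]) auto
  qed
  moreover have "fv.dim (Mw e) + fv.dim (Mw f) \<le> fv.dim (Mw A1)"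
  proof (rule dim_sum_ge[OF Mw_sub Mw_sub _ _ _ Mw_G fin])
    show "Mw e \<inter> Mw f \<subseteq> {0}"
    proof
      fix y assume "y \<in> Mw e \<inter> Mw f"
      hence "e \<star> y = y" "f \<star> y = y" "y \<in> FS (carrier G)" by (auto simp: Mw_def Mf_def)
      thus "y \<in> {0}" using fe[of y] by simp
    qed
  qed (auto simp: Mw_def Mf_def)
  moreover have "fv.dim (Mf e) \<le> card S * fv.dim (Mw e)" by (rule dim_Mf_le[OF e_in e_cent])
  moreover have "fv.dim (Mf f) \<le> card S * fv.dim (Mw f)" by (rule dim_Mf_le[OF f_in f_c])
  moreover have "card S * fv.dim (Mw e) + card S * fv.dim (Mw f) \<le> card S * fv.dim (Mw A1)"
    using calculation(2) by (metis distrib_left mult_le_mono2)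
  ultimately show ?thesis using dim_Mw_le by linarith
qed

text \<open>By \<open>trace_S\<close> the idempotent \<open>e\<close> lies in the two-sided ideal
  generated by \<open>i\<close>: it is a combination of conjugates of \<open>z \<star> e\<close>,
  and \<open>z\<close> is a sum of conjugates of \<open>i\<close>.\<close>

lemma e_ideal:
  assumes x: "x \<in> FS (carrier G)" and ix: "\<And>g. g \<in> carrier G \<Longrightarrow> i \<star> sing g \<star> x = 0"
  shows "e \<star> x = 0"
proof -
  obtain c where c: "e = sc c (Tr S (z \<star> e))" by (rule trace_S[OF S S_St S_ind])
  have z0: "cj g z \<star> x = 0" if g: "g \<in> carrier G" for g
  proof -
    have "cj g (cj y i) \<star> x = 0" if "y \<in> N" for y
    proof -
      have gy: "g \<otimes> y \<in> carrier G" "y \<in> carrier G" using that g N_carr by auto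
      have "cj g (cj y i) \<star> x = sing (g \<otimes> y) \<star> (i \<star> sing (inv (g \<otimes> y)) \<star> x)"
        using gy g by (simp add: cj_cj) (simp add: cj_def conv_assoc)
      thus ?thesis using ix[of "inv (g \<otimes> y)"] gy by simp
    qed
    thus ?thesis by (simp add: z_def cj_sum conv_sum_left)
  qed
  have "cj g (z \<star> e) \<star> x = 0" if g: "g \<in> carrier G" for g
  proof -
    have "cj g (z \<star> e) \<star> x = cj g z \<star> (e \<star> x)"
      using g by (simp add: cj_mult central_cj[OF e_in g e_cent] conv_assoc)
    also have "\<dots> = cj g z \<star> x \<star> e" using e_cent[OF x] by (simp add: conv_assoc)
    finally show ?thesis using z0[OF g] by simp
  qed
  hence "Tr S (z \<star> e) \<star> x = 0"
    unfolding Tr_def conv_sum_left using lcoset_rep(2)[OF S] by (intro sum.neutral) blast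
  thus ?thesis by (subst c) (simp add: conv_sc_left)
qed

text \<open>A dual system, giving \<open>h\<close> orthogonal idempotents
  \<open>a j \<star> b j\<close> equivalent to \<open>i\<close>. Opposite degrees of
  \<open>a j\<close> and \<open>b j\<close> keep these idempotents in the group algebra of
  \<open>N\<close>.\<close>

definition fam :: "nat \<Rightarrow> (nat \<Rightarrow> 'g \<Rightarrow> 'a) \<Rightarrow> (nat \<Rightarrow> 'g \<Rightarrow> 'a) \<Rightarrow> bool" where
  "fam h a b \<longleftrightarrow> (\<forall>j<h. \<exists>g\<in>carrier G. a j \<in> FS (N #> g) \<and> b j \<in> FS (N #> inv g)) \<and>
     (\<forall>j<h. a j \<star> i = a j \<and> i \<star> b j = b j) \<and> (\<forall>j<h. \<forall>l<h. b j \<star> a l = (if j = l then i else 0))"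

lemma fam_bound:
  assumes "fam h a b"
  shows "h \<le> card (carrier G)"
proof -
  have "card {..<h} \<le> fv.dim (FS (carrier G) :: ('g \<Rightarrow> 'a) set)"
  proof (rule family_card_le_dim[where v = a and S = "carrier G"])
    fix c assume *: "(\<Sum>j\<in>{..<h}. sc (c j) (a j)) = 0"
    show "\<forall>j\<in>{..<h}. c j = 0"
    proof
      fix l assume l: "l \<in> {..<h}"
      have "b l \<star> (\<Sum>j\<in>{..<h}. sc (c j) (a j)) = (\<Sum>j\<in>{..<h}. if j = l then sc (c l) i else 0)"
        unfolding conv_sum_right conv_sc_right using assms l by (intro sum.cong) (auto simp: fam_def)
      also have "\<dots> = sc (c l) i" using l by (subst sum.delta) simp_all
      finally have "sc (c l) i = 0" using * by simp
      thus "c l = 0" using i0 by (metis fv.scale_eq_0_iff)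
    qed
  next
    show "a j \<in> FS (carrier G)" if "j \<in> {..<h}" for j
    proof -
      have "a j \<star> i = a j" using that assms by (simp add: fam_def)
      thus ?thesis by (metis conv_in)
    qed
  qed (use fin in auto)
  thus ?thesis using fin by (simp add: dim_FS)
qed

text \<open>A family of maximal length works. Its complement \<open>\<eta>\<close> annihilates
  everything generated by \<open>i\<close>, on both sides, so \<open>e_ideal\<close> shows that
  \<open>e\<close> annihilates \<open>\<eta>\<close>.\<close>

lemma exists_fam:
  obtains h a b where "fam h a b" "h > 0" "e = (\<Sum>j<h. a j \<star> b j) \<star> e"
proof -
  have "fam 0 (\<lambda>_. 0) (\<lambda>_. 0)" by (simp add: fam_def)
  hence ex: "\<exists>a b. fam 0 a b" by blast
  have bd: "\<forall>y. (\<exists>a b. fam y a b) \<longrightarrow> y \<le> card (carrier G)" using fam_bound by blast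
  define Hs where "Hs = {h. \<exists>a b. fam h a b}"
  have finH: "finite Hs" using bd finite_nat_set_iff_bounded_le by (auto simp: Hs_def)
  define h where "h = Max Hs"
  have "Hs \<noteq> {}" using ex by (auto simp: Hs_def)
  hence "h \<in> Hs" unfolding h_def by (rule Max_in[OF finH])
  hence h: "\<exists>a b. fam h a b" by (simp add: Hs_def)
  have hmax: "y \<le> h" if "\<exists>a b. fam y a b" for y
    using that Max_ge[OF finH, of y] by (simp add: Hs_def h_def)
  from h obtain a b where fm: "fam h a b" by blast
  have abg: "\<exists>g\<in>carrier G. a j \<in> FS (N #> g) \<and> b j \<in> FS (N #> inv g)" if "j < h" for j
    using fm that by (simp add: fam_def)
  have ai: "a j \<star> i = a j" and ib: "i \<star> b j = b j" if "j < h" for j using fm that by (auto simp: fam_def)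
  have ba: "b j \<star> a l = (if j = l then i else 0)" if "j < h" "l < h" for j l using fm that by (auto simp: fam_def)
  define \<epsilon> where "\<epsilon> = (\<Sum>j<h. a j \<star> b j)"
  have ea: "\<epsilon> \<star> a l = a l" if l: "l < h" for l
  proof -
    have "\<epsilon> \<star> a l = (\<Sum>j<h. if j = l then a l else 0)"
      unfolding \<epsilon>_def conv_sum_left conv_assoc using ba ai l by (intro sum.cong) auto
    thus ?thesis using l by (subst (asm) sum.delta) simp_all
  qed
  have be: "b l \<star> \<epsilon> = b l" if l: "l < h" for l
  proof -
    have "b l \<star> \<epsilon> = (\<Sum>j<h. if j = l then b l else 0)"
      unfolding \<epsilon>_def conv_sum_right conv_assoc[symmetric] using ba ib l by (intro sum.cong) auto
    thus ?thesis using l by (subst (asm) sum.delta) simp_all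
  qed
  have "\<epsilon> \<star> \<epsilon> = (\<Sum>j<h. \<epsilon> \<star> a j \<star> b j)" by (subst (2) \<epsilon>_def) (simp add: conv_sum_right conv_assoc)
  hence \<epsilon>\<epsilon>: "\<epsilon> \<star> \<epsilon> = \<epsilon>" using ea by (simp add: \<epsilon>_def)
  have \<epsilon>N: "\<epsilon> \<in> FS N" unfolding \<epsilon>_def
  proof (rule FS_sum)
    fix j assume "j \<in> {..<h}"
    then obtain g where "g \<in> carrier G" "a j \<in> FS (N #> g)" "b j \<in> FS (N #> inv g)" using abg by blast
    thus "a j \<star> b j \<in> FS N" using coset_conv[of "a j" g "b j" "inv g"] by (simp add: coset_one)
  qed
  define \<eta> where "\<eta> = A1 - \<epsilon>"
  have \<eta>N: "\<eta> \<in> FS N" unfolding \<eta>_def by (rule FS_diff[OF A1_N \<epsilon>N])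
  have \<eta>G: "\<eta> \<in> FS (carrier G)" by (rule FSN_in[OF \<eta>N])
  have \<epsilon>G: "\<epsilon> \<in> FS (carrier G)" by (rule FSN_in[OF \<epsilon>N])
  have \<eta>\<eta>: "\<eta> \<star> \<eta> = \<eta>" using \<epsilon>\<epsilon> \<epsilon>G by (simp add: \<eta>_def conv_diff_left conv_diff_right)
  have aG: "a j \<in> FS (carrier G)" and bG: "b j \<in> FS (carrier G)" if "j < h" for j
    using ai[OF that] ib[OF that] conv_in by metis+
  have \<eta>a: "\<eta> \<star> a j = 0" and b\<eta>: "b j \<star> \<eta> = 0" if "j < h" for j
    using ea be aG bG that by (simp_all add: \<eta>_def conv_diff_left conv_diff_right)
  \<comment> \<open>A nonzero element here has a dual vector by \<open>left_inv\<close>; after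
    multiplication by \<open>\<eta>\<close> both are orthogonal to the family, which could be
    lengthened.\<close>
  have left: "\<eta> \<star> sing g \<star> i = 0" if g: "g \<in> carrier G" for g
  proof (rule ccontr)
    define y where "y = \<eta> \<star> sing g \<star> i"
    assume "\<eta> \<star> sing g \<star> i \<noteq> 0"
    hence y0: "y \<noteq> 0" by (simp add: y_def)
    have yc: "y \<in> FS (N #> g)" unfolding y_def by (intro coset_conv_r coset_conv_l \<eta>N i_N coset_sing g)
    have yi: "y \<star> i = y" by (simp add: y_def ii_r)
    obtain b' where b': "b' \<in> FS (N #> inv g)" "i \<star> b' = b'" "b' \<star> y = i" by (rule left_inv[OF yc g yi y0])
    define q where "q = b' \<star> \<eta>"
    have q: "q \<in> FS (N #> inv g)" unfolding q_def using coset_conv_r[OF b'(1) \<eta>N] g by simp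
    have iq: "i \<star> q = q" by (simp add: q_def conv_assoc[symmetric] b'(2))
    have "\<eta> \<star> y = y" by (simp add: y_def conv_assoc[symmetric] \<eta>\<eta>)
    hence qy: "q \<star> y = i" by (simp add: q_def conv_assoc b'(3))
    have "fam (Suc h) (a(h := y)) (b(h := q))"
      unfolding fam_def
    proof (intro conjI allI impI)
      fix j assume "j < Suc h"
      thus "\<exists>g\<in>carrier G. (a(h := y)) j \<in> FS (N #> g) \<and> (b(h := q)) j \<in> FS (N #> inv g)"
        using abg yc q g by (cases "j = h") auto
      show "(a(h := y)) j \<star> i = (a(h := y)) j" "i \<star> (b(h := q)) j = (b(h := q)) j"
        using ai ib yi iq \<open>j < Suc h\<close> by (cases "j = h"; simp)+
      fix l assume "l < Suc h"
      have "b j \<star> y = 0" if "j < h" for j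
        by (simp add: y_def conv_assoc[symmetric] b\<eta>[OF that])
      moreover have "q \<star> a l = 0" if "l < h" for l by (simp add: q_def conv_assoc \<eta>a[OF that])
      ultimately show "(b(h := q)) j \<star> (a(h := y)) l = (if j = l then i else 0)"
        using qy ba \<open>j < Suc h\<close> \<open>l < Suc h\<close> by (cases "j = h"; cases "l = h") auto
    qed
    hence "Suc h \<le> h" using hmax by blast
    thus False by simp
  qed
  \<comment> \<open>The right inverse of a nonzero element here would lie in the left ideal of
    \<open>i\<close>, on which \<open>\<eta>\<close> acts as zero by \<open>left\<close>.\<close>
  have right: "i \<star> sing g \<star> \<eta> = 0" if g: "g \<in> carrier G" for g
  proof (rule ccontr)
    define y where "y = i \<star> sing g \<star> \<eta>"
    assume "i \<star> sing g \<star> \<eta> \<noteq> 0"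
    hence y0: "y \<noteq> 0" by (simp add: y_def)
    have yc: "y \<in> FS (N #> g)" unfolding y_def by (intro coset_conv_r coset_conv_l \<eta>N i_N coset_sing g)
    have iy: "i \<star> y = y" by (simp add: y_def ii_l conv_assoc)
    obtain a' where a': "a' \<in> FS (N #> inv g)" "a' \<star> i = a'" "y \<star> a' = i" by (rule right_inv[OF yc g iy y0])
    have a'G: "a' \<in> FS (carrier G)" by (rule coset_FS_G[OF inv_closed[OF g] a'(1)])
    have "\<eta> \<star> a' \<star> i = (\<Sum>g\<in>carrier G. sc (a' g) (\<eta> \<star> sing g \<star> i))"
      by (subst FS_expand[OF a'G fin]) (simp add: conv_sum_left conv_sum_right conv_sc_left conv_sc_right)
    hence "\<eta> \<star> a' \<star> i = 0" using left by simp
    hence "\<eta> \<star> a' = 0" by (simp add: conv_assoc a'(2))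
    hence "y \<star> a' = 0" by (simp add: y_def conv_assoc)
    thus False using a'(3) i0 by simp
  qed
  have "e \<star> \<eta> = 0" by (rule e_ideal[OF \<eta>G right])
  hence "\<eta> \<star> e = 0" using e_cent[OF \<eta>G] by simp
  hence e\<epsilon>: "e = \<epsilon> \<star> e" using e_in by (simp add: \<eta>_def conv_diff_left)
  moreover have "h > 0"
  proof (rule ccontr)
    assume "\<not> h > 0"
    hence "\<epsilon> = 0" by (simp add: \<epsilon>_def)
    thus False using e\<epsilon> e_nz by simp
  qed
  ultimately show ?thesis using that fm unfolding \<epsilon>_def by blast
qed

text \<open>Multiplication by the \<open>b j\<close> identifies \<open>M\<close> with
  \<open>h\<close> copies of its part cut out by \<open>i\<close>; the \<open>a j\<close> reassemble
  it.\<close>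

lemma dim_left_ideal:
  assumes fm: "fam h a b" "e = (\<Sum>j<h. a j \<star> b j) \<star> e"
    and M: "M \<subseteq> FS (carrier G)" "fv.subspace M" "\<And>y. y \<in> M \<Longrightarrow> e \<star> y = y" "\<And>r y. y \<in> M \<Longrightarrow> r \<star> y \<in> M"
  shows "fv.dim M = h * fv.dim {y \<in> M. i \<star> y = y}"
proof -
  let ?M = "{y \<in> M. i \<star> y = y}"
  have "?M \<subseteq> FS (carrier G)" using M(1) by blast
  then obtain B where B: "B \<subseteq> ?M" "fv.independent B" "?M \<subseteq> fv.span B" "finite B" "card B = fv.dim ?M"
    by (rule finite_basis[OF _ fin])
  have fam: "b j \<star> a l = (if j = l then i else 0)" "i \<star> b j = b j" if "j < h" "l < h" for j l
    using fm(1) that by (auto simp: fam_def)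
  have "fv.dim M = card ({..<h} \<times> B)"
  proof (rule dim_family[where v = "\<lambda>(j, b'). a j \<star> b'"])
    fix c assume "(\<Sum>jb\<in>{..<h} \<times> B. sc (c jb) (case jb of (j, b') \<Rightarrow> a j \<star> b')) = 0"
    hence *: "(\<Sum>j<h. \<Sum>b'\<in>B. sc (c (j, b')) (a j \<star> b')) = 0"
      by (simp add: sum.cartesian_product split_def)
    have "c (l, b0) = 0" if lb: "l < h" "b0 \<in> B" for l b0
    proof -
      have "0 = b l \<star> (\<Sum>j<h. \<Sum>b'\<in>B. sc (c (j, b')) (a j \<star> b'))" by (simp add: * )
      also have "\<dots> = (\<Sum>j<h. \<Sum>b'\<in>B. sc (c (j, b')) (b l \<star> a j \<star> b'))"
        by (simp add: conv_sum_right conv_sc_right conv_assoc)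
      also have "\<dots> = (\<Sum>j<h. if j = l then (\<Sum>b'\<in>B. sc (c (l, b')) b') else 0)"
      proof (rule sum.cong[OF refl])
        fix j assume j: "j \<in> {..<h}"
        have ib: "i \<star> b' = b'" if "b' \<in> B" for b' using that B(1) by blast
        show "(\<Sum>b'\<in>B. sc (c (j, b')) (b l \<star> a j \<star> b')) = (if j = l then (\<Sum>b'\<in>B. sc (c (l, b')) b') else 0)"
        proof (cases "j = l")
          case True
          have "(\<Sum>b'\<in>B. sc (c (l, b')) (b l \<star> a l \<star> b')) = (\<Sum>b'\<in>B. sc (c (l, b')) b')"
            using fam(1)[OF lb(1) lb(1)] ib by (intro sum.cong) auto
          thus ?thesis using True by simp
        next
          case False
          have "(\<Sum>b'\<in>B. sc (c (j, b')) (b l \<star> a j \<star> b')) = 0"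
            using fam(1)[OF lb(1), of j] j False by (intro sum.neutral) auto
          thus ?thesis using False by simp
        qed
      qed
      also have "\<dots> = (\<Sum>b'\<in>B. sc (c (l, b')) b')" using lb(1) by (subst sum.delta) simp_all
      finally have "(\<Sum>b'\<in>B. sc (c (l, b')) b') = 0" by (rule sym)
      thus ?thesis using basis_unique[OF B(4,2), of "\<lambda>b'. c (l, b')"] lb(2) by blast
    qed
    thus "\<forall>j\<in>{..<h} \<times> B. c j = 0" by auto
  next
    show "(case j of (j, b') \<Rightarrow> a j \<star> b') \<in> M" if "j \<in> {..<h} \<times> B" for j
      using that B(1) M(4) by auto
  next
    fix y assume y: "y \<in> M"
    have "\<forall>j\<in>{..<h}. \<exists>c. b j \<star> y = (\<Sum>b'\<in>B. sc (c b') b')"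
    proof
      fix j assume j: "j \<in> {..<h}"
      have "b j \<star> y \<in> ?M" using M(4)[OF y] fam(2)[of j j] j by (simp add: conv_assoc[symmetric])
      thus "\<exists>c. b j \<star> y = (\<Sum>b'\<in>B. sc (c b') b')" using basis_expand[OF B(4)] B(3) by blast
    qed
    then obtain c where c: "\<forall>j\<in>{..<h}. b j \<star> y = (\<Sum>b'\<in>B. sc (c j b') b')" using bchoice by metis
    have "y = (\<Sum>j<h. a j \<star> b j) \<star> e \<star> y" using M(3)[OF y] fm(2) by simp
    also have "\<dots> = (\<Sum>j<h. a j \<star> (b j \<star> y))" using M(3)[OF y] by (simp add: conv_assoc conv_sum_left)
    also have "\<dots> = (\<Sum>j<h. \<Sum>b'\<in>B. sc (c j b') (a j \<star> b'))"
      using c by (intro sum.cong) (auto simp: conv_sum_right conv_sc_right)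
    also have "\<dots> = (\<Sum>jb\<in>{..<h} \<times> B. sc (case jb of (j, b') \<Rightarrow> c j b') (case jb of (j, b') \<Rightarrow> a j \<star> b'))"
      by (simp add: sum.cartesian_product split_def)
    finally show "\<exists>c. y = (\<Sum>jb\<in>{..<h} \<times> B. sc (c jb) (case jb of (j, b') \<Rightarrow> a j \<star> b'))" by blast
  qed (use B(4) in simp)
  thus ?thesis using B(5) by (simp add: card_cartesian_product)
qed

text \<open>The left socle of the block, as the part annihilated by the radical.\<close>

definition Ze :: "('g \<Rightarrow> 'a) set" where
  "Ze = {y \<in> FS (carrier G). e \<star> y = y \<and> (\<forall>r\<in>J. r \<star> y = 0)}"

text \<open>The functions \<open>Zc\<close> form a basis of the annihilator of the radical, and
  \<open>e\<close> keeps those of the simple modules in its block and kills the others.\<close>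

lemma dim_Ze:
  assumes Ie: "Ie \<subseteq> I" "\<And>k a b. k \<in> Ie \<Longrightarrow> a < n k \<Longrightarrow> b < n k \<Longrightarrow> ev k a b e = (if a = b then 1 else 0)"
    and nIe: "\<And>k a b. k \<in> I - Ie \<Longrightarrow> a < n k \<Longrightarrow> b < n k \<Longrightarrow> ev k a b e = 0"
  shows "fv.dim Ze = (\<Sum>k\<in>Ie. (n k)\<^sup>2)"
proof -
  define Ix where "Ix K = (SIGMA k:K. {..<n k} \<times> {..<n k})" for K :: "'i set"
  have finIx: "finite (Ix K)" if "K \<subseteq> I" for K using that finI finite_subset by (auto simp: Ix_def)
  have "\<forall>x\<in>Ix I. \<exists>d. d \<in> FS (carrier G) \<and> (\<forall>k'\<in>I. \<forall>i'<n k'. \<forall>j'<n k'.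
      ev k' i' j' d = (if (k', i', j') = x then 1 else 0))"
  proof
    fix x assume "x \<in> Ix I"
    then obtain k a b where x: "x = (k, a, b)" "k \<in> I" "a < n k" "b < n k" by (auto simp: Ix_def)
    show "\<exists>d. d \<in> FS (carrier G) \<and> (\<forall>k'\<in>I. \<forall>i'<n k'. \<forall>j'<n k'.
      ev k' i' j' d = (if (k', i', j') = x then 1 else 0))"
      using m_surj[OF x(2-4)] unfolding x(1) ev_def by blast
  qed
  then obtain d where d: "\<forall>x\<in>Ix I. d x \<in> FS (carrier G) \<and> (\<forall>k'\<in>I. \<forall>i'<n k'. \<forall>j'<n k'.
      ev k' i' j' (d x) = (if (k', i', j') = x then 1 else 0))"
    using bchoice by metis
  have dev: "ev k a b (d x) = (if (k, a, b) = x then 1 else 0)"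
    if "x \<in> Ix I" "k \<in> I" "a < n k" "b < n k" for x k a b
    using d that by blast
  have dG: "d x \<in> FS (carrier G)" if "x \<in> Ix I" for x using d that by blast
  define Z where "Z x = (case x of (k, a, b) \<Rightarrow> Zc k a b)" for x
  have eZ: "e \<star> Z x = (if fst x \<in> Ie then Z x else 0)" if x: "x \<in> Ix I" for x
  proof -
    obtain k a b where xk: "x = (k, a, b)" "k \<in> I" "a < n k" "b < n k" using x by (auto simp: Ix_def)
    show ?thesis
    proof (cases "k \<in> Ie")
      case True
      have "e \<star> Zc k a b = (\<Sum>c<n k. if c = b then Zc k a b else 0)"
        unfolding conv_Zc[OF xk(2-4)] using Ie(2)[OF True _ xk(4)] by (intro sum.cong) auto
      also have "\<dots> = Zc k a b" using xk by (subst sum.delta) simp_all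
      finally show ?thesis using True xk by (simp add: Z_def)
    next
      case False
      have "e \<star> Zc k a b = 0"
        unfolding conv_Zc[OF xk(2-4)] using nIe[of k _ b] False xk by (intro sum.neutral) auto
      thus ?thesis using False xk by (simp add: Z_def)
    qed
  qed
  have XI: "Ix Ie \<subseteq> Ix I" using Ie(1) by (auto simp: Ix_def)
  have dZ: "(d x \<star> Z y) \<one> = (if y = x then 1 else 0)" if xy: "x \<in> Ix I" "y \<in> Ix I" for x y
  proof -
    obtain k a b where y: "y = (k, a, b)" "k \<in> I" "a < n k" "b < n k" using xy(2) by (auto simp: Ix_def)
    show ?thesis using conv_Zc_one[OF y(2-4), of "d x"] dev[OF xy(1) y(2-4)] by (auto simp: Z_def y(1))
  qed
  have "fv.dim Ze = card (Ix Ie)"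
  proof (rule dim_family[where v = Z])
    show "finite (Ix Ie)" using finIx Ie(1) .
    fix c assume *: "(\<Sum>x\<in>Ix Ie. sc (c x) (Z x)) = 0"
    show "\<forall>x\<in>Ix Ie. c x = 0"
    proof
      fix x assume x: "x \<in> Ix Ie"
      have "0 = (d x \<star> (\<Sum>x\<in>Ix Ie. sc (c x) (Z x))) \<one>" by (simp add: * )
      also have "\<dots> = (\<Sum>y\<in>Ix Ie. c y * (d x \<star> Z y) \<one>)" by (simp add: conv_sum_right conv_sc_right sum_fun_apply)
      also have "\<dots> = (\<Sum>y\<in>Ix Ie. if y = x then c x else 0)" 
      proof (rule sum.cong[OF refl])
        fix y assume "y \<in> Ix Ie"
        hence "(d x \<star> Z y) \<one> = (if y = x then 1 else 0)" using dZ[of x y] x XI by blast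
        thus "c y * (d x \<star> Z y) \<one> = (if y = x then c x else 0)" by simp
      qed
      also have "\<dots> = c x" using x finIx[OF Ie(1)] by simp
      finally show "c x = 0" by simp
    qed
  next
    fix x assume x: "x \<in> Ix Ie"
    then obtain k a b where xk: "x = (k, a, b)" "k \<in> Ie" "k \<in> I" "a < n k" "b < n k"
      using Ie(1) by (auto simp: Ix_def)
    have "r \<star> Z x = 0" if "r \<in> J" for r
      using that xk conv_Zc[OF xk(3-5), of r] by (simp add: Z_def J_def)
    thus "Z x \<in> Ze" using eZ[of x] x XI xk by (auto simp: Ze_def Z_def Zc_G)
  next
    fix y assume "y \<in> Ze"
    hence y: "y \<in> FS (carrier G)" "e \<star> y = y" "\<And>r. r \<in> J \<Longrightarrow> r \<star> y = 0" by (auto simp: Ze_def)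
    define c where "c x = (d x \<star> y) \<one>" for x
    have yI: "y = (\<Sum>x\<in>Ix I. sc (c x) (Z x))"
    proof (rule FS_eqI)
      show "(\<Sum>x\<in>Ix I. sc (c x) (Z x)) \<in> FS (carrier G)"
        by (intro FS_sum FS_sc) (auto simp: Ix_def Z_def Zc_G)
      fix g assume g: "g \<in> carrier G"
      define evx where "evx x = (case x of (k, a, b) \<Rightarrow> m k a b (inv g))" for x
      \<comment> \<open>The inverse of \<open>g\<close> minus the combination of dual elements with
        the same matrix coefficients lies in the radical. So its product with \<open>y\<close> is
        zero, and the coefficient at \<open>\<one>\<close> expresses \<open>y g\<close> by the
        functions \<open>Zc\<close>.\<close>
      define D where "D = sing (inv g) - (\<Sum>x\<in>Ix I. sc (evx x) (d x))"
      have DG: "D \<in> FS (carrier G)"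
        unfolding D_def using dG g by (intro FS_diff FS_sum FS_sc FS_sing) auto
      have "ev k a b D = 0" if k: "k \<in> I" "a < n k" "b < n k" for k a b
      proof -
        have "ev k a b (\<Sum>x\<in>Ix I. sc (evx x) (d x)) = (\<Sum>x\<in>Ix I. if x = (k, a, b) then evx (k, a, b) else 0)"
          unfolding ev_sum ev_sc
        proof (rule sum.cong[OF refl])
          fix x assume "x \<in> Ix I"
          from dev[OF this k] show "evx x * ev k a b (d x) = (if x = (k, a, b) then evx (k, a, b) else 0)"
            by auto
        qed
        also have "\<dots> = m k a b (inv g)" using k finIx[of I] by (simp add: Ix_def evx_def)
        finally show ?thesis using g by (simp add: D_def ev_diff ev_sing)
      qed
      hence "D \<star> y = 0" using DG y(3) by (simp add: J_def)
      hence "sing (inv g) \<star> y = (\<Sum>x\<in>Ix I. sc (evx x) (d x \<star> y))"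
        by (simp add: D_def conv_diff_left conv_sum_left conv_sc_left)
      hence "(sing (inv g) \<star> y) \<one> = (\<Sum>x\<in>Ix I. evx x * c x)" by (simp add: sum_fun_apply c_def)
      moreover have "(sing (inv g) \<star> y) \<one> = y g" using g by (simp add: sing_conv)
      moreover have "evx x = Z x g" for x using g by (auto simp: evx_def Z_def Zc_def split: prod.split)
      ultimately show "y g = (\<Sum>x\<in>Ix I. sc (c x) (Z x)) g" by (simp add: sum_fun_apply mult.commute)
    qed (rule y(1))
    have "y = (\<Sum>x\<in>Ix I. sc (c x) (e \<star> Z x))" by (subst y(2)[symmetric], subst yI) (simp add: conv_sum_right conv_sc_right)
    also have "\<dots> = (\<Sum>x\<in>Ix I. if fst x \<in> Ie then sc (c x) (Z x) else 0)"
      using eZ by (intro sum.cong) auto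
    also have "\<dots> = (\<Sum>x\<in>{x \<in> Ix I. fst x \<in> Ie}. sc (c x) (Z x))"
      by (rule sum.inter_filter[OF finIx[OF subset_refl], symmetric])
    also have "{x \<in> Ix I. fst x \<in> Ie} = Ix Ie" using Ie(1) by (auto simp: Ix_def)
    finally show "\<exists>c. y = (\<Sum>x\<in>Ix Ie. sc (c x) (Z x))" by blast
  qed
  also have "card (Ix Ie) = (\<Sum>k\<in>Ie. card ({..<n k} \<times> {..<n k}))"
    unfolding Ix_def using finite_subset[OF Ie(1) finI] by (intro card_SigmaI) auto
  also have "\<dots> = (\<Sum>k\<in>Ie. (n k)\<^sup>2)" by (simp add: card_cartesian_product power2_eq_square)
  finally show ?thesis .
qed

text \<open>The block and its socle both consist of \<open>h\<close> copies of their parts cut out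
  by \<open>i\<close>. In these parts the socle is the space of fixed points, by \<open>w_J\<close>
  and \<open>J_fixed\<close>, and \<open>dim_Me\<close> supplies the factor
  \<open>card S\<close>.\<close>

lemma dim_block:
  assumes Ie: "Ie \<subseteq> I" "\<And>k a b. k \<in> Ie \<Longrightarrow> a < n k \<Longrightarrow> b < n k \<Longrightarrow> ev k a b e = (if a = b then 1 else 0)"
    and nIe: "\<And>k a b. k \<in> I - Ie \<Longrightarrow> a < n k \<Longrightarrow> b < n k \<Longrightarrow> ev k a b e = 0"
  shows "fv.dim {y \<in> FS (carrier G). e \<star> y = y} = card S * (\<Sum>k\<in>Ie. (n k)\<^sup>2)"
proof -
  obtain h a b where fm: "fam h a b" "h > 0" "e = (\<Sum>j<h. a j \<star> b j) \<star> e" by (rule exists_fam)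
  let ?E = "{y \<in> FS (carrier G). e \<star> y = y}"
  have e_l: "e \<star> (r \<star> y) = r \<star> y" if y: "y \<in> FS (carrier G)" "e \<star> y = y" for r y
  proof -
    have "e \<star> (r \<star> y) = r \<star> y \<star> e" by (rule e_cent) simp
    also have "\<dots> = r \<star> (e \<star> y)" using e_cent[OF y(1)] by (simp add: conv_assoc)
    finally show ?thesis using y(2) by simp
  qed
  have "fv.dim ?E = h * fv.dim {y \<in> ?E. i \<star> y = y}"
    by (rule dim_left_ideal[OF fm(1,3)])
       (auto simp: fv.subspace_def FS_add FS_sc conv_add_right conv_sc_right e_l)
  also have "{y \<in> ?E. i \<star> y = y} = Mf e" by (auto simp: Mf_def)
  also have "fv.dim (Mf e) = card S * fv.dim (Mw e)" by (rule dim_Me)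
  also have "Mw e = {y \<in> Ze. i \<star> y = y}"
  proof (intro equalityI subsetI)
    fix y assume "y \<in> Mw e"
    thus "y \<in> {y \<in> Ze. i \<star> y = y}" using J_fixed by (auto simp: Mw_def Mf_def Ze_def)
  next
    fix y assume y: "y \<in> {y \<in> Ze. i \<star> y = y}"
    have "w x \<star> y = y" if "x \<in> S" for x
    proof -
      have "(w x - i) \<star> y = 0" using w_J[OF that] y by (simp add: Ze_def)
      thus ?thesis using y by (simp add: conv_diff_left)
    qed
    thus "y \<in> Mw e" using y by (auto simp: Mw_def Mf_def Ze_def)
  qed
  also have "h * (card S * fv.dim {y \<in> Ze. i \<star> y = y}) = card S * (h * fv.dim {y \<in> Ze. i \<star> y = y})"
    by simp
  also have "h * fv.dim {y \<in> Ze. i \<star> y = y} = fv.dim Ze"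
  proof (rule dim_left_ideal[OF fm(1,3), symmetric])
    show "r \<star> y \<in> Ze" if "y \<in> Ze" for r y
    proof -
      have "r' \<star> (r \<star> y) = 0" if "r' \<in> J" for r'
        using J_mult_r[OF that, of r] \<open>y \<in> Ze\<close> by (simp add: Ze_def conv_assoc[symmetric])
      thus ?thesis using that by (auto simp: Ze_def e_l)
    qed
  qed (auto simp: Ze_def fv.subspace_def FS_add FS_sc conv_add_right conv_sc_right)
  also have "fv.dim Ze = (\<Sum>k\<in>Ie. (n k)\<^sup>2)" by (rule dim_Ze[OF assms])
  finally show ?thesis .
qed

lemma conj_trace:
  assumes g: "g \<in> carrier G"
  obtains b where "subgroup ((\<lambda>x. inv g \<otimes> x \<otimes> g) ` S) G" "card ((\<lambda>x. inv g \<otimes> x \<otimes> g) ` S) = card S"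
    "b \<in> FS (carrier G)" "\<forall>d\<in>(\<lambda>x. inv g \<otimes> x \<otimes> g) ` S. cj d b = b"
    "e = Tr ((\<lambda>x. inv g \<otimes> x \<otimes> g) ` S) b"
proof -
  let ?f = "\<lambda>x. inv g \<otimes> x \<otimes> g"
  let ?D = "?f ` S"
  have f_mult: "?f x \<otimes> ?f y = ?f (x \<otimes> y)" if "x \<in> S" "y \<in> S" for x y
  proof -
    have "x \<in> carrier G" "y \<in> carrier G" using that SG by auto
    thus ?thesis using g by (simp add: m_assoc) (simp add: m_assoc[symmetric])
  qed
  have D: "subgroup ?D G"
  proof (rule subgroupI)
    show "?D \<subseteq> carrier G" using SG g by auto
    show "?D \<noteq> {}" using S_one by blast
    fix d assume "d \<in> ?D"
    then obtain x where x: "x \<in> S" "d = ?f x" by blast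
    have "inv d = ?f (inv x)" using x g SG[OF x(1)] by (simp add: inv_mult_group m_assoc)
    thus "inv d \<in> ?D" using S_inv[OF x(1)] by blast
  next
    fix d d' assume "d \<in> ?D" "d' \<in> ?D"
    thus "d \<otimes> d' \<in> ?D" using f_mult S_mult by auto
  qed
  have "inj_on ?f S" using SG g by (intro inj_onI) auto
  hence cD: "card ?D = card S" by (rule card_image)
  obtain c where c: "e = sc c (Tr S (z \<star> e))" by (rule trace_S[OF S S_St S_ind])
  define b0 where "b0 = z \<star> e"
  have b0: "cj x b0 = b0" if "x \<in> S" for x
    using tz that S_St SG by (auto simp: b0_def cj_mult central_cj[OF e_in _ e_cent])
  define b where "b = sc c (cj (inv g) b0)"
  have bfix: "cj d b = b" if d: "d \<in> ?D" for d
  proof -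
    obtain x where x: "x \<in> S" "d = ?f x" using d by blast
    have xG: "x \<in> carrier G" using SG x by blast
    have "cj d (cj (inv g) b0) = cj (inv g \<otimes> x) b0"
      using x xG g by (simp add: cj_cj m_assoc)
    also have "\<dots> = cj (inv g) b0" using b0[OF x(1)] xG g by (simp flip: cj_cj)
    finally show ?thesis by (simp add: b_def cj_sc)
  qed
  have "Tr ?D (cj (inv g) b0) = Tr S b0"
    unfolding Tr_def
  proof (rule sum.reindex_bij_witness[of _ "\<lambda>c. c #> g" "\<lambda>c. c #> inv g"])
    have tog: "(t <# S) #> g = (t \<otimes> g) <# ?D" if t: "t \<in> carrier G" for t
    proof -
      have "t \<otimes> x \<otimes> g = t \<otimes> g \<otimes> ?f x" if "x \<in> S" for x
        using SG[OF that] g t by (simp add: m_assoc) (simp add: m_assoc[symmetric])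
      thus ?thesis by (auto simp: l_coset_def r_coset_def)
    qed
    have toinv: "(t <# ?D) #> inv g = (t \<otimes> inv g) <# S" if t: "t \<in> carrier G" for t
    proof -
      have "t \<otimes> ?f x \<otimes> inv g = t \<otimes> inv g \<otimes> x" if "x \<in> S" for x
        using SG[OF that] g t by (simp add: m_assoc)
      thus ?thesis by (auto simp: l_coset_def r_coset_def)
    qed
    show "c #> inv g \<in> lcosets S" if "c \<in> lcosets ?D" for c
      using that toinv g by (auto simp: LCOSETS_def)
    show "c #> g \<in> lcosets ?D" if "c \<in> lcosets S" for c
      using that tog g by (auto simp: LCOSETS_def)
    show "c #> g #> inv g = c" if "c \<in> lcosets S" for c
      using lcoset_rep(4)[OF S that] g by (simp add: coset_mult_assoc coset_mult_one)
    show "c #> inv g #> g = c" if "c \<in> lcosets ?D" for c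
      using lcoset_rep(4)[OF D that] g by (simp add: coset_mult_assoc coset_mult_one)
    fix c assume c: "c \<in> lcosets ?D"
    have r: "(SOME t. t \<in> c) \<in> c" "(SOME t. t \<in> c) \<in> carrier G" using lcoset_rep[OF D c] by auto
    have cS: "c #> inv g \<in> lcosets S" using c toinv g by (auto simp: LCOSETS_def)
    have "(SOME t. t \<in> c) \<otimes> inv g \<in> c #> inv g" using r(1) by (auto simp: r_coset_def)
    from cj_coset[OF S b0 cS this]
    show "cj (SOME t. t \<in> c #> inv g) b0 = cj (SOME t. t \<in> c) (cj (inv g) b0)"
      using r g by (simp add: cj_cj)
  qed
  moreover have "Tr ?D b = sc c (Tr ?D (cj (inv g) b0))"
    by (simp add: Tr_def b_def cj_sc fv.scale_sum_right)
  ultimately have "e = Tr ?D b" using c by (simp add: b0_def)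
  moreover have "b \<in> FS (carrier G)" by (simp add: b_def FS_sc)
  ultimately show ?thesis using that D cD bfix by blast
qed

end

context core
begin

text \<open>The defect group enters only through relative traces from subgroups of a given
  \<open>D\<close>, a form in which the result can be pulled back to the small field and met with
  minimality there.\<close>

theorem core_result:
  assumes Ie: "Ie \<subseteq> I"
    and e1: "\<And>k a b. k \<in> Ie \<Longrightarrow> a < n k \<Longrightarrow> b < n k \<Longrightarrow> (\<Sum>g\<in>carrier G. e g * m k a b g) = (if a = b then 1 else 0)"
    and e0: "\<And>k a b. k \<in> I - Ie \<Longrightarrow> a < n k \<Longrightarrow> b < n k \<Longrightarrow> (\<Sum>g\<in>carrier G. e g * m k a b g) = 0"
  obtains s where "fv.dim {y \<in> FS (carrier G). e \<star> y = y} = s * (\<Sum>k\<in>Ie. (n k)\<^sup>2)"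
    "\<forall>D a. subgroup D G \<longrightarrow> a \<in> FS (carrier G) \<longrightarrow> (\<forall>d\<in>D. cj d a = a) \<longrightarrow> e = Tr D a \<longrightarrow>
      (\<exists>D' b. subgroup D' G \<and> D' \<subseteq> D \<and> card D' = s \<and> b \<in> FS (carrier G) \<and> (\<forall>d\<in>D'. cj d b = b) \<and> e = Tr D' b)"
proof -
  obtain i where i: "i \<in> FS N" "i \<star> i = i" "e \<star> i \<noteq> 0" "\<forall>a\<in>FS N. \<exists>c. i \<star> a \<star> i = sc c i"
    by (rule exists_prim_idem)
  interpret ci: core_i G p N H I n m e i by unfold_locales (fact i)+
  obtain S k where S: "subgroup S G" "S \<subseteq> ci.St" "card S = p ^ k" "\<not> p dvd card ci.St div card S"
    "S \<inter> N = {\<one>}" "\<forall>y\<in>ci.St \<inter> H. \<exists>x\<in>S. y \<in> N #> x" by (rule ci.exists_S)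
  obtain w where w: "\<forall>x\<in>S. w x \<in> ci.Rt x \<and> w x \<noteq> 0" "\<forall>x\<in>S. \<forall>y\<in>S. w x \<star> w y = w (x \<otimes> y)"
    by (rule ci.exists_w[OF S(1-3)])
  interpret cw: core_w G p N H I n m e i S k w by (rule core_w.intro[OF ci.core_i_axioms core_w_axioms.intro[OF S w]])
  show ?thesis
  proof (rule that)
    show "fv.dim {y \<in> FS (carrier G). e \<star> y = y} = card S * (\<Sum>k\<in>Ie. (n k)\<^sup>2)"
      by (rule cw.dim_block[OF Ie]) (use e1 e0 in \<open>simp_all add: cw.ev_def\<close>)
    show "\<forall>D a. subgroup D G \<longrightarrow> a \<in> FS (carrier G) \<longrightarrow> (\<forall>d\<in>D. cj d a = a) \<longrightarrow> e = Tr D a \<longrightarrow>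
      (\<exists>D' b. subgroup D' G \<and> D' \<subseteq> D \<and> card D' = card S \<and> b \<in> FS (carrier G) \<and> (\<forall>d\<in>D'. cj d b = b) \<and> e = Tr D' b)"
    proof (intro allI impI)
      fix D a assume D: "subgroup D G" "a \<in> FS (carrier G)" "\<forall>d\<in>D. cj d a = a" "e = Tr D a"
      obtain g where g: "g \<in> carrier G" "\<forall>x\<in>S. inv g \<otimes> x \<otimes> g \<in> D"
        using cw.defect_lower[OF D(1,2) _ D(4)] D(3) by blast
      obtain b where b: "subgroup ((\<lambda>x. inv g \<otimes> x \<otimes> g) ` S) G" "card ((\<lambda>x. inv g \<otimes> x \<otimes> g) ` S) = card S"
        "b \<in> FS (carrier G)" "\<forall>d\<in>(\<lambda>x. inv g \<otimes> x \<otimes> g) ` S. cj d b = b"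
        "e = Tr ((\<lambda>x. inv g \<otimes> x \<otimes> g) ` S) b" by (rule cw.conj_trace[OF g(1)])
      show "\<exists>D' b. subgroup D' G \<and> D' \<subseteq> D \<and> card D' = card S \<and> b \<in> FS (carrier G) \<and> (\<forall>d\<in>D'. cj d b = b) \<and> e = Tr D' b"
        using g(2) b by (intro exI[of _ "(\<lambda>x. inv g \<otimes> x \<otimes> g) ` S"] exI[of _ b]) blast
    qed
  qed
qed

end

section \<open>Irreducible matrix representations\<close>

lemma subspace_module_vec:
  "VectorSpace.subspace class_ring W (module_vec TYPE('a::field) d) \<longleftrightarrow>
     W \<subseteq> carrier_vec d \<and> 0\<^sub>v d \<in> W \<and> (\<forall>x\<in>W. \<forall>y\<in>W. x + y \<in> W) \<and> (\<forall>c. \<forall>x\<in>W. c \<cdot>\<^sub>v x \<in> W)"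
  by (auto simp: VectorSpace.subspace_def submodule_def vec_vs vec_module module_vec_simps)

context fin_group
begin

definition cf :: "('g \<Rightarrow> 'a::field mat) \<Rightarrow> nat \<Rightarrow> nat \<Rightarrow> ('g \<Rightarrow> 'a) \<Rightarrow> 'a" where
  "cf \<rho> i j a = (\<Sum>g\<in>carrier G. a g * \<rho> g $$ (i, j))"

lemma rep_extend_index: "i < d \<Longrightarrow> j < d \<Longrightarrow> rep_extend G d \<rho> a $$ (i, j) = cf \<rho> i j a"
  by (simp add: rep_extend_def cf_def)

lemma rep_extend_carrier: "rep_extend G d \<rho> a \<in> carrier_mat d d"
  by (simp add: rep_extend_def)

lemma cf_add: "cf \<rho> i j (a + b) = cf \<rho> i j a + cf \<rho> i j b"
  and cf_diff: "cf \<rho> i j (a - b) = cf \<rho> i j a - cf \<rho> i j b"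
  and cf_sc: "cf \<rho> i j (sc c a) = c * cf \<rho> i j a"
  and cf_0: "cf \<rho> i j 0 = 0"
  by (simp_all add: cf_def algebra_simps sum.distrib sum_subtractf sum_distrib_left)

lemma cf_sum: "cf \<rho> i j (sum f U) = (\<Sum>x\<in>U. cf \<rho> i j (f x))"
  by (rule additive_sum[of "cf \<rho> i j"]) (simp_all add: cf_0 cf_add)

lemma cf_sing: "g \<in> carrier G \<Longrightarrow> cf \<rho> i j (sing g) = \<rho> g $$ (i, j)"
  using fin by (simp add: cf_def sing_def if_distrib[of "\<lambda>x. x * _"] cong: if_cong)

lemma mat_rep_mult:
  assumes "mat_rep G d \<rho>" "g \<in> carrier G" "h \<in> carrier G" "i < d" "j < d"
  shows "\<rho> (g \<otimes> h) $$ (i, j) = (\<Sum>r<d. \<rho> g $$ (i, r) * \<rho> h $$ (r, j))"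
proof -
  have c: "\<rho> g \<in> carrier_mat d d" "\<rho> h \<in> carrier_mat d d" "\<rho> (g \<otimes> h) = \<rho> g * \<rho> h"
    using assms by (auto simp: mat_rep_def)
  have "(\<rho> g * \<rho> h) $$ (i, j) = (\<Sum>r\<in>{0..<d}. \<rho> g $$ (i, r) * \<rho> h $$ (r, j))"
    using c assms by (simp add: scalar_prod_def)
  thus ?thesis using c by (simp add: atLeast0LessThan)
qed

lemma mat_rep_one: "mat_rep G d \<rho> \<Longrightarrow> i < d \<Longrightarrow> j < d \<Longrightarrow> \<rho> \<one> $$ (i, j) = (if i = j then 1 else 0)"
  by (simp add: mat_rep_def)

lemma cf_mult:
  assumes "mat_rep G d \<rho>" "i < d" "j < d"
  shows "cf \<rho> i j (a \<star> b) = (\<Sum>r<d. cf \<rho> i r a * cf \<rho> r j b)"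
proof -
  have "cf \<rho> i j (a \<star> b) = (\<Sum>g\<in>carrier G. \<rho> g $$ (i, j) * (a \<star> b) g)" by (simp add: cf_def mult.commute)
  also have "\<dots> = (\<Sum>g\<in>carrier G. \<Sum>h\<in>carrier G. (\<Sum>r<d. \<rho> g $$ (i, r) * \<rho> h $$ (r, j)) * a g * b h)"
    using assms by (simp add: conv_pair mat_rep_mult)
  also have "\<dots> = (\<Sum>g\<in>carrier G. \<Sum>h\<in>carrier G. \<Sum>r<d. (a g * \<rho> g $$ (i, r)) * (b h * \<rho> h $$ (r, j)))"
    by (intro sum.cong refl) (simp add: sum_distrib_right sum_distrib_left mult_ac)
  also have "\<dots> = (\<Sum>g\<in>carrier G. \<Sum>r<d. \<Sum>h\<in>carrier G. (a g * \<rho> g $$ (i, r)) * (b h * \<rho> h $$ (r, j)))"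
    by (rule sum.cong[OF refl], rule sum.swap)
  also have "\<dots> = (\<Sum>r<d. \<Sum>g\<in>carrier G. \<Sum>h\<in>carrier G. (a g * \<rho> g $$ (i, r)) * (b h * \<rho> h $$ (r, j)))"
    by (rule sum.swap)
  also have "\<dots> = (\<Sum>r<d. cf \<rho> i r a * cf \<rho> r j b)" by (simp add: cf_def sum_product)
  finally show ?thesis .
qed

lemma irred_rep_mat: "irred_rep G d \<rho> \<Longrightarrow> mat_rep G d \<rho>" "irred_rep G d \<rho> \<Longrightarrow> 0 < d"
  by (auto simp: irred_rep_def)

lemma irred_rep_cases:
  fixes \<rho> :: "'g \<Rightarrow> 'b::field mat"
  assumes "irred_rep G d \<rho>" "W \<subseteq> carrier_vec d" "0\<^sub>v d \<in> W" "\<And>x y. x \<in> W \<Longrightarrow> y \<in> W \<Longrightarrow> x + y \<in> W"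
    "\<And>c x. x \<in> W \<Longrightarrow> c \<cdot>\<^sub>v x \<in> W" "\<And>g x. g \<in> carrier G \<Longrightarrow> x \<in> W \<Longrightarrow> \<rho> g *\<^sub>v x \<in> W"
  shows "W = {0\<^sub>v d} \<or> W = carrier_vec d"
proof -
  have "VectorSpace.subspace class_ring W (module_vec TYPE('b) d)"
    unfolding subspace_module_vec using assms by blast
  thus ?thesis using assms unfolding irred_rep_def by blast
qed

subsection \<open>Elements acting as zero on all simple modules\<close>

definition JF :: "('g \<Rightarrow> 'a::field) set" where
  "JF = {a \<in> FS (carrier G). \<forall>d \<rho>. irred_rep G d \<rho> \<longrightarrow> (\<forall>i<d. \<forall>j<d. cf \<rho> i j a = 0)}"

definition linv :: "('g \<Rightarrow> 'a::field) set \<Rightarrow> bool" where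
  "linv U \<longleftrightarrow> fv.subspace U \<and> U \<subseteq> FS (carrier G) \<and> (\<forall>a. \<forall>u\<in>U. a \<star> u \<in> U)"

lemma dim_psubset:
  fixes U V :: "('g \<Rightarrow> 'a::field) set"
  assumes "fv.subspace U" "fv.subspace V" "U \<subset> V" "V \<subseteq> FS (carrier G)"
  shows "fv.dim U < fv.dim V"
proof -
  obtain v where v: "v \<in> V" "v \<notin> U" using assms(3) by blast
  have v0: "v \<noteq> 0" using v(2) fv.subspace_0[OF assms(1)] by auto
  define L where "L = range (\<lambda>c. sc c v)"
  have L: "fv.subspace L"
  proof -
    have "sc c v + sc d v = sc (c + d) v" "sc c (sc d v) = sc (c * d) v" for c d
      by (simp_all add: fv.scale_left_distrib)
    moreover have "0 = sc 0 v" by simp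
    ultimately show ?thesis unfolding fv.subspace_def L_def by (metis (no_types, lifting) rangeE rangeI)
  qed
  have "fv.dim U + fv.dim L \<le> fv.dim V"
  proof (rule dim_sum_ge[OF assms(1) L _ _ _ assms(4) fin])
    show "U \<inter> L \<subseteq> {0}"
    proof
      fix x assume "x \<in> U \<inter> L"
      then obtain c where c: "x = sc c v" "x \<in> U" by (auto simp: L_def)
      have "c = 0"
      proof (rule ccontr)
        assume "c \<noteq> 0"
        hence "v = sc (inverse c) x" using c by simp
        thus False using v(2) c fv.subspace_scale[OF assms(1) c(2)] by metis
      qed
      thus "x \<in> {0}" using c by simp
    qed
    show "L \<subseteq> V" using v(1) fv.subspace_scale[OF assms(2)] by (auto simp: L_def)
  qed (use assms in auto)
  moreover have "v \<in> L" unfolding L_def by (metis fv.scale_one rangeI)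
  hence "fv.dim L > 0"
    by (intro dim_pos[of L "carrier G" v])
       (use v0 v(1) assms(4) fin FS_sc in \<open>auto simp: L_def\<close>)
  ultimately show ?thesis by simp
qed

lemma maximal_linv:
  fixes U :: "('g \<Rightarrow> 'a::field) set"
  assumes U: "linv U" "U \<noteq> {0}"
  obtains U' where "linv U'" "U' \<subset> U" "\<And>W. linv W \<Longrightarrow> U' \<subseteq> W \<Longrightarrow> W \<subseteq> U \<Longrightarrow> W = U' \<or> W = U"
proof -
  define Ds where "Ds = {d. \<exists>U'. linv U' \<and> U' \<subset> U \<and> fv.dim U' = d}"
  have U0: "0 \<in> U" using U(1) fv.subspace_0 by (auto simp: linv_def)
  have "linv {0 :: 'g \<Rightarrow> 'a}" by (auto simp: linv_def fv.subspace_def)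
  moreover have "{0} \<subset> U" using U0 U(2) by blast
  ultimately have ne: "Ds \<noteq> {}" by (auto simp: Ds_def)
  have "Ds \<subseteq> {..fv.dim U}"
  proof
    fix d assume "d \<in> Ds"
    then obtain U' where U': "linv U'" "U' \<subset> U" "fv.dim U' = d" by (auto simp: Ds_def)
    have "fv.dim U' \<le> fv.dim U"
      by (rule dim_mono_FS[of U' U "carrier G"]) (use U' U fin in \<open>auto simp: linv_def\<close>)
    thus "d \<in> {..fv.dim U}" using U' by simp
  qed
  hence finD: "finite Ds" using finite_subset by blast
  have "Max Ds \<in> Ds" by (rule Max_in[OF finD ne])
  then obtain U' where U': "linv U'" "U' \<subset> U" "fv.dim U' = Max Ds" unfolding Ds_def by blast
  have "W = U' \<or> W = U" if W: "linv W" "U' \<subseteq> W" "W \<subseteq> U" for W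
  proof (rule ccontr)
    assume *: "\<not> (W = U' \<or> W = U)"
    hence "fv.dim W \<in> Ds" using W by (auto simp: Ds_def)
    hence "fv.dim W \<le> fv.dim U'" using Max_ge[OF finD] U'(3) by simp
    moreover have "fv.dim U' < fv.dim W"
      by (rule dim_psubset) (use * W U' in \<open>auto simp: linv_def\<close>)
    ultimately show False by simp
  qed
  thus ?thesis using that U' by blast
qed

text \<open>\<open>U\<close> modulo \<open>U'\<close> is a simple module, on which \<open>a\<close>
  acts as zero. As \<open>JF\<close> refers to matrix representations, the quotient is written out
  in coordinates.\<close>

lemma JF_maximal:
  fixes U :: "('g \<Rightarrow> 'a::field) set"
  assumes U: "linv U" and U': "linv U'" "U' \<subset> U"
    and max: "\<And>W. linv W \<Longrightarrow> U' \<subseteq> W \<Longrightarrow> W \<subseteq> U \<Longrightarrow> W = U' \<or> W = U"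
    and a: "a \<in> JF" and u: "u \<in> U"
  shows "a \<star> u \<in> U'"
proof -
  have sU: "fv.subspace U" "U \<subseteq> FS (carrier G)" and iU: "\<And>a u. u \<in> U \<Longrightarrow> a \<star> u \<in> U"
    using U by (auto simp: linv_def)
  have sU': "fv.subspace U'" "U' \<subseteq> FS (carrier G)" and iU': "\<And>a u. u \<in> U' \<Longrightarrow> a \<star> u \<in> U'"
    using U' by (auto simp: linv_def)
  obtain B' where B': "B' \<subseteq> U'" "fv.independent B'" "U' \<subseteq> fv.span B'" "finite B'" "card B' = fv.dim U'"
    by (rule finite_basis[OF sU'(2) fin])
  have "B' \<subseteq> U" using B'(1) U'(2) by blast
  then obtain B where B: "B' \<subseteq> B" "B \<subseteq> U" "fv.independent B" "U \<subseteq> fv.span B"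
    using fv.maximal_independent_subset_extend[OF _ B'(2)] by metis
  have finB: "finite B"
  proof -
    have "B \<subseteq> fv.span (sing ` carrier G)" using B(2) sU(2) FS_span[OF fin] by blast
    thus ?thesis using fv.independent_span_bound[of "sing ` carrier G" B] B(3) fin by auto
  qed
  define d where "d = card (B - B')"
  \<comment> \<open>The basis vectors outside \<open>U'\<close> form a basis of the quotient, and
    the coordinates along them vanish on \<open>U'\<close>.\<close>
  obtain f where f: "bij_betw f {..<d} (B - B')"
    using ex_bij_betw_nat_finite[of "B - B'"] finB by (auto simp: d_def atLeast0LessThan)
  have fB: "f i \<in> B" "f i \<in> U" "f i \<notin> B'" if "i < d" for i
    using bij_betwE[OF f] that B(2) by auto
  define c where "c i u = fv.representation B u (f i)" for i u
  have spB: "u \<in> fv.span B" if "u \<in> U" for u using that B(4) by blast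
  have c_add: "c i (x + y) = c i x + c i y" if "x \<in> U" "y \<in> U" for i x y
    using fun_cong[OF fv.representation_add[OF B(3) spB[OF that(2)] spB[OF that(1)]], of "f i"] by (simp add: c_def)
  have c_sc: "c i (sc r x) = r * c i x" if "x \<in> U" for i r x
    using fv.representation_scale[OF B(3) spB[OF that]] by (simp add: c_def)
  have U0: "0 \<in> U" by (rule fv.subspace_0[OF sU(1)])
  have c_0: "c i 0 = 0" for i using c_sc[OF U0, of i 0] by simp
  have c_sum: "c i (\<Sum>j\<in>K. sc (r j) (v j)) = (\<Sum>j\<in>K. r j * c i (v j))"
    if "finite K" "\<And>j. j \<in> K \<Longrightarrow> v j \<in> U" for i and K :: "nat set" and r v
  proof -
    define P where "P K \<longleftrightarrow> c i (\<Sum>j\<in>K. sc (r j) (v j)) = (\<Sum>j\<in>K. r j * c i (v j))" for K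
    have "K \<subseteq> K' \<Longrightarrow> (\<And>j. j \<in> K' \<Longrightarrow> v j \<in> U) \<Longrightarrow> P K" for K'
      using that(1)
    proof (induction K rule: finite_induct)
      case empty show ?case by (simp add: P_def c_0)
    next
      case (insert k K)
      have vk: "sc (r k) (v k) \<in> U" using insert.prems by (intro fv.subspace_scale[OF sU(1)]) blast
      have vK: "(\<Sum>j\<in>K. sc (r j) (v j)) \<in> U" by (rule subspace_sum_sc[OF sU(1)]) (use insert.prems in blast)
      have "v k \<in> U" using insert.prems by blast
      thus ?case using insert c_add[OF vk vK] c_sc by (simp add: P_def)
    qed
    thus ?thesis using that(2) unfolding P_def by blast
  qed
  have c_f: "c i (f j) = (if i = j then 1 else 0)" if "i < d" "j < d" for i j
    using fv.representation_basis[OF B(3) fB(1)[OF that(2)]] bij_betw_imp_inj_on[OF f] that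
    by (auto simp: c_def inj_on_def)
  have c_U': "c i x = 0" if "x \<in> U'" "i < d" for i x
  proof -
    have "x \<in> fv.span B'" using that B'(3) by blast
    hence "fv.representation B x = fv.representation B' x"
      by (rule fv.representation_extend[OF B(3) _ B(1)])
    thus ?thesis using fv.representation_ne_zero[of B' x "f i"] fB(3)[OF that(2)] by (auto simp: c_def)
  qed
  have decomp: "x - (\<Sum>i<d. sc (c i x) (f i)) \<in> U'" if x: "x \<in> U" for x
  proof -
    have "x = (\<Sum>b\<in>B. sc (fv.representation B x b) b)"
      using fv.sum_representation_eq[OF B(3) spB[OF x] finB subset_refl] by simp
    also have "\<dots> = (\<Sum>b\<in>B'. sc (fv.representation B x b) b) + (\<Sum>b\<in>B - B'. sc (fv.representation B x b) b)"
      using sum.subset_diff[OF B(1) finB] by (simp add: add.commute)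
    also have "(\<Sum>b\<in>B - B'. sc (fv.representation B x b) b) = (\<Sum>i<d. sc (c i x) (f i))"
      using sum.reindex_bij_betw[OF f, of "\<lambda>b. sc (fv.representation B x b) b"] by (simp add: c_def)
    finally have "x - (\<Sum>i<d. sc (c i x) (f i)) = (\<Sum>b\<in>B'. sc (fv.representation B x b) b)"
      by (metis add_diff_cancel_right')
    also have "\<dots> \<in> U'" using B'(1) by (intro subspace_sum_sc[OF sU'(1)]) blast
    finally show ?thesis .
  qed
  have in_U': "x \<in> U'" if "x \<in> U" "\<And>i. i < d \<Longrightarrow> c i x = 0" for x
    using decomp[OF that(1)] that(2) by simp
  define \<rho> where "\<rho> g = mat d d (\<lambda>(i, j). c i (sing g \<star> f j))" for g
  have c_act: "c i (sing g \<star> x) = (\<Sum>j<d. \<rho> g $$ (i, j) * c j x)" if x: "x \<in> U" and i: "i < d" for g x i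
  proof -
    define y where "y = (\<Sum>j<d. sc (c j x) (f j))"
    have yU: "y \<in> U" unfolding y_def by (rule subspace_sum_sc[OF sU(1)]) (use fB in auto)
    have "c i (sing g \<star> x) = c i (sing g \<star> (x - y) + sing g \<star> y)"
      by (simp add: conv_add_right[symmetric])
    also have "\<dots> = c i (sing g \<star> y)"
    proof -
      have "sing g \<star> (x - y) \<in> U'" using iU' decomp[OF x] by (simp add: y_def)
      moreover from this have "sing g \<star> (x - y) \<in> U" using U'(2) by blast
      ultimately show ?thesis using c_add[OF _ iU[OF yU]] c_U' i by simp
    qed
    also have "sing g \<star> y = (\<Sum>j<d. sc (c j x) (sing g \<star> f j))"
      by (simp add: y_def conv_sum_right conv_sc_right)
    also have "c i \<dots> = (\<Sum>j<d. c j x * c i (sing g \<star> f j))"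
      by (rule c_sum) (use fB iU in auto)
    finally show ?thesis using i by (simp add: \<rho>_def mult.commute)
  qed
  have rep: "mat_rep G d \<rho>"
    unfolding mat_rep_def
  proof (intro conjI ballI)
    show "\<rho> g \<in> carrier_mat d d" for g by (simp add: \<rho>_def)
    show "\<rho> \<one> = 1\<^sub>m d"
      by (rule eq_matI) (use fB sU(2) in \<open>auto simp: \<rho>_def c_f subset_iff\<close>)
    fix g h assume gh: "g \<in> carrier G" "h \<in> carrier G"
    show "\<rho> (g \<otimes> h) = \<rho> g * \<rho> h"
    proof (rule eq_matI)
      fix i j assume "i < dim_row (\<rho> g * \<rho> h)" "j < dim_col (\<rho> g * \<rho> h)"
      hence ij: "i < d" "j < d" by (auto simp: \<rho>_def)
      have "\<rho> (g \<otimes> h) $$ (i, j) = c i (sing g \<star> (sing h \<star> f j))"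
        using ij gh by (simp add: \<rho>_def sing_mult conv_assoc[symmetric])
      also have "\<dots> = (\<Sum>r<d. \<rho> g $$ (i, r) * c r (sing h \<star> f j))"
        by (rule c_act[OF iU[OF fB(2)[OF ij(2)]] ij(1)])
      also have "\<dots> = (\<rho> g * \<rho> h) $$ (i, j)"
        using ij by (simp add: \<rho>_def scalar_prod_def atLeast0LessThan)
      finally show "\<rho> (g \<otimes> h) $$ (i, j) = (\<rho> g * \<rho> h) $$ (i, j)" .
    qed (simp_all add: \<rho>_def)
  qed
  have d0: "0 < d"
  proof (rule ccontr)
    assume "\<not> 0 < d"
    hence "U \<subseteq> U'" using in_U' by auto
    thus False using U'(2) by blast
  qed
  have "irred_rep G d \<rho>"
    unfolding irred_rep_def
  proof (intro conjI allI impI)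
    fix W assume "VectorSpace.subspace class_ring W (module_vec TYPE('a) d)" and inv: "\<forall>g\<in>carrier G. \<forall>w\<in>W. \<rho> g *\<^sub>v w \<in> W"
    hence W: "W \<subseteq> carrier_vec d" "0\<^sub>v d \<in> W" "\<And>x y. x \<in> W \<Longrightarrow> y \<in> W \<Longrightarrow> x + y \<in> W"
      "\<And>r x. x \<in> W \<Longrightarrow> r \<cdot>\<^sub>v x \<in> W"
      unfolding subspace_module_vec by blast+
    \<comment> \<open>The preimage of \<open>W\<close> is a left ideal between \<open>U'\<close> and
      \<open>U\<close>, so maximality makes it one of the two.\<close>
    define V where "V = {x \<in> U. vec d (\<lambda>i. c i x) \<in> W}"
    have Vadd: "x + y \<in> V" if "x \<in> V" "y \<in> V" for x y
    proof -
      have "vec d (\<lambda>i. c i (x + y)) = vec d (\<lambda>i. c i x) + vec d (\<lambda>i. c i y)"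
        using that c_add by (intro eq_vecI) (auto simp: V_def)
      thus ?thesis using that W(3) fv.subspace_add[OF sU(1)] by (auto simp: V_def)
    qed
    have Vsc: "sc r x \<in> V" if "x \<in> V" for r x
    proof -
      have "vec d (\<lambda>i. c i (sc r x)) = r \<cdot>\<^sub>v vec d (\<lambda>i. c i x)"
        using that c_sc by (intro eq_vecI) (auto simp: V_def)
      thus ?thesis using that W(4) fv.subspace_scale[OF sU(1)] by (auto simp: V_def)
    qed
    have V0: "0 \<in> V"
    proof -
      have "vec d (\<lambda>i. c i 0) = 0\<^sub>v d" by (intro eq_vecI) (auto simp: c_0)
      thus ?thesis using W(2) U0 by (simp add: V_def)
    qed
    have Vs: "fv.subspace V" using V0 Vadd Vsc by (auto simp: fv.subspace_def)
    have Vg: "sing g \<star> x \<in> V" if "g \<in> carrier G" "x \<in> V" for g x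
    proof -
      have "vec d (\<lambda>i. c i (sing g \<star> x)) = \<rho> g *\<^sub>v vec d (\<lambda>i. c i x)"
        using that c_act by (intro eq_vecI) (auto simp: V_def \<rho>_def scalar_prod_def atLeast0LessThan)
      thus ?thesis using that inv iU by (auto simp: V_def)
    qed
    have "a \<star> x \<in> V" if x: "x \<in> V" for a x
    proof -
      have "a \<star> x = A1 \<star> (a \<star> x)" by simp
      have ax: "a \<star> x = res (carrier G) a \<star> x" unfolding conv_def res_def by (intro ext) (auto intro!: sum.cong)
      have "res (carrier G) a \<star> x = (\<Sum>g\<in>carrier G. sc (res (carrier G) a g) (sing g \<star> x))"
        by (subst FS_expand[OF FS_res' fin]) (simp add: conv_sum_left conv_sc_left)
      also have "\<dots> \<in> V" by (rule subspace_sum_sc[OF Vs]) (rule Vg[OF _ x])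
      finally show ?thesis using ax by simp
    qed
    hence "linv V" using Vs sU(2) by (auto simp: linv_def V_def)
    moreover have "U' \<subseteq> V"
    proof
      fix x assume x: "x \<in> U'"
      have "vec d (\<lambda>i. c i x) = 0\<^sub>v d" using c_U'[OF x] by (intro eq_vecI) auto
      thus "x \<in> V" using x U'(2) W(2) by (auto simp: V_def)
    qed
    moreover have "V \<subseteq> U" by (auto simp: V_def)
    ultimately consider "V = U'" | "V = U" using max by blast
    moreover have lift: "(\<Sum>j<d. sc (w $ j) (f j)) \<in> U" "vec d (\<lambda>i. c i (\<Sum>j<d. sc (w $ j) (f j))) = w"
      if w: "w \<in> carrier_vec d" for w :: "'a vec"
    proof -
      show "(\<Sum>j<d. sc (w $ j) (f j)) \<in> U" by (rule subspace_sum_sc[OF sU(1)]) (use fB in auto)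
      have "c i (\<Sum>j<d. sc (w $ j) (f j)) = w $ i" if i: "i < d" for i
      proof -
        have "c i (\<Sum>j<d. sc (w $ j) (f j)) = (\<Sum>j<d. w $ j * c i (f j))"
          by (rule c_sum) (use fB in auto)
        also have "\<dots> = (\<Sum>j<d. if j = i then w $ i else 0)" using c_f i by (intro sum.cong) auto
        finally show ?thesis using i by simp
      qed
      thus "vec d (\<lambda>i. c i (\<Sum>j<d. sc (w $ j) (f j))) = w" using w by (intro eq_vecI) auto
    qed
    ultimately show "W = {0\<^sub>v d} \<or> W = carrier_vec d"
    proof cases
      case 1
      have "w = 0\<^sub>v d" if w: "w \<in> W" for w
      proof -
        have wc: "w \<in> carrier_vec d" using w W(1) by blast
        have "(\<Sum>j<d. sc (w $ j) (f j)) \<in> V" using lift[OF wc] w by (simp add: V_def)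
        hence "\<And>i. i < d \<Longrightarrow> c i (\<Sum>j<d. sc (w $ j) (f j)) = 0" using 1 c_U' by blast
        hence "vec d (\<lambda>i. c i (\<Sum>j<d. sc (w $ j) (f j))) = 0\<^sub>v d" by (intro eq_vecI) auto
        thus ?thesis using lift(2)[OF wc] by simp
      qed
      thus ?thesis using W(2) by blast
    next
      case 2
      have "w \<in> W" if w: "w \<in> carrier_vec d" for w
      proof -
        have "(\<Sum>j<d. sc (w $ j) (f j)) \<in> V" using lift(1)[OF w] 2 by simp
        thus ?thesis using lift(2)[OF w] by (simp add: V_def)
      qed
      thus ?thesis using W(1) by blast
    qed
  qed (use rep d0 in auto)
  hence cf0: "cf \<rho> i j a = 0" if "i < d" "j < d" for i j using a that by (auto simp: JF_def)
  have aG: "a \<in> FS (carrier G)" using a by (simp add: JF_def)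
  show ?thesis
  proof (rule in_U'[OF iU[OF u]])
    fix i assume i: "i < d"
    have sgU: "sing g \<star> u \<in> U" for g by (rule iU[OF u])
    obtain K :: "nat set" and q where K: "finite K" "bij_betw q K (carrier G)"
      using ex_bij_betw_nat_finite[OF fin] by (metis finite_atLeastLessThan)
    have "a \<star> u = (\<Sum>g\<in>carrier G. sc (a g) (sing g \<star> u))"
      by (subst FS_expand[OF aG fin]) (simp add: conv_sum_left conv_sc_left)
    also have "\<dots> = (\<Sum>k\<in>K. sc (a (q k)) (sing (q k) \<star> u))"
      by (rule sum.reindex_bij_betw[OF K(2), symmetric])
    finally have "c i (a \<star> u) = (\<Sum>k\<in>K. a (q k) * c i (sing (q k) \<star> u))"
      using c_sum[OF K(1), of "\<lambda>k. sing (q k) \<star> u"] sgU by simp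
    also have "\<dots> = (\<Sum>g\<in>carrier G. a g * c i (sing g \<star> u))"
      by (rule sum.reindex_bij_betw[OF K(2)])
    also have "\<dots> = (\<Sum>g\<in>carrier G. \<Sum>j<d. (a g * \<rho> g $$ (i, j)) * c j u)"
      using c_act[OF u i] by (simp add: sum_distrib_left mult.assoc)
    also have "\<dots> = (\<Sum>j<d. cf \<rho> i j a * c j u)"
      by (subst sum.swap) (simp add: cf_def sum_distrib_right)
    also have "\<dots> = 0" using cf0[OF i] by simp
    finally show "c i (a \<star> u) = 0" .
  qed
qed

text \<open>Induction down a chain of maximal left ideals. Products of different elements are
  needed, not only powers, because an element of the radical over the closure is a combination of
  several elements of \<open>JF\<close>.\<close>

lemma JF_nilpotent_on:
  fixes U :: "('g \<Rightarrow> 'a::field) set"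
  assumes "linv U"
  shows "\<exists>M. \<forall>as u. set as \<subseteq> (JF :: ('g \<Rightarrow> 'a) set) \<longrightarrow> length as = M \<longrightarrow> u \<in> U \<longrightarrow> foldr (\<star>) as u = 0"
  using assms
proof (induction "fv.dim U" arbitrary: U rule: less_induct)
  case less
  show ?case
  proof (cases "U = {0}")
    case True
    show ?thesis by (rule exI[of _ 0]) (simp add: True)
  next
    case False
    obtain U' where U': "linv U'" "U' \<subset> U" "\<And>W. linv W \<Longrightarrow> U' \<subseteq> W \<Longrightarrow> W \<subseteq> U \<Longrightarrow> W = U' \<or> W = U"
      using maximal_linv[OF less.prems False] by metis
    have "fv.dim U' < fv.dim U"
      by (rule dim_psubset) (use U' less.prems in \<open>auto simp: linv_def\<close>)
    then obtain M where M: "\<And>as u. set as \<subseteq> (JF :: ('g \<Rightarrow> 'a) set) \<Longrightarrow> length as = M \<Longrightarrow> u \<in> U' \<Longrightarrow> foldr (\<star>) as u = 0"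
      using less.hyps[OF _ U'(1)] by blast
    show ?thesis
    proof (intro exI[of _ "Suc M"] allI impI)
      fix as u assume as: "set as \<subseteq> (JF :: ('g \<Rightarrow> 'a) set)" "length as = Suc M" "u \<in> U"
      obtain bs b where b: "as = bs @ [b]" using as(2) by (metis append_butlast_last_id length_0_conv nat.distinct(1))
      have "b \<star> u \<in> U'" by (rule JF_maximal[OF less.prems U' _ as(3)]) (use as b in auto)
      thus "foldr (\<star>) as u = 0" using M[of bs "b \<star> u"] as b by simp
    qed
  qed
qed

lemma JF_nilpotent:
  "\<exists>M. \<forall>as. set as \<subseteq> (JF :: ('g \<Rightarrow> 'a::field) set) \<longrightarrow> length as = M \<longrightarrow> foldr (\<star>) as A1 = 0"
proof -
  have "linv (FS (carrier G) :: ('g \<Rightarrow> 'a) set)" by (auto simp: linv_def subspace_FS)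
  from JF_nilpotent_on[OF this] show ?thesis using A1_in by blast
qed

lemma JF_nilp: "(a :: 'g \<Rightarrow> 'a::field) \<in> JF \<Longrightarrow> nilp a"
proof -
  assume a: "a \<in> JF"
  obtain M where M: "\<And>as. set as \<subseteq> (JF :: ('g \<Rightarrow> 'a::field) set) \<Longrightarrow> length as = M \<Longrightarrow> foldr (\<star>) as A1 = 0"
    using JF_nilpotent by blast
  have "foldr (\<star>) (replicate m a) A1 = pw A1 a m" for m by (induction m) auto
  moreover have "foldr (\<star>) (replicate M a) A1 = 0" by (rule M) (use a in \<open>auto simp: set_replicate_conv_if split: if_splits\<close>)
  ultimately show "nilp a" unfolding nilp_def by metis
qed

subsection \<open>Density\<close>

definition disj_rep :: "nat \<Rightarrow> ('g \<Rightarrow> 'a::field mat) \<Rightarrow> nat \<Rightarrow> ('g \<Rightarrow> 'a mat) \<Rightarrow> bool" where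
  "disj_rep d \<rho> d' \<rho>' \<longleftrightarrow> (\<forall>M\<in>carrier_mat d' d. (\<forall>g\<in>carrier G. M * \<rho> g = \<rho>' g * M) \<longrightarrow> M = 0\<^sub>m d' d)"

text \<open>Jacobson density for pairwise non-isomorphic absolutely simple modules, with prescribed
  matrix columns: \<open>L\<close> is a set of pairs of a module and a column index, and columns are
  added one at a time.\<close>

lemma density:
  fixes \<rho> :: "'i \<Rightarrow> 'g \<Rightarrow> 'a::field mat"
  assumes split: "splitting_field TYPE('a) G"
    and irr: "\<And>k. k \<in> I \<Longrightarrow> irred_rep G (d k) (\<rho> k)"
    and dis: "\<And>k k'. k \<in> I \<Longrightarrow> k' \<in> I \<Longrightarrow> k \<noteq> k' \<Longrightarrow> disj_rep (d k) (\<rho> k) (d k') (\<rho> k')"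
    and L: "finite L" "L \<subseteq> (SIGMA k:I. {..<d k})"
  shows "\<exists>a\<in>FS (carrier G). \<forall>l\<in>L. \<forall>i<d (fst l). cf (\<rho> (fst l)) i (snd l) a = y l i"
  using L
proof (induction L arbitrary: y rule: finite_induct)
  case empty
  show ?case by (intro bexI[of _ 0]) auto
next
  case (insert l0 L)
  obtain k0 q0 where l0: "l0 = (k0, q0)" by (cases l0)
  have k0: "k0 \<in> I" "q0 < d k0" using insert.prems l0 by auto
  have LI: "fst l \<in> I" "snd l < d (fst l)" if "l \<in> L" for l using insert.prems that by auto
  have rep: "mat_rep G (d k) (\<rho> k)" if "k \<in> I" for k using irr[OF that] by (rule irred_rep_mat)
  have IH: "\<exists>a\<in>FS (carrier G). \<forall>l\<in>L. \<forall>i<d (fst l). cf (\<rho> (fst l)) i (snd l) a = y l i" for y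
    using insert.IH insert.prems by blast
  have "\<exists>b\<in>FS (carrier G). (\<forall>l\<in>L. \<forall>i<d (fst l). cf (\<rho> (fst l)) i (snd l) b = 0) \<and>
      (\<exists>i<d k0. cf (\<rho> k0) i q0 b \<noteq> 0)"
  proof (rule ccontr)
    assume no: "\<not> ?thesis"
    have "\<forall>lr. \<exists>a. a \<in> FS (carrier G) \<and> (\<forall>l\<in>L. \<forall>i<d (fst l). cf (\<rho> (fst l)) i (snd l) a = (if (l, i) = lr then 1 else 0))"
    proof
      fix lr
      show "\<exists>a. a \<in> FS (carrier G) \<and> (\<forall>l\<in>L. \<forall>i<d (fst l). cf (\<rho> (fst l)) i (snd l) a = (if (l, i) = lr then 1 else 0))"
        using IH[of "\<lambda>l i. if (l, i) = lr then 1 else 0"] by blast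
    qed
    then obtain al where al: "\<And>lr. al lr \<in> FS (carrier G)"
      "\<And>lr l i. l \<in> L \<Longrightarrow> i < d (fst l) \<Longrightarrow> cf (\<rho> (fst l)) i (snd l) (al lr) = (if (l, i) = lr then 1 else 0)"
      by metis
    \<comment> \<open>If vanishing of the columns in \<open>L\<close> forced column
      \<open>l0\<close> to vanish, the latter would be a linear function of the former. The
      \<open>M l\<close> are the blocks of this function, and they intertwine the
      representations.\<close>
    define M where "M l = mat (d k0) (d (fst l)) (\<lambda>(i, r). cf (\<rho> k0) i q0 (al (l, r)))" for l
    have star: "cf (\<rho> k0) i q0 a = (\<Sum>l\<in>L. \<Sum>r<d (fst l). cf (\<rho> (fst l)) r (snd l) a * M l $$ (i, r))"
      if a: "a \<in> FS (carrier G)" and i: "i < d k0" for a i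
    proof -
      define b where "b = a - (\<Sum>l\<in>L. \<Sum>r<d (fst l). sc (cf (\<rho> (fst l)) r (snd l) a) (al (l, r)))"
      have bG: "b \<in> FS (carrier G)" unfolding b_def using a al(1) by (intro FS_diff FS_sum FS_sc)
      have "cf (\<rho> (fst l)) j (snd l) b = 0" if l: "l \<in> L" and j: "j < d (fst l)" for l j
      proof -
        have "cf (\<rho> (fst l)) j (snd l) (\<Sum>l'\<in>L. \<Sum>r<d (fst l'). sc (cf (\<rho> (fst l')) r (snd l') a) (al (l', r)))
          = (\<Sum>l'\<in>L. \<Sum>r<d (fst l'). cf (\<rho> (fst l')) r (snd l') a * (if (l, j) = (l', r) then 1 else 0))"
          unfolding cf_sum cf_sc using al(2)[OF l j] by simp
        also have "\<dots> = (\<Sum>l'\<in>L. if l' = l then \<Sum>r<d (fst l). if r = j then cf (\<rho> (fst l)) j (snd l) a else 0 else 0)"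
        proof (rule sum.cong[OF refl])
          fix l' assume "l' \<in> L"
          show "(\<Sum>r<d (fst l'). cf (\<rho> (fst l')) r (snd l') a * (if (l, j) = (l', r) then 1 else 0)) =
              (if l' = l then \<Sum>r<d (fst l). if r = j then cf (\<rho> (fst l)) j (snd l) a else 0 else 0)"
          proof (cases "l' = l")
            case True
            show ?thesis by (simp only: True simp_thms if_True prod.inject) (rule sum.cong[OF refl], auto)
          qed simp
        qed
        also have "\<dots> = (\<Sum>r<d (fst l). if r = j then cf (\<rho> (fst l)) j (snd l) a else 0)"
          using l insert.hyps(1) by (subst sum.delta) simp_all
        also have "\<dots> = cf (\<rho> (fst l)) j (snd l) a" using j by (subst sum.delta) simp_all
        finally show ?thesis by (simp add: b_def cf_diff)
      qed
      hence "cf (\<rho> k0) i q0 b = 0" using no bG i by blast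
      hence "cf (\<rho> k0) i q0 a = cf (\<rho> k0) i q0 (\<Sum>l\<in>L. \<Sum>r<d (fst l). sc (cf (\<rho> (fst l)) r (snd l) a) (al (l, r)))"
        by (simp add: b_def cf_diff)
      also have "\<dots> = (\<Sum>l\<in>L. \<Sum>r<d (fst l). cf (\<rho> (fst l)) r (snd l) a * M l $$ (i, r))"
        unfolding cf_sum cf_sc using i by (intro sum.cong refl) (simp add: M_def)
      finally show ?thesis .
    qed
    have Mc: "M l \<in> carrier_mat (d k0) (d (fst l))" for l by (simp add: M_def)
    have tw: "M l * \<rho> (fst l) g = \<rho> k0 g * M l" if l: "l \<in> L" and g: "g \<in> carrier G" for l g
    proof (rule eq_matI)
      have rc: "\<rho> (fst l) g \<in> carrier_mat (d (fst l)) (d (fst l))" "\<rho> k0 g \<in> carrier_mat (d k0) (d k0)"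
        using rep[OF LI(1)[OF l]] rep[OF k0(1)] g by (auto simp: mat_rep_def)
      fix i r assume "i < dim_row (\<rho> k0 g * M l)" "r < dim_col (\<rho> k0 g * M l)"
      hence ir: "i < d k0" "r < d (fst l)" using rc Mc[of l] by auto
      have "(\<rho> k0 g * M l) $$ (i, r) = (\<Sum>s<d k0. \<rho> k0 g $$ (i, s) * cf (\<rho> k0) s q0 (al (l, r)))"
        using ir rc by (simp add: scalar_prod_def M_def atLeast0LessThan)
      also have "\<dots> = cf (\<rho> k0) i q0 (sing g \<star> al (l, r))"
        using cf_mult[OF rep[OF k0(1)] ir(1) k0(2)] g by (simp add: cf_sing)
      also have "\<dots> = (\<Sum>l'\<in>L. \<Sum>s<d (fst l'). cf (\<rho> (fst l')) s (snd l') (sing g \<star> al (l, r)) * M l' $$ (i, s))"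
        by (rule star[OF conv_in ir(1)])
      also have "\<dots> = (\<Sum>l'\<in>L. if l' = l then \<Sum>s<d (fst l). \<rho> (fst l) g $$ (s, r) * M l $$ (i, s) else 0)"
      proof (rule sum.cong[OF refl])
        fix l' assume l': "l' \<in> L"
        have e: "cf (\<rho> (fst l')) s (snd l') (sing g \<star> al (l, r)) = (if l' = l then \<rho> (fst l) g $$ (s, r) else 0)"
          if s: "s < d (fst l')" for s
        proof -
          have "cf (\<rho> (fst l')) s (snd l') (sing g \<star> al (l, r)) =
              (\<Sum>t<d (fst l'). \<rho> (fst l') g $$ (s, t) * (if (l', t) = (l, r) then 1 else 0))"
            using cf_mult[OF rep[OF LI(1)[OF l']] s LI(2)[OF l']] g al(2)[OF l'] by (simp add: cf_sing)
          also have "\<dots> = (\<Sum>t<d (fst l'). if t = r then (if l' = l then \<rho> (fst l) g $$ (s, r) else 0) else 0)"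
            by (intro sum.cong) auto
          also have "\<dots> = (if l' = l then \<rho> (fst l) g $$ (s, r) else 0)"
            using ir by (subst sum.delta) auto
          finally show ?thesis .
        qed
        show "(\<Sum>s<d (fst l'). cf (\<rho> (fst l')) s (snd l') (sing g \<star> al (l, r)) * M l' $$ (i, s)) =
            (if l' = l then \<Sum>s<d (fst l). \<rho> (fst l) g $$ (s, r) * M l $$ (i, s) else 0)"
          using e by (cases "l' = l") (auto intro!: sum.neutral)
      qed
      also have "\<dots> = (\<Sum>s<d (fst l). \<rho> (fst l) g $$ (s, r) * M l $$ (i, s))"
        using l insert.hyps(1) by (subst sum.delta) simp_all
      also have "\<dots> = (M l * \<rho> (fst l) g) $$ (i, r)"
        using ir rc Mc[of l] by (simp add: scalar_prod_def atLeast0LessThan mult.commute)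
      finally show "(M l * \<rho> (fst l) g) $$ (i, r) = (\<rho> k0 g * M l) $$ (i, r)" by (rule sym)
    next
      have rc: "\<rho> (fst l) g \<in> carrier_mat (d (fst l)) (d (fst l))" "\<rho> k0 g \<in> carrier_mat (d k0) (d k0)"
        using rep[OF LI(1)[OF l]] rep[OF k0(1)] g by (auto simp: mat_rep_def)
      show "dim_row (M l * \<rho> (fst l) g) = dim_row (\<rho> k0 g * M l)" "dim_col (M l * \<rho> (fst l) g) = dim_col (\<rho> k0 g * M l)"
        using rc Mc[of l] by auto
    qed
    \<comment> \<open>By Schur's lemma \<open>M l\<close> is zero or, for the same module, a scalar
      matrix; in the second case the columns differ, so the entry is off the diagonal.\<close>
    have M0: "M l $$ (q0, snd l) = 0" if l: "l \<in> L" for l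
    proof (cases "fst l = k0")
      case False
      have "M l = 0\<^sub>m (d k0) (d (fst l))"
        using dis[OF LI(1)[OF l] k0(1) False] tw[OF l] Mc[of l] unfolding disj_rep_def by blast
      thus ?thesis using k0 LI(2)[OF l] by simp
    next
      case True
      have "M l \<in> carrier_mat (d k0) (d k0)" "\<forall>g\<in>carrier G. M l * \<rho> k0 g = \<rho> k0 g * M l"
        using Mc[of l] tw[OF l] True by auto
      then obtain c where c: "M l = c \<cdot>\<^sub>m 1\<^sub>m (d k0)"
        using split irr[OF k0(1)] unfolding splitting_field_def by blast
      have "snd l \<noteq> q0" using insert.hyps(2) l l0 True by (metis prod.collapse)
      thus ?thesis using c k0 LI(2)[OF l] True by simp
    qed
    have "1 = cf (\<rho> k0) q0 q0 A1" using mat_rep_one[OF rep[OF k0(1)] k0(2) k0(2)] by (simp add: cf_sing)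
    also have "\<dots> = (\<Sum>l\<in>L. \<Sum>r<d (fst l). cf (\<rho> (fst l)) r (snd l) A1 * M l $$ (q0, r))"
      by (rule star[OF A1_in k0(2)])
    also have "\<dots> = 0"
    proof (intro sum.neutral ballI)
      fix l r assume l: "l \<in> L" and r: "r \<in> {..<d (fst l)}"
      have "cf (\<rho> (fst l)) r (snd l) A1 = (if r = snd l then 1 else 0)"
        using mat_rep_one[OF rep[OF LI(1)[OF l]] _ LI(2)[OF l], of r] r by (simp add: cf_sing)
      thus "cf (\<rho> (fst l)) r (snd l) A1 * M l $$ (q0, r) = 0" using M0[OF l] by simp
    qed
    finally show False by simp
  qed
  then obtain b where b: "b \<in> FS (carrier G)" "\<And>l i. l \<in> L \<Longrightarrow> i < d (fst l) \<Longrightarrow> cf (\<rho> (fst l)) i (snd l) b = 0"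
    "\<exists>i<d k0. cf (\<rho> k0) i q0 b \<noteq> 0" by blast
  \<comment> \<open>Left multiples of \<open>b\<close> leave the columns in \<open>L\<close> at
    zero. In column \<open>l0\<close> they sweep out an invariant subspace, hence everything, so the
    column can be corrected at will.\<close>
  define W where "W = {w. \<exists>a. w = vec (d k0) (\<lambda>i. cf (\<rho> k0) i q0 (a \<star> b))}"
  have W: "W = {0\<^sub>v (d k0)} \<or> W = carrier_vec (d k0)"
  proof (rule irred_rep_cases[OF irr[OF k0(1)]])
    show "W \<subseteq> carrier_vec (d k0)" by (auto simp: W_def)
    have "0\<^sub>v (d k0) = vec (d k0) (\<lambda>i. cf (\<rho> k0) i q0 (0 \<star> b))" by (intro eq_vecI) (auto simp: cf_0)
    thus "0\<^sub>v (d k0) \<in> W" unfolding W_def by blast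
    fix x assume "x \<in> W"
    then obtain a where a: "x = vec (d k0) (\<lambda>i. cf (\<rho> k0) i q0 (a \<star> b))" by (auto simp: W_def)
    have "c \<cdot>\<^sub>v x = vec (d k0) (\<lambda>i. cf (\<rho> k0) i q0 (sc c a \<star> b))" for c
      by (intro eq_vecI) (auto simp: a conv_sc_left cf_sc)
    thus "c \<cdot>\<^sub>v x \<in> W" for c unfolding W_def by blast
    show "x + x' \<in> W" if "x' \<in> W" for x'
    proof -
      obtain a' where a': "x' = vec (d k0) (\<lambda>i. cf (\<rho> k0) i q0 (a' \<star> b))" using \<open>x' \<in> W\<close> by (auto simp: W_def)
      have "x + x' = vec (d k0) (\<lambda>i. cf (\<rho> k0) i q0 ((a + a') \<star> b))"
        by (intro eq_vecI) (auto simp: a a' conv_add_left cf_add)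
      thus ?thesis unfolding W_def by blast
    qed
    fix g assume g: "g \<in> carrier G"
    have rc: "\<rho> k0 g \<in> carrier_mat (d k0) (d k0)" using rep[OF k0(1)] g by (auto simp: mat_rep_def)
    have "\<rho> k0 g *\<^sub>v x = vec (d k0) (\<lambda>i. cf (\<rho> k0) i q0 ((sing g \<star> a) \<star> b))"
    proof (rule eq_vecI)
      fix i assume "i < dim_vec (vec (d k0) (\<lambda>i. cf (\<rho> k0) i q0 ((sing g \<star> a) \<star> b)))"
      hence i: "i < d k0" by simp
      have "cf (\<rho> k0) i q0 ((sing g \<star> a) \<star> b) = (\<Sum>r<d k0. \<rho> k0 g $$ (i, r) * cf (\<rho> k0) r q0 (a \<star> b))"
        using cf_mult[OF rep[OF k0(1)] i k0(2), of "sing g" "a \<star> b"] g by (simp add: cf_sing conv_assoc)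
      thus "(\<rho> k0 g *\<^sub>v x) $ i = vec (d k0) (\<lambda>i. cf (\<rho> k0) i q0 ((sing g \<star> a) \<star> b)) $ i"
        using i rc by (simp add: a scalar_prod_def atLeast0LessThan)
    qed (use rc in simp)
    thus "\<rho> k0 g *\<^sub>v x \<in> W" unfolding W_def by blast
  qed
  have "W \<noteq> {0\<^sub>v (d k0)}"
  proof
    assume W0: "W = {0\<^sub>v (d k0)}"
    have "vec (d k0) (\<lambda>i. cf (\<rho> k0) i q0 (A1 \<star> b)) \<in> W" unfolding W_def by blast
    hence "vec (d k0) (\<lambda>i. cf (\<rho> k0) i q0 b) = 0\<^sub>v (d k0)" using W0 b(1) by simp
    hence "cf (\<rho> k0) i q0 b = 0" if "i < d k0" for i using that by (metis index_vec index_zero_vec(1))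
    thus False using b(3) by blast
  qed
  hence Wall: "W = carrier_vec (d k0)" using W by blast
  obtain a1 where a1: "a1 \<in> FS (carrier G)" "\<And>l i. l \<in> L \<Longrightarrow> i < d (fst l) \<Longrightarrow> cf (\<rho> (fst l)) i (snd l) a1 = y l i"
    using IH[of y] by blast
  have "vec (d k0) (\<lambda>i. y l0 i - cf (\<rho> k0) i q0 a1) \<in> W" using Wall by simp
  then obtain a2 where a2: "vec (d k0) (\<lambda>i. y l0 i - cf (\<rho> k0) i q0 a1) = vec (d k0) (\<lambda>i. cf (\<rho> k0) i q0 (a2 \<star> b))"
    by (auto simp: W_def)
  have a2': "cf (\<rho> k0) i q0 (a2 \<star> b) = y l0 i - cf (\<rho> k0) i q0 a1" if "i < d k0" for i
    using that a2 by (metis (mono_tags, lifting) index_vec)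
  have a2L: "cf (\<rho> (fst l)) i (snd l) (a2 \<star> b) = 0" if "l \<in> L" "i < d (fst l)" for l i
    using cf_mult[OF rep[OF LI(1)[OF that(1)]] that(2) LI(2)[OF that(1)], of a2 b] b(2)[OF that(1)] by simp
  show ?case
  proof (intro bexI[of _ "a1 + a2 \<star> b"] ballI allI impI)
    fix l i assume l: "l \<in> insert l0 L" and i: "i < d (fst l)"
    show "cf (\<rho> (fst l)) i (snd l) (a1 + a2 \<star> b) = y l i"
    proof (cases "l = l0")
      case True thus ?thesis using a2' i l0 by (simp add: cf_add)
    next
      case False
      hence "l \<in> L" using l by simp
      thus ?thesis using a1(2) a2L i by (simp add: cf_add)
    qed
  qed (use a1 in \<open>auto intro: FS_add\<close>)
qed

end

section \<open>Traces and lifts of roots of unity\<close>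

lemma prod_linear_coeff:
  fixes A :: "'a::comm_ring_1 multiset"
  shows "poly.coeff (\<Prod>x\<in>#A. [:- x, 1:]) (size A) = 1"
    and "A \<noteq> {#} \<Longrightarrow> poly.coeff (\<Prod>x\<in>#A. [:- x, 1:]) (size A - 1) = - \<Sum>\<^sub># A"
proof -
  \<comment> \<open>The degree bound is carried along so that the coefficient beyond the leading one
    is known to be zero.\<close>
  have "poly.coeff (\<Prod>x\<in>#A. [:- x, 1:]) (size A) = 1 \<and> degree (\<Prod>x\<in>#A. [:- x, 1:]) \<le> size A \<and>
     (A \<noteq> {#} \<longrightarrow> poly.coeff (\<Prod>x\<in>#A. [:- x, 1:]) (size A - 1) = - \<Sum>\<^sub># A)"
  proof (induction A)
    case (add y A)
    define P where "P = (\<Prod>x\<in>#A. [:- x, 1:])"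
    have e: "(\<Prod>x\<in>#add_mset y A. [:- x, 1:]) = pCons 0 P - smult y P" by (simp add: P_def algebra_simps)
    have c: "poly.coeff P (size A) = 1" "degree P \<le> size A" using add by (simp_all add: P_def)
    have c0: "poly.coeff P (Suc (size A)) = 0" by (rule coeff_eq_0) (use c in simp)
    have d: "degree (pCons 0 P - smult y P) \<le> Suc (size A)"
      by (rule degree_diff_le) (use c degree_pCons_le[of 0 P] degree_smult_le[of y P] in simp_all)
    show ?case
    proof (cases "A = {#}")
      case True
      thus ?thesis by simp
    next
      case False
      then obtain m where m: "size A = Suc m" by (metis gr0_implies_Suc nonempty_has_size)
      have "poly.coeff P m = - \<Sum>\<^sub># A" using add False m by (simp add: P_def)
      thus ?thesis unfolding e using c c0 d m by (simp add: coeff_pCons)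
    qed
  qed simp
  thus "poly.coeff (\<Prod>x\<in>#A. [:- x, 1:]) (size A) = 1"
    and "A \<noteq> {#} \<Longrightarrow> poly.coeff (\<Prod>x\<in>#A. [:- x, 1:]) (size A - 1) = - \<Sum>\<^sub># A" by auto
qed

lemma char_poly_trace:
  fixes A :: "'a::field mat"
  assumes A: "A \<in> carrier_mat n n" and n: "0 < n"
  shows "poly.coeff (char_poly A) (n - 1) = - (\<Sum>i<n. A $$ (i, i))"
proof -
  define T where "T = [:0, 1:] \<cdot>\<^sub>m 1\<^sub>m n + map_mat (\<lambda>a. [:- a:]) A"
  have T: "T \<in> carrier_mat n n" and Ti: "\<And>i j. i < n \<Longrightarrow> j < n \<Longrightarrow> T $$ (i, j) = (if i = j then [:- (A $$ (i, i)), 1:] else [:- (A $$ (i, j)):])"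
    using A by (auto simp: T_def)
  have "char_poly A = det T" using A by (simp add: char_poly_defs T_def)
  also have "\<dots> = (\<Sum>p\<in>{p. p permutes {0..<n}}. signof p * (\<Prod>i = 0..<n. T $$ (i, p i)))"
    by (rule det_def'[OF T])
  finally have "poly.coeff (char_poly A) (n - 1) =
      (\<Sum>p\<in>{p. p permutes {0..<n}}. poly.coeff (signof p * (\<Prod>i = 0..<n. T $$ (i, p i))) (n - 1))"
    by (simp add: coeff_sum)
  also have "\<dots> = (\<Sum>p\<in>{id}. poly.coeff (signof p * (\<Prod>i = 0..<n. T $$ (i, p i))) (n - 1))"
  proof (rule sum.mono_neutral_right)
    show "finite {p. p permutes {0..<n}}" by (simp add: finite_permutations)
    show "{id} \<subseteq> {p. p permutes {0..<n}}" by (auto simp: permutes_id)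
    show "\<forall>p\<in>{p. p permutes {0..<n}} - {id}. poly.coeff (signof p * (\<Prod>i = 0..<n. T $$ (i, p i))) (n - 1) = 0"
    proof
      fix p assume "p \<in> {p. p permutes {0..<n}} - {id}"
      hence p: "p permutes {0..<n}" "p \<noteq> id" by auto
      \<comment> \<open>A permutation other than the identity moves the two indices \<open>i\<close>
        and \<open>p i\<close>, so its product loses two linear factors and misses the
        coefficient.\<close>
      then obtain i where i: "p i \<noteq> i" by (metis eq_id_iff)
      have il: "i < n" using i p(1) by (metis permutes_not_in atLeastLessThan_iff le0)
      have pil: "p i < n" using permutes_in_image[OF p(1), of i] il by simp
      have ppi: "p (p i) \<noteq> p i" using i permutes_inj[OF p(1)] by (auto dest: injD)
      have pl: "p j < n" if "j < n" for j using permutes_in_image[OF p(1), of j] that by simp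
      have "degree (\<Prod>i = 0..<n. T $$ (i, p i)) \<le> (\<Sum>j = 0..<n. degree (T $$ (j, p j)))"
        using degree_prod_sum_le[of "{0..<n}" "\<lambda>i. T $$ (i, p i)"] by (simp add: comp_def)
      also have "\<dots> \<le> (\<Sum>j = 0..<n. if j \<in> {i, p i} then 0 else 1)"
        by (rule sum_mono) (use Ti pl i ppi in auto)
      also have "\<dots> = card ({0..<n} - {i, p i})"
        by (subst card_eq_sum, rule sum.mono_neutral_cong_right) auto
      also have "\<dots> = n - 2" using il pil i by (subst card_Diff_subset) auto
      also have "\<dots> < n - 1" using il pil i by auto
      finally have "degree (signof p * (\<Prod>i = 0..<n. T $$ (i, p i))) < n - 1" by simp
      thus "poly.coeff (signof p * (\<Prod>i = 0..<n. T $$ (i, p i))) (n - 1) = 0" by (rule coeff_eq_0)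
    qed
  qed
  also have "\<dots> = poly.coeff (\<Prod>i\<in>{0..<n}. [:- (A $$ (i, i)), 1:]) (n - 1)"
    using Ti by (simp add: sign_id)
  also have "(\<Prod>i\<in>{0..<n}. [:- (A $$ (i, i)), 1:]) = (\<Prod>x\<in>#image_mset (\<lambda>i. A $$ (i, i)) (mset_set {0..<n}). [:- x, 1:])"
    by (simp add: prod_unfold_prod_mset multiset.map_comp comp_def)
  also have "poly.coeff \<dots> (n - 1) = - (\<Sum>\<^sub># (image_mset (\<lambda>i. A $$ (i, i)) (mset_set {0..<n})))"
    using prod_linear_coeff(2)[of "image_mset (\<lambda>i. A $$ (i, i)) (mset_set {0..<n})"] n
    by (simp add: mset_set_empty_iff)
  finally show ?thesis by (simp add: sum_unfold_sum_mset atLeast0LessThan)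
qed

lemma proots_linear_prod: "proots (\<Prod>x\<in>#A. [:- x, 1:] :: 'a::idom poly) = A"
proof (induction A)
  case (add y A)
  have "(\<Prod>x\<in>#A. [:- x, 1:]) \<noteq> 0" by (auto simp: prod_mset_zero_iff)
  thus ?case using add by (simp add: proots_mult del: mult_pCons_left)
qed simp

lemma alg_closed_proots:
  fixes P :: "'a::alg_closed_field poly"
  assumes "monic P"
  shows "P = (\<Prod>x\<in>#proots P. [:- x, 1:])" "size (proots P) = degree P"
proof -
  obtain A where A: "size A = degree P" "P = smult (lead_coeff P) (\<Prod>x\<in>#A. [:-x, 1:])"
    using alg_closed_imp_factorization[of P] assms by fastforce
  have "P = (\<Prod>x\<in>#A. [:-x, 1:])" using A(2) assms by simp
  thus "P = (\<Prod>x\<in>#proots P. [:- x, 1:])" "size (proots P) = degree P"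
    using A(1) proots_linear_prod[of A] by auto
qed

lemma to_ac_hom: "comm_ring_hom to_ac"
  by unfold_locales auto

definition eigen :: "'a::field mat \<Rightarrow> 'a alg_closure multiset" where
  "eigen A = proots (map_poly to_ac (char_poly A))"

lemma eigen_facts:
  fixes A :: "'a::field mat"
  assumes A: "A \<in> carrier_mat n n" and n: "0 < n"
  shows "size (eigen A) = n" "\<Sum>\<^sub># (eigen A) = to_ac (\<Sum>i<n. A $$ (i, i))"
proof -
  define P where "P = map_poly to_ac (char_poly A)"
  have c: "poly.coeff P i = to_ac (poly.coeff (char_poly A) i)" for i by (simp add: P_def coeff_map_poly)
  have dg: "degree P = n" using degree_monic_char_poly[OF A] unfolding P_def by (subst degree_map_poly) auto
  have mon: "monic P" unfolding dg c using degree_monic_char_poly[OF A] by simp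
  have P: "P = (\<Prod>x\<in>#eigen A. [:- x, 1:])" and s: "size (eigen A) = n"
    using alg_closed_proots[OF mon] dg by (simp_all add: eigen_def P_def)
  show "size (eigen A) = n" by (rule s)
  have "- \<Sum>\<^sub># (eigen A) = poly.coeff P (n - 1)"
    using prod_linear_coeff(2)[of "eigen A"] P s n by (metis nat_less_le size_empty)
  also have "\<dots> = to_ac (- (\<Sum>i<n. A $$ (i, i)))" unfolding c char_poly_trace[OF A n] ..
  finally show "\<Sum>\<^sub># (eigen A) = to_ac (\<Sum>i<n. A $$ (i, i))" by simp
qed

lemma eigen_root:
  fixes A :: "'a::field mat"
  assumes A: "A \<in> carrier_mat n n" and z: "z \<in># eigen A" and pow: "A ^\<^sub>m m = 1\<^sub>m n"
  shows "z ^ m = 1"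
proof -
  interpret comm_ring_hom to_ac by (rule to_ac_hom)
  define B where "B = map_mat to_ac A"
  have B: "B \<in> carrier_mat n n" using A by (simp add: B_def)
  have "char_poly B \<noteq> 0" using degree_monic_char_poly[OF B] by auto
  moreover have "map_poly to_ac (char_poly A) = char_poly B" by (simp add: B_def char_poly_hom[OF A])
  ultimately have "poly (char_poly B) z = 0" using z by (simp add: eigen_def)
  then obtain w where w: "eigenvector B w z"
    using eigenvalue_root_char_poly[OF B] unfolding eigenvalue_def by blast
  have wc: "w \<in> carrier_vec n" "w \<noteq> 0\<^sub>v n" using w B by (auto simp: eigenvector_def)
  have "B ^\<^sub>m m = map_mat to_ac (A ^\<^sub>m m)" unfolding B_def by (rule mat_hom_pow[OF A, symmetric])
  hence "B ^\<^sub>m m = 1\<^sub>m n" using pow mat_hom_one by simp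
  hence "z ^ m \<cdot>\<^sub>v w = w" using eigenvector_pow[OF B w, of m] wc by simp
  moreover obtain i where "i < n" "w $ i \<noteq> 0" using wc by (metis eq_vecI carrier_vecD index_zero_vec)
  ultimately show ?thesis
    using wc by (metis carrier_vecD index_smult_vec(1) mult_cancel_right1)
qed

lemma sum_mset_count:
  assumes "finite Z" "set_mset M \<subseteq> Z"
  shows "\<Sum>\<^sub># M = (\<Sum>z\<in>Z. of_nat (count M z) * (z :: 'a::comm_semiring_1))"
  using assms(2)
proof (induction M)
  case (add y M)
  have "(\<Sum>z\<in>Z. of_nat (count (add_mset y M) z) * z) =
      (\<Sum>z\<in>Z. (if z = y then y else 0) + of_nat (count M z) * z)"
    by (rule sum.cong) (auto simp: algebra_simps)
  also have "\<dots> = y + (\<Sum>z\<in>Z. of_nat (count M z) * z)"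
    using add.prems assms(1) by (simp add: sum.distrib)
  finally show ?case using add by simp
qed simp

locale mod_sys =
  fixes p :: nat and v :: "'k::field_char_0 \<Rightarrow> int" and red :: "'k \<Rightarrow> 'f::field"
    and \<theta> :: "'k alg_closure \<Rightarrow> 'f alg_closure"
  assumes p: "prime p" and dv: "discrete_valuation v" and rm: "residue_map v red"
    and ch: "CHAR('f) = p" and re: "residue_extension v red \<theta>"
begin

lemma v_mult: "x \<noteq> 0 \<Longrightarrow> y \<noteq> 0 \<Longrightarrow> v (x * y) = v x + v y"
  and v_add: "x \<noteq> 0 \<Longrightarrow> y \<noteq> 0 \<Longrightarrow> x + y \<noteq> 0 \<Longrightarrow> min (v x) (v y) \<le> v (x + y)"
  using dv by (auto simp: discrete_valuation_def)

lemma val_1: "v 1 = 0" using v_mult[of 1 1] by simp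

lemma of_int_val_ring: "of_int n \<in> val_ring v"
proof -
  have nat: "of_nat m \<in> val_ring v" for m
  proof (induction m)
    case (Suc m)
    show ?case
    proof (cases "m = 0")
      case False
      have "(of_nat m :: 'k) \<noteq> 0" "(of_nat m + 1 :: 'k) \<noteq> 0"
        using False by (simp, metis of_nat_Suc add.commute of_nat_eq_0_iff nat.distinct(1))
      hence "min (v (of_nat m)) (v 1) \<le> v (of_nat m + 1)" by (intro v_add) simp_all
      thus ?thesis using Suc False val_1 by (simp add: val_ring_def add.commute)
    qed (simp add: val_ring_def val_1)
  qed (simp add: val_ring_def)
  have m1: "v (- 1) = 0" using v_mult[of "- 1" "- 1"] val_1 by simp
  show ?thesis
  proof (cases n)
    case (nonneg m)
    thus ?thesis using nat by simp
  next
    case (neg m)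
    have "of_int n = - 1 * (of_nat (Suc m) :: 'k)" using neg by simp
    moreover have "v (- 1 * of_nat (Suc m)) = v (of_nat (Suc m))"
      using v_mult[of "- 1" "of_nat (Suc m)"] m1 by (simp del: of_nat_Suc)
    moreover have "0 \<le> v (of_nat (Suc m))" using nat[of "Suc m"] by (simp add: val_ring_def del: of_nat_Suc)
    ultimately show ?thesis unfolding val_ring_def by simp
  qed
qed

text \<open>A sum of roots of unity is an eigenvalue of the integer matrix which describes its
  multiplication with all roots of unity of a suitable order.\<close>

lemma root_sum_integral:
  assumes m: "0 < m" and M: "\<And>z. z \<in># M \<Longrightarrow> z ^ m = 1"
  shows "\<Sum>\<^sub># M \<in> integral_over (val_ring v)"
proof -
  define Z where "Z = {z :: 'k alg_closure. z ^ m = 1}"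
  have "Z = {z. poly (monom 1 m - 1) z = 0}" by (simp add: Z_def poly_monom)
  moreover have "monom 1 m - (1 :: 'k alg_closure poly) \<noteq> 0"
    using m by (metis degree_1 degree_monom_eq eq_iff_diff_eq_0 less_irrefl zero_neq_one)
  ultimately have fZ: "finite Z" using poly_roots_finite by metis
  obtain zs where zs: "set zs = Z" "distinct zs" using finite_distinct_list[OF fZ] by blast
  define n where "n = length zs"
  \<comment> \<open>The multiplicity of the quotient of two roots, chosen so that the vector of all
    roots is an eigenvector of this integer matrix with the given sum as eigenvalue.\<close>
  define C where "C = mat n n (\<lambda>(i, j). int (count M (zs ! j / zs ! i)))"
  have C: "C \<in> carrier_mat n n" by (simp add: C_def)
  define D where "D = (map_mat of_int C :: 'k alg_closure mat)"
  have D: "D \<in> carrier_mat n n" using C by (simp add: D_def)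
  define x where "x = \<Sum>\<^sub># M"
  have MZ: "set_mset M \<subseteq> Z" using M by (auto simp: Z_def)
  have x: "x = (\<Sum>z\<in>Z. of_nat (count M z) * z)"
    unfolding x_def by (rule sum_mset_count[OF fZ MZ])
  have nz: "z \<noteq> 0" if "z \<in> Z" for z using that m by (auto simp: Z_def power_0_left)
  define w where "w = vec n (\<lambda>i. zs ! i)"
  have "eigenvector D w x"
    unfolding eigenvector_def
  proof (intro conjI)
    show "w \<in> carrier_vec (dim_row D)" using D by (simp add: w_def)
    have "1 \<in> Z" by (simp add: Z_def)
    then obtain i where i: "i < n" "zs ! i = 1" using zs(1) unfolding n_def by (metis in_set_conv_nth)
    hence "w $ i = 1" by (simp add: w_def)
    thus "w \<noteq> 0\<^sub>v (dim_row D)" using i D by auto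
    show "D *\<^sub>v w = x \<cdot>\<^sub>v w"
    proof (rule eq_vecI)
      fix i assume "i < dim_vec (x \<cdot>\<^sub>v w)"
      hence i: "i < n" by (simp add: w_def)
      have zi: "zs ! i \<in> Z" using i nth_mem[of i zs] zs(1) by (simp add: n_def)
      have "(D *\<^sub>v w) $ i = (\<Sum>j<n. of_nat (count M (zs ! j / zs ! i)) * zs ! j)"
        using i by (simp add: D_def C_def w_def scalar_prod_def atLeast0LessThan)
      also have "\<dots> = (\<Sum>u\<in>Z. of_nat (count M (u / zs ! i)) * u)"
        using sum.reindex_bij_betw[OF bij_betw_nth[OF zs(2) _ zs(1)[symmetric]], of "{..<n}" "\<lambda>u. of_nat (count M (u / zs ! i)) * u"]
        by (simp add: n_def)
      also have "\<dots> = (\<Sum>u\<in>Z. of_nat (count M u) * (u * zs ! i))"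
      proof (rule sum.reindex_bij_witness[where i = "\<lambda>u. u * zs ! i" and j = "\<lambda>u. u / zs ! i"])
        show "a / zs ! i \<in> Z" if "a \<in> Z" for a using that zi by (simp add: Z_def power_divide)
        show "a * zs ! i \<in> Z" if "a \<in> Z" for a using that zi by (simp add: Z_def power_mult_distrib)
      qed (use nz[OF zi] in auto)
      also have "\<dots> = x * zs ! i" unfolding x sum_distrib_right by (simp add: mult.assoc)
      finally show "(D *\<^sub>v w) $ i = (x \<cdot>\<^sub>v w) $ i" using i by (simp add: w_def)
    qed (use D in \<open>simp add: w_def\<close>)
  qed
  hence "eigenvalue D x" by (auto simp: eigenvalue_def)
  hence r: "poly (char_poly D) x = 0" using eigenvalue_root_char_poly[OF D] by simp
  define q where "q = (map_poly of_int (char_poly C) :: 'k poly)"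
  have hom: "comm_ring_hom (of_int :: int \<Rightarrow> 'k alg_closure)" by unfold_locales auto
  have q: "map_poly to_ac q = char_poly D"
    unfolding D_def comm_ring_hom.char_poly_hom[OF hom C] q_def by (subst map_poly_map_poly) (simp_all add: comp_def)
  have "degree q = n" using degree_monic_char_poly[OF C] unfolding q_def by (subst degree_map_poly) auto
  hence "lead_coeff q = 1" using degree_monic_char_poly[OF C] by (simp add: q_def coeff_map_poly)
  moreover have "poly.coeff q i \<in> val_ring v" for i
    unfolding q_def by (simp add: coeff_map_poly of_int_val_ring)
  ultimately show ?thesis using r q unfolding integral_over_def x_def by auto
qed

definition rt :: "nat \<Rightarrow> 'k alg_closure set" where "rt m = {z. z ^ m = 1}"

lemma rt_power: "z \<in> rt m \<Longrightarrow> z ^ i \<in> rt m"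
  by (simp add: rt_def) (metis mult.commute power_mult power_one)

lemma rt_integral: "0 < m \<Longrightarrow> z \<in> rt m \<Longrightarrow> z \<in> integral_over (val_ring v)"
  using root_sum_integral[of m "{#z#}"] by (simp add: rt_def)

lemma theta_to_ac: "r \<in> val_ring v \<Longrightarrow> \<theta> (to_ac r) = to_ac (red r)"
  using re by (simp add: residue_extension_def)

lemma theta_0: "\<theta> 0 = 0" and theta_1: "\<theta> 1 = 1"
proof -
  have "red 0 = 0" "red 1 = 1" using rm by (auto simp: residue_map_def val_ring_def val_ideal_def)
  thus "\<theta> 0 = 0" "\<theta> 1 = 1"
    using theta_to_ac[of 0] theta_to_ac[of 1] val_1 by (simp_all add: val_ring_def)
qed

lemma theta_sum:
  assumes m: "0 < m" and M: "set_mset M \<subseteq> rt m"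
  shows "\<theta> (\<Sum>\<^sub># M) = \<Sum>\<^sub># (image_mset \<theta> M)"
  using M
proof (induction M)
  case (add z M)
  have "z \<in> integral_over (val_ring v)" using add.prems rt_integral[OF m] by simp
  moreover have "\<Sum>\<^sub># M \<in> integral_over (val_ring v)"
    by (rule root_sum_integral[OF m]) (use add.prems in \<open>auto simp: rt_def\<close>)
  ultimately have "\<theta> (z + \<Sum>\<^sub># M) = \<theta> z + \<theta> (\<Sum>\<^sub># M)" using re by (simp add: residue_extension_def)
  thus ?case using add by simp
qed (simp add: theta_0)

lemma theta_mult: "0 < m \<Longrightarrow> z \<in> rt m \<Longrightarrow> w \<in> rt m \<Longrightarrow> \<theta> (z * w) = \<theta> z * \<theta> w"
  using re rt_integral by (simp add: residue_extension_def)

lemma theta_power: "0 < m \<Longrightarrow> z \<in> rt m \<Longrightarrow> \<theta> (z ^ i) = \<theta> z ^ i"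
proof (induction i)
  case (Suc i)
  have "z ^ i \<in> rt m" by (rule rt_power[OF Suc.prems(2)])
  thus ?case using Suc theta_mult by simp
qed (simp add: theta_1)

lemma theta_rt: "0 < m \<Longrightarrow> z \<in> rt m \<Longrightarrow> \<theta> z ^ m = 1"
  using theta_power[of m z m] by (simp add: rt_def theta_1)

text \<open>Otherwise the sum of the powers of \<open>z\<close> is zero, while
  \<open>\<theta>\<close> maps it to \<open>of_nat m\<close>, which is nonzero because
  \<open>m\<close> is prime to \<open>p\<close>.\<close>

lemma theta_eq_1:
  assumes m: "0 < m" "coprime m p" and z: "z \<in> rt m" "\<theta> z = 1"
  shows "z = 1"
proof (rule ccontr)
  assume z1: "z \<noteq> 1"
  have "(z - 1) * (\<Sum>i<m. z ^ i) = 0" using z(1) power_diff_1_eq[of z m] by (simp add: rt_def)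
  hence s: "(\<Sum>i<m. z ^ i) = 0" using z1 by simp
  have "\<theta> (\<Sum>i<m. z ^ i) = \<theta> (\<Sum>\<^sub># (image_mset (\<lambda>i. z ^ i) (mset_set {..<m})))"
    by (simp add: sum_unfold_sum_mset)
  also have "\<dots> = \<Sum>\<^sub># (image_mset \<theta> (image_mset (\<lambda>i. z ^ i) (mset_set {..<m})))"
    by (rule theta_sum[OF m(1)]) (use rt_power[OF z(1)] in auto)
  also have "\<dots> = (\<Sum>i<m. \<theta> (z ^ i))" by (simp add: sum_unfold_sum_mset multiset.map_comp comp_def)
  also have "\<dots> = of_nat m" using theta_power[OF m(1) z(1)] z(2) by simp
  finally have "(of_nat m :: 'f alg_closure) = 0" using s theta_0 by simp
  hence "p dvd m" using ch by (simp add: of_nat_eq_0_iff_char_dvd)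
  thus False using m p by (metis coprime_common_divisor dvd_refl not_prime_unit)
qed

lemma theta_inj: "0 < m \<Longrightarrow> coprime m p \<Longrightarrow> inj_on \<theta> (rt m)"
proof (rule inj_onI)
  fix z w assume m: "0 < m" "coprime m p" and zw: "z \<in> rt m" "w \<in> rt m" "\<theta> z = \<theta> w"
  have wi: "w ^ (m - 1) \<in> rt m" by (rule rt_power[OF zw(2)])
  have ww: "w * w ^ (m - 1) = 1" using m zw(2) by (simp add: rt_def flip: power_Suc)
  have "\<theta> (z * w ^ (m - 1)) = \<theta> (w * w ^ (m - 1))" using theta_mult[OF m(1) _ wi] zw by simp
  hence "\<theta> (z * w ^ (m - 1)) = 1" using ww theta_1 by simp
  moreover have "z * w ^ (m - 1) \<in> rt m" using zw(1) wi by (simp add: rt_def power_mult_distrib)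
  ultimately have "z * w ^ (m - 1) = w * w ^ (m - 1)" using theta_eq_1[OF m] ww by simp
  thus "z = w" using ww by (metis mult_cancel_right mult_zero_right zero_neq_one)
qed

lemma card_rt: "0 < m \<Longrightarrow> card (rt m) = m"
proof -
  assume m: "0 < m"
  define P where "P = monom 1 m - (1 :: 'k alg_closure poly)"
  have dg: "degree P = m" unfolding P_def using m by (subst diff_conv_add_uminus, subst degree_add_eq_left) (simp_all add: degree_monom_eq)
  have mon: "monic P" unfolding dg using m by (simp add: P_def)
  have rs: "rsquarefree P" unfolding rsquarefree_roots using m
    by (auto simp: P_def poly_monom pderiv_monom pderiv_diff power_0_left)
  have P0: "P \<noteq> 0" using mon by auto
  have rtP: "rt m = set_mset (proots P)"
    using P0 by (subst set_count_proots) (auto simp: rt_def P_def poly_monom)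
  have "proots P = mset_set (rt m)"
  proof (rule multiset_eqI)
    fix z
    have "finite (rt m)" unfolding rtP by simp
    thus "count (proots P) z = count (mset_set (rt m)) z"
      using spec[OF conjunct2[OF rs[unfolded rsquarefree_def]], of z] P0 order_root[of P z]
      by (auto simp: rtP count_mset_set' order_root)
  qed
  thus ?thesis using alg_closed_proots(2)[OF mon] dg by (metis size_mset_set)
qed

text \<open>Counting: there are \<open>m\<close> roots of unity upstairs, \<open>\<theta>\<close> is
  injective on them, and there are at most \<open>m\<close> downstairs.\<close>

lemma theta_surj:
  assumes m: "0 < m" "coprime m p" and \<zeta>: "\<zeta> ^ m = 1"
  shows "\<exists>z\<in>rt m. \<theta> z = \<zeta>"
proof -
  define Z where "Z = {z :: 'f alg_closure. z ^ m = 1}"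
  define P where "P = monom 1 m - (1 :: 'f alg_closure poly)"
  have dg: "degree P = m" unfolding P_def using m by (subst diff_conv_add_uminus, subst degree_add_eq_left) (simp_all add: degree_monom_eq)
  have P0: "P \<noteq> 0" using dg m by auto
  have Z: "Z = {z. poly P z = 0}" by (simp add: Z_def P_def poly_monom)
  have fZ: "finite Z" unfolding Z by (rule poly_roots_finite[OF P0])
  have "card Z \<le> m" unfolding Z using card_poly_roots_bound[OF P0] dg by simp
  moreover have "card (\<theta> ` rt m) = m" using card_image[OF theta_inj[OF m]] card_rt[OF m(1)] by simp
  moreover have "\<theta> ` rt m \<subseteq> Z" using theta_rt[OF m(1)] by (auto simp: Z_def)
  ultimately have "\<theta> ` rt m = Z" using card_seteq[OF fZ] by simp
  moreover have "\<zeta> \<in> Z" using \<zeta> by (simp add: Z_def)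
  ultimately show ?thesis by blast
qed

lemma root_lift:
  assumes m: "0 < m" "coprime m p" and \<zeta>: "\<zeta> ^ m = 1"
  shows "root_lift p \<theta> \<zeta> \<in> rt m" "\<theta> (root_lift p \<theta> \<zeta>) = \<zeta>"
proof -
  obtain z where z: "z \<in> rt m" "\<theta> z = \<zeta>" using theta_surj[OF assms] by blast
  have "root_lift p \<theta> \<zeta> = z"
    unfolding root_lift_def
  proof (rule the_equality)
    show "(\<exists>m>0. coprime m p \<and> z ^ m = 1) \<and> \<theta> z = \<zeta>" using z m by (auto simp: rt_def)
    fix w assume "(\<exists>m>0. coprime m p \<and> w ^ m = 1) \<and> \<theta> w = \<zeta>"
    then obtain l where l: "0 < l" "coprime l p" "w ^ l = 1" "\<theta> w = \<zeta>" by blast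
    \<comment> \<open>A competing lift may have an order unrelated to \<open>m\<close>; both are
      compared among the roots of order \<open>m * l\<close>.\<close>
    have "z \<in> rt (m * l)" "w \<in> rt (l * m)" using z l by (simp_all add: rt_def power_mult)
    moreover have "0 < m * l" "coprime (m * l) p" using m l by simp_all
    ultimately show "w = z" using theta_inj[of "m * l"] z(2) l(4) by (metis inj_onD mult.commute)
  qed
  thus "root_lift p \<theta> \<zeta> \<in> rt m" "\<theta> (root_lift p \<theta> \<zeta>) = \<zeta>" using z by simp_all
qed

text \<open>Applied to the matrix of a \<open>p\<close>-regular element, this is the reduction of
  the Brauer character value to the ordinary trace.\<close>

lemma theta_lift_sum:
  fixes A :: "'f mat"
  assumes A: "A \<in> carrier_mat n n" "0 < n" and m: "0 < m" "coprime m p" "A ^\<^sub>m m = 1\<^sub>m n"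
  shows "\<theta> (\<Sum>\<zeta>\<in>#eigen A. root_lift p \<theta> \<zeta>) = to_ac (\<Sum>i<n. A $$ (i, i))"
proof -
  have e: "\<zeta> ^ m = 1" if "\<zeta> \<in># eigen A" for \<zeta> using eigen_root[OF A(1) that m(3)] .
  have "\<theta> (\<Sum>\<zeta>\<in>#eigen A. root_lift p \<theta> \<zeta>) = \<Sum>\<^sub># (image_mset \<theta> (image_mset (root_lift p \<theta>) (eigen A)))"
    by (rule theta_sum[OF m(1)]) (use root_lift(1)[OF m(1,2) e] in auto)
  also have "\<dots> = \<Sum>\<^sub># (image_mset (\<lambda>\<zeta>. \<zeta>) (eigen A))"
    unfolding multiset.map_comp comp_def
    by (rule arg_cong[of _ _ sum_mset], rule image_mset_cong) (rule root_lift(2)[OF m(1,2) e])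
  finally show ?thesis using eigen_facts(2)[OF A] by simp
qed

lemma lift_sum_one:
  assumes "0 < n"
  shows "(\<Sum>\<zeta>\<in>#eigen (1\<^sub>m n :: 'f mat). root_lift p \<theta> \<zeta>) = of_nat n"
proof -
  have e: "\<zeta> = 1" if "\<zeta> \<in># eigen (1\<^sub>m n :: 'f mat)" for \<zeta> using eigen_root[OF one_carrier_mat that, of 1] by simp
  have "root_lift p \<theta> 1 \<in> rt 1" by (rule root_lift(1)) simp_all
  hence "root_lift p \<theta> 1 = 1" by (simp add: rt_def)
  hence "image_mset (root_lift p \<theta>) (eigen (1\<^sub>m n :: 'f mat)) = image_mset (\<lambda>_. 1) (eigen (1\<^sub>m n :: 'f mat))"
    using e by (intro image_mset_cong) auto
  thus ?thesis using eigen_facts(1)[of "1\<^sub>m n :: 'f mat" n] assms by simp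
qed

end

section \<open>Schur's lemma and isomorphism of matrix representations\<close>

lemma mult_mat_zero_vec: "A \<in> carrier_mat r c \<Longrightarrow> A *\<^sub>v 0\<^sub>v c = (0\<^sub>v r :: 'a::semiring_0 vec)"
  by (rule eq_vecI) (simp_all add: scalar_prod_def)

lemma mat_left_inverse_dim:
  fixes M :: "'a::field mat"
  assumes M: "M \<in> carrier_mat r c" and Q: "Q \<in> carrier_mat c r" and QM: "Q * M = 1\<^sub>m c"
  shows "c \<le> r"
proof -
  define f where "f a = (\<lambda>i. if i < r then \<Sum>j<c. M $$ (i, j) * a j else 0)" for a :: "nat \<Rightarrow> 'a"
  have "fv.dim (FS {..<c} :: (nat \<Rightarrow> 'a) set) \<le> fv.dim (FS {..<r} :: (nat \<Rightarrow> 'a) set)"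
  proof (rule dim_le_inj[of _ "{..<c}" f _ "{..<r}"])
    show "f (x + y) = f x + f y" for x y by (simp add: f_def fun_eq_iff ring_distribs sum.distrib)
    show "f (sc b x) = sc b (f x)" for b x by (simp add: f_def fun_eq_iff sum_distrib_left mult.left_commute)
    show "f x \<in> FS {..<r}" for x by (rule FS_I) (simp add: f_def)
    fix x :: "nat \<Rightarrow> 'a" assume x: "x \<in> FS {..<c}" "f x = 0"
    have "M *\<^sub>v vec c x = 0\<^sub>v r"
    proof (rule eq_vecI)
      fix i assume i: "i < dim_vec (0\<^sub>v r :: 'a vec)"
      have "(M *\<^sub>v vec c x) $ i = f x i" using i M by (simp add: f_def scalar_prod_def atLeast0LessThan)
      thus "(M *\<^sub>v vec c x) $ i = (0\<^sub>v r) $ i" using i x(2) by simp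
    qed (use M in simp)
    hence "(Q * M) *\<^sub>v vec c x = Q *\<^sub>v 0\<^sub>v r" using assoc_mult_mat_vec[OF Q M, of "vec c x"] by simp
    hence z: "vec c x = 0\<^sub>v c" using QM mult_mat_zero_vec[OF Q] by simp
    have "x j = 0" for j
      using z FS_D[OF x(1), of j] by (cases "j < c") (metis index_vec index_zero_vec(1), simp)
    thus "x = 0" by (simp add: fun_eq_iff)
  qed (auto simp: subspace_FS)
  thus ?thesis by (simp add: dim_FS)
qed

context fin_group
begin

definition iso_rep :: "nat \<Rightarrow> ('g \<Rightarrow> 'a::field mat) \<Rightarrow> ('g \<Rightarrow> 'a mat) \<Rightarrow> bool" where
  "iso_rep d \<rho> \<rho>' \<longleftrightarrow> (\<exists>P\<in>carrier_mat d d. \<exists>Q\<in>carrier_mat d d. P * Q = 1\<^sub>m d \<and> Q * P = 1\<^sub>m d \<and>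
     (\<forall>g\<in>carrier G. \<rho>' g = P * \<rho> g * Q))"

text \<open>Schur's lemma: kernel and image of a nonzero intertwiner are invariant, so it is
  bijective. Its inverse is assembled from preimages of the unit vectors, and equality of the
  degrees follows from the two one-sided inverses.\<close>

lemma not_disj_iso:
  fixes \<rho> \<rho>' :: "'g \<Rightarrow> 'a::field mat"
  assumes irr: "irred_rep G d \<rho>" "irred_rep G d' \<rho>'" and nd: "\<not> disj_rep d \<rho> d' \<rho>'"
  shows "d' = d \<and> iso_rep d \<rho> \<rho>'"
proof -
  obtain M where M: "M \<in> carrier_mat d' d" "\<And>g. g \<in> carrier G \<Longrightarrow> M * \<rho> g = \<rho>' g * M" "M \<noteq> 0\<^sub>m d' d"
    using nd unfolding disj_rep_def by blast
  have rc: "\<rho> g \<in> carrier_mat d d" "\<rho>' g \<in> carrier_mat d' d'" if "g \<in> carrier G" for g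
    using irr that by (auto simp: irred_rep_def mat_rep_def)
  have tw: "M *\<^sub>v (\<rho> g *\<^sub>v w) = \<rho>' g *\<^sub>v (M *\<^sub>v w)" if "g \<in> carrier G" "w \<in> carrier_vec d" for g w
    using M(2)[OF that(1)] assoc_mult_mat_vec[OF M(1) rc(1)[OF that(1)] that(2)]
      assoc_mult_mat_vec[OF rc(2)[OF that(1)] M(1) that(2)] by simp
  define K where "K = {w \<in> carrier_vec d. M *\<^sub>v w = 0\<^sub>v d'}"
  have "K = {0\<^sub>v d} \<or> K = carrier_vec d"
  proof (rule irred_rep_cases[OF irr(1)])
    show "\<rho> g *\<^sub>v x \<in> K" if "g \<in> carrier G" "x \<in> K" for g x
    proof -
      have "\<rho>' g *\<^sub>v 0\<^sub>v d' = 0\<^sub>v d'" by (rule mult_mat_zero_vec[OF rc(2)[OF that(1)]])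
      moreover have "\<rho> g *\<^sub>v x \<in> carrier_vec d" using rc(1)[OF that(1)] that(2) by (auto simp: K_def)
      ultimately show ?thesis using that tw by (simp add: K_def)
    qed
    show "x + y \<in> K" if "x \<in> K" "y \<in> K" for x y
      using that M(1) by (auto simp: K_def mult_add_distrib_mat_vec)
    show "c \<cdot>\<^sub>v x \<in> K" if "x \<in> K" for c x
      using that M(1) by (auto simp: K_def mult_mat_vec)
    show "0\<^sub>v d \<in> K" using mult_mat_zero_vec[OF M(1)] by (simp add: K_def)
  qed (auto simp: K_def)
  moreover have "K \<noteq> carrier_vec d"
  proof
    assume K: "K = carrier_vec d"
    have "M = 0\<^sub>m d' d"
    proof (rule eq_matI)
      fix i j assume ij: "i < dim_row (0\<^sub>m d' d :: 'a mat)" "j < dim_col (0\<^sub>m d' d :: 'a mat)"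
      have "unit_vec d j \<in> K" using K by simp
      moreover have "M *\<^sub>v unit_vec d j = col M j" using M(1) ij by (intro eq_vecI) auto
      ultimately have "col M j = 0\<^sub>v d'" by (simp add: K_def)
      moreover have "col M j $ i = M $$ (i, j)" using ij M(1) by simp
      ultimately show "M $$ (i, j) = 0\<^sub>m d' d $$ (i, j)" using ij by simp
    qed (use M(1) in auto)
    thus False using M(3) by simp
  qed
  ultimately have K0: "K = {0\<^sub>v d}" by blast
  define R where "R = (\<lambda>w. M *\<^sub>v w) ` carrier_vec d"
  have "R = {0\<^sub>v d'} \<or> R = carrier_vec d'"
  proof (rule irred_rep_cases[OF irr(2)])
    show "R \<subseteq> carrier_vec d'" using M(1) by (auto simp: R_def)
    have "0\<^sub>v d' = M *\<^sub>v 0\<^sub>v d" by (rule mult_mat_zero_vec[OF M(1), symmetric])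
    thus "0\<^sub>v d' \<in> R" unfolding R_def by (rule image_eqI) simp
    fix x assume "x \<in> R"
    then obtain w where w: "w \<in> carrier_vec d" "x = M *\<^sub>v w" by (auto simp: R_def)
    have "c \<cdot>\<^sub>v x = M *\<^sub>v (c \<cdot>\<^sub>v w)" for c using w M(1) by (simp add: mult_mat_vec)
    thus "c \<cdot>\<^sub>v x \<in> R" for c unfolding R_def by (rule image_eqI) (use w in simp)
    show "x + y \<in> R" if y: "y \<in> R" for y
    proof -
      obtain u where u: "u \<in> carrier_vec d" "y = M *\<^sub>v u" using y by (auto simp: R_def)
      have "x + y = M *\<^sub>v (w + u)" using w u M(1) by (simp add: mult_add_distrib_mat_vec)
      thus ?thesis unfolding R_def by (rule image_eqI) (use w u in simp)
    qed
    fix g assume g: "g \<in> carrier G"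
    have "\<rho>' g *\<^sub>v x = M *\<^sub>v (\<rho> g *\<^sub>v w)" using tw[OF g w(1)] w(2) by simp
    moreover have "\<rho> g *\<^sub>v w \<in> carrier_vec d" using rc(1)[OF g] w(1) by simp
    ultimately show "\<rho>' g *\<^sub>v x \<in> R" unfolding R_def by (rule image_eqI)
  qed
  moreover have "R \<noteq> {0\<^sub>v d'}"
  proof
    assume R: "R = {0\<^sub>v d'}"
    have "K = carrier_vec d"
    proof
      show "carrier_vec d \<subseteq> K"
      proof
        fix w :: "'a vec" assume w: "w \<in> carrier_vec d"
        hence "M *\<^sub>v w \<in> R" unfolding R_def by (rule imageI)
        thus "w \<in> K" using w R by (simp add: K_def)
      qed
    qed (auto simp: K_def)
    thus False using \<open>K \<noteq> carrier_vec d\<close> by blast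
  qed
  ultimately have R: "R = carrier_vec d'" by blast
  have "\<forall>i. \<exists>w. w \<in> carrier_vec d \<and> M *\<^sub>v w = unit_vec d' i"
  proof
    fix i
    have "unit_vec d' i \<in> R" using R by simp
    thus "\<exists>w. w \<in> carrier_vec d \<and> M *\<^sub>v w = unit_vec d' i" unfolding R_def by force
  qed
  then obtain u where u: "\<And>i. u i \<in> carrier_vec d" "\<And>i. M *\<^sub>v u i = unit_vec d' i" by metis
  define Q where "Q = mat d d' (\<lambda>(r, i). u i $ r)"
  have Q: "Q \<in> carrier_mat d d'" by (simp add: Q_def)
  have Qc: "col Q i = u i" if "i < d'" for i using that u(1)[of i] by (intro eq_vecI) (auto simp: Q_def)
  have MQ: "M * Q = 1\<^sub>m d'"
  proof (rule eq_matI)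
    fix i j assume ij: "i < dim_row (1\<^sub>m d' :: 'a mat)" "j < dim_col (1\<^sub>m d' :: 'a mat)"
    have "(M * Q) $$ (i, j) = (M *\<^sub>v u j) $ i" using ij M(1) Q Qc by simp
    thus "(M * Q) $$ (i, j) = 1\<^sub>m d' $$ (i, j)" using ij by (simp add: u(2))
  qed (use M(1) Q in auto)
  have inj: "w = w'" if w: "w \<in> carrier_vec d" "w' \<in> carrier_vec d" "M *\<^sub>v w = M *\<^sub>v w'" for w w'
  proof -
    have "M *\<^sub>v (w - w') = 0\<^sub>v d'" using w M(1) by (simp add: mult_minus_distrib_mat_vec)
    hence "w - w' \<in> K" using w by (simp add: K_def)
    hence "w - w' = 0\<^sub>v d" using K0 by simp
    thus ?thesis using w by (metis eq_vecI carrier_vecD index_minus_vec(1) index_zero_vec(1) right_minus_eq)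
  qed
  have QM: "Q * M = 1\<^sub>m d"
  proof (rule mat_col_eqI)
    fix j assume j: "j < dim_col (1\<^sub>m d :: 'a mat)"
    have "M *\<^sub>v col (Q * M) j = col (M * (Q * M)) j"
      using j by (intro col_mult2[OF M(1) mult_carrier_mat[OF Q M(1)], symmetric]) simp
    also have "M * (Q * M) = (M * Q) * M" by (rule assoc_mult_mat[OF M(1) Q M(1), symmetric])
    also have "\<dots> = M" using MQ M(1) by simp
    also have "col M j = M *\<^sub>v col (1\<^sub>m d) j" using j M(1) by (intro eq_vecI) auto
    finally have eq: "M *\<^sub>v col (Q * M) j = M *\<^sub>v col (1\<^sub>m d) j" .
    show "col (Q * M) j = col (1\<^sub>m d) j" by (rule inj[OF _ _ eq]) (use j M(1) Q in auto)
  qed (use M(1) Q in auto)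
  have "d \<le> d'" by (rule mat_left_inverse_dim[OF M(1) Q QM])
  moreover have "d' \<le> d" by (rule mat_left_inverse_dim[OF Q M(1) MQ])
  ultimately have dd: "d' = d" by simp
  have "\<rho>' g = M * \<rho> g * Q" if g: "g \<in> carrier G" for g
  proof -
    have "M * \<rho> g * Q = \<rho>' g * (M * Q)" unfolding M(2)[OF g] by (rule assoc_mult_mat[OF rc(2)[OF g] M(1) Q])
    thus ?thesis using MQ rc(2)[OF g] by simp
  qed
  thus ?thesis using dd M(1) Q MQ QM unfolding iso_rep_def by blast
qed

lemma iso_rep_sym:
  fixes \<rho> \<rho>' :: "'g \<Rightarrow> 'a::field mat"
  assumes "iso_rep d \<rho> \<rho>'" "mat_rep G d \<rho>"
  shows "iso_rep d \<rho>' \<rho>"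
proof -
  obtain P Q where PQ: "P \<in> carrier_mat d d" "Q \<in> carrier_mat d d" "P * Q = 1\<^sub>m d" "Q * P = 1\<^sub>m d"
     "\<And>g. g \<in> carrier G \<Longrightarrow> \<rho>' g = P * \<rho> g * Q" using assms(1) unfolding iso_rep_def by blast
  have "\<rho> g = Q * \<rho>' g * P" if g: "g \<in> carrier G" for g
  proof -
    have r: "\<rho> g \<in> carrier_mat d d" using assms(2) g by (simp add: mat_rep_def)
    have "Q * (P * \<rho> g * Q) * P = (Q * P) * \<rho> g * (Q * P)"
      using r PQ(1,2) by (simp add: assoc_mult_mat[of _ d d _ d _ d])
    thus ?thesis using PQ(5)[OF g] PQ(4) r by simp
  qed
  thus ?thesis using PQ unfolding iso_rep_def by blast
qed

lemma iso_rep_cf: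
  fixes \<rho> \<rho>' :: "'g \<Rightarrow> 'a::field mat"
  assumes "iso_rep d \<rho> \<rho>'" "mat_rep G d \<rho>"
  shows "\<exists>P Q. (\<forall>i<d. \<forall>j<d. \<forall>a. cf \<rho>' i j a = (\<Sum>s<d. \<Sum>r<d. P i r * cf \<rho> r s a * Q s j)) \<and>
    (\<forall>i<d. \<forall>j<d. (\<Sum>r<d. P i r * Q r j) = (if i = j then 1 else 0))"
proof -
  obtain P Q where PQ: "P \<in> carrier_mat d d" "Q \<in> carrier_mat d d" "P * Q = 1\<^sub>m d" "Q * P = 1\<^sub>m d"
     "\<And>g. g \<in> carrier G \<Longrightarrow> \<rho>' g = P * \<rho> g * Q" using assms(1) unfolding iso_rep_def by blast
  have e: "\<rho>' g $$ (i, j) = (\<Sum>s<d. \<Sum>r<d. P $$ (i, r) * \<rho> g $$ (r, s) * Q $$ (s, j))"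
    if g: "g \<in> carrier G" and ij: "i < d" "j < d" for g i j
  proof -
    have r: "\<rho> g \<in> carrier_mat d d" using assms(2) g by (simp add: mat_rep_def)
    define R where "R = P * \<rho> g"
    have R: "R \<in> carrier_mat d d" using r PQ(1) by (simp add: R_def)
    have "(R * Q) $$ (i, j) = (\<Sum>s<d. R $$ (i, s) * Q $$ (s, j))"
      using R PQ(2) ij by (simp add: scalar_prod_def atLeast0LessThan)
    also have "\<dots> = (\<Sum>s<d. (\<Sum>r<d. P $$ (i, r) * \<rho> g $$ (r, s)) * Q $$ (s, j))"
      using r PQ(1) ij by (intro sum.cong refl) (simp add: R_def scalar_prod_def atLeast0LessThan)
    finally show ?thesis using PQ(5)[OF g] by (simp add: R_def sum_distrib_right)
  qed
  show ?thesis
  proof (rule exI[of _ "\<lambda>i r. P $$ (i, r)"], rule exI[of _ "\<lambda>s j. Q $$ (s, j)"], intro conjI allI impI)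
    fix i j a assume ij: "i < d" "j < d"
    have "cf \<rho>' i j a = (\<Sum>g\<in>carrier G. \<Sum>s<d. \<Sum>r<d. P $$ (i, r) * (a g * \<rho> g $$ (r, s)) * Q $$ (s, j))"
      unfolding cf_def using e[OF _ ij] by (intro sum.cong refl) (simp add: sum_distrib_left mult_ac)
    also have "\<dots> = (\<Sum>s<d. \<Sum>g\<in>carrier G. \<Sum>r<d. P $$ (i, r) * (a g * \<rho> g $$ (r, s)) * Q $$ (s, j))"
      by (rule sum.swap)
    also have "\<dots> = (\<Sum>s<d. \<Sum>r<d. \<Sum>g\<in>carrier G. P $$ (i, r) * (a g * \<rho> g $$ (r, s)) * Q $$ (s, j))"
      by (rule sum.cong[OF refl]) (rule sum.swap)
    also have "\<dots> = (\<Sum>s<d. \<Sum>r<d. P $$ (i, r) * cf \<rho> r s a * Q $$ (s, j))"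
      by (simp add: cf_def sum_distrib_left sum_distrib_right mult.assoc)
    finally show "cf \<rho>' i j a = (\<Sum>s<d. \<Sum>r<d. P $$ (i, r) * cf \<rho> r s a * Q $$ (s, j))" .
  next
    fix i j assume ij: "i < d" "j < d"
    have "(\<Sum>r<d. P $$ (i, r) * Q $$ (r, j)) = (P * Q) $$ (i, j)"
      using PQ(1,2) ij by (simp add: scalar_prod_def atLeast0LessThan)
    thus "(\<Sum>r<d. P $$ (i, r) * Q $$ (r, j)) = (if i = j then 1 else 0)" using PQ(3) ij by simp
  qed
qed

lemma iso_rep_scalar:
  fixes \<rho> \<rho>' :: "'g \<Rightarrow> 'a::field mat"
  assumes iso: "iso_rep d \<rho> \<rho>'" "mat_rep G d \<rho>"
    and c: "\<And>i j. i < d \<Longrightarrow> j < d \<Longrightarrow> cf \<rho> i j a = (if i = j then c else 0)"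
    and ij: "i < d" "j < d"
  shows "cf \<rho>' i j a = (if i = j then c else 0)"
proof -
  obtain P Q where PQ: "\<forall>i<d. \<forall>j<d. \<forall>a. cf \<rho>' i j a = (\<Sum>s<d. \<Sum>r<d. P i r * cf \<rho> r s a * Q s j)"
    "\<forall>i<d. \<forall>j<d. (\<Sum>r<d. P i r * Q r j) = (if i = j then 1 else 0)"
    using iso_rep_cf[OF iso] by blast
  have "cf \<rho>' i j a = (\<Sum>s<d. \<Sum>r<d. if r = s then c * (P i s * Q s j) else 0)"
    unfolding PQ(1)[rule_format, OF ij] using c by (intro sum.cong refl) auto
  also have "\<dots> = c * (\<Sum>s<d. P i s * Q s j)" by (simp add: sum_distrib_left)
  finally show ?thesis using PQ(2) ij by simp
qed

lemma iso_rep_eigen: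
  fixes \<rho> \<rho>' :: "'g \<Rightarrow> 'a::field mat"
  assumes "iso_rep d \<rho> \<rho>'" "mat_rep G d \<rho>" "g \<in> carrier G"
  shows "char_poly (\<rho>' g) = char_poly (\<rho> g)"
proof -
  obtain P Q where PQ: "P \<in> carrier_mat d d" "Q \<in> carrier_mat d d" "P * Q = 1\<^sub>m d" "Q * P = 1\<^sub>m d"
     "\<rho>' g = P * \<rho> g * Q" using assms(1,3) unfolding iso_rep_def by blast
  have r: "\<rho> g \<in> carrier_mat d d" using assms by (simp add: mat_rep_def)
  have "similar_mat (\<rho>' g) (\<rho> g)"
    by (rule similar_matI[of _ _ P Q d]) (use PQ r in auto)
  thus ?thesis by (rule char_poly_similar)
qed

lemma disj_rep_sym:
  fixes \<rho> \<rho>' :: "'g \<Rightarrow> 'a::field mat"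
  assumes irr: "irred_rep G d \<rho>" "irred_rep G d' \<rho>'" and dis: "disj_rep d \<rho> d' \<rho>'"
  shows "disj_rep d' \<rho>' d \<rho>"
proof (rule ccontr)
  assume "\<not> disj_rep d' \<rho>' d \<rho>"
  hence d: "d = d'" and iso: "iso_rep d' \<rho>' \<rho>" using not_disj_iso[OF irr(2,1)] by auto
  obtain P Q where PQ: "P \<in> carrier_mat d d" "Q \<in> carrier_mat d d" "P * Q = 1\<^sub>m d" "Q * P = 1\<^sub>m d"
     "\<And>g. g \<in> carrier G \<Longrightarrow> \<rho> g = P * \<rho>' g * Q" using iso unfolding iso_rep_def d by blast
  have "Q * \<rho> g = \<rho>' g * Q" if g: "g \<in> carrier G" for g
  proof -
    have r: "\<rho>' g \<in> carrier_mat d d" using irred_rep_mat(1)[OF irr(2)] g d by (simp add: mat_rep_def)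
    have "Q * (P * \<rho>' g * Q) = (Q * P) * \<rho>' g * Q"
      using r PQ(1,2) by (simp add: assoc_mult_mat[of _ d d _ d _ d])
    thus ?thesis using PQ(5)[OF g] PQ(4) r by simp
  qed
  hence "Q = 0\<^sub>m d d" using dis PQ(2) unfolding disj_rep_def d by blast
  hence "(0\<^sub>m d d :: 'a mat) = 1\<^sub>m d" using PQ(1,3) by simp
  hence "(0\<^sub>m d d :: 'a mat) $$ (0, 0) = 1\<^sub>m d $$ (0, 0)" by simp
  thus False using irred_rep_mat(2)[OF irr(1)] by simp
qed

lemma rep_pow: "mat_rep G d \<rho> \<Longrightarrow> g \<in> carrier G \<Longrightarrow> \<rho> g ^\<^sub>m k = \<rho> (g [^] k)"
proof (induction k)
  case 0 thus ?case by (auto simp: mat_rep_def)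
next
  case (Suc k) thus ?case by (simp add: mat_rep_def)
qed

lemma central_scalar:
  fixes \<rho> :: "'g \<Rightarrow> 'a::field mat"
  assumes split: "splitting_field TYPE('a) G" and irr: "irred_rep G d \<rho>"
    and z: "\<And>g. g \<in> carrier G \<Longrightarrow> z \<star> sing g = sing g \<star> z"
  shows "\<exists>c. \<forall>i<d. \<forall>j<d. cf \<rho> i j z = (if i = j then c else 0)"
proof -
  have rep: "mat_rep G d \<rho>" using irr by (rule irred_rep_mat)
  have "rep_extend G d \<rho> z * \<rho> g = \<rho> g * rep_extend G d \<rho> z" if g: "g \<in> carrier G" for g
  proof -
    have r: "\<rho> g \<in> carrier_mat d d" using rep g by (simp add: mat_rep_def)
    show ?thesis
    proof (rule eq_matI)
      fix i j assume "i < dim_row (\<rho> g * rep_extend G d \<rho> z)" "j < dim_col (\<rho> g * rep_extend G d \<rho> z)"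
      hence ij: "i < d" "j < d" using r rep_extend_carrier[of d \<rho> z] by auto
      have "(rep_extend G d \<rho> z * \<rho> g) $$ (i, j) = cf \<rho> i j (z \<star> sing g)"
        unfolding cf_mult[OF rep ij] using ij r rep_extend_carrier[of d \<rho> z] g
        by (simp add: scalar_prod_def atLeast0LessThan rep_extend_index cf_sing)
      also have "\<dots> = cf \<rho> i j (sing g \<star> z)" using z[OF g] by simp
      also have "\<dots> = (\<rho> g * rep_extend G d \<rho> z) $$ (i, j)"
        unfolding cf_mult[OF rep ij] using ij r rep_extend_carrier[of d \<rho> z] g
        by (simp add: scalar_prod_def atLeast0LessThan rep_extend_index cf_sing)
      finally show "(rep_extend G d \<rho> z * \<rho> g) $$ (i, j) = (\<rho> g * rep_extend G d \<rho> z) $$ (i, j)" .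
    qed (use r rep_extend_carrier[of d \<rho> z] in auto)
  qed
  then obtain c where "rep_extend G d \<rho> z = c \<cdot>\<^sub>m 1\<^sub>m d"
    using split irr rep_extend_carrier unfolding splitting_field_def by blast
  hence "cf \<rho> i j z = (if i = j then c else 0)" if "i < d" "j < d" for i j
    using that rep_extend_index[of i d j \<rho> z] by (auto split: if_splits)
  thus ?thesis by blast
qed

lemma cf_pow_scalar:
  fixes \<rho> :: "'g \<Rightarrow> 'a::field mat"
  assumes "mat_rep G d \<rho>" and "\<And>i j. i < d \<Longrightarrow> j < d \<Longrightarrow> cf \<rho> i j a = (if i = j then c else 0)"
    and "i < d" "j < d"
  shows "cf \<rho> i j (pw A1 a n) = (if i = j then c ^ n else 0)"
  using assms(3,4)
proof (induction n arbitrary: i j)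
  case 0 thus ?case using mat_rep_one[OF assms(1)] by (simp add: cf_sing)
next
  case (Suc n)
  have "cf \<rho> i j (pw A1 a (Suc n)) = (\<Sum>r<d. if r = i then c * (if i = j then c ^ n else 0) else 0)"
    unfolding pw.simps cf_mult[OF assms(1) Suc.prems] by (rule sum.cong[OF refl]) (use Suc assms(2) in auto)
  thus ?case using Suc.prems by simp
qed

lemma cf_scalar_mult:
  fixes \<rho> :: "'g \<Rightarrow> 'a::field mat"
  assumes "mat_rep G d \<rho>" and "\<And>i j. i < d \<Longrightarrow> j < d \<Longrightarrow> cf \<rho> i j a = (if i = j then c else 0)"
    and "i < d" "j < d"
  shows "cf \<rho> i j (a \<star> b) = c * cf \<rho> i j b"
proof -
  have "cf \<rho> i j (a \<star> b) = (\<Sum>r<d. if r = i then c * cf \<rho> i j b else 0)"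
    unfolding cf_mult[OF assms(1,3,4)] by (rule sum.cong[OF refl]) (use assms(2,3) in auto)
  thus ?thesis using assms(3) by simp
qed

text \<open>Ensures that the idempotent which \<open>fitting\<close> extracts from a central element
  is central.\<close>

lemma pev_comm:
  "(\<And>a. a \<in> FS (carrier G) \<Longrightarrow> u \<star> a = a \<star> u) \<Longrightarrow> (\<And>a. a \<in> FS (carrier G) \<Longrightarrow> y \<star> a = a \<star> y) \<Longrightarrow>
    a \<in> FS (carrier G) \<Longrightarrow> pev u y f \<star> a = a \<star> pev u y f"
proof (induction f)
  case (pCons c f)
  have "y \<star> pev u y f \<star> a = y \<star> (a \<star> pev u y f)" using pCons by (simp add: conv_assoc)
  also have "\<dots> = a \<star> y \<star> pev u y f" using pCons.prems(2,3) by (simp add: conv_assoc[symmetric])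
  finally have "(sc c u + y \<star> pev u y f) \<star> a = a \<star> (sc c u + y \<star> pev u y f)"
    using pCons.prems(1)[OF pCons.prems(3)]
    by (simp only: conv_add_left conv_add_right conv_sc_left conv_sc_right conv_assoc)
  thus ?case unfolding pev_pCons .
qed simp

text \<open>The exponent is the full power of \<open>p\<close> in the group order.\<close>

lemma p_regular_power:
  assumes "prime p"
  obtains k where "\<And>g. g \<in> carrier G \<Longrightarrow> g [^] (p ^ k) \<in> p_regular G p"
proof -
  have c0: "Coset.order G \<noteq> 0" using fin by (simp add: Coset.order_def card_eq_0_iff) (use one_closed in blast)
  then obtain k m where km: "Coset.order G = p ^ k * m" "\<not> p dvd m"
    using assms by (metis multiplicity_decompose' not_prime_unit)
  show ?thesis
  proof (rule that[of k])
    fix g assume g: "g \<in> carrier G"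
    have "(g [^] (p ^ k)) [^] m = \<one>" using g km(1) pow_order_eq_1[OF g] by (simp add: nat_pow_pow)
    hence "group.ord G (g [^] (p ^ k)) dvd m" using g by (simp add: pow_eq_id)
    thus "g [^] (p ^ k) \<in> p_regular G p" using km(2) g dvd_trans unfolding p_regular_def by blast
  qed
qed

end

section \<open>Irreducible Brauer characters and blocks\<close>

locale rep_sys = fin_group G + mod_sys p v red \<theta>
  for G :: "('g, 'm) monoid_scheme" (structure) and p :: nat and v :: "'k::field_char_0 \<Rightarrow> int"
    and red :: "'k \<Rightarrow> 'f::field" and \<theta> :: "'k alg_closure \<Rightarrow> 'f alg_closure" +
  assumes split: "splitting_field TYPE('f) G"
begin

abbreviation br :: "('g \<Rightarrow> 'f mat) \<Rightarrow> 'g \<Rightarrow> 'k alg_closure" where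
  "br \<rho> \<equiv> brauer_character G p \<theta> \<rho>"

lemma one_p_regular: "\<one> \<in> p_regular G p"
  using p by (auto simp: p_regular_def)

lemma br_at: "g \<in> p_regular G p \<Longrightarrow> br \<rho> g = (\<Sum>\<zeta>\<in>#eigen (\<rho> g). root_lift p \<theta> \<zeta>)"
  by (simp add: brauer_character_def eigen_def)

lemma theta_br:
  assumes "mat_rep G d \<rho>" "0 < d" "g \<in> p_regular G p"
  shows "\<theta> (br \<rho> g) = to_ac (\<Sum>i<d. \<rho> g $$ (i, i))"
  unfolding br_at[OF assms(3)]
proof (rule theta_lift_sum)
  have g: "g \<in> carrier G" "\<not> p dvd group.ord G g" using assms(3) by (auto simp: p_regular_def)
  show "\<rho> g \<in> carrier_mat d d" using assms(1) g by (simp add: mat_rep_def)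
  show "0 < group.ord G g" using ord_ge_1[OF fin g(1)] by simp
  show "coprime (group.ord G g) p" using prime_imp_coprime[OF p g(2)] by (simp add: coprime_commute)
  show "\<rho> g ^\<^sub>m group.ord G g = 1\<^sub>m d"
    using rep_pow[OF assms(1) g(1)] pow_ord_eq_1[OF g(1)] assms(1) by (simp add: mat_rep_def)
qed (rule assms)

lemma br_one: "mat_rep G d \<rho> \<Longrightarrow> 0 < d \<Longrightarrow> br \<rho> \<one> = of_nat d"
  unfolding br_at[OF one_p_regular] using lift_sum_one by (simp add: mat_rep_def)

lemma iso_br:
  assumes "iso_rep d \<rho> \<rho>'" "mat_rep G d \<rho>"
  shows "br \<rho>' = br \<rho>"
proof
  fix g
  show "br \<rho>' g = br \<rho> g"
    using iso_rep_eigen[OF assms, of g] by (auto simp: brauer_character_def restrict_def p_regular_def)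
qed

text \<open>Density yields \<open>a\<close> acting as a diagonal matrix unit on
  \<open>\<rho>\<close> and as zero on \<open>\<rho>'\<close>, and so do its powers. By
  \<open>word_rotate_sum\<close> the trace of the \<open>q\<close>-th power involves only the traces
  at the elements \<open>g [^] q\<close>, which are \<open>p\<close>-regular, where equal Brauer
  characters give equal traces. This yields 1 = 0.\<close>

lemma br_iso:
  assumes irr: "irred_rep G d \<rho>" "irred_rep G d' \<rho>'" and eq: "br \<rho> = br \<rho>'"
  shows "\<not> disj_rep d \<rho> d' \<rho>'"
proof
  assume dis: "disj_rep d \<rho> d' \<rho>'"
  have d: "0 < d" "0 < d'" and rep: "mat_rep G d \<rho>" "mat_rep G d' \<rho>'" using irr irred_rep_mat by auto
  define dd where "dd b = (if b then d else d')" for b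
  define rr where "rr b = (if b then \<rho> else \<rho>')" for b
  define L where "L = (SIGMA b:(UNIV :: bool set). {..<dd b})"
  have "\<exists>a\<in>FS (carrier G). \<forall>l\<in>L. \<forall>i<dd (fst l). cf (rr (fst l)) i (snd l) a = (if fst l \<and> snd l = 0 \<and> i = 0 then 1 else 0)"
    by (rule density[OF split, of UNIV dd rr L])
       (use irr dis disj_rep_sym[OF irr dis] in \<open>auto simp: dd_def rr_def L_def\<close>)
  then obtain a where a: "a \<in> FS (carrier G)"
    "\<forall>l\<in>L. \<forall>i<dd (fst l). cf (rr (fst l)) i (snd l) a = (if fst l \<and> snd l = 0 \<and> i = 0 then 1 else 0)" by blast
  have a1: "cf \<rho> i j a = (if i = 0 \<and> j = 0 then 1 else 0)" if "i < d" "j < d" for i j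
  proof -
    have "(True, j) \<in> L" using that by (simp add: L_def dd_def)
    from a(2)[rule_format, OF this, of i] show ?thesis using that by (simp add: dd_def rr_def conj_commute)
  qed
  have a2: "cf \<rho>' i j a = 0" if "i < d'" "j < d'" for i j
  proof -
    have "(False, j) \<in> L" using that by (simp add: L_def dd_def)
    from a(2)[rule_format, OF this, of i] show ?thesis using that by (simp add: dd_def rr_def)
  qed
  have pw1: "cf \<rho> i j (pw A1 a (Suc n)) = (if i = 0 \<and> j = 0 then 1 else 0)" if "i < d" "j < d" for i j n
    using that
  proof (induction n arbitrary: i j)
    case 0
    have "pw A1 a (Suc 0) = a" using a(1) by simp
    thus ?case using a1 0 by simp
  next
    case (Suc n)
    have "cf \<rho> i j (pw A1 a (Suc (Suc n))) = (\<Sum>r<d. cf \<rho> i r a * cf \<rho> r j (pw A1 a (Suc n)))"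
      unfolding pw.simps(2)[of _ _ "Suc n"] by (rule cf_mult[OF rep(1) Suc.prems])
    also have "\<dots> = (\<Sum>r<d. if r = 0 then (if i = 0 \<and> j = 0 then 1 else 0) else 0)"
      by (rule sum.cong[OF refl]) (use Suc a1 in auto)
    finally show ?case using d by simp
  qed
  have pw2: "cf \<rho>' i j (pw A1 a (Suc n)) = 0" if "i < d'" "j < d'" for i j n
    using cf_mult[OF rep(2) that, of a "pw A1 a n"] a2[OF that(1)] by simp
  obtain k where k: "\<And>g. g \<in> carrier G \<Longrightarrow> g [^] (p ^ k) \<in> p_regular G p" by (rule p_regular_power[OF p]) blast
  define q where "q = p ^ k"
  have "q \<noteq> 0" using p by (auto simp: q_def dest: prime_gt_0_nat)
  then obtain n where n: "q = Suc n" using not0_implies_Suc by blast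
  define tr where "tr \<sigma> c g = (\<Sum>i<c. \<sigma> g $$ (i, i))" for \<sigma> :: "'g \<Rightarrow> 'f mat" and c g
  have trcf: "(\<Sum>g\<in>carrier G. tr \<sigma> c g * b g) = (\<Sum>i<c. cf \<sigma> i i b)" for \<sigma> c b
    unfolding tr_def cf_def sum_distrib_right by (subst sum.swap) (simp add: mult.commute)
  have trc: "tr \<sigma> c (g \<otimes> h) = tr \<sigma> c (h \<otimes> g)" if "mat_rep G c \<sigma>" "g \<in> carrier G" "h \<in> carrier G" for \<sigma> c g h
  proof -
    have "tr \<sigma> c (g \<otimes> h) = (\<Sum>i<c. \<Sum>r<c. \<sigma> g $$ (i, r) * \<sigma> h $$ (r, i))"
      unfolding tr_def by (intro sum.cong refl mat_rep_mult[OF that]) auto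
    also have "\<dots> = (\<Sum>r<c. \<Sum>i<c. \<sigma> h $$ (r, i) * \<sigma> g $$ (i, r))" by (subst sum.swap) (simp add: mult.commute)
    also have "\<dots> = tr \<sigma> c (h \<otimes> g)"
      unfolding tr_def by (intro sum.cong refl mat_rep_mult[OF that(1,3,2), symmetric]) auto
    finally show ?thesis .
  qed
  have treq: "tr \<rho> d h = tr \<rho>' d' h" if "h \<in> p_regular G p" for h
  proof -
    have "to_ac (tr \<rho> d h) = to_ac (tr \<rho>' d' h)"
      unfolding tr_def using theta_br[OF rep(1) d(1) that] theta_br[OF rep(2) d(2) that] eq by simp
    thus ?thesis by simp
  qed
  have "(\<Sum>g\<in>carrier G. tr \<rho> d g * pw A1 a q g) = (\<Sum>g\<in>carrier G. tr \<rho> d (g [^] q) * a g ^ q)"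
    by (rule word_rotate_sum[OF p ch q_def]) (rule trc[OF rep(1)])
  also have "\<dots> = (\<Sum>g\<in>carrier G. tr \<rho>' d' (g [^] q) * a g ^ q)"
    using treq[OF k] by (simp add: q_def)
  also have "\<dots> = (\<Sum>g\<in>carrier G. tr \<rho>' d' g * pw A1 a q g)"
    by (rule sym, rule word_rotate_sum[OF p ch q_def]) (rule trc[OF rep(2)])
  finally have e: "(\<Sum>i<d. cf \<rho> i i (pw A1 a q)) = (\<Sum>i<d'. cf \<rho>' i i (pw A1 a q))" by (simp only: trcf)
  have "(\<Sum>i<d. cf \<rho> i i (pw A1 a q)) = (\<Sum>i<d. if i = 0 then 1 else 0)"
    unfolding n by (rule sum.cong[OF refl]) (use pw1 in auto)
  hence "(\<Sum>i<d. cf \<rho> i i (pw A1 a q)) = 1" using d by simp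
  moreover have "(\<Sum>i<d'. cf \<rho>' i i (pw A1 a q)) = 0" unfolding n by (rule sum.neutral) (use pw2 in auto)
  ultimately show False using e by simp
qed

definition BC :: "('g \<Rightarrow> 'k alg_closure) set" where
  "BC = {\<phi>. \<exists>d \<rho>. irred_rep G d \<rho> \<and> \<phi> = br \<rho>}"

text \<open>Simple modules are indexed by their Brauer characters, with one chosen representation
  \<open>rp\<close> each. By \<open>br_iso\<close> the choice is unique up to isomorphism, so sums
  over Brauer characters are sums over simple modules.\<close>

definition dg :: "('g \<Rightarrow> 'k alg_closure) \<Rightarrow> nat" where
  "dg \<phi> = (SOME d. \<exists>\<rho>. irred_rep G d \<rho> \<and> \<phi> = br \<rho>)"

definition rp :: "('g \<Rightarrow> 'k alg_closure) \<Rightarrow> 'g \<Rightarrow> 'f mat" where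
  "rp \<phi> = (SOME \<rho>. irred_rep G (dg \<phi>) \<rho> \<and> \<phi> = br \<rho>)"

lemma rp: assumes "\<phi> \<in> BC" shows "irred_rep G (dg \<phi>) (rp \<phi>)" "br (rp \<phi>) = \<phi>" "mat_rep G (dg \<phi>) (rp \<phi>)" "0 < dg \<phi>"
proof -
  have "\<exists>\<rho>. irred_rep G (dg \<phi>) \<rho> \<and> \<phi> = br \<rho>"
    unfolding dg_def by (rule someI_ex) (use assms in \<open>auto simp: BC_def\<close>)
  from someI_ex[OF this, folded rp_def] show "irred_rep G (dg \<phi>) (rp \<phi>)" "br (rp \<phi>) = \<phi>" by auto
  thus "mat_rep G (dg \<phi>) (rp \<phi>)" "0 < dg \<phi>" using irred_rep_mat by auto
qed

lemma rp_disj: "k \<in> BC \<Longrightarrow> k' \<in> BC \<Longrightarrow> k \<noteq> k' \<Longrightarrow> disj_rep (dg k) (rp k) (dg k') (rp k')"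
  using not_disj_iso[OF rp(1) rp(1)] iso_br rp by metis

lemma rp_complete:
  assumes "irred_rep G d \<rho>"
  shows "br \<rho> \<in> BC" "dg (br \<rho>) = d" "iso_rep d (rp (br \<rho>)) \<rho>"
proof -
  show b: "br \<rho> \<in> BC" using assms by (auto simp: BC_def)
  have "\<not> disj_rep (dg (br \<rho>)) (rp (br \<rho>)) d \<rho>" by (rule br_iso[OF rp(1)[OF b] assms rp(2)[OF b]])
  from not_disj_iso[OF rp(1)[OF b] assms this] show "dg (br \<rho>) = d" "iso_rep d (rp (br \<rho>)) \<rho>" by auto
qed

lemma BC_degree: "\<phi> \<in> BC \<Longrightarrow> \<phi> \<one> = of_nat (dg \<phi>)"
  using br_one[OF rp(3,4)] rp(2) by metis

lemma character_degree_BC: "\<phi> \<in> BC \<Longrightarrow> character_degree G \<phi> = dg \<phi>"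
  unfolding character_degree_def by (rule the_equality) (auto simp: BC_degree)

text \<open>All columns of finitely many chosen representations at once in \<open>density\<close>,
  that is, surjectivity onto the product of the matrix algebras.\<close>

lemma slots_surj:
  assumes "finite \<Phi>" "\<Phi> \<subseteq> BC"
  shows "\<exists>a\<in>FS (carrier G). \<forall>k\<in>\<Phi>. \<forall>i<dg k. \<forall>j<dg k. cf (rp k) i j a = y k i j"
proof -
  have "\<exists>a\<in>FS (carrier G). \<forall>l\<in>(SIGMA k:\<Phi>. {..<dg k}). \<forall>i<dg (fst l). cf (rp (fst l)) i (snd l) a = y (fst l) i (snd l)"
    by (rule density[OF split, of BC dg rp]) (use assms rp rp_disj in auto)
  then obtain a where a: "a \<in> FS (carrier G)"
    "\<forall>l\<in>(SIGMA k:\<Phi>. {..<dg k}). \<forall>i<dg (fst l). cf (rp (fst l)) i (snd l) a = y (fst l) i (snd l)" by blast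
  show ?thesis
  proof (intro bexI[OF _ a(1)] ballI allI impI)
    fix k i j assume k: "k \<in> \<Phi>" "i < dg k" "j < dg k"
    hence "(k, j) \<in> (SIGMA k:\<Phi>. {..<dg k})" by simp
    from a(2)[rule_format, OF this, of i] k show "cf (rp k) i j a = y k i j" by simp
  qed
qed

text \<open>Elements acting as the identity on one simple module and as zero on the others are
  independent in the group algebra, which bounds their number.\<close>

lemma finite_BC: "finite BC"
proof (rule ccontr)
  assume inf: "infinite BC"
  obtain \<Phi> where F: "finite \<Phi>" "card \<Phi> = Suc (card (carrier G))" "\<Phi> \<subseteq> BC"
    using infinite_arbitrarily_large[OF inf] by blast
  have "\<forall>k0. \<exists>a. a \<in> FS (carrier G) \<and> (\<forall>k\<in>\<Phi>. \<forall>i<dg k. \<forall>j<dg k. cf (rp k) i j a = (if k = k0 then 1 else 0))"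
    using slots_surj[OF F(1,3), of "\<lambda>k i j. if k = _ then 1 else 0"] by blast
  then obtain a where a: "\<And>k0. a k0 \<in> FS (carrier G)"
    "\<And>k0 k i j. k \<in> \<Phi> \<Longrightarrow> i < dg k \<Longrightarrow> j < dg k \<Longrightarrow> cf (rp k) i j (a k0) = (if k = k0 then 1 else 0)" by metis
  have "card \<Phi> \<le> fv.dim (FS (carrier G) :: ('g \<Rightarrow> 'f) set)"
  proof (rule family_card_le_dim[OF F(1) _ a(1) subset_refl fin])
    fix c assume c: "(\<Sum>j\<in>\<Phi>. sc (c j) (a j)) = 0"
    show "\<forall>j\<in>\<Phi>. c j = 0"
    proof
      fix k assume k: "k \<in> \<Phi>"
      hence "0 < dg k" using rp(4) F(3) by blast
      hence "cf (rp k) 0 0 (\<Sum>j\<in>\<Phi>. sc (c j) (a j)) = (\<Sum>j\<in>\<Phi>. c j * (if k = j then 1 else 0))"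
        unfolding cf_sum cf_sc using a(2)[OF k] by simp
      also have "\<dots> = c k" using k F(1) by (simp add: if_distrib cong: if_cong)
      finally show "c k = 0" unfolding c by (simp add: cf_0)
    qed
  qed
  thus False using F(2) by (simp add: dim_FS[OF fin])
qed

lemma JF_I:
  assumes a: "a \<in> FS (carrier G)" and z: "\<And>k i j. k \<in> BC \<Longrightarrow> i < dg k \<Longrightarrow> j < dg k \<Longrightarrow> cf (rp k) i j a = 0"
  shows "a \<in> (JF :: ('g \<Rightarrow> 'f) set)"
  unfolding JF_def
proof (intro CollectI conjI allI impI a)
  fix d and \<rho> :: "'g \<Rightarrow> 'f mat" and i j assume irr: "irred_rep G d \<rho>" and ij: "i < d" "j < d"
  note c = rp_complete[OF irr]
  have "cf \<rho> i j a = (if i = j then 0 else 0)"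
    by (rule iso_rep_scalar[OF c(3) _ _ ij]) (use rp(3)[OF c(1)] z[OF c(1)] c(2) in auto)
  thus "cf \<rho> i j a = 0" by simp
qed

subsection \<open>Block idempotents\<close>

lemma group_algebra_simps:
  "carrier (group_algebra G) = FS (carrier G)" "monoid.mult (group_algebra G) = (\<star>)"
  "zero (group_algebra G) = 0" "add (group_algebra G) = (+)"
  by (auto simp: group_algebra_def FS_def conv_def fun_eq_iff)

abbreviation cidem :: "('g \<Rightarrow> 'f) set" where "cidem \<equiv> central_idempotents (group_algebra G)"
abbreviation bidem :: "('g \<Rightarrow> 'f) set" where "bidem \<equiv> block_idempotents (group_algebra G)"

lemma cidem_iff: "e \<in> cidem \<longleftrightarrow> e \<in> FS (carrier G) \<and> e \<star> e = e \<and> (\<forall>a\<in>FS (carrier G). a \<star> e = e \<star> a)"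
  by (auto simp: central_idempotents_def group_algebra_simps)

lemma block_algebra_eq: "e \<in> cidem \<Longrightarrow> block_algebra (group_algebra G) e = {y \<in> FS (carrier G). e \<star> y = y}"
  unfolding block_algebra_def group_algebra_simps
proof -
  assume e: "e \<in> cidem"
  have ee: "e \<star> e = e" and ec: "\<And>a. a \<in> FS (carrier G) \<Longrightarrow> a \<star> e = e \<star> a"
    using e unfolding cidem_iff by blast+
  have "e \<star> (a \<star> e) = a \<star> e" if "a \<in> FS (carrier G)" for a
    unfolding ec[OF that] using ee by (simp flip: conv_assoc)
  moreover have "y \<in> (\<lambda>a. a \<star> e) ` FS (carrier G)" if "y \<in> FS (carrier G)" "e \<star> y = y" for y
    by (rule image_eqI[OF _ that(1)]) (use that(2) ec[OF that(1)] in simp)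
  ultimately show "(\<lambda>a. a \<star> e) ` FS (carrier G) = {y \<in> FS (carrier G). e \<star> y = y}" by auto
qed

lemma bidem_cidem: "e \<in> bidem \<Longrightarrow> e \<in> cidem" "e \<in> bidem \<Longrightarrow> e \<noteq> 0"
  by (auto simp: block_idempotents_def group_algebra_simps)

lemma block_idem_eq:
  assumes "e \<in> bidem"
  shows "block_idem G (block_algebra (group_algebra G) e) = e"
  unfolding block_idem_def
proof (rule the_equality)
  show "e \<in> bidem \<and> block_algebra (group_algebra G) e = block_algebra (group_algebra G) e" using assms by simp
  fix e' assume e': "e' \<in> bidem \<and> block_algebra (group_algebra G) e = block_algebra (group_algebra G) e'"
  have c: "e \<in> cidem" "e' \<in> cidem" using assms e' bidem_cidem by auto
  have eq: "{y \<in> FS (carrier G). e \<star> y = y} = {y \<in> FS (carrier G). e' \<star> y = y}"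
    using e' block_algebra_eq[OF c(1)] block_algebra_eq[OF c(2)] by simp
  have "e \<in> {y \<in> FS (carrier G). e \<star> y = y}" "e' \<in> {y \<in> FS (carrier G). e' \<star> y = y}" using c unfolding cidem_iff by blast+
  hence "e' \<star> e = e" "e \<star> e' = e'" using eq by auto
  moreover have "e' \<star> e = e \<star> e'" using c unfolding cidem_iff by blast
  ultimately show "e' = e" by simp
qed

lemma bidem_prim:
  assumes e: "e \<in> bidem" and k: "k \<in> cidem"
  shows "k \<star> e = e \<or> k \<star> e = 0"
proof (rule ccontr)
  assume no: "\<not> ?thesis"
  have ec: "e \<in> FS (carrier G)" "e \<star> e = e" "\<And>a. a \<in> FS (carrier G) \<Longrightarrow> a \<star> e = e \<star> a"
    using bidem_cidem(1)[OF e] unfolding cidem_iff by blast+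
  have kc: "k \<in> FS (carrier G)" "k \<star> k = k" "\<And>a. a \<in> FS (carrier G) \<Longrightarrow> a \<star> k = k \<star> a"
    using k unfolding cidem_iff by blast+
  define f where "f = k \<star> e"
  have fc: "a \<star> f = f \<star> a" if "a \<in> FS (carrier G)" for a
  proof -
    have "a \<star> f = k \<star> a \<star> e" using kc(3)[OF that] by (simp add: f_def flip: conv_assoc)
    thus ?thesis using ec(3)[OF that] by (simp add: f_def conv_assoc)
  qed
  have fG: "f \<in> FS (carrier G)" by (simp add: f_def)
  have ef2: "f \<star> e = f" using ec(2) by (simp add: f_def conv_assoc)
  hence ef1: "e \<star> f = f" using ec(3)[OF fG] by simp
  have "f \<star> f = k \<star> (e \<star> f)" by (simp add: f_def conv_assoc)
  also have "\<dots> = f" unfolding ef1 unfolding f_def using kc(2) by (simp flip: conv_assoc)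
  finally have ef: "e \<star> f = f" "f \<star> e = f" "f \<star> f = f" using ef1 ef2 by auto
  have f: "f \<in> cidem" unfolding cidem_iff using fc ef(3) fG by blast
  have "(e - f) \<star> (e - f) = e - f" using ef ec(2) by (simp add: conv_diff_left conv_diff_right)
  moreover have "a \<star> (e - f) = (e - f) \<star> a" if "a \<in> FS (carrier G)" for a
    using fc[OF that] ec(3)[OF that] by (simp add: conv_diff_left conv_diff_right)
  ultimately have g: "e - f \<in> cidem" unfolding cidem_iff using FS_diff[OF ec(1) fG] by blast
  have "f \<star> (e - f) = 0" using ef by (simp add: conv_diff_right)
  moreover have "e = f + (e - f)" by simp
  ultimately have "\<exists>e1\<in>cidem. \<exists>e2\<in>cidem. e1 \<noteq> 0 \<and> e2 \<noteq> 0 \<and> e1 \<star> e2 = 0 \<and> e = e1 + e2"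
    using f g no unfolding f_def by (metis right_minus_eq)
  thus False using e unfolding block_idempotents_def group_algebra_simps by blast
qed

text \<open>Over a splitting field a central element acts on a simple module as a scalar, and an
  idempotent scalar is 0 or 1.\<close>

lemma cidem_scalar:
  assumes e: "e \<in> cidem" and k: "k \<in> BC"
  shows "(\<forall>i<dg k. \<forall>j<dg k. cf (rp k) i j e = (if i = j then 1 else 0)) \<or> (\<forall>i<dg k. \<forall>j<dg k. cf (rp k) i j e = 0)"
proof -
  have es: "e \<star> sing g = sing g \<star> e" if "g \<in> carrier G" for g
  proof -
    have "(sing g :: 'g \<Rightarrow> 'f) \<in> FS (carrier G)" by (rule FS_sing[OF that])
    moreover have "\<forall>a\<in>FS (carrier G). a \<star> e = e \<star> a" using e unfolding cidem_iff by blast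
    ultimately show ?thesis by (metis (no_types))
  qed
  then obtain c where c: "\<And>i j. i < dg k \<Longrightarrow> j < dg k \<Longrightarrow> cf (rp k) i j e = (if i = j then c else 0)"
    using central_scalar[OF split rp(1)[OF k] es] by blast
  have ee: "e \<star> e = e" using e unfolding cidem_iff by blast
  have "c * c = c" using cf_scalar_mult[OF rp(3)[OF k] c rp(4)[OF k] rp(4)[OF k], of e] c[OF rp(4)[OF k] rp(4)[OF k]]
    by (simp add: ee)
  hence "c = 1 \<or> c = 0" by auto
  thus ?thesis using c by auto
qed

definition BI :: "('g \<Rightarrow> 'f) \<Rightarrow> ('g \<Rightarrow> 'k alg_closure) set" where
  "BI e = {k \<in> BC. \<forall>i<dg k. \<forall>j<dg k. cf (rp k) i j e = (if i = j then 1 else 0)}"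

lemma IBr_BI:
  assumes "e \<in> bidem"
  shows "IBr G p \<theta> (block_algebra (group_algebra G) e) = BI e"
proof -
  have rb: "rep_in_block G (block_algebra (group_algebra G) e) d \<rho> \<longleftrightarrow> (\<forall>i<d. \<forall>j<d. cf \<rho> i j e = (if i = j then 1 else 0))"
    for d and \<rho> :: "'g \<Rightarrow> 'f mat"
  proof -
    have "rep_extend G d \<rho> e = 1\<^sub>m d \<longleftrightarrow> (\<forall>i<d. \<forall>j<d. rep_extend G d \<rho> e $$ (i, j) = 1\<^sub>m d $$ (i, j))"
      by (rule iffI, simp, rule eq_matI) (auto simp: rep_extend_def)
    thus ?thesis unfolding rep_in_block_def block_idem_eq[OF assms] by (simp add: rep_extend_index)
  qed
  show ?thesis
  proof (intro equalityI subsetI)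
    fix \<phi> assume "\<phi> \<in> IBr G p \<theta> (block_algebra (group_algebra G) e)"
    then obtain d \<rho> where r: "irred_rep G d \<rho>" "\<forall>i<d. \<forall>j<d. cf \<rho> i j e = (if i = j then 1 else 0)" "\<phi> = br \<rho>"
      unfolding IBr_def rb by blast
    note c = rp_complete[OF r(1)]
    have m: "mat_rep G d (rp (br \<rho>))" using rp(3)[OF c(1)] c(2) by simp
    have "cf (rp \<phi>) i j e = (if i = j then 1 else 0)" if "i < dg \<phi>" "j < dg \<phi>" for i j
      unfolding r(3)
      by (rule iso_rep_scalar[OF iso_rep_sym[OF c(3) m] irred_rep_mat(1)[OF r(1)]]) (use r that c in auto)
    thus "\<phi> \<in> BI e" using c(1) r(3) by (simp add: BI_def)
  next
    fix \<phi> assume "\<phi> \<in> BI e"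
    hence b: "\<phi> \<in> BC" "\<forall>i<dg \<phi>. \<forall>j<dg \<phi>. cf (rp \<phi>) i j e = (if i = j then 1 else 0)" by (auto simp: BI_def)
    show "\<phi> \<in> IBr G p \<theta> (block_algebra (group_algebra G) e)"
      unfolding IBr_def rb
      by (intro CollectI exI[of _ "dg \<phi>"] exI[of _ "rp \<phi>"] conjI) (use rp[OF b(1)] b(2) in simp_all)
  qed
qed

lemma BI_out: "e \<in> cidem \<Longrightarrow> k \<in> BC - BI e \<Longrightarrow> i < dg k \<Longrightarrow> j < dg k \<Longrightarrow> cf (rp k) i j e = 0"
  using cidem_scalar[of e k] by (auto simp: BI_def)

text \<open>A block idempotent without simple modules would act as zero on all of them, hence be
  nilpotent.\<close>

lemma BI_nonempty: "e \<in> bidem \<Longrightarrow> BI e \<noteq> {}"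
proof
  assume e: "e \<in> bidem" and 0: "BI e = {}"
  have "e \<in> JF"
  proof (rule JF_I)
    show "e \<in> FS (carrier G)" using bidem_cidem(1)[OF e] unfolding cidem_iff by blast
  qed (use BI_out[OF bidem_cidem(1)[OF e]] 0 in simp)
  hence "nilp e" by (rule JF_nilp)
  moreover have "e \<star> e = e" using bidem_cidem(1)[OF e] unfolding cidem_iff by blast
  ultimately have "e = 0" by (rule nilp_idem)
  thus False using bidem_cidem(2)[OF e] by simp
qed

text \<open>The central element \<open>e \<star> (z - sc c' A1)\<close> acts as zero on
  \<open>k'\<close> and as the scalar \<open>c - c'\<close> on \<open>k\<close>. If these differ it
  is not nilpotent, and Fitting's lemma gives a central idempotent multiple of it, which must be
  \<open>e\<close>; but \<open>e\<close> acts as the identity on \<open>k'\<close>.\<close>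

lemma block_central_char:
  assumes e: "e \<in> bidem" and k: "k \<in> BI e" "k' \<in> BI e"
    and z: "z \<in> FS (carrier G)" "\<And>a. a \<in> FS (carrier G) \<Longrightarrow> z \<star> a = a \<star> z"
    and c: "\<And>i j. i < dg k \<Longrightarrow> j < dg k \<Longrightarrow> cf (rp k) i j z = (if i = j then c else 0)"
    and c': "\<And>i j. i < dg k' \<Longrightarrow> j < dg k' \<Longrightarrow> cf (rp k') i j z = (if i = j then c' else 0)"
  shows "c = c'"
proof (rule ccontr)
  assume cc: "c \<noteq> c'"
  have ec: "e \<in> FS (carrier G)" "e \<star> e = e" "\<And>a. a \<in> FS (carrier G) \<Longrightarrow> a \<star> e = e \<star> a"
    using bidem_cidem(1)[OF e] unfolding cidem_iff by blast+
  have kB: "k \<in> BC" "k' \<in> BC" and ek: "\<And>i j. i < dg k \<Longrightarrow> j < dg k \<Longrightarrow> cf (rp k) i j e = (if i = j then 1 else 0)"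
    "\<And>i j. i < dg k' \<Longrightarrow> j < dg k' \<Longrightarrow> cf (rp k') i j e = (if i = j then 1 else 0)"
    using k by (auto simp: BI_def)
  note r = rp[OF kB(1)] and r' = rp[OF kB(2)]
  define y where "y = e \<star> (z - sc c' A1)"
  have yG: "y \<in> FS (carrier G)" by (simp add: y_def)
  have yc: "y \<star> a = a \<star> y" if a: "a \<in> FS (carrier G)" for a
  proof -
    have w: "(z - sc c' A1) \<star> a = a \<star> (z - sc c' A1)"
      using z(2)[OF a] a by (simp add: conv_diff_left conv_diff_right conv_sc_left conv_sc_right)
    have "y \<star> a = e \<star> (a \<star> (z - sc c' A1))" by (simp add: y_def conv_assoc w)
    also have "\<dots> = e \<star> a \<star> (z - sc c' A1)" by (simp add: conv_assoc)
    also have "\<dots> = a \<star> y" by (simp add: y_def ec(3)[OF a, symmetric] conv_assoc)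
    finally show ?thesis .
  qed
  have y1: "cf (rp k) i j y = (if i = j then c - c' else 0)" if "i < dg k" "j < dg k" for i j
    using cf_scalar_mult[OF r(3) ek(1) that, of "z - sc c' A1"] c[OF that] mat_rep_one[OF r(3) that]
    by (simp add: y_def cf_diff cf_sc cf_sing)
  have y2: "cf (rp k') i j y = (if i = j then 0 else 0)" if "i < dg k'" "j < dg k'" for i j
    using cf_scalar_mult[OF r'(3) ek(2) that, of "z - sc c' A1"] c'[OF that] mat_rep_one[OF r'(3) that]
    by (simp add: y_def cf_diff cf_sc cf_sing)
  have "pw A1 y n \<noteq> 0" for n
  proof
    assume 0: "pw A1 y n = 0"
    have "cf (rp k) 0 0 (pw A1 y n) = (c - c') ^ n" using cf_pow_scalar[OF r(3) y1 r(4) r(4), of n] by simp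
    thus False using cc by (simp add: 0 cf_0)
  qed
  have A1A1: "A1 \<star> A1 = (A1 :: 'g \<Rightarrow> 'f)" by simp
  obtain q where q: "pev A1 y (pCons 0 q) \<noteq> 0" "pev A1 y (pCons 0 q) \<star> pev A1 y (pCons 0 q) = pev A1 y (pCons 0 q)"
    using fitting[OF A1A1, of y] yG \<open>\<And>n. pw A1 y n \<noteq> 0\<close> by (metis A1_left A1_right)
  define f where "f = pev A1 y (pCons 0 q)"
  have fy: "f = y \<star> pev A1 y q" by (simp add: f_def fun_eq_iff)
  have fa: "f \<star> a = a \<star> f" if "a \<in> FS (carrier G)" for a
    unfolding f_def by (rule pev_comm) (use yc that in auto)
  have fG: "f \<in> FS (carrier G)" by (simp add: fy)
  have "f \<star> f = f" unfolding f_def by (rule q(2))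
  hence fc: "f \<in> cidem" unfolding cidem_iff by (intro conjI ballI fG fa[symmetric])
  have ef: "e \<star> f = f" using ec(2) by (simp add: fy y_def flip: conv_assoc)
  hence fe: "f \<star> e = f" using ec(3)[OF fG] by simp
  have "f \<noteq> 0" using q(1) by (simp add: f_def)
  hence fe': "f = e" using bidem_prim[OF e fc] fe by auto
  have "cf (rp k') 0 0 f = 0" unfolding fy using cf_scalar_mult[OF r'(3) y2 r'(4) r'(4)] by simp
  thus False unfolding fe' using ek(2)[OF r'(4) r'(4)] by simp
qed

end

section \<open>Groups with a block all of whose simple modules are linear\<close>

context fin_group
begin

lemma pw_sing_idem:
  fixes u :: "'g \<Rightarrow> 'a::field"
  assumes g: "g \<in> carrier G" and u: "u \<in> FS (carrier G)" "u \<star> u = u" "u \<star> sing g = sing g \<star> u"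
  shows "pw u (sing g \<star> u) n = sing (g [^] n) \<star> u"
proof -
  define P where "P n \<longleftrightarrow> pw u (sing g \<star> u) n = sing (g [^] n) \<star> u \<and> u \<star> sing (g [^] n) = sing (g [^] n) \<star> u" for n
  have "P n"
  proof (induction n)
    case 0 show ?case using u by (simp add: P_def)
  next
    case (Suc n)
    have gn: "sing (g [^] Suc n) = (sing g \<star> sing (g [^] n) :: 'g \<Rightarrow> 'a)"
      using g by (simp add: sing_mult nat_pow_comm flip: nat_pow_Suc2)
    have 1: "u \<star> sing (g [^] Suc n) = sing (g [^] Suc n) \<star> u"
    proof -
      have "u \<star> (sing g \<star> sing (g [^] n)) = sing g \<star> (u \<star> sing (g [^] n))"
        using u(3) by (simp flip: conv_assoc)
      thus ?thesis using Suc unfolding gn by (simp add: P_def conv_assoc)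
    qed
    have "pw u (sing g \<star> u) n = sing (g [^] n) \<star> u" using Suc by (simp only: P_def)
    hence "pw u (sing g \<star> u) (Suc n) = sing g \<star> (u \<star> sing (g [^] n)) \<star> u"
      by (simp only: pw.simps conv_assoc)
    also have "u \<star> sing (g [^] n) = sing (g [^] n) \<star> u" using Suc by (simp only: P_def)
    also have "sing g \<star> (sing (g [^] n) \<star> u) \<star> u = sing (g [^] Suc n) \<star> u"
      using u(2) unfolding gn by (simp add: conv_assoc)
    finally show ?case using 1 by (simp only: P_def)
  qed
  thus ?thesis by (simp add: P_def)
qed

end

context rep_sys
begin

lemma linear_block_groups:
  assumes e: "e \<in> bidem" and lin: "\<And>k. k \<in> BI e \<Longrightarrow> dg k = 1"
  obtains N H where "N \<lhd> G" "\<not> p dvd card N" "H \<lhd> G" "N \<subseteq> H" "pelt p \<subseteq> H"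
    "\<forall>h\<in>H. \<exists>k. h [^] (p ^ k) \<in> N"
proof -
  have ec: "e \<in> FS (carrier G)" "e \<star> e = e" "\<And>a. a \<in> FS (carrier G) \<Longrightarrow> a \<star> e = e \<star> a"
    using bidem_cidem(1)[OF e] unfolding cidem_iff by blast+
  obtain l where l: "l \<in> BI e" using BI_nonempty[OF e] ex_in_conv[of "BI e"] by metis
  define lam where "lam k g = rp k g $$ (0, 0)" for k g
  have lam1: "lam k \<one> = 1" and lamm: "\<And>g h. g \<in> carrier G \<Longrightarrow> h \<in> carrier G \<Longrightarrow> lam k (g \<otimes> h) = lam k g * lam k h"
    and lamc: "\<And>a b. cf (rp k) 0 0 (a \<star> b) = cf (rp k) 0 0 a * cf (rp k) 0 0 b"
    and lame: "cf (rp k) 0 0 e = 1" if k: "k \<in> BI e" for k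
  proof -
    have kB: "k \<in> BC" "dg k = 1" using k lin[OF k] by (simp_all add: BI_def)
    have r: "mat_rep G 1 (rp k)" using rp(3)[OF kB(1)] kB(2) by simp
    show "lam k \<one> = 1" "\<And>g h. g \<in> carrier G \<Longrightarrow> h \<in> carrier G \<Longrightarrow> lam k (g \<otimes> h) = lam k g * lam k h"
      "\<And>a b. cf (rp k) 0 0 (a \<star> b) = cf (rp k) 0 0 a * cf (rp k) 0 0 b"
      using mat_rep_one[OF r, of 0 0] mat_rep_mult[OF r, of _ _ 0 0] cf_mult[OF r, of 0 0]
      by (simp_all add: lam_def)
    show "cf (rp k) 0 0 e = 1" using k kB by (simp add: BI_def)
  qed
  have lamp: "lam k (g [^] n) = lam k g ^ n" if "k \<in> BI e" "g \<in> carrier G" for k g and n :: nat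
    using that lam1[OF that(1)] lamm[OF that(1)] by (induction n) (simp_all add: mult.commute)
  have laminv: "lam k g * lam k (inv g) = 1" if "k \<in> BI e" "g \<in> carrier G" for k g
    using that lam1[OF that(1)] lamm[OF that(1), of g "inv g"] by simp
  have lams: "cf (rp k) 0 0 (sing g) = lam k g" if "g \<in> carrier G" for k g
    using that by (simp add: cf_sing lam_def)
  define H where "H = {g \<in> carrier G. \<forall>k\<in>BI e. lam k g = lam l g}"
  have HD: "g \<in> carrier G" "\<And>k. k \<in> BI e \<Longrightarrow> lam k g = lam l g" if "g \<in> H" for g
    using that unfolding H_def by blast+
  have HI: "g \<in> H" if "g \<in> carrier G" "\<And>k. k \<in> BI e \<Longrightarrow> lam k g = lam l g" for g
    using that unfolding H_def by blast
  define N where "N = {g \<in> carrier G. sing g \<star> e = sc (lam l g) e}"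
  have HG: "H \<lhd> G"
    unfolding normal_inv_iff
  proof (intro conjI ballI)
    show "subgroup H G"
    proof (rule subgroupI)
      have "\<one> \<in> H" by (rule HI) (simp_all add: lam1 l)
      thus "H \<noteq> {}" by blast
      show "H \<subseteq> carrier G" using HD(1) by blast
      fix g assume g: "g \<in> H"
      note gc = HD(1)[OF g]
      have "lam k (inv g) = lam l (inv g)" if "k \<in> BI e" for k
      proof -
        have "lam l g * lam k (inv g) = lam l g * lam l (inv g)"
          using laminv[OF that gc] laminv[OF l gc] unfolding HD(2)[OF g that] by simp
        moreover have "lam l g \<noteq> 0" using laminv[OF l gc] by auto
        ultimately show ?thesis by simp
      qed
      thus "inv g \<in> H" using gc by (intro HI) auto
      show "g \<otimes> h \<in> H" if h: "h \<in> H" for h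
      proof (rule HI)
        fix k assume k: "k \<in> BI e"
        show "lam k (g \<otimes> h) = lam l (g \<otimes> h)"
          unfolding lamm[OF k gc HD(1)[OF h]] lamm[OF l gc HD(1)[OF h]] HD(2)[OF g k] HD(2)[OF h k] ..
      qed (use gc HD(1)[OF h] in simp)
    qed
    fix x h assume x: "x \<in> carrier G" and h: "h \<in> H"
    note hc = HD(1)[OF h]
    have c: "lam k (x \<otimes> h \<otimes> inv x) = lam k h" if "k \<in> BI e" for k
    proof -
      have "lam k (x \<otimes> h \<otimes> inv x) = (lam k x * lam k (inv x)) * lam k h" using lamm[OF that] x hc by (simp add: mult_ac)
      thus ?thesis using laminv[OF that x] by simp
    qed
    show "x \<otimes> h \<otimes> inv x \<in> H"
      by (rule HI) (use x hc c[OF l] c HD(2)[OF h] in \<open>metis inv_closed m_closed\<close>)+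
  qed
  have NG: "N \<lhd> G"
    unfolding normal_inv_iff
  proof (intro conjI ballI)
    show "subgroup N G"
    proof (rule subgroupI)
      have "\<one> \<in> N" using lam1[OF l] ec(1) by (simp add: N_def)
      thus "N \<noteq> {}" by blast
      fix g assume g: "g \<in> N"
      hence gc: "g \<in> carrier G" "sing g \<star> e = sc (lam l g) e" by (auto simp: N_def)
      have f: "sc (lam l (inv g)) (sing (inv g) \<star> (sing g \<star> e)) = sc (lam l (inv g) * lam l g) (sing (inv g) \<star> e)"
        unfolding gc(2) by (simp add: conv_sc_right)
      have m1: "lam l (inv g) * lam l g = 1" using laminv[OF l gc(1)] by (simp add: mult.commute)
      have m2: "sing (inv g) \<star> (sing g \<star> e) = e" using gc(1) ec(1) by (simp add: sing_inv_l)
      have "sing (inv g) \<star> e = sc (lam l (inv g)) e" using f unfolding m1 m2 by simp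
      thus "inv g \<in> N" using gc by (simp add: N_def)
      show "g \<otimes> h \<in> N" if h: "h \<in> N" for h
      proof -
        have hc: "h \<in> carrier G" "sing h \<star> e = sc (lam l h) e" using h by (auto simp: N_def)
        have "sing (g \<otimes> h) \<star> e = sing g \<star> (sing h \<star> e)" using gc(1) hc(1) by (simp add: sing_mult flip: conv_assoc)
        also have "\<dots> = sc (lam l g * lam l h) e" unfolding hc(2) conv_sc_right gc(2) by (simp add: mult.commute)
        finally show ?thesis using lamm[OF l] gc hc by (simp add: N_def)
      qed
    qed (auto simp: N_def)
    fix x h assume x: "x \<in> carrier G" and h: "h \<in> N"
    have hc: "h \<in> carrier G" "sing h \<star> e = sc (lam l h) e" using h by (auto simp: N_def)
    have "sing (x \<otimes> h \<otimes> inv x) \<star> e = sing x \<star> sing h \<star> (sing (inv x) \<star> e)"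
      using x hc(1) by (simp add: sing_mult flip: conv_assoc)
    also have "sing (inv x) \<star> e = e \<star> sing (inv x)" using x by (intro ec(3) FS_sing) simp
    also have "sing x \<star> sing h \<star> (e \<star> sing (inv x)) = sing x \<star> (sing h \<star> e) \<star> sing (inv x)" by (simp add: conv_assoc)
    also have "\<dots> = sc (lam l h) (sing x \<star> (e \<star> sing (inv x)))"
      unfolding hc(2) by (simp add: conv_sc_right conv_sc_left conv_assoc)
    also have "e \<star> sing (inv x) = sing (inv x) \<star> e" using x by (intro ec(3)[symmetric] FS_sing) simp
    also have "sing x \<star> (sing (inv x) \<star> e) = e" using x ec(1) by (simp add: sing_inv_r)
    finally have "sing (x \<otimes> h \<otimes> inv x) \<star> e = sc (lam l h) e" .
    moreover have "lam l (x \<otimes> h \<otimes> inv x) = lam l h"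
    proof -
      have "lam l (x \<otimes> h \<otimes> inv x) = (lam l x * lam l (inv x)) * lam l h" using lamm[OF l] x hc by (simp add: mult_ac)
      thus ?thesis using laminv[OF l x] by simp
    qed
    ultimately show "x \<otimes> h \<otimes> inv x \<in> N" using x hc by (simp add: N_def)
  qed
  have NH: "N \<subseteq> H"
  proof
    fix g assume "g \<in> N"
    hence gc: "g \<in> carrier G" "sing g \<star> e = sc (lam l g) e" by (auto simp: N_def)
    have "lam k g = lam l g" if "k \<in> BI e" for k
      using lamc[OF that, of "sing g" e] lame[OF that] lams[OF gc(1)] unfolding gc(2) by (simp add: cf_sc)
    thus "g \<in> H" by (rule HI[OF gc(1)])
  qed
  have pl: "lam k g = 1" if "g [^] (p ^ j) = \<one>" "g \<in> carrier G" "k \<in> BI e" for g k j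
    by (rule char_p_root_1[OF p ch]) (use lamp[OF that(3,2), of "p ^ j"] that(1) lam1[OF that(3)] in simp)
  have pN: "\<not> p dvd card N"
  proof
    assume dv: "p dvd card N"
    have sN: "subgroup N G" using NG by (simp add: normal_def)
    obtain S j m where S: "subgroup S G" "S \<subseteq> N" "card S = p ^ j" "card N = p ^ j * m" "\<not> p dvd m"
      by (rule sylow_subgroup[OF p sN])
    have j: "j \<noteq> 0" using S(4,5) dv by (cases j) auto
    have Sc: "S \<subseteq> carrier G" using S(1) subgroup.subset by blast
    have sx: "sing x \<star> e = e" "lam l x = 1" if x: "x \<in> S" for x
    proof -
      have xc: "x \<in> carrier G" "sing x \<star> e = sc (lam l x) e" using x S(2) by (auto simp: N_def)
      show "lam l x = 1" using subgroup_pow_card[OF S(1) x] unfolding S(3) by (rule pl[OF _ xc(1) l])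
      thus "sing x \<star> e = e" using xc(2) by simp
    qed
    interpret S: group "G\<lparr>carrier := S\<rparr>" using S(1) by (rule subgroup_imp_group)
    \<comment> \<open>A Sylow \<open>p\<close>-subgroup of \<open>N\<close> fixes \<open>e\<close>
      and has trivial \<open>lam l\<close>, so the summand is invariant under left translation, an
      action without fixed points. The sum would vanish, but it is the value 1 of \<open>e\<close>
      on the module \<open>l\<close>.\<close>
    have "(\<Sum>g\<in>carrier G. e g * lam l g) =
        (\<Sum>g\<in>{w \<in> carrier G. \<forall>x\<in>carrier (G\<lparr>carrier := S\<rparr>). x \<otimes> w = w}. e g * lam l g)"
    proof (rule p_group_sum_fixed[OF S.is_group _ p ch fin, where k = j])
      fix x w assume x: "x \<in> carrier (G\<lparr>carrier := S\<rparr>)" and w: "w \<in> carrier G"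
      hence xS: "x \<in> S" "x \<in> carrier G" using Sc by auto
      show "x \<otimes> w \<in> carrier G" using xS w by simp
      have "e (x \<otimes> w) = (sing x \<star> e) (x \<otimes> w)" using sx(1)[OF xS(1)] by simp
      also have "\<dots> = e w" using xS w by (simp add: sing_conv flip: m_assoc)
      finally show "e (x \<otimes> w) * lam l (x \<otimes> w) = e w * lam l w" using lamm[OF l xS(2) w] sx(2)[OF xS(1)] by simp
    qed (use S(3) Sc in \<open>auto simp: m_assoc subset_iff\<close>)
    also have "{w \<in> carrier G. \<forall>x\<in>carrier (G\<lparr>carrier := S\<rparr>). x \<otimes> w = w} = {}"
    proof -
      have "1 < card S" unfolding S(3) using j prime_gt_1_nat[OF p] by (intro one_less_power) auto
      then obtain x where "x \<in> S" "x \<noteq> \<one>" using card_mono[of "{\<one>}" S] by fastforce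
      thus ?thesis using Sc by (auto simp: subset_iff)
    qed
    also have "(\<Sum>g\<in>{}. e g * lam l g) = 0" by simp
    finally show False using lame[OF l] by (simp add: cf_def lam_def)
  qed
  have pH: "pelt p \<subseteq> H"
  proof
    fix g assume "g \<in> pelt p"
    then obtain j where g: "g \<in> carrier G" "g [^] (p ^ j) = \<one>" by (auto simp: pelt_def)
    show "g \<in> H" by (rule HI[OF g(1)]) (simp add: pl[OF g(2,1)] l)
  qed
  have HN: "\<exists>k. h [^] (p ^ k) \<in> N" if h: "h \<in> H" for h
  proof -
    have hc: "h \<in> carrier G" "\<And>k. k \<in> BI e \<Longrightarrow> lam k h = lam l h" using HD[OF h] by auto
    have sG: "(sing h :: 'g \<Rightarrow> 'f) \<in> FS (carrier G)" using hc by (rule_tac FS_sing)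
    have she: "e \<star> sing h = sing h \<star> e" by (rule ec(3)[OF sG, symmetric])
    define y where "y = sing h \<star> e - sc (lam l h) e"
    have yG: "y \<in> FS (carrier G)" using ec(1) by (simp add: y_def FS_diff FS_sc)
    have ye: "y = y \<star> e" using ec(2) by (simp add: y_def conv_diff_left conv_sc_left conv_assoc)
    \<comment> \<open>On the modules of the block \<open>h\<close> acts as the common scalar
      \<open>lam l h\<close>, by the choice of \<open>H\<close>; the other simple modules are
      annihilated by \<open>e\<close>.\<close>
    have "y \<in> JF"
    proof (rule JF_I[OF yG])
      fix k i j assume k: "k \<in> BC" "i < dg k" "j < dg k"
      show "cf (rp k) i j y = 0"
      proof (cases "k \<in> BI e")
        case True
        hence "i = 0" "j = 0" using k lin[OF True] by auto
        thus ?thesis using lamc[OF True] lame[OF True] lams[OF hc(1)] hc(2)[OF True] by (simp add: y_def cf_diff cf_sc)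
      next
        case False
        thus ?thesis using cf_mult[OF rp(3)[OF k(1)] k(2,3), of y e] ye BI_out[OF bidem_cidem(1)[OF e], of k] k by simp
      qed
    qed
    hence "nilp y" by (rule JF_nilp)
    then obtain n where n: "pw A1 y n = 0" unfolding nilp_def by blast
    have "n \<le> p ^ n" using less_exp[of n] power_mono[of 2 p n] prime_ge_2_nat[OF p] by linarith
    hence y0: "pw A1 y (p ^ n) = 0" by (rule pw_le[OF n _ yG])
    have ey: "e \<star> y = y" using ye ec(3)[OF yG] by simp
    have "pw e y (p ^ n) = e \<star> pw A1 y (p ^ n)" by (rule pw_unit[OF ec(2) ey ye[symmetric] yG ec(1)])
    hence "pw e y (p ^ n) = 0" using y0 by simp
    \<comment> \<open>Frobenius turns the nilpotency of \<open>y\<close> into the equation that puts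
      \<open>h [^] (p ^ n)\<close> into \<open>N\<close>.\<close>
    moreover have "pw e y (p ^ n) = pw e (sing h \<star> e) (p ^ n) - sc (lam l h ^ (p ^ n)) e"
      unfolding y_def
      by (rule pev_frobenius[of e "sing h \<star> e" _ n])
         (use ec(2) p ch she in \<open>simp_all add: conv_assoc flip: conv_assoc[of e]\<close>)
    moreover have "pw e (sing h \<star> e) (p ^ n) = sing (h [^] (p ^ n)) \<star> e"
      by (rule pw_sing_idem[OF hc(1) ec(1,2) she])
    ultimately have "sing (h [^] (p ^ n)) \<star> e = sc (lam l (h [^] (p ^ n))) e"
      using lamp[OF l hc(1)] by simp
    thus ?thesis using hc(1) by (auto simp: N_def)
  qed
  show ?thesis by (rule that[OF NG pN HG NH pH]) (use HN in blast)
qed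

end

section \<open>Extension of scalars to the algebraic closure\<close>

text \<open>A retraction onto the small field, linear but not multiplicative; this suffices for
  products in which one factor has coefficients in the small field.\<close>

lemma exists_functional:
  "\<exists>\<pi> :: 'a::field alg_closure \<Rightarrow> 'a. (\<forall>x y. \<pi> (x + y) = \<pi> x + \<pi> y) \<and> (\<forall>c x. \<pi> (to_ac c * x) = c * \<pi> x) \<and> \<pi> 1 = 1"
proof -
  interpret V: vector_space "\<lambda>(c :: 'a) (x :: 'a alg_closure). to_ac c * x"
    by unfold_locales (simp_all add: algebra_simps)
  have i1: "V.independent {1 :: 'a alg_closure}" by simp
  define B where "B = V.extend_basis {1 :: 'a alg_closure}"
  have B: "V.independent B" "V.span B = UNIV" "1 \<in> B"
    using V.independent_extend_basis[OF i1] V.span_extend_basis[OF i1] V.extend_basis_superset[OF i1]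
    by (auto simp: B_def)
  have sp: "x \<in> V.span B" for x using B(2) by simp
  show ?thesis
  proof (intro exI[of _ "\<lambda>x. V.representation B x 1"] conjI allI)
    show "V.representation B (x + y) 1 = V.representation B x 1 + V.representation B y 1" for x y
      using fun_cong[OF V.representation_add[OF B(1) sp sp], of x y 1] by (simp add: add.commute)
    show "V.representation B (to_ac c * x) 1 = c * V.representation B x 1" for c x
      using fun_cong[OF V.representation_scale[OF B(1) sp], of c x 1] by simp
    show "V.representation B 1 1 = 1"
      using V.representation_basis[OF B(1,3)] by simp
  qed
qed

definition pr :: "'a::field alg_closure \<Rightarrow> 'a" where
  "pr = (SOME \<pi>. (\<forall>x y. \<pi> (x + y) = \<pi> x + \<pi> y) \<and> (\<forall>c x. \<pi> (to_ac c * x) = c * \<pi> x) \<and> \<pi> 1 = 1)"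

lemma pr_add: "pr (x + y) = pr x + pr y" and pr_mult: "pr (to_ac c * x) = c * pr x" and pr_1: "pr 1 = 1"
  using someI_ex[OF exists_functional, folded pr_def] by blast+

lemma pr_0: "pr 0 = 0"
  using pr_mult[of 0 0] by simp

lemma pr_to_ac: "pr (to_ac c) = c"
  using pr_mult[of c 1] by (simp add: pr_1)

lemma pr_sum: "pr (sum f A) = (\<Sum>x\<in>A. pr (f x))"
  by (rule additive_sum[of pr, OF pr_0 pr_add])

lemma eq_0_if_pr: "(\<And>t. pr (t * x) = 0) \<Longrightarrow> x = 0"
  by (metis left_inverse pr_1 zero_neq_one)

definition up :: "('x \<Rightarrow> 'a::field) \<Rightarrow> 'x \<Rightarrow> 'a alg_closure" where
  "up a = (\<lambda>x. to_ac (a x))"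

text \<open>As \<open>t\<close> varies, the functionals \<open>x \<mapsto> pr (t * x)\<close>
  separate the points of the closure (\<open>eq_0_if_pr\<close>), so equations over the closure can
  be tested in the small field. The case \<open>t = 1\<close> is the retraction.\<close>

definition dn :: "'a::field alg_closure \<Rightarrow> ('x \<Rightarrow> 'a alg_closure) \<Rightarrow> 'x \<Rightarrow> 'a" where
  "dn t a = (\<lambda>x. pr (t * a x))"

lemma up_simps: "up 0 = 0" "up (a + b) = up a + up b" "up (a - b) = up a - up b" "up (sc c a) = sc (to_ac c) (up a)"
  "up (sing g) = sing g" "up a = up b \<longleftrightarrow> a = b" "a \<in> FS S \<Longrightarrow> up a \<in> FS S"
  by (auto simp: up_def fun_eq_iff sing_def FS_def)

lemma up_sum: "up (sum f A) = (\<Sum>x\<in>A. up (f x))"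
  by (rule additive_sum[of up]) (simp_all add: up_simps)

lemma dn_simps: "dn t 0 = 0" "dn t (a + b) = dn t a + dn t b" "a \<in> FS S \<Longrightarrow> dn t a \<in> FS S"
  by (auto simp: dn_def fun_eq_iff FS_def pr_0 pr_add ring_distribs)

lemma dn_sum: "dn t (sum f A) = (\<Sum>x\<in>A. dn t (f x))"
  by (rule additive_sum[of "dn t"]) (simp_all add: dn_simps)

lemma dn_up: "dn 1 (up a) = a"
  by (simp add: dn_def up_def pr_to_ac)

lemma dn_sc_up: "dn t (sc c (up a)) = sc (pr (t * c)) a"
proof
  fix x
  have "t * (c * to_ac (a x)) = to_ac (a x) * (t * c)" by (simp add: mult_ac)
  thus "dn t (sc c (up a)) x = sc (pr (t * c)) a x" by (simp only: dn_def up_def sc_apply pr_mult mult.commute)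
qed

context fin_group
begin

lemma up_conv: "up (a \<star> b) = up a \<star> up b"
  by (auto simp: up_def conv_def fun_eq_iff to_ac_sum)

lemma dn_conv_right: "dn t (a \<star> up b) = dn t a \<star> b"
proof
  fix g
  show "dn t (a \<star> up b) g = (dn t a \<star> b) g"
  proof (cases "g \<in> carrier G")
    case True
    have 1: "t * (a \<star> up b) g = (\<Sum>h\<in>carrier G. to_ac (b (inv h \<otimes> g)) * (t * a h))"
      using True by (simp add: conv_def up_def sum_distrib_left mult_ac)
    have 2: "pr (t * (a \<star> up b) g) = (\<Sum>h\<in>carrier G. b (inv h \<otimes> g) * pr (t * a h))"
      unfolding 1 pr_sum pr_mult ..
    show ?thesis unfolding conv_apply[OF True, of "dn t a"] unfolding dn_def 2 by (simp only: mult.commute)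
  qed (simp add: dn_def conv_def pr_0)
qed

lemma dn_conv_left: "dn t (up b \<star> a) = b \<star> dn t a"
proof
  fix g
  show "dn t (up b \<star> a) g = (b \<star> dn t a) g"
  proof (cases "g \<in> carrier G")
    case True
    have 1: "t * (up b \<star> a) g = (\<Sum>h\<in>carrier G. to_ac (b h) * (t * a (inv h \<otimes> g)))"
      using True by (simp add: conv_def up_def sum_distrib_left mult_ac)
    have 2: "pr (t * (up b \<star> a) g) = (\<Sum>h\<in>carrier G. b h * pr (t * a (inv h \<otimes> g)))"
      unfolding 1 pr_sum pr_mult ..
    show ?thesis unfolding conv_apply[OF True, of b] unfolding dn_def 2 ..
  qed (simp add: dn_def conv_def pr_0)
qed

lemma cj_up: "cj g (up a) = up (cj g a)"
  by (simp add: cj_def up_conv up_simps)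

lemma cj_dn:
  fixes a :: "'g \<Rightarrow> 'a::field alg_closure"
  shows "cj g (dn t a) = dn t (cj g a)"
proof -
  have "cj g a = up (sing g :: 'g \<Rightarrow> 'a) \<star> a \<star> up (sing (inv g) :: 'g \<Rightarrow> 'a)"
    by (simp only: cj_def up_simps(5))
  thus ?thesis by (simp only: dn_conv_left dn_conv_right) (simp only: cj_def)
qed

lemma Tr_up: "Tr D (up a) = up (Tr D a)"
  by (simp add: Tr_def cj_up up_sum)

lemma Tr_dn: "Tr D (dn t a) = dn t (Tr D a)"
  by (simp add: Tr_def cj_dn dn_sum)

text \<open>A basis over the small field remains one: independence is tested by the maps
  \<open>dn t\<close>, and the generators \<open>e \<star> sing g\<close> already have their
  coordinates in the small field.\<close>

lemma dim_up:
  fixes e :: "'g \<Rightarrow> 'a::field"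
  assumes e: "e \<in> FS (carrier G)" "e \<star> e = e"
  shows "fv.dim {y \<in> FS (carrier G). up e \<star> y = y} = fv.dim {y \<in> FS (carrier G). e \<star> y = y}"
proof -
  define U where "U = {y \<in> FS (carrier G). e \<star> y = y}"
  have UG: "U \<subseteq> FS (carrier G)" by (auto simp: U_def)
  obtain B where B: "B \<subseteq> U" "fv.independent B" "U \<subseteq> fv.span B" "finite B" "card B = fv.dim U"
    by (rule finite_basis[OF UG fin])
  have "fv.dim {y \<in> FS (carrier G). up e \<star> y = y} = card B"
  proof (rule dim_family[OF B(4)])
    fix c assume c: "(\<Sum>b\<in>B. sc (c b) (up b)) = 0"
    show "\<forall>b\<in>B. c b = 0"
    proof
      fix b assume b: "b \<in> B"
      show "c b = 0"
      proof (rule eq_0_if_pr)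
        fix t
        have "(\<Sum>b\<in>B. sc (pr (t * c b)) b) = dn t (\<Sum>b\<in>B. sc (c b) (up b))"
          unfolding dn_sum dn_sc_up ..
        also have "\<dots> = 0" unfolding c by (rule dn_simps(1))
        finally have z: "(\<Sum>b\<in>B. sc (pr (t * c b)) b) = 0" .
        show "pr (t * c b) = 0" using basis_unique[OF B(4,2) z] b by blast
      qed
    qed
  next
    fix b assume "b \<in> B"
    hence "b \<in> FS (carrier G)" "e \<star> b = b" using B(1) by (auto simp: U_def)
    thus "up b \<in> {y \<in> FS (carrier G). up e \<star> y = y}" by (simp add: up_simps flip: up_conv)
  next
    fix y assume y: "y \<in> {y \<in> FS (carrier G). up e \<star> y = y}"
    have "\<forall>g. \<exists>c. e \<star> sing g = (\<Sum>b\<in>B. sc (c b) b)"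
    proof
      fix g
      have "e \<star> sing g \<in> U" using e(2) by (simp add: U_def flip: conv_assoc)
      thus "\<exists>c. e \<star> sing g = (\<Sum>b\<in>B. sc (c b) b)" using B(3) by (intro basis_expand[OF B(4)]) blast
    qed
    then obtain c where c: "\<And>g. e \<star> sing g = (\<Sum>b\<in>B. sc (c g b) b)" by metis
    have yG: "y \<in> FS (carrier G)" using y by simp
    have "y = up e \<star> y" using y by simp
    also have "\<dots> = up e \<star> (\<Sum>g\<in>carrier G. sc (y g) (sing g))" using FS_expand[OF yG fin] by simp
    also have "\<dots> = (\<Sum>g\<in>carrier G. sc (y g) (up (e \<star> sing g)))"
      by (simp add: conv_sum_right conv_sc_right up_conv up_simps)
    also have "\<dots> = (\<Sum>g\<in>carrier G. \<Sum>b\<in>B. sc (y g * to_ac (c g b)) (up b))"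
      unfolding c up_sum up_simps by (simp add: fv.scale_sum_right)
    also have "\<dots> = (\<Sum>b\<in>B. \<Sum>g\<in>carrier G. sc (y g * to_ac (c g b)) (up b))" by (rule sum.swap)
    also have "\<dots> = (\<Sum>b\<in>B. sc (\<Sum>g\<in>carrier G. y g * to_ac (c g b)) (up b))" by (simp add: sc_sum_left)
    finally show "\<exists>c. y = (\<Sum>b\<in>B. sc (c b) (up b))" by (rule exI[of _ "\<lambda>b. \<Sum>g\<in>carrier G. y g * to_ac (c g b)"])
  qed
  thus ?thesis using B(5) by (simp add: U_def)
qed

end

section \<open>Simple modules and block idempotents over the closure\<close>

context rep_sys
begin

definition mm :: "('g \<Rightarrow> 'k alg_closure) \<Rightarrow> nat \<Rightarrow> nat \<Rightarrow> 'g \<Rightarrow> 'f alg_closure" where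
  "mm k i j g = to_ac (rp k g $$ (i, j))"

lemma mm_up: "(\<Sum>g\<in>carrier G. up a g * mm k i j g) = to_ac (cf (rp k) i j a)"
  by (simp add: up_def mm_def cf_def to_ac_sum)

lemma mm_mult:
  assumes "k \<in> BC" "i < dg k" "j < dg k" "g \<in> carrier G" "h \<in> carrier G"
  shows "mm k i j (g \<otimes> h) = (\<Sum>r<dg k. mm k i r g * mm k r j h)"
  unfolding mm_def mat_rep_mult[OF rp(3)[OF assms(1)] assms(4,5,2,3)] by (simp add: to_ac_sum)

lemma mm_conv:
  assumes "k \<in> BC" "i < dg k" "j < dg k"
  shows "(\<Sum>g\<in>carrier G. (a \<star> b) g * mm k i j g) =
    (\<Sum>r<dg k. (\<Sum>g\<in>carrier G. a g * mm k i r g) * (\<Sum>g\<in>carrier G. b g * mm k r j g))"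
proof -
  have "(\<Sum>g\<in>carrier G. (a \<star> b) g * mm k i j g) = (\<Sum>g\<in>carrier G. mm k i j g * (a \<star> b) g)" by (simp add: mult.commute)
  also have "\<dots> = (\<Sum>g\<in>carrier G. \<Sum>h\<in>carrier G. \<Sum>r<dg k. (a g * mm k i r g) * (b h * mm k r j h))"
    unfolding conv_pair using mm_mult[OF assms]
    by (intro sum.cong refl) (simp add: sum_distrib_right sum_distrib_left mult_ac)
  also have "\<dots> = (\<Sum>g\<in>carrier G. \<Sum>r<dg k. \<Sum>h\<in>carrier G. (a g * mm k i r g) * (b h * mm k r j h))"
    by (rule sum.cong[OF refl], rule sum.swap)
  also have "\<dots> = (\<Sum>r<dg k. \<Sum>g\<in>carrier G. \<Sum>h\<in>carrier G. (a g * mm k i r g) * (b h * mm k r j h))"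
    by (rule sum.swap)
  finally show ?thesis by (simp add: sum_product)
qed

text \<open>Over the algebraic closure the common kernel of the representations is spanned by
  elements with coefficients in the small field, hence still nilpotent.\<close>

lemma mm_nilp:
  assumes a: "a \<in> FS (carrier G)"
    and z: "\<And>k i j. k \<in> BC \<Longrightarrow> i < dg k \<Longrightarrow> j < dg k \<Longrightarrow> (\<Sum>g\<in>carrier G. a g * mm k i j g) = 0"
  shows "nilp a"
proof -
  define L where "L = (SIGMA k:BC. {..<dg k} \<times> {..<dg k})"
  have finL: "finite L" using finite_BC by (simp add: L_def)
  have "\<forall>l. \<exists>b. b \<in> FS (carrier G) \<and> (\<forall>k\<in>BC. \<forall>i<dg k. \<forall>j<dg k. cf (rp k) i j b = (if (k, i, j) = l then 1 else 0))"
  proof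
    fix l
    show "\<exists>b. b \<in> FS (carrier G) \<and> (\<forall>k\<in>BC. \<forall>i<dg k. \<forall>j<dg k. cf (rp k) i j b = (if (k, i, j) = l then 1 else 0))"
      using slots_surj[OF finite_BC subset_refl, of "\<lambda>k i j. if (k, i, j) = l then 1 else 0"] by blast
  qed
  then obtain b where b: "\<And>l. b l \<in> FS (carrier G)"
    "\<And>l k i j. k \<in> BC \<Longrightarrow> i < dg k \<Longrightarrow> j < dg k \<Longrightarrow> cf (rp k) i j (b l) = (if (k, i, j) = l then 1 else 0)" by metis
  define r where "r l g = rp (fst l) g $$ (fst (snd l), snd (snd l))" for l g
  \<comment> \<open>Subtracting elements dual to the matrix coefficients moves each group element
    into \<open>JF\<close>. As \<open>a\<close> has zero coefficients, the corrections cancel in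
    \<open>ay\<close>.\<close>
  define y where "y g = (sing g :: 'g \<Rightarrow> 'f) - (\<Sum>l\<in>L. sc (r l g) (b l))" for g
  have y: "y g \<in> JF" if g: "g \<in> carrier G" for g
  proof (rule JF_I)
    show "y g \<in> FS (carrier G)" unfolding y_def by (intro FS_diff FS_sum FS_sc FS_sing g b)
    fix k i j assume k: "k \<in> BC" "i < dg k" "j < dg k"
    have kL: "(k, i, j) \<in> L" using k by (simp add: L_def)
    have "cf (rp k) i j (\<Sum>l\<in>L. sc (r l g) (b l)) = (\<Sum>l\<in>L. if l = (k, i, j) then r (k, i, j) g else 0)"
      unfolding cf_sum cf_sc b(2)[OF k] by (rule sum.cong) auto
    also have "\<dots> = r (k, i, j) g" using kL finL by (subst sum.delta) simp_all
    finally show "cf (rp k) i j (y g) = 0" using g by (simp add: y_def cf_diff cf_sing r_def)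
  qed
  have ay: "a = (\<Sum>g\<in>carrier G. sc (a g) (up (y g)))"
  proof -
    have "(\<Sum>g\<in>carrier G. sc (a g) (up (y g))) =
        (\<Sum>g\<in>carrier G. sc (a g) (sing g)) - (\<Sum>g\<in>carrier G. \<Sum>l\<in>L. sc (a g * to_ac (r l g)) (up (b l)))"
      by (simp add: y_def up_simps up_sum fv.scale_right_diff_distrib fv.scale_sum_right sum_subtractf)
    also have "(\<Sum>g\<in>carrier G. \<Sum>l\<in>L. sc (a g * to_ac (r l g)) (up (b l))) =
        (\<Sum>l\<in>L. sc (\<Sum>g\<in>carrier G. a g * to_ac (r l g)) (up (b l)))"
      by (subst sum.swap) (simp add: sc_sum_left)
    also have "\<dots> = 0"
    proof (rule sum.neutral, rule ballI)
      fix l assume "l \<in> L"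
      then obtain k i j where l: "l = (k, i, j)" "k \<in> BC" "i < dg k" "j < dg k" by (auto simp: L_def)
      have "(\<Sum>g\<in>carrier G. a g * to_ac (r l g)) = 0" using z[OF l(2-4)] by (simp add: r_def l(1) mm_def)
      thus "sc (\<Sum>g\<in>carrier G. a g * to_ac (r l g)) (up (b l)) = 0" by simp
    qed
    finally have h: "(\<Sum>g\<in>carrier G. sc (a g) (up (y g))) = (\<Sum>g\<in>carrier G. sc (a g) (sing g)) - 0" .
    show ?thesis unfolding h diff_0_right by (rule FS_expand[OF a fin])
  qed
  obtain M where M: "\<And>as. set as \<subseteq> (JF :: ('g \<Rightarrow> 'f) set) \<Longrightarrow> length as = M \<Longrightarrow> foldr (\<star>) as A1 = 0"
    using JF_nilpotent by blast
  \<comment> \<open>Products of \<open>n\<close> elements of the small radical; the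
    \<open>n\<close>-th power of \<open>a\<close> lies in their span over the closure.\<close>
  define SP where "SP n = {up (foldr (\<star>) as (A1 :: 'g \<Rightarrow> 'f)) | as. set as \<subseteq> JF \<and> length as = n}" for n
  have step: "a \<star> w \<in> fv.span (SP (Suc n))" if w: "w \<in> fv.span (SP n)" for w n
    using w
  proof (rule fv.span_induct)
    show "fv.subspace {w. a \<star> w \<in> fv.span (SP (Suc n))}"
      unfolding fv.subspace_def
      by (auto simp: conv_add_right conv_sc_right intro: fv.span_add fv.span_scale fv.span_zero)
    fix w assume "w \<in> SP n"
    then obtain as where as: "w = up (foldr (\<star>) as A1)" "set as \<subseteq> (JF :: ('g \<Rightarrow> 'f) set)" "length as = n"
      unfolding SP_def by blast
    have "a \<star> w = (\<Sum>g\<in>carrier G. sc (a g) (up (y g))) \<star> w" using ay by simp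
    also have "\<dots> = (\<Sum>g\<in>carrier G. sc (a g) (up (foldr (\<star>) (y g # as) A1)))"
      by (simp add: conv_sum_left conv_sc_left as(1) up_conv)
    also have "\<dots> \<in> fv.span (SP (Suc n))"
    proof (rule span_sum_sc)
      fix g assume "g \<in> carrier G"
      hence "set (y g # as) \<subseteq> JF" "length (y g # as) = Suc n" using y as by auto
      thus "up (foldr (\<star>) (y g # as) A1) \<in> SP (Suc n)" unfolding SP_def by blast
    qed
    finally show "a \<star> w \<in> fv.span (SP (Suc n))" .
  qed
  define Q where "Q n \<longleftrightarrow> pw A1 a n \<in> fv.span (SP n)" for n
  have "Q n" for n
  proof (induction n)
    case 0
    have "up (foldr (\<star>) [] (A1 :: 'g \<Rightarrow> 'f)) \<in> SP 0" unfolding SP_def by force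
    hence "A1 \<in> SP 0" by (simp add: up_simps)
    thus ?case unfolding Q_def pw.simps(1) by (rule fv.span_base)
  next
    case (Suc n)
    thus ?case unfolding Q_def pw.simps(2) by (rule step)
  qed
  moreover have "SP M \<subseteq> {0}" using M by (auto simp: SP_def up_simps)
  hence "fv.span (SP M) \<subseteq> {0}" using fv.span_mono[of "SP M" "{0}"] by simp
  ultimately have "pw A1 a M = 0" unfolding Q_def by blast
  thus ?thesis unfolding nilp_def by blast
qed

text \<open>The central characters of the simple modules of a block agree on central elements with
  coefficients in the algebraic closure, because they do so after applying linear functionals.\<close>

lemma up_bidem_prim:
  assumes e: "e \<in> bidem" and x: "x \<in> FS (carrier G)" "x \<star> x = x" "\<And>a. a \<in> FS (carrier G) \<Longrightarrow> x \<star> a = a \<star> x"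
  shows "x \<star> up e = up e \<or> x \<star> up e = 0"
proof -
  have ec: "e \<in> FS (carrier G)" "e \<star> e = e" using bidem_cidem(1)[OF e] unfolding cidem_iff by blast+
  have ue: "up e \<in> FS (carrier G)" "up e \<star> up e = up e" using ec by (simp_all add: up_simps flip: up_conv)
  have xe: "up e \<star> x = x \<star> up e" by (rule x(3)[OF ue(1), symmetric])
  define ev where "ev k i j a = (\<Sum>g\<in>carrier G. a g * mm k i j g)" for k i j and a :: "'g \<Rightarrow> 'f alg_closure"
  obtain k0 where k0: "k0 \<in> BI e" using BI_nonempty[OF e] by blast
  have k0B: "k0 \<in> BC" using k0 by (simp add: BI_def)
  define c where "c = ev k0 0 0 x"
  have prev: "pr (t * ev k i j x) = cf (rp k) i j (dn t x)" for t k i j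
  proof -
    have 1: "t * ev k i j x = (\<Sum>g\<in>carrier G. to_ac (rp k g $$ (i, j)) * (t * x g))"
      by (simp add: ev_def mm_def sum_distrib_left mult_ac)
    have "pr (t * ev k i j x) = (\<Sum>g\<in>carrier G. rp k g $$ (i, j) * pr (t * x g))"
      unfolding 1 pr_sum pr_mult ..
    thus ?thesis by (simp only: cf_def dn_def mult.commute)
  qed
  have dnc: "dn t x \<star> a = a \<star> dn t x" if "a \<in> FS (carrier G)" for t a
    using x(3)[OF up_simps(7)[OF that]] by (metis dn_conv_left dn_conv_right)
  have evx: "ev k i j x = (if i = j then c else 0)" if k: "k \<in> BI e" and ij: "i < dg k" "j < dg k" for k i j
  proof -
    have kB: "k \<in> BC" using k by (simp add: BI_def)
    have "ev k i j x - (if i = j then c else 0) = 0"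
    proof (rule eq_0_if_pr)
      fix t
      have dc: "dn t x \<star> sing g = sing g \<star> dn t x" if "g \<in> carrier G" for g by (rule dnc) (rule FS_sing[OF that])
      obtain d where d: "\<And>i j. i < dg k \<Longrightarrow> j < dg k \<Longrightarrow> cf (rp k) i j (dn t x) = (if i = j then d else 0)"
        using central_scalar[OF split rp(1)[OF kB] dc] by blast
      obtain d0 where d0: "\<And>i j. i < dg k0 \<Longrightarrow> j < dg k0 \<Longrightarrow> cf (rp k0) i j (dn t x) = (if i = j then d0 else 0)"
        using central_scalar[OF split rp(1)[OF k0B] dc] by blast
      have "d = d0" by (rule block_central_char[OF e k k0 dn_simps(3)[OF x(1)] dnc d d0])
      moreover have "pr (t * c) = d0" unfolding c_def prev using d0 rp(4)[OF k0B] by simp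
      moreover have "t * (ev k i j x - (if i = j then c else 0)) + t * (if i = j then c else 0) = t * ev k i j x"
        by (simp add: algebra_simps)
      hence "pr (t * (ev k i j x - (if i = j then c else 0))) + pr (t * (if i = j then c else 0)) = pr (t * ev k i j x)"
        by (metis pr_add)
      ultimately show "pr (t * (ev k i j x - (if i = j then c else 0))) = 0"
        unfolding prev d[OF ij] by (cases "i = j") (simp_all add: pr_0)
    qed
    thus ?thesis by simp
  qed
  have evc: "ev k i j (a \<star> b) = (\<Sum>r<dg k. ev k i r a * ev k r j b)" if "k \<in> BC" "i < dg k" "j < dg k" for k i j a b
    unfolding ev_def by (rule mm_conv[OF that])
  have eve: "ev k i j (up e) = to_ac (cf (rp k) i j e)" for k i j unfolding ev_def by (rule mm_up)
  have ev_xe: "ev k i j (x \<star> up e) = (if k \<in> BI e \<and> i = j then c else 0)" if k: "k \<in> BC" "i < dg k" "j < dg k" for k i j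
  proof (cases "k \<in> BI e")
    case True
    have "ev k i j (x \<star> up e) = (\<Sum>r<dg k. if r = i then c * (if i = j then 1 else 0) else 0)"
      unfolding evc[OF k] by (rule sum.cong[OF refl]) (use evx[OF True] eve True k in \<open>auto simp: BI_def\<close>)
    thus ?thesis using True k by simp
  next
    case False
    thus ?thesis unfolding evc[OF k] eve using BI_out[OF bidem_cidem(1)[OF e]] k by simp
  qed
  have ev_e: "ev k i j (up e) = (if k \<in> BI e \<and> i = j then 1 else 0)" if k: "k \<in> BC" "i < dg k" "j < dg k" for k i j
  proof (cases "k \<in> BI e")
    case True
    hence "cf (rp k) i j e = (if i = j then 1 else 0)" using k by (simp add: BI_def)
    thus ?thesis using True by (simp add: eve)
  next
    case False
    thus ?thesis using BI_out[OF bidem_cidem(1)[OF e] _ k(2,3)] k(1) by (simp add: eve)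
  qed
  have ff: "(x \<star> up e) \<star> (x \<star> up e) = x \<star> up e"
  proof -
    have "(x \<star> up e) \<star> (x \<star> up e) = x \<star> (up e \<star> x) \<star> up e" by (simp add: conv_assoc)
    also have "\<dots> = (x \<star> x) \<star> (up e \<star> up e)" unfolding xe by (simp add: conv_assoc)
    finally show ?thesis using x(2) ue(2) by simp
  qed
  have "c * c = c"
  proof -
    have "ev k0 0 0 (x \<star> x) = (\<Sum>r<dg k0. if r = 0 then c * c else 0)"
      unfolding evc[OF k0B rp(4)[OF k0B] rp(4)[OF k0B]]
      by (rule sum.cong[OF refl]) (use evx[OF k0] rp(4)[OF k0B] in auto)
    thus ?thesis using x(2) evx[OF k0] rp(4)[OF k0B] by simp
  qed
  \<comment> \<open>According to the case, \<open>x \<star> up e\<close> or its complement in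
    \<open>up e\<close> acts as zero on all simple modules, and a nilpotent idempotent is
    zero.\<close>
  hence "c = 0 \<or> c = 1" by auto
  thus ?thesis
  proof
    assume c0: "c = 0"
    have "nilp (x \<star> up e)"
      by (rule mm_nilp) (use ev_xe c0 in \<open>auto simp: ev_def\<close>)
    hence "x \<star> up e = 0" using ff by (rule nilp_idem)
    thus ?thesis ..
  next
    assume c1: "c = 1"
    define f where "f = up e - x \<star> up e"
    have evf: "ev k i j f = ev k i j (up e) - ev k i j (x \<star> up e)" for k i j
      by (simp add: ev_def f_def algebra_simps sum_subtractf)
    have "nilp f"
    proof (rule mm_nilp)
      show "f \<in> FS (carrier G)" using ue(1) by (simp add: f_def FS_diff)
      show "(\<Sum>g\<in>carrier G. f g * mm k i j g) = 0" if "k \<in> BC" "i < dg k" "j < dg k" for k i j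
        using evf[of k i j] unfolding ev_xe[OF that] ev_e[OF that] c1 by (simp add: ev_def)
    qed
    moreover have "f \<star> f = f"
    proof -
      have 1: "up e \<star> (x \<star> up e) = x \<star> up e" using xe ue(2) by (metis conv_assoc)
      have 2: "(x \<star> up e) \<star> up e = x \<star> up e" using ue(2) by (simp add: conv_assoc)
      show ?thesis by (simp only: f_def conv_diff_left conv_diff_right ff 1 2 ue(2)) simp
    qed
    ultimately have "f = 0" by (rule nilp_idem)
    thus ?thesis by (simp add: f_def)
  qed
qed

text \<open>The local result is applied to \<open>up e\<close>, which is still a block idempotent
  over the closure because the small field splits the group. Dimension and relative traces are then
  carried back.\<close>

theorem block_dim_defect:
  assumes e1: "e1 \<in> bidem" and lin: "\<And>k. k \<in> BI e1 \<Longrightarrow> dg k = 1" and e: "e \<in> bidem"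
    and D: "defect_group G (block_algebra (group_algebra G) e) D"
  shows "block_dim (block_algebra (group_algebra G) e) = card D * (\<Sum>k\<in>BI e. (dg k)\<^sup>2)"
proof -
  obtain N H where NH: "N \<lhd> G" "\<not> p dvd card N" "H \<lhd> G" "N \<subseteq> H" "pelt p \<subseteq> H"
    "\<forall>h\<in>H. \<exists>k. h [^] (p ^ k) \<in> N" by (rule linear_block_groups[OF e1 lin])
  have eI: "e \<in> cidem" by (rule bidem_cidem(1)[OF e])
  have ec: "e \<in> FS (carrier G)" "e \<star> e = e" "\<And>a. a \<in> FS (carrier G) \<Longrightarrow> a \<star> e = e \<star> a"
    using eI unfolding cidem_iff by blast+
  interpret co: core G p N H BC dg mm "up e"
  proof (rule core.intro[OF fin_group_axioms core_axioms.intro])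
    show "prime p" by (rule p)
    show "CHAR('f alg_closure) = p" using ch by simp
    show "mm k i j \<one> = (if i = j then 1 else 0)" if "k \<in> BC" "i < dg k" "j < dg k" for k i j
      using mat_rep_one[OF rp(3)[OF that(1)] that(2,3)] by (simp add: mm_def)
    show "mm k i j (g \<otimes> h) = (\<Sum>r<dg k. mm k i r g * mm k r j h)"
      if "k \<in> BC" "i < dg k" "j < dg k" "g \<in> carrier G" "h \<in> carrier G" for k i j g h
      by (rule mm_mult[OF that])
    show "\<exists>a\<in>FS (carrier G). \<forall>k'\<in>BC. \<forall>i'<dg k'. \<forall>j'<dg k'.
        (\<Sum>g\<in>carrier G. a g * mm k' i' j' g) = (if (k', i', j') = (k, i, j) then 1 else 0)" for k i j
    proof -
      obtain a where a: "a \<in> FS (carrier G)"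
        "\<forall>k'\<in>BC. \<forall>i'<dg k'. \<forall>j'<dg k'. cf (rp k') i' j' a = (if (k', i', j') = (k, i, j) then 1 else 0)"
        using slots_surj[OF finite_BC subset_refl, of "\<lambda>k' i' j'. if (k', i', j') = (k, i, j) then 1 else 0"] by blast
      show ?thesis by (rule bexI[of _ "up a"]) (use a in \<open>simp_all add: mm_up up_simps\<close>)
    qed
    show "nilp a" if "a \<in> FS (carrier G)" "\<And>k i j. k \<in> BC \<Longrightarrow> i < dg k \<Longrightarrow> j < dg k \<Longrightarrow>
        (\<Sum>g\<in>carrier G. a g * mm k i j g) = 0" for a
      by (rule mm_nilp[OF that])
    show "up e \<in> FS (carrier G)" by (rule up_simps(7)[OF ec(1)])
    show "up e \<star> up e = up e" using ec(2) by (simp flip: up_conv)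
    show "up e \<noteq> 0" using bidem_cidem(2)[OF e] up_simps(6)[of e 0] by (simp add: up_simps(1))
    show "up e \<star> a = a \<star> up e" if "a \<in> FS (carrier G)" for a
    proof (rule central_if_sing[OF up_simps(7)[OF ec(1)] subset_refl _ that])
      fix g assume "g \<in> carrier G"
      hence "sing g \<star> e = e \<star> sing g" by (intro ec(3) FS_sing)
      hence "up (sing g \<star> e) = up (e \<star> sing g)" by simp
      thus "up e \<star> sing g = sing g \<star> up e" by (simp add: up_conv up_simps)
    qed
    show "k \<star> up e = up e \<or> k \<star> up e = 0" if "k \<in> FS (carrier G)" "k \<star> k = k"
      "\<And>a. a \<in> FS (carrier G) \<Longrightarrow> k \<star> a = a \<star> k" for k
      by (rule up_bidem_prim[OF e that])
    show "\<exists>k. h [^] (p ^ k) \<in> N" if "h \<in> H" for h using NH(6) that by blast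
  qed (fact NH finite_BC)+
  obtain s where s: "fv.dim {y \<in> FS (carrier G). up e \<star> y = y} = s * (\<Sum>k\<in>BI e. (dg k)\<^sup>2)"
    "\<forall>D a. subgroup D G \<longrightarrow> a \<in> FS (carrier G) \<longrightarrow> (\<forall>d\<in>D. cj d a = a) \<longrightarrow> up e = Tr D a \<longrightarrow>
      (\<exists>D' b. subgroup D' G \<and> D' \<subseteq> D \<and> card D' = s \<and> b \<in> FS (carrier G) \<and> (\<forall>d\<in>D'. cj d b = b) \<and> up e = Tr D' b)"
  proof (rule co.core_result[of "BI e"])
    show "BI e \<subseteq> BC" by (auto simp: BI_def)
    show "(\<Sum>g\<in>carrier G. up e g * mm k a b g) = (if a = b then 1 else 0)" if "k \<in> BI e" "a < dg k" "b < dg k" for k a b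
      unfolding mm_up using that by (simp add: BI_def)
    show "(\<Sum>g\<in>carrier G. up e g * mm k a b g) = 0" if "k \<in> BC - BI e" "a < dg k" "b < dg k" for k a b
      unfolding mm_up using BI_out[OF eI that] by simp
  qed
  define T where "T Q \<longleftrightarrow> (\<exists>a\<in>FS (carrier G). (\<forall>d\<in>Q. cj d a = a) \<and> e = Tr Q a)" for Q
  have T: "block_idem G (block_algebra (group_algebra G) e) \<in> relative_trace G Q ` fixed_points G Q \<longleftrightarrow> T Q"
    if "subgroup Q G" for Q
    unfolding block_idem_eq[OF e] T_def fixed_points_cj[OF that] image_iff relative_trace_Tr[OF that] by blast
  have D1: "subgroup D G" "T D" and Dmin: "\<And>Q. subgroup Q G \<Longrightarrow> T Q \<Longrightarrow> Q \<subseteq> D \<Longrightarrow> Q = D"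
    using D T unfolding defect_group_def by blast+
  obtain a where a: "a \<in> FS (carrier G)" "\<forall>d\<in>D. cj d a = a" "e = Tr D a" using D1(2) unfolding T_def by blast
  have "\<forall>d\<in>D. cj d (up a) = up a" "up e = Tr D (up a)" using a(2,3) by (simp_all add: cj_up Tr_up)
  then obtain D' b where b: "subgroup D' G" "D' \<subseteq> D" "card D' = s" "b \<in> FS (carrier G)" "\<forall>d\<in>D'. cj d b = b" "up e = Tr D' b"
    using s(2)[rule_format, OF D1(1) up_simps(7)[OF a(1)]] by blast
  \<comment> \<open>The retraction commutes with conjugation and with traces, so \<open>e\<close> is
    a trace from \<open>D'\<close> already over the small field, and minimality of \<open>D\<close>
    makes the two subgroups equal.\<close>
  have "e = Tr D' (dn 1 b)" unfolding Tr_dn b(6)[symmetric] dn_up ..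
  moreover have "\<forall>d\<in>D'. cj d (dn 1 b) = dn 1 b" using b(5) by (simp add: cj_dn)
  ultimately have "T D'" unfolding T_def using dn_simps(3)[OF b(4)] by blast
  hence "D' = D" using Dmin[OF b(1) _ b(2)] by blast
  hence "card D = s" using b(3) by simp
  moreover have "block_dim (block_algebra (group_algebra G) e) = fv.dim {y \<in> FS (carrier G). up e \<star> y = y}"
  proof -
    have "(\<lambda>(c :: 'f) a g. c * a g) = (sc :: 'f \<Rightarrow> ('g \<Rightarrow> 'f) \<Rightarrow> 'g \<Rightarrow> 'f)" by (intro ext) simp
    thus ?thesis unfolding block_dim_def block_algebra_eq[OF eI] dim_up[OF ec(1,2)] by simp
  qed
  ultimately show ?thesis using s(1) by simp
qed

end

theorem theorem2p5:
  fixes G :: "('g, 'm) monoid_scheme"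
    and p :: nat
    and v :: "'k::field_char_0 \<Rightarrow> int"
    and red :: "'k \<Rightarrow> 'f::field"
    and \<theta> :: "'k alg_closure \<Rightarrow> 'f alg_closure"
    and B\<^sub>1 :: "('g \<Rightarrow> 'f) set"
  assumes "group G" and "finite (carrier G)" and "prime p"
    and "splitting_modular_system G p v red"
    and "residue_extension v red \<theta>"
    and "B\<^sub>1 \<in> Bl G" and "IBr G p \<theta> B\<^sub>1 \<subseteq> LBr G p \<theta>"
  shows "(\<forall>(B :: ('g \<Rightarrow> 'f) set) D. B \<in> Bl G \<longrightarrow> defect_group G B D \<longrightarrow>
            real (block_dim B) / real (card D)
              = (\<Sum>\<phi>\<in>IBr G p \<theta> B. (real (character_degree G \<phi>))\<^sup>2)) \<and>
         (\<forall>(B :: ('g \<Rightarrow> 'f) set) D. B \<in> Bl G \<longrightarrow> defect_group G B D \<longrightarrow>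
            real (block_dim B) / (real (card (IBr G p \<theta> B)) * real (card D))
              \<le> (\<Sum>\<phi>\<in>IBr G p \<theta> B. (real (character_degree G \<phi>))\<^sup>2) \<and>
            (real (block_dim B) / (real (card (IBr G p \<theta> B)) * real (card D))
              = (\<Sum>\<phi>\<in>IBr G p \<theta> B. (real (character_degree G \<phi>))\<^sup>2)
             \<longleftrightarrow> card (IBr G p \<theta> B) = 1))"
proof -
  interpret rep_sys G p v red \<theta>
    using assms unfolding splitting_modular_system_def
    by (intro rep_sys.intro fin_group.intro mod_sys.intro fin_group_axioms.intro rep_sys_axioms.intro) auto
  obtain e1 where e1: "e1 \<in> bidem" "B\<^sub>1 = block_algebra (group_algebra G) e1"
    using assms(6) unfolding Bl_def by blast
  have lin: "dg k = 1" if k: "k \<in> BI e1" for k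
  proof -
    have "k \<in> LBr G p \<theta>" using assms(7) k unfolding e1(2) IBr_BI[OF e1(1)] by blast
    moreover have "k \<in> BC" using k by (simp add: BI_def)
    ultimately have "(of_nat (dg k) :: 'k alg_closure) = of_nat 1" using BC_degree by (simp add: LBr_def)
    thus ?thesis by (simp only: of_nat_eq_iff)
  qed
  have key: "real (block_dim B) / real (card D) = (\<Sum>\<phi>\<in>IBr G p \<theta> B. (real (character_degree G \<phi>))\<^sup>2)"
    "0 < (\<Sum>\<phi>\<in>IBr G p \<theta> B. (real (character_degree G \<phi>))\<^sup>2)" "0 < card (IBr G p \<theta> B)"
    if B: "B \<in> Bl G" and D: "defect_group G B D" for B :: "('g \<Rightarrow> 'f) set" and D
  proof -
    obtain e where e: "e \<in> bidem" "B = block_algebra (group_algebra G) e" using B unfolding Bl_def by blast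
    have I: "IBr G p \<theta> B = BI e" unfolding e(2) by (rule IBr_BI[OF e(1)])
    have BIB: "BI e \<subseteq> BC" by (auto simp: BI_def)
    hence finI: "finite (BI e)" using finite_BC finite_subset by blast
    have sD: "subgroup D G" using D by (simp add: defect_group_def)
    have D0: "card D \<noteq> 0" using finite_sub[OF subgroup.subset[OF sD]] subgroup.one_closed[OF sD] by auto
    have sq: "(\<Sum>\<phi>\<in>BI e. (real (character_degree G \<phi>))\<^sup>2) = real (\<Sum>k\<in>BI e. (dg k)\<^sup>2)"
      using BIB by (simp add: character_degree_BC subset_iff)
    have "block_dim B = card D * (\<Sum>k\<in>BI e. (dg k)\<^sup>2)"
      unfolding e(2) by (rule block_dim_defect[OF e1(1) lin e(1) D[unfolded e(2)]])
    thus "real (block_dim B) / real (card D) = (\<Sum>\<phi>\<in>IBr G p \<theta> B. (real (character_degree G \<phi>))\<^sup>2)"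
      unfolding I sq using D0 by (simp del: of_nat_sum)
    show "0 < card (IBr G p \<theta> B)" unfolding I using BI_nonempty[OF e(1)] finI by (simp add: card_gt_0_iff)
    show "0 < (\<Sum>\<phi>\<in>IBr G p \<theta> B. (real (character_degree G \<phi>))\<^sup>2)"
      unfolding I
    proof (rule sum_pos[OF finI BI_nonempty[OF e(1)]])
      fix k assume "k \<in> BI e"
      hence "k \<in> BC" using BIB by blast
      thus "0 < (real (character_degree G k))\<^sup>2" using rp(4) by (simp add: character_degree_BC)
    qed
  qed
  \<comment> \<open>Dividing a positive sum by a positive natural number decreases it strictly
    unless that number is 1.\<close>
  have ineq: "a / (l * d) \<le> S \<and> (a / (l * d) = S \<longleftrightarrow> n = 1)"
    if "a / d = S" "0 < S" "0 < n" "l = real n" for a d S l :: real and n :: nat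
  proof -
    have e: "a / (l * d) = S / l" using that(1) by (simp add: mult.commute flip: divide_divide_eq_left)
    have l: "1 \<le> l" using that by simp
    have "S / l \<le> S" using l that(2) by (simp add: divide_le_eq mult_le_cancel_left1)
    moreover have "S / l = S \<longleftrightarrow> n = 1" using that by (simp add: divide_eq_eq)
    ultimately show ?thesis unfolding e by blast
  qed
  show ?thesis
  proof (intro conjI allI impI)
    fix B :: "('g \<Rightarrow> 'f) set" and D assume BD: "B \<in> Bl G" "defect_group G B D"
    show "real (block_dim B) / real (card D) = (\<Sum>\<phi>\<in>IBr G p \<theta> B. (real (character_degree G \<phi>))\<^sup>2)"
      by (rule key(1)[OF BD])
    note i = ineq[OF key[OF BD] refl]
    show "real (block_dim B) / (real (card (IBr G p \<theta> B)) * real (card D))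
        \<le> (\<Sum>\<phi>\<in>IBr G p \<theta> B. (real (character_degree G \<phi>))\<^sup>2)" by (rule conjunct1[OF i])
    show "real (block_dim B) / (real (card (IBr G p \<theta> B)) * real (card D))
        = (\<Sum>\<phi>\<in>IBr G p \<theta> B. (real (character_degree G \<phi>))\<^sup>2) \<longleftrightarrow> card (IBr G p \<theta> B) = 1" by (rule conjunct2[OF i])
  qed
qed

end
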